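(* Suppose $\alpha$ and $\beta$ are real. If $1\le p_0\le p_1<\infty$ and $$\frac1p=\frac{1-\theta}{p_0}+\frac{\theta}{p_1}$$ for some $\theta\in(0,1)$, then $$\left[A^{p_0}_\alpha,A^{p_1}_\beta\right]_\theta=A^p_\gamma$$ with equivalent norms, where $\gamma$ is determined by $$\frac{\gamma}{p}=\frac{\alpha}{p_0}(1-\theta)+\frac{\beta}{p_1}\,\theta.$$
   Context: Fix a positive integer $n$. $\mathbb B_n$ is the open unit ball of $\mathbb C^n$, $dv$ is volume measure, and $dv_\alpha(z)=(1-|z|^2)^\alpha dv(z)$ for real $\alpha$ (normalized to be a probability measure when $\alpha>-1$). The radial derivative is $Rf(z)=\sum_{k=1}^n z_k\frac{\partial f}{\partial z_k}(z)$, $R^k$ is its $k$-fold iterate, $R^0f=f$. For $p>0$ and real $\alpha$, $A^p_\alpha$ is the space of holomorphic $f$ in $\mathbb B_n$ such that, for a nonnegative integer $k$ with $pk+\alpha>-1$, $(1-|z|^2)^kR^kf(z)\in L^p(\mathbb B_n,dv_\alpha)$ (independent of the choice of such $k$). With $N$ the smallest nonnegative integer such that $pN+\alpha>-1$, put $$\|f\|_{p,\alpha}=|f(0)|+\left[\int_{\mathbb B_n}(1-|z|^2)^{pN}|R^Nf(z)|^p\,dv_\alpha(z)\right]^{1/p};$$ for $p\ge1$ this makes $A^p_\alpha$ a Banach space. Complex interpolation: let $S=\{x+iy\in\mathbb C:0<x<1\}$, $\overline S$ its closure, $L(S)=\{\mathrm{Re}\,\zeta=0\}$, $R(S)=\{\mathrm{Re}\,\zeta=1\}$.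 For Banach spaces $X,Y$ of holomorphic functions in $\mathbb B_n$, $X+Y$ carries the norm $\|f\|_{X+Y}=\inf(\|g\|_X+\|h\|_Y)$ over decompositions $f=g+h$, $g\in X$, $h\in Y$. For $\theta\in(0,1)$, $[X,Y]_\theta$ consists of the holomorphic $f$ in $\mathbb B_n$ for which there is a map $\zeta\mapsto f_\zeta$ from $\overline S$ into $X+Y$ that is (1) analytic in $S$, continuous and bounded on $\overline S$; (2) $f_\theta=f$; (3) bounded and continuous from $L(S)$ into $X$; (4) bounded and continuous from $R(S)$ into $Y$. Its norm is $\|f\|_\theta=\inf\max\left(\sup_{\mathrm{Re}\,\zeta=0}\|f_\zeta\|_X,\ \sup_{\mathrm{Re}\,\zeta=1}\|f_\zeta\|_Y\right)$, the infimum over all such maps. *)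

theory Defs
  imports "HOL-Analysis.Analysis"
begin

text \<open>A function on the open unit ball of \<open>\<complex>\<^sup>n\<close> is represented by a total function on
  \<^typ>\<open>complex^'n\<close> vanishing off the ball. This makes the representation unique, so that equality
  of functions on the ball is equality in HOL and the norms below separate points.\<close>

definition ball_holomorphic :: "(complex^'n \<Rightarrow> complex) set" where
  "ball_holomorphic =
     {f. (\<forall>z\<in>ball 0 1. \<exists>D. (f has_derivative D) (at z) \<and> (\<forall>c v. D (c *s v) = c * D v)) \<and>
         (\<forall>z. z \<notin> ball 0 1 \<longrightarrow> f z = 0)}"

definition partial_deriv :: "'n \<Rightarrow> (complex^'n \<Rightarrow> complex) \<Rightarrow> complex^'n \<Rightarrow> complex" where
  "partial_deriv k f z = deriv (\<lambda>t. f (z + axis k t)) 0"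

text \<open>Values of \<open>radial_deriv f\<close> off the open ball are meaningless, and never used.\<close>

definition radial_deriv :: "(complex^'n \<Rightarrow> complex) \<Rightarrow> complex^'n \<Rightarrow> complex" where
  "radial_deriv f z = (\<Sum>k\<in>UNIV. z $ k * partial_deriv k f z)"

text \<open>The measures \<open>dv\<^sub>\<alpha>\<close>. For \<open>\<alpha> \<le> -1\<close> the total mass is infinite and no normalization is made.\<close>

definition weight_const :: "'n::finite itself \<Rightarrow> real \<Rightarrow> real" where
  "weight_const _ \<alpha> =
     (if \<alpha> > -1 then 1 / (LINT z:ball (0::complex^'n) 1|lborel. (1 - (norm z)\<^sup>2) powr \<alpha>) else 1)"

definition weighted_volume :: "real \<Rightarrow> (complex^'n) measure" where
  "weighted_volume \<alpha> =
     density (restrict_space lborel (ball 0 1))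
       (\<lambda>z. ennreal (weight_const TYPE('n) \<alpha> * (1 - (norm z)\<^sup>2) powr \<alpha>))"

definition Lp_fun :: "real \<Rightarrow> 'a measure \<Rightarrow> ('a \<Rightarrow> complex) set" where
  "Lp_fun p M = {g \<in> borel_measurable M. integrable M (\<lambda>z. norm (g z) powr p)}"

definition bergman_space :: "real \<Rightarrow> real \<Rightarrow> (complex^'n \<Rightarrow> complex) set" where
  "bergman_space p \<alpha> =
     {f \<in> ball_holomorphic. \<exists>k::nat. p * real k + \<alpha> > -1 \<and>
        (\<lambda>z. complex_of_real ((1 - (norm z)\<^sup>2) ^ k) * (radial_deriv ^^ k) f z)
          \<in> Lp_fun p (weighted_volume \<alpha>)}"

definition bergman_order :: "real \<Rightarrow> real \<Rightarrow> nat" where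
  "bergman_order p \<alpha> = (LEAST k::nat. p * real k + \<alpha> > -1)"

definition bergman_norm :: "real \<Rightarrow> real \<Rightarrow> (complex^'n \<Rightarrow> complex) \<Rightarrow> real" where
  "bergman_norm p \<alpha> f =
     (let N = bergman_order p \<alpha> in
      norm (f 0) +
      (LINT z|weighted_volume \<alpha>.
         (1 - (norm z)\<^sup>2) powr (p * real N) * norm ((radial_deriv ^^ N) f z) powr p) powr (1 / p))"

text \<open>In what follows a normed space of functions is given by its set of elements \<open>X\<close> and its norm
  \<open>nX\<close>, which is only meaningful on \<open>X\<close>.\<close>

definition sum_space :: "('a \<Rightarrow> complex) set \<Rightarrow> ('a \<Rightarrow> complex) set \<Rightarrow> ('a \<Rightarrow> complex) set" where
  "sum_space X Y = {(\<lambda>z. g z + h z) | g h. g \<in> X \<and> h \<in> Y}"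

definition sum_norm ::
  "('a \<Rightarrow> complex) set \<Rightarrow> (('a \<Rightarrow> complex) \<Rightarrow> real) \<Rightarrow>
   ('a \<Rightarrow> complex) set \<Rightarrow> (('a \<Rightarrow> complex) \<Rightarrow> real) \<Rightarrow> ('a \<Rightarrow> complex) \<Rightarrow> real" where
  "sum_norm X nX Y nY f =
     Inf {nX g + nY h | g h. g \<in> X \<and> h \<in> Y \<and> f = (\<lambda>z. g z + h z)}"

definition bdd_cont_into ::
  "complex set \<Rightarrow> ('a \<Rightarrow> complex) set \<Rightarrow> (('a \<Rightarrow> complex) \<Rightarrow> real) \<Rightarrow>
   (complex \<Rightarrow> 'a \<Rightarrow> complex) \<Rightarrow> bool" where
  "bdd_cont_into A X nX F \<longleftrightarrow>
     (\<forall>\<zeta>\<in>A. F \<zeta> \<in> X) \<and>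
     (\<exists>M. \<forall>\<zeta>\<in>A. nX (F \<zeta>) \<le> M) \<and>
     (\<forall>\<zeta>\<in>A. ((\<lambda>w. nX (\<lambda>z. F w z - F \<zeta> z)) \<longlongrightarrow> 0) (at \<zeta> within A))"

definition analytic_into ::
  "complex set \<Rightarrow> ('a \<Rightarrow> complex) set \<Rightarrow> (('a \<Rightarrow> complex) \<Rightarrow> real) \<Rightarrow>
   (complex \<Rightarrow> 'a \<Rightarrow> complex) \<Rightarrow> bool" where
  "analytic_into A X nX F \<longleftrightarrow>
     (\<forall>\<zeta>\<in>A. \<exists>G\<in>X. ((\<lambda>w. nX (\<lambda>z. (F w z - F \<zeta> z) / (w - \<zeta>) - G z)) \<longlongrightarrow> 0) (at \<zeta>))"

definition strip :: "complex set" where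
  "strip = {\<zeta>. 0 < Re \<zeta> \<and> Re \<zeta> < 1}"

definition left_line :: "complex set" where
  "left_line = {\<zeta>. Re \<zeta> = 0}"

definition right_line :: "complex set" where
  "right_line = {\<zeta>. Re \<zeta> = 1}"

definition interp_maps ::
  "('a \<Rightarrow> complex) set \<Rightarrow> (('a \<Rightarrow> complex) \<Rightarrow> real) \<Rightarrow>
   ('a \<Rightarrow> complex) set \<Rightarrow> (('a \<Rightarrow> complex) \<Rightarrow> real) \<Rightarrow> real \<Rightarrow> ('a \<Rightarrow> complex) \<Rightarrow>
   (complex \<Rightarrow> 'a \<Rightarrow> complex) set" where
  "interp_maps X nX Y nY \<theta> f =
     {F. analytic_into strip (sum_space X Y) (sum_norm X nX Y nY) F \<and>
         bdd_cont_into (closure strip) (sum_space X Y) (sum_norm X nX Y nY) F \<and>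
         F (complex_of_real \<theta>) = f \<and>
         bdd_cont_into left_line X nX F \<and>
         bdd_cont_into right_line Y nY F}"

definition interp_space ::
  "(complex^'n \<Rightarrow> complex) set \<Rightarrow> ((complex^'n \<Rightarrow> complex) \<Rightarrow> real) \<Rightarrow>
   (complex^'n \<Rightarrow> complex) set \<Rightarrow> ((complex^'n \<Rightarrow> complex) \<Rightarrow> real) \<Rightarrow> real \<Rightarrow>
   (complex^'n \<Rightarrow> complex) set" where
  "interp_space X nX Y nY \<theta> = {f \<in> ball_holomorphic. interp_maps X nX Y nY \<theta> f \<noteq> {}}"

definition interp_norm ::
  "('a \<Rightarrow> complex) set \<Rightarrow> (('a \<Rightarrow> complex) \<Rightarrow> real) \<Rightarrow>
   ('a \<Rightarrow> complex) set \<Rightarrow> (('a \<Rightarrow> complex) \<Rightarrow> real) \<Rightarrow> real \<Rightarrow> ('a \<Rightarrow> complex) \<Rightarrow> real" where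
  "interp_norm X nX Y nY \<theta> f =
     (INF F\<in>interp_maps X nX Y nY \<theta> f.
        max (SUP \<zeta>\<in>left_line. nX (F \<zeta>)) (SUP \<zeta>\<in>right_line. nY (F \<zeta>)))"

definition equivalent_norms_on ::
  "'b set \<Rightarrow> ('b \<Rightarrow> real) \<Rightarrow> ('b \<Rightarrow> real) \<Rightarrow> bool" where
  "equivalent_norms_on X n1 n2 \<longleftrightarrow>
     (\<exists>c>0. \<exists>C>0. \<forall>f\<in>X. c * n2 f \<le> n1 f \<and> n1 f \<le> C * n2 f)"

end

theory Submission imports Defs "HOL-Complex_Analysis.Complex_Analysis" begin

text \<open>Let \<open>N\<close> be large. The map \<open>f \<mapsto> (1 - \<bar>z\<bar>\<^sup>2)\<^sup>N R\<^sup>N f\<close> embeds \<open>A\<^sup>p\<^sub>\<alpha>\<close>, up to the value \<open>f 0\<close>, into the weighted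
  space \<open>L\<^sup>p((1 - \<bar>z\<bar>\<^sup>2)\<^sup>\<alpha> dv)\<close>, and an integral operator \<open>bergman_operator b N\<close> inverts it. For large \<open>b\<close>
  this operator is bounded from \<open>L\<^sup>p\<close> to \<open>A\<^sup>p\<^sub>\<alpha>\<close> for all the pairs \<open>(p, \<alpha>)\<close> in question at the same time
  (\<open>bergman_operator_bounded\<close>). So the Bergman spaces are simultaneous retracts of weighted
  Lebesgue spaces, and they interpolate like these: with the exponents and weights of Stein and Weiss.

  The operator comes from homogeneous expansions. \<open>R\<close> multiplies the part of degree \<open>k\<close> by \<open>k\<close>, and
  integrating it against \<open>\<langle>z, w\<rangle>\<^sup>k\<close> with weight \<open>(1 - \<bar>w\<bar>\<^sup>2)\<^sup>t\<close> returns it times an explicit quotient of Gamma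
  values (\<open>moment_formula\<close>). That formula is first proved for Gaussian weights, where it is the
  reproducing property of the Fock kernel \<open>exp \<langle>z, u\<rangle>\<close>, and moved to the ball by comparing radial
  integrals. Dividing by these factors yields a kernel with \<open>radial_reproducing_formula\<close>; it is
  \<open>O(\<bar>1 - \<langle>z, w\<rangle>\<bar>\<^sup>-\<^sup>\<sigma>)\<close> with an explicit \<open>\<sigma>\<close> (\<open>repr_coeff_order\<close>), and Schur's test based on the
  Forelli--Rudin estimate gives the boundedness (\<open>schur_estimate\<close>). In particular the number of
  derivatives used to define the norm is immaterial (\<open>radial_data_equivalence\<close>).

  If \<open>f \<in> A\<^sup>p\<^sub>\<gamma>\<close>, the operator is applied to the Calderon family that joins suitable powers of
  the data of \<open>f\<close>. The result is admissible, passes through \<open>f\<close> at \<open>\<theta>\<close> and has the right norms on the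
  two lines (\<open>calderon_map\<close>, \<open>bergman_imp_interp_maps\<close>). Conversely, if \<open>F\<close> is admissible with \<open>F \<theta> = f\<close>,
  the data of \<open>F \<zeta>\<close> is paired with the family that is extremal for the data of \<open>f\<close>. The pairing
  is a bounded analytic function of \<open>\<zeta>\<close>, Hoelder's inequality bounds it on the two lines, and the
  three lines theorem bounds its value at \<open>\<theta>\<close>, which is the norm of the data of \<open>f\<close> to the power \<open>p\<close>
  (\<open>truncated_data_bound\<close>, \<open>interp_maps_imp_bergman\<close>).\<close>

section \<open>The volume of the ball and its rotations\<close>

lemma norm_vec_smult: "norm (c *s v) = cmod c * norm (v :: complex^'n)"
  by (simp add: norm_vec_def norm_mult L2_set_right_distrib)

text \<open>Uniqueness of Haar measure: evaluating \<open>\<integral>\<integral> 1\<^sub>A(x) 1\<^sub>B(x + y)\<close> in both orders gives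
  \<open>lborel A * \<nu> B = \<nu> A * lborel B\<close>; the unit ball is a set \<open>A\<close> on which the two measures are
  equal, positive and finite.\<close>

lemma translation_invariant_imp_lborel:
  fixes \<nu> :: "'a::euclidean_space measure"
  assumes sets: "sets \<nu> = sets borel"
   and transl: "\<And>a. distr \<nu> borel (\<lambda>x. a + x) = \<nu>"
   and ball: "emeasure \<nu> (ball 0 1) = emeasure lborel (ball (0::'a) 1)"
   and sf: "sigma_finite_measure \<nu>"
  shows "\<nu> = lborel"
proof (rule measure_eqI)
  show "sets \<nu> = sets lborel" using sets by simp
  note [measurable_cong] = sets
  fix B assume "B \<in> sets \<nu>"
  then have B [measurable]: "B \<in> sets borel" by (simp add: sets)
  interpret pair_sigma_finite \<nu> "lborel :: 'a measure"
   using sf by (simp add: pair_sigma_finite_def lborel.sigma_finite_measure_axioms)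
  define A :: "'a set" where "A = ball 0 1"
  have A [measurable]: "A \<in> sets borel" by (simp add: A_def)
  define I where "I = (\<integral>\<^sup>+x. \<integral>\<^sup>+y. indicator A x * indicator B (x + y) \<partial>\<nu> \<partial>lborel)"
  have nu_transl: "(\<integral>\<^sup>+y. f (a + y) \<partial>\<nu>) = (\<integral>\<^sup>+y. f y \<partial>\<nu>)" if [measurable]: "f \<in> borel_measurable borel" for f a
   by (subst (2) transl [of a, symmetric]) (simp add: nn_integral_distr)
  have lb_transl: "(\<integral>\<^sup>+y. f (a + y) \<partial>lborel) = (\<integral>\<^sup>+y. f y \<partial>lborel)" if [measurable]: "f \<in> borel_measurable borel" for f and a :: 'a
   by (subst (2) lborel_distr_plus [of a, symmetric]) (simp add: nn_integral_distr)
  have "I = (\<integral>\<^sup>+x. indicator A x * emeasure \<nu> B \<partial>(lborel :: 'a measure))"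
   unfolding I_def
   by (intro nn_integral_cong) (simp add: nn_integral_cmult nu_transl[of "indicator B"] nn_integral_indicator)
  also have "\<dots> = emeasure lborel A * emeasure \<nu> B"
   by (simp add: nn_integral_multc)
  finally have 1: "I = emeasure lborel A * emeasure \<nu> B" .
  have "I = (\<integral>\<^sup>+y. \<integral>\<^sup>+x. indicator A x * indicator B (x + y) \<partial>lborel \<partial>\<nu>)"
   unfolding I_def by (rule Fubini') measurable
  also have "\<dots> = (\<integral>\<^sup>+y. \<integral>\<^sup>+x. indicator A (x - y) * indicator B x \<partial>lborel \<partial>\<nu>)"
  proof (rule nn_integral_cong)
   fix y
   show "(\<integral>\<^sup>+x. indicator A x * indicator B (x + y) \<partial>lborel) = (\<integral>\<^sup>+x. indicator A (x - y) * indicator B x \<partial>lborel)"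
    using lb_transl[of "\<lambda>x. indicator A (x - y) * indicator B x" y] by (simp add: add.commute)
  qed
  also have "\<dots> = (\<integral>\<^sup>+x. \<integral>\<^sup>+y. indicator A (x - y) * indicator B x \<partial>\<nu> \<partial>lborel)"
   by (rule Fubini'[symmetric]) measurable
  also have "\<dots> = (\<integral>\<^sup>+x. emeasure \<nu> A * indicator B x \<partial>(lborel :: 'a measure))"
  proof (rule nn_integral_cong)
   fix x :: 'a
   have "(\<integral>\<^sup>+y. indicator A (x - y) \<partial>\<nu>) = (\<integral>\<^sup>+y. indicator A (- x + y) \<partial>\<nu>)"
    by (intro nn_integral_cong) (simp add: A_def indicator_def dist_norm norm_minus_commute)
   also have "\<dots> = emeasure \<nu> A"
    using nu_transl[of "indicator A" "-x"] by (simp add: nn_integral_indicator)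
   finally show "(\<integral>\<^sup>+y. indicator A (x - y) * indicator B x \<partial>\<nu>) = emeasure \<nu> A * indicator B x"
    by (simp add: nn_integral_multc)
  qed
  also have "\<dots> = emeasure lborel A * emeasure lborel B"
   using ball by (simp add: nn_integral_cmult_indicator A_def)
  finally have "emeasure lborel A * emeasure \<nu> B = emeasure lborel A * emeasure lborel B"
   using 1 by simp
  moreover have "emeasure lborel A \<noteq> 0" "emeasure lborel A \<noteq> \<infinity>"
   using less_imp_neq[OF unit_ball_vol_pos[of "real DIM('a)"]] by (auto simp: A_def emeasure_ball)
  ultimately show "emeasure \<nu> B = emeasure lborel B"
   by (simp add: ennreal_mult_cancel_left)
qed

text \<open>The image of Lebesgue measure is again translation invariant and gives the unit ball the same
  mass. This is the way in which rotations by complex scalars enter all averaging arguments below.\<close>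

lemma lborel_distr_isometry:
  fixes T :: "'a::euclidean_space \<Rightarrow> 'a"
  assumes lin: "linear T" and iso: "\<And>x. norm (T x) = norm x"
  shows "distr lborel borel T = lborel"
proof (rule translation_invariant_imp_lborel)
  have [measurable]: "T \<in> borel \<rightarrow>\<^sub>M borel"
   using lin by (intro borel_measurable_continuous_onI linear_continuous_on linear_conv_bounded_linear[THEN iffD1])
  have ot: "orthogonal_transformation T" using lin iso by (simp add: orthogonal_transformation)
  then have surj: "surj T" by (rule orthogonal_transformation_surj)
  show "distr (distr lborel borel T) borel ((+) a) = distr lborel borel T" for a
  proof -
   obtain b where b: "a = T b" using surj by blast
   have "distr (distr lborel borel T) borel ((+) a) = distr lborel borel (\<lambda>x. T (b + x))"
    by (simp add: distr_distr comp_def b linear_add[OF lin])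
   also have "\<dots> = distr (distr lborel borel ((+) b)) borel T"
    by (simp add: distr_distr comp_def)
   finally show ?thesis by (simp add: lborel_distr_plus)
  qed
  have "T -` ball 0 1 = ball 0 1" by (auto simp: iso)
  then show "emeasure (distr lborel borel T) (ball 0 1) = emeasure lborel (ball (0::'a) 1)"
   by (simp add: emeasure_distr)
  show "sigma_finite_measure (distr lborel borel T)"
  proof (standard, intro exI conjI ballI)
   show "countable (range (\<lambda>n. ball (0::'a) (real n)))" by simp
   show "range (\<lambda>n. ball 0 (real n)) \<subseteq> sets (distr lborel borel T)" by auto
   show "\<Union> (range (\<lambda>n. ball 0 (real n))) = space (distr lborel borel T)"
    by (auto simp: reals_Archimedean2)
   fix A assume "A \<in> range (\<lambda>n. ball (0::'a) (real n))"
   then obtain n where n: "A = ball 0 (real n)" by auto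
   have "T -` A = A" by (auto simp: iso n)
   then show "emeasure (distr lborel borel T) A \<noteq> \<infinity>"
    using emeasure_lborel_ball_finite[of "0::'a" "real n"] by (simp add: emeasure_distr n)
  qed
qed simp

definition cdot :: "complex^'n \<Rightarrow> complex^'n \<Rightarrow> complex" where
  "cdot z w = (\<Sum>k\<in>UNIV. z $ k * cnj (w $ k))"

lemma cdot_add_left: "cdot (x + y) w = cdot x w + cdot y w"
  and cdot_smult_left: "cdot (c *s x) w = c * cdot x w"
  and cdot_smult_right: "cdot w (c *s x) = cnj c * cdot w x"
  and cdot_zero_left [simp]: "cdot 0 w = 0"
  and cdot_zero_right [simp]: "cdot w 0 = 0"
  and cnj_cdot: "cnj (cdot z w) = cdot w z"
  by (simp_all add: cdot_def algebra_simps sum.distrib sum_subtractf sum_distrib_left)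

lemma Re_cdot: "Re (cdot z w) = z \<bullet> w"
  by (simp add: cdot_def inner_vec_def inner_complex_def)

lemma cdot_self: "cdot z z = of_real ((norm z)\<^sup>2)"
proof -
  have "Im (cdot z z) = 0" by (simp add: cdot_def)
  then show ?thesis by (simp add: complex_eq_iff Re_cdot power2_norm_eq_inner)
qed

lemma norm_cdot_le: "cmod (cdot z w) \<le> norm z * norm w"
proof (cases "cdot z w = 0")
  case False
  define u where "u = cnj (cdot z w) / cmod (cdot z w)"
  have u: "cmod u = 1" using False by (simp add: u_def norm_divide)
  have "u * cdot z w = cmod (cdot z w)" unfolding u_def using False
   by (simp add: field_simps complex_norm_square power2_eq_square flip: of_real_mult)
     (simp add: complex_mult_cnj cmod_def power2_eq_square)
  then have "cmod (cdot z w) = Re (cdot (u *s z) w)" by (simp add: cdot_smult_left)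
  also have "\<dots> \<le> norm (u *s z) * norm w" unfolding Re_cdot by (rule norm_cauchy_schwarz)
  finally show ?thesis by (simp add: norm_vec_smult u)
qed simp

lemma continuous_cdot [continuous_intros]:
  assumes "continuous_on A f" "continuous_on A g"
  shows "continuous_on A (\<lambda>x. cdot (f x) (g x))"
  unfolding cdot_def by (intro continuous_intros assms)

lemma measurable_cdot [measurable (raw)]:
  fixes f g :: "'a \<Rightarrow> complex^'n"
  assumes [measurable]: "f \<in> borel_measurable M" "g \<in> borel_measurable M"
  shows "(\<lambda>x. cdot (f x) (g x)) \<in> borel_measurable M"
proof -
  have "(\<lambda>(z, w). cdot z w :: complex) \<in> borel_measurable (borel :: ((complex^'n) \<times> (complex^'n)) measure)"
   by (intro borel_measurable_continuous_onI) (auto intro!: continuous_intros simp: split_beta)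
  then have "(\<lambda>(z, w). cdot z w :: complex) \<in> borel_measurable ((borel :: (complex^'n) measure) \<Otimes>\<^sub>M (borel :: (complex^'n) measure))"
   by (simp add: borel_prod)
  then show ?thesis
   using measurable_compose[of "\<lambda>x. (f x, g x)" M "borel \<Otimes>\<^sub>M borel" "\<lambda>(z, w). cdot z w" borel] by simp
qed

abbreviation rho :: "complex^'n \<Rightarrow> real" where "rho w \<equiv> 1 - (norm w)\<^sup>2"

definition ball_measure :: "(complex^'n) measure" (\<open>\<nu>\<close>) where
  "\<nu> = restrict_space lborel (ball 0 1)"

lemma space_ball_measure [simp]: "space \<nu> = ball 0 1"
  by (simp add: ball_measure_def space_restrict_space)

lemma sets_ball_measure [measurable_cong]: "sets \<nu> = sets (restrict_space borel (ball 0 1))"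
  unfolding ball_measure_def by (intro sets_restrict_space_cong) simp

lemma borel_imp_ball_measurable [measurable (raw)]:
  "f \<in> borel_measurable borel \<Longrightarrow> f \<in> borel_measurable \<nu>"
  by (simp add: ball_measure_def measurable_restrict_space1)

lemma finite_ball_measure: "finite_measure (\<nu> :: (complex^'n) measure)"
proof
  show "emeasure (\<nu> :: (complex^'n) measure) (space \<nu>) \<noteq> \<infinity>"
   using emeasure_lborel_ball_finite[of "0::complex^'n" 1]
   by (simp add: ball_measure_def emeasure_restrict_space)
qed

interpretation ball_measure: finite_measure "\<nu> :: (complex^'n::finite) measure"
  by (rule finite_ball_measure)

lemma rho_pos: "norm w < 1 \<Longrightarrow> 0 < rho w"
  by (simp add: abs_square_less_1)

text \<open>For \<open>c = x\<close> this is an equality, and the right-hand side is convex in \<open>x\<close>: the parameter makes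
  it possible to optimize after integration.\<close>

lemma weighted_young:
  fixes x c p :: real
  assumes "x \<ge> 0" "c > 0" "p \<ge> 1"
  shows "x \<le> (1/p) * c powr (1 - p) * x powr p + (1 - 1/p) * c"
proof (cases "x = 0")
  case True then show ?thesis using assms by auto
next
  case False
  then have x: "x > 0" using assms by simp
  have "(1 - p) / p + (1 - 1/p) = 0"
   using assms by (simp add: field_simps)
  then have "c powr ((1 - p) / p) * c powr (1 - 1/p) = 1"
   using assms(2) by (simp flip: powr_add)
  then have "x = (c powr (1-p) * x powr p) powr (1/p) * c powr (1 - 1/p)"
   using x assms by (simp add: powr_mult powr_powr mult.commute mult.left_commute)
  also have "\<dots> \<le> (1/p) * (c powr (1-p) * x powr p) + (1 - 1/p) * c"
   by (rule Youngs_inequality_0) (use assms x in auto)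
  finally show ?thesis by (simp add: mult.assoc)
qed

text \<open>Hoelder's inequality for the measure \<open>k dM\<close>, in the form in which the constant \<open>K\<close> only bounds
  the total mass. Integrating the weighted Young inequality pointwise avoids any theory of conjugate exponents and covers
  \<open>p = 1\<close>.\<close>

lemma integral_power_le:
  fixes \<phi> k :: "'a \<Rightarrow> real"
  assumes p: "p \<ge> 1" and [measurable]: "\<phi> \<in> borel_measurable M" "k \<in> borel_measurable M"
   and nonneg: "\<And>x. x \<in> space M \<Longrightarrow> \<phi> x \<ge> 0" "\<And>x. x \<in> space M \<Longrightarrow> k x \<ge> 0"
   and K: "(\<integral>\<^sup>+x. ennreal (k x) \<partial>M) \<le> ennreal K" "K > 0"
   and X: "(\<integral>\<^sup>+x. ennreal (\<phi> x powr p * k x) \<partial>M) \<le> ennreal X" "X \<ge> 0"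
  shows "integrable M (\<lambda>x. \<phi> x * k x) \<and> (\<integral>x. \<phi> x * k x \<partial>M) powr p \<le> K powr (p - 1) * X"
proof -
  have ik: "integrable M k"
   using K nonneg by (intro integrableI_nonneg) (auto simp: top_unique less_top[symmetric] AE_I2)
  have iX: "integrable M (\<lambda>x. \<phi> x powr p * k x)"
   using X nonneg by (intro integrableI_nonneg) (auto simp: top_unique less_top[symmetric] AE_I2)
  have K': "(\<integral>x. k x \<partial>M) \<le> K"
   using K nonneg by (subst integral_eq_nn_integral) (auto intro!: enn2real_leI)
  have X': "(\<integral>x. \<phi> x powr p * k x \<partial>M) \<le> X"
   using X nonneg by (subst integral_eq_nn_integral) (auto intro!: enn2real_leI)
  have y: "\<phi> x * k x \<le> (1/p) * c powr (1 - p) * (\<phi> x powr p * k x) + (1 - 1/p) * c * k x"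
   if "x \<in> space M" "c > 0" for x c
   using mult_right_mono[OF weighted_young[of "\<phi> x" c p] nonneg(2)[OF that(1)]] nonneg(1)[OF that(1)] p that
   by (simp add: algebra_simps)
  have int: "integrable M (\<lambda>x. \<phi> x * k x)"
  proof (rule Bochner_Integration.integrable_bound)
   show "integrable M (\<lambda>x. (1/p) * 1 powr (1 - p) * (\<phi> x powr p * k x) + (1 - 1/p) * 1 * k x)"
    using ik iX by simp
   show "AE x in M. norm (\<phi> x * k x) \<le> norm ((1/p) * 1 powr (1 - p) * (\<phi> x powr p * k x) + (1 - 1/p) * 1 * k x)"
    using y[of _ 1] nonneg by (intro AE_I2) (smt (verit) mult_nonneg_nonneg real_norm_def)
  qed simp
  have le: "(\<integral>x. \<phi> x * k x \<partial>M) \<le> (1/p) * c powr (1 - p) * X + (1 - 1/p) * c * K" if "c > 0" for c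
  proof -
   have "(\<integral>x. \<phi> x * k x \<partial>M) \<le> (\<integral>x. (1/p) * c powr (1 - p) * (\<phi> x powr p * k x) + (1 - 1/p) * c * k x \<partial>M)"
    using y[OF _ that] ik iX int by (intro integral_mono) auto
   also have "\<dots> = (1/p) * c powr (1 - p) * (\<integral>x. \<phi> x powr p * k x \<partial>M) + (1 - 1/p) * c * (\<integral>x. k x \<partial>M)"
    using ik iX by simp
   also have "\<dots> \<le> (1/p) * c powr (1 - p) * X + (1 - 1/p) * c * K"
    using K' X' p that by (intro add_mono mult_left_mono) auto
   finally show ?thesis .
  qed
  define I where "I = (\<integral>x. \<phi> x * k x \<partial>M)"
  have I0: "I \<ge> 0" unfolding I_def using nonneg by (intro integral_nonneg_AE) (auto intro!: AE_I2)
  \<comment> \<open>the optimal parameter in Young's inequality is \<open>c = I / K\<close>\<close>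
  have "I powr p \<le> K powr (p - 1) * X"
  proof (cases "I = 0")
   case True then show ?thesis using X K p by simp
  next
   case False
   with I0 have I: "I > 0" by simp
   define c where "c = I / K"
   have c: "c > 0" using I K by (simp add: c_def)
   have "I \<le> (1/p) * c powr (1 - p) * X + (1 - 1/p) * I"
    using le[OF c] K unfolding I_def[symmetric] by (simp add: c_def)
   then have "I \<le> c powr (1 - p) * X" using p by (simp add: field_simps)
   then have "c powr (p - 1) * I \<le> c powr (p - 1) * (c powr (1 - p) * X)"
    by (intro mult_left_mono) auto
   also have "\<dots> = X" using c by (simp flip: powr_add mult.assoc)
   finally have "c powr (p - 1) * I \<le> X" .
   then have "K powr (p - 1) * (c powr (p - 1) * I) \<le> K powr (p - 1) * X"
    by (intro mult_left_mono) auto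
   moreover have "K powr (p - 1) * (c powr (p - 1) * I) = I powr p"
    using I K c by (simp add: c_def powr_divide powr_diff)
   ultimately show ?thesis by simp
  qed
  then show ?thesis using int by (simp add: I_def)
qed

lemma ball_measure_distr_isometry:
  fixes T :: "complex^'n \<Rightarrow> complex^'n"
  assumes lin: "linear T" and iso: "\<And>x. norm (T x) = norm x"
  shows "distr \<nu> \<nu> T = \<nu>"
proof (rule measure_eqI)
  have [measurable]: "T \<in> borel \<rightarrow>\<^sub>M borel"
   using lin by (intro borel_measurable_continuous_onI linear_continuous_on linear_conv_bounded_linear[THEN iffD1])
  have [measurable]: "T \<in> \<nu> \<rightarrow>\<^sub>M \<nu>"
   unfolding ball_measure_def by (rule measurable_restrict_space3) (auto simp: iso)
  fix A assume "A \<in> sets (distr \<nu> \<nu> T)"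
  then have A: "A \<in> sets (\<nu> :: (complex^'n) measure)" by simp
  then obtain B where B: "B \<in> sets borel" "A = B \<inter> ball 0 1"
   by (auto simp: sets_ball_measure sets_restrict_space)
  have TA: "T -` A \<inter> ball 0 1 = T -` A" "T -` A \<subseteq> ball 0 1" using B by (auto simp: iso)
  have A': "A \<in> sets borel" using B by auto
  have "emeasure (distr \<nu> \<nu> T) A = emeasure lborel (T -` A)"
   using A TA by (simp add: emeasure_distr) (simp add: ball_measure_def emeasure_restrict_space)
  also have "\<dots> = emeasure (distr lborel borel T) A"
   using A' by (simp add: emeasure_distr)
  also have "\<dots> = emeasure \<nu> A"
   using B by (simp add: lborel_distr_isometry[OF lin iso] ball_measure_def emeasure_restrict_space)
  finally show "emeasure (distr \<nu> \<nu> T) A = emeasure \<nu> A" .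
qed simp

lemma linear_vec_smult: "linear (\<lambda>w :: complex^'n. c *s w)"
  by (rule linearI) (simp_all add: vec_eq_iff algebra_simps)

lemma integral_ball_rotate:
  fixes h :: "complex^'n \<Rightarrow> complex"
  assumes "cmod c = 1" and [measurable]: "h \<in> borel_measurable \<nu>"
  shows "(\<integral>w. h (c *s w) \<partial>\<nu>) = (\<integral>w. h w \<partial>\<nu>)"
proof -
  have m: "(\<lambda>w :: complex^'n. c *s w) \<in> borel \<rightarrow>\<^sub>M borel"
   by (intro borel_measurable_continuous_onI linear_continuous_on linear_conv_bounded_linear[THEN iffD1] linear_vec_smult)
  have [measurable]: "(\<lambda>w :: complex^'n. c *s w) \<in> \<nu> \<rightarrow>\<^sub>M \<nu>"
   unfolding ball_measure_def using m by (intro measurable_restrict_space3) (auto simp: norm_vec_smult assms)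
  have "(\<integral>w. h w \<partial>\<nu>) = (\<integral>w. h w \<partial>distr \<nu> \<nu> (\<lambda>w. c *s w))"
   by (subst ball_measure_distr_isometry) (simp_all add: linear_vec_smult norm_vec_smult assms)
  also have "\<dots> = (\<integral>w. h (c *s w) \<partial>\<nu>)"
   by (rule integral_distr) simp_all
  finally show ?thesis by simp
qed

lemma integral_lborel_rotate:
  fixes h :: "complex^'n \<Rightarrow> complex"
  assumes "cmod c = 1" and [measurable]: "h \<in> borel_measurable borel"
  shows "(\<integral>w. h (c *s w) \<partial>lborel) = (\<integral>w. h w \<partial>lborel)"
proof -
  have m [measurable]: "(\<lambda>w :: complex^'n. c *s w) \<in> borel \<rightarrow>\<^sub>M borel"
   by (intro borel_measurable_continuous_onI linear_continuous_on linear_conv_bounded_linear[THEN iffD1] linear_vec_smult)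
  have "(\<integral>w. h w \<partial>lborel) = (\<integral>w. h w \<partial>distr lborel borel (\<lambda>w. c *s w))"
   by (subst lborel_distr_isometry) (simp_all add: linear_vec_smult norm_vec_smult assms)
  also have "\<dots> = (\<integral>w. h (c *s w) \<partial>lborel)"
   by (rule integral_distr) simp_all
  finally show ?thesis by simp
qed

section \<open>Moments of homogeneous functions\<close>

lemma nn_integral_lborel_scale:
  fixes f :: "complex^'n \<Rightarrow> ennreal"
  assumes [measurable]: "f \<in> borel_measurable borel" and r: "r > 0"
  shows "(\<integral>\<^sup>+w. f w \<partial>lborel) = ennreal (r ^ (2 * CARD('n))) * (\<integral>\<^sup>+w. f (r *\<^sub>R w) \<partial>lborel)"
proof -
  define c where "c = ennreal (\<bar>r\<bar> ^ DIM(complex^'n))"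
  have "lborel = density (distr lborel borel (\<lambda>x. 0 + r *\<^sub>R x)) (\<lambda>_ :: complex^'n. c)"
   unfolding c_def by (rule lborel_affine) (use r in simp)
  then have "(\<integral>\<^sup>+w. f w \<partial>lborel) = (\<integral>\<^sup>+w. f w \<partial>density (distr lborel borel (\<lambda>x. 0 + r *\<^sub>R x)) (\<lambda>_. c))"
   by (rule arg_cong)
  also have "\<dots> = (\<integral>\<^sup>+w. c * f (r *\<^sub>R w) \<partial>lborel)"
   by (simp add: nn_integral_density nn_integral_distr)
  also have "\<dots> = c * (\<integral>\<^sup>+w. f (r *\<^sub>R w) \<partial>lborel)"
   by (rule nn_integral_cmult) simp
  also have "c = ennreal (r ^ (2 * CARD('n)))"
   using r by (simp add: c_def mult.commute)
  finally show ?thesis .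
qed

text \<open>Integration in polar coordinates without surface measure: the image of \<open>Q dv\<close> under
  \<open>w \<mapsto> \<bar>w\<bar>\<^sup>2\<close> is determined by the masses of balls, which homogeneity gives as
  \<open>q x\<^sup>m\<close>. Hence it has density \<open>q m x\<^sup>m\<^sup>-\<^sup>1\<close>.\<close>

lemma nn_integral_homogeneous_radial:
  fixes Q :: "complex^'n \<Rightarrow> real" and h :: "real \<Rightarrow> ennreal"
  assumes [measurable]: "Q \<in> borel_measurable borel" "h \<in> borel_measurable borel"
   and nonneg: "\<And>w. Q w \<ge> 0"
   and hom: "\<And>r w. r > 0 \<Longrightarrow> Q (r *\<^sub>R w) = r ^ (2 * k) * Q w"
   and q: "(\<integral>\<^sup>+w. ennreal (Q w) * indicator (ball 0 1) w \<partial>lborel) = ennreal q" "q \<ge> 0"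
  defines "m \<equiv> k + CARD('n)"
  shows "(\<integral>\<^sup>+w. ennreal (Q w) * h ((norm w)\<^sup>2) \<partial>lborel) =
      ennreal (q * m) * (\<integral>\<^sup>+x. ennreal (x ^ (m - 1)) * h x * indicator {0<..} x \<partial>lborel)"
proof -
  have m: "m > 0" by (simp add: m_def)
  have [measurable]: "ball (0 :: complex^'n) 1 \<in> sets borel" by simp
  define M1 where "M1 = distr (density lborel (\<lambda>w. ennreal (Q w))) borel (\<lambda>w. (norm w)\<^sup>2)"
  define M2 where "M2 = density lborel (\<lambda>x. ennreal (q * m) * ennreal (x ^ (m - 1)) * indicator {0<..} (x::real))"
  have M1: "emeasure M1 {..<x} = ennreal (q * (max 0 x) ^ m)" for x
  proof (cases "x > 0")
   case False
   have "emeasure M1 {..<x} = (\<integral>\<^sup>+w. ennreal (Q w) * indicator {w. (norm w)\<^sup>2 < x} w \<partial>lborel)"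
    by (simp add: M1_def emeasure_distr emeasure_density vimage_def)
   also have "\<dots> = (\<integral>\<^sup>+(w::complex^'n). 0 \<partial>lborel)"
    using False by (intro nn_integral_cong) (auto simp: indicator_def dest: le_less_trans[OF zero_le_power2])
   finally show ?thesis using False m by (simp add: max_def power_0_left)
  next
   case True
   define r where "r = sqrt x"
   have r: "r > 0" "x = r\<^sup>2" using True by (auto simp: r_def)
   have "emeasure M1 {..<x} = (\<integral>\<^sup>+w. ennreal (Q w) * indicator {w. (norm w)\<^sup>2 < x} w \<partial>lborel)"
    by (simp add: M1_def emeasure_distr emeasure_density vimage_def)
   also have "\<dots> = ennreal (r ^ (2 * CARD('n))) * (\<integral>\<^sup>+w. ennreal (Q (r *\<^sub>R w)) * indicator {w. (norm w)\<^sup>2 < x} (r *\<^sub>R w) \<partial>lborel)"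
    by (rule nn_integral_lborel_scale) (use r in auto)
   also have "(\<integral>\<^sup>+w. ennreal (Q (r *\<^sub>R w)) * indicator {w. (norm w)\<^sup>2 < x} (r *\<^sub>R w) \<partial>lborel)
     = (\<integral>\<^sup>+w. ennreal (r ^ (2 * k)) * (ennreal (Q w) * indicator (ball 0 1) w) \<partial>lborel)"
   proof (rule nn_integral_cong)
    fix w :: "complex^'n"
    have "(norm (r *\<^sub>R w))\<^sup>2 < x \<longleftrightarrow> norm w < 1"
     using r by (simp add: power_mult_distrib abs_square_less_1)
    then show "ennreal (Q (r *\<^sub>R w)) * indicator {w. (norm w)\<^sup>2 < x} (r *\<^sub>R w) = ennreal (r ^ (2 * k)) * (ennreal (Q w) * indicator (ball 0 1) w)"
     using r nonneg by (auto simp: indicator_def hom ennreal_mult)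
   qed
   also have "\<dots> = ennreal (r ^ (2 * k)) * ennreal q"
    unfolding q(1)[symmetric] by (rule nn_integral_cmult) measurable
   finally have "emeasure M1 {..<x} = ennreal (r ^ (2 * CARD('n)) * (r ^ (2 * k) * q))"
    using r q by (simp add: ennreal_mult)
   also have "r ^ (2 * CARD('n)) * (r ^ (2 * k) * q) = q * x ^ m"
    unfolding r(2) m_def power_mult[symmetric] by (simp add: distrib_left power_add)
   finally show ?thesis using True by (simp add: max_def)
  qed
  have M2: "emeasure M2 {..<x} = ennreal (q * (max 0 x) ^ m)" for x
  proof -
   have "emeasure M2 {..<x} = (\<integral>\<^sup>+y. ennreal (q * (m * y ^ (m - 1))) * indicator {0..max 0 x} y \<partial>lborel)"
   proof -
    have "AE y in lborel. y \<noteq> 0 \<and> y \<noteq> x"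
     by (intro AE_conjI AE_lborel_singleton)
    then have "AE y in lborel. ennreal (q * m) * ennreal (y ^ (m - 1)) * indicator {0<..} y * indicator {..<x} y
      = ennreal (q * (m * y ^ (m - 1))) * indicator {0..max 0 x} y"
     by eventually_elim (use q in \<open>auto simp: indicator_def ennreal_mult'[symmetric] mult_ac max_def split: if_splits\<close>)
    then show ?thesis
     unfolding M2_def by (subst emeasure_density) (auto intro!: nn_integral_cong_AE)
   qed
   also have "\<dots> = q * (max 0 x) ^ m - q * 0 ^ m"
    using q m by (intro nn_integral_FTC_Icc) (auto intro!: derivative_eq_intros)
   finally show ?thesis using m by (simp add: power_0_left)
  qed
  have "M1 = M2"
  proof (rule measure_eqI_generator_eq[where E = "range lessThan" and \<Omega> = UNIV and A = "\<lambda>i. {..<real i}"])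
   show "Int_stable (range (lessThan :: real \<Rightarrow> _))"
   proof (unfold Int_stable_def, intro ballI)
    fix a b :: "real set" assume "a \<in> range lessThan" "b \<in> range lessThan"
    then obtain x y where "a = {..<x}" "b = {..<y}" by blast
    then have "a \<inter> b = {..<min x y}" by auto
    then show "a \<inter> b \<in> range lessThan" by (simp only: rangeI)
   qed
   show "sets M1 = sigma_sets UNIV (range lessThan)" "sets M2 = sigma_sets UNIV (range lessThan)"
    by (simp_all add: M1_def M2_def borel_Iio)
   show "(\<Union>i. {..<real i}) = UNIV" by (auto simp: reals_Archimedean2)
  qed (auto simp: M1 M2)
  have "(\<integral>\<^sup>+w. ennreal (Q w) * h ((norm w)\<^sup>2) \<partial>lborel) = (\<integral>\<^sup>+x. h x \<partial>M1)"
   by (simp add: M1_def nn_integral_distr nn_integral_density)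
  also have "\<dots> = (\<integral>\<^sup>+x. ennreal (q * m) * (ennreal (x ^ (m - 1)) * h x * indicator {0<..} x) \<partial>lborel)"
   unfolding \<open>M1 = M2\<close> M2_def by (subst nn_integral_density) (simp_all add: mult_ac)
  also have "\<dots> = ennreal (q * m) * (\<integral>\<^sup>+x. ennreal (x ^ (m - 1)) * h x * indicator {0<..} x \<partial>lborel)"
   by (rule nn_integral_cmult) simp
  finally show ?thesis .
qed

text \<open>By the radial formula the Gaussian integral of \<open>Q\<close> is \<open>q m \<Gamma>(m)\<close> and the weighted integral
  over the ball is \<open>q m B(m, t + 1)\<close>; the quotient is the one claimed. So integrals of homogeneous
  functions over the ball can be read off from Gaussian integrals, where the exponential kernel
  is available.\<close>

lemma moments_nonneg:
  fixes Q :: "complex^'n \<Rightarrow> real"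
  assumes [measurable]: "Q \<in> borel_measurable borel"
   and nonneg: "\<And>w. Q w \<ge> 0" and le: "\<And>w. Q w \<le> C * norm w ^ (2 * k)"
   and hom: "\<And>r w. r > 0 \<Longrightarrow> Q (r *\<^sub>R w) = r ^ (2 * k) * Q w" and t: "t > -1"
  shows "\<exists>G. has_bochner_integral lborel (\<lambda>w. Q w * exp (- (norm w)\<^sup>2)) G \<and>
        has_bochner_integral \<nu> (\<lambda>w. Q w * rho w powr t)
         (Gamma (t + 1) / Gamma (real k + real CARD('n) + t + 1) * G)"
proof -
  define m where "m = k + CARD('n)"
  have m: "m > 0" by (simp add: m_def)
  have C: "Q w \<le> C" if "norm w < 1" for w
  proof -
   have "0 \<le> C * norm w ^ (2 * k)" using nonneg[of w] le[of w] by linarith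
   show ?thesis
   proof (cases "C \<ge> 0")
    case True
    have "C * norm w ^ (2 * k) \<le> C * 1" using that True by (intro mult_left_mono power_le_one) auto
    then show ?thesis using le[of w] by simp
   next
    case False
    have "Q (axis undefined 1) \<le> C" using le[of "axis undefined 1"] by (simp add: norm_axis_1)
    with False nonneg[of "axis undefined 1"] show ?thesis by simp
   qed
  qed
  have "(\<integral>\<^sup>+w. ennreal (Q w) * indicator (ball 0 1) w \<partial>lborel) \<le> (\<integral>\<^sup>+w. ennreal C * indicator (ball (0::complex^'n) 1) w \<partial>lborel)"
   using C by (intro nn_integral_mono) (auto simp: indicator_def intro!: ennreal_leI)
  also have "\<dots> = ennreal C * emeasure lborel (ball (0::complex^'n) 1)"
   by (simp add: nn_integral_cmult_indicator)
  also have "\<dots> < \<infinity>" using emeasure_lborel_ball_finite[of "0::complex^'n" 1]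
   by (simp add: ennreal_mult_less_top)
  finally obtain q where q: "q \<ge> 0" "(\<integral>\<^sup>+w. ennreal (Q w) * indicator (ball 0 1) w \<partial>lborel) = ennreal q"
   by (cases "\<integral>\<^sup>+w. ennreal (Q w) * indicator (ball 0 1) w \<partial>lborel" rule: ennreal_cases) auto
  note rad = nn_integral_homogeneous_radial[OF assms(1) _ nonneg hom q(2) q(1), folded m_def]
  have pw: "x ^ (m - 1) = x powr (real m - 1)" if "x > 0" for x :: real
  proof -
   have "real m - 1 = real (m - 1)" using m by (simp add: of_nat_diff Suc_leI)
   then show ?thesis using powr_realpow[OF that, of "m - 1"] by metis
  qed
  have "(\<integral>\<^sup>+w. ennreal (Q w) * ennreal (exp (- (norm w)\<^sup>2)) \<partial>lborel) =
    ennreal (q * m) * (\<integral>\<^sup>+x. ennreal (x ^ (m - 1)) * ennreal (exp (-x)) * indicator {0<..} x \<partial>lborel)"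
   by (rule rad) auto
  also have "(\<integral>\<^sup>+x. ennreal (x ^ (m - 1)) * ennreal (exp (-x)) * indicator {0<..} x \<partial>lborel) =
    (\<integral>\<^sup>+x. ennreal (x powr (real m - 1) / exp x) * indicator {0..} x \<partial>lborel)"
  proof (rule nn_integral_cong)
   fix x :: real
   show "ennreal (x ^ (m - 1)) * ennreal (exp (-x)) * indicator {0<..} x =
     ennreal (x powr (real m - 1) / exp x) * indicator {0..} x"
   proof (cases "x > 0")
    case True
    then show ?thesis unfolding pw[OF True] by (simp add: ennreal_mult[symmetric] exp_minus divide_inverse)
   qed (auto simp: indicator_def)
  qed
  also have "\<dots> = ennreal (Gamma m)"
   using m by (intro nn_integral_has_integral_lebesgue' Gamma_integral_real) auto
  finally have 1: "(\<integral>\<^sup>+w. ennreal (Q w * exp (- (norm w)\<^sup>2)) \<partial>lborel) = ennreal (q * m * Gamma m)"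
   using nonneg q m by (simp add: ennreal_mult' ennreal_mult'')
  have "(\<integral>\<^sup>+w. ennreal (Q w * rho w powr t) \<partial>\<nu>) =
    (\<integral>\<^sup>+w. ennreal (Q w) * (ennreal ((1 - (norm w)\<^sup>2) powr t) * indicator {..<1} ((norm w)\<^sup>2)) \<partial>lborel)"
   unfolding ball_measure_def using nonneg
   by (subst nn_integral_restrict_space)
     (auto intro!: nn_integral_cong simp: indicator_def ennreal_mult' abs_square_less_1)
  also have "\<dots> = ennreal (q * m) * (\<integral>\<^sup>+x. ennreal (x ^ (m - 1)) * (ennreal ((1 - x) powr t) * indicator {..<1} x) * indicator {0<..} x \<partial>lborel)"
   by (rule rad) auto
  also have "(\<integral>\<^sup>+x. ennreal (x ^ (m - 1)) * (ennreal ((1 - x) powr t) * indicator {..<1} x) * indicator {0<..} x \<partial>lborel)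
    = (\<integral>\<^sup>+x. ennreal (x powr (real m - 1) * (1 - x) powr (t + 1 - 1)) * indicator {0..1} x \<partial>lborel)"
  proof (rule nn_integral_cong)
   fix x :: real
   show "ennreal (x ^ (m - 1)) * (ennreal ((1 - x) powr t) * indicator {..<1} x) * indicator {0<..} x =
     ennreal (x powr (real m - 1) * (1 - x) powr (t + 1 - 1)) * indicator {0..1} x"
   proof (cases "x > 0")
    case True
    then show ?thesis unfolding pw[OF True] by (auto simp: ennreal_mult[symmetric] indicator_def)
   qed (auto simp: indicator_def)
  qed
  also have "\<dots> = ennreal (Beta m (t + 1))"
   using m t by (intro nn_integral_has_integral_lebesgue' has_integral_Beta_real) auto
  finally have 2: "(\<integral>\<^sup>+w. ennreal (Q w * rho w powr t) \<partial>\<nu>) = ennreal (q * m * Beta m (t + 1))"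
   using q by (simp add: ennreal_mult')
  have Gp: "Gamma (real m) > 0" "Gamma (real m + (t + 1)) > 0" "Gamma (t + 1) > 0"
   using m t by (auto intro!: Gamma_real_pos)
  show ?thesis
  proof (intro exI conjI)
   show "has_bochner_integral lborel (\<lambda>w. Q w * exp (- (norm w)\<^sup>2)) (q * m * Gamma m)"
    using 1 nonneg q m Gp by (intro has_bochner_integral_nn_integral) auto
   have "has_bochner_integral \<nu> (\<lambda>w. Q w * rho w powr t) (q * m * Beta m (t + 1))"
    using 2 nonneg q m Gp by (intro has_bochner_integral_nn_integral) (auto simp: Beta_def)
   also have "q * m * Beta m (t + 1) = Gamma (t + 1) / Gamma (real k + real CARD('n) + t + 1) * (q * m * Gamma m)"
    by (simp add: Beta_def m_def add_ac)
   finally show "has_bochner_integral \<nu> (\<lambda>w. Q w * rho w powr t) \<dots>" .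
  qed
qed

lemma moments_real:
  fixes Q :: "complex^'n \<Rightarrow> real"
  assumes [measurable]: "Q \<in> borel_measurable borel" and le: "\<And>w. \<bar>Q w\<bar> \<le> C * norm w ^ (2 * k)"
   and hom: "\<And>r w. r > 0 \<Longrightarrow> Q (r *\<^sub>R w) = r ^ (2 * k) * Q w" and t: "t > -1"
  shows "\<exists>G. has_bochner_integral lborel (\<lambda>w. Q w * exp (- (norm w)\<^sup>2)) G \<and>
        has_bochner_integral \<nu> (\<lambda>w. Q w * rho w powr t)
         (Gamma (t + 1) / Gamma (real k + real CARD('n) + t + 1) * G)"
proof -
  obtain G1 where G1: "has_bochner_integral lborel (\<lambda>w. max 0 (Q w) * exp (- (norm w)\<^sup>2)) G1"
    "has_bochner_integral \<nu> (\<lambda>w. max 0 (Q w) * rho w powr t)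
         (Gamma (t + 1) / Gamma (real k + real CARD('n) + t + 1) * G1)"
  proof -
   have "max 0 (Q w) \<le> C * norm w ^ (2 * k)" for w using le[of w] by linarith
   moreover have "max 0 (Q (r *\<^sub>R w)) = r ^ (2 * k) * max 0 (Q w)" if "r > 0" for r w
    using that by (simp add: hom max_mult_distrib_left)
   ultimately show ?thesis using moments_nonneg[of "\<lambda>w. max 0 (Q w)" C k t] t that by auto
  qed
  obtain G2 where G2: "has_bochner_integral lborel (\<lambda>w. max 0 (- Q w) * exp (- (norm w)\<^sup>2)) G2"
    "has_bochner_integral \<nu> (\<lambda>w. max 0 (- Q w) * rho w powr t)
         (Gamma (t + 1) / Gamma (real k + real CARD('n) + t + 1) * G2)"
  proof -
   have "max 0 (- Q w) \<le> C * norm w ^ (2 * k)" for w using le[of w] by linarith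
   moreover have "max 0 (- Q (r *\<^sub>R w)) = r ^ (2 * k) * max 0 (- Q w)" if "r > 0" for r w
    using that by (simp add: hom max_mult_distrib_left)
   ultimately show ?thesis using moments_nonneg[of "\<lambda>w. max 0 (- Q w)" C k t] t that by auto
  qed
  have eq: "max 0 (Q w) * x - max 0 (- Q w) * x = Q w * x" for w x by (auto simp: max_def)
  show ?thesis
   using has_bochner_integral_diff[OF G1(1) G2(1)] has_bochner_integral_diff[OF G1(2) G2(2)]
   unfolding eq right_diff_distrib[symmetric] by blast
qed

lemma homogeneous_moments:
  fixes Q :: "complex^'n \<Rightarrow> complex"
  assumes [measurable]: "Q \<in> borel_measurable borel" and le: "\<And>w. cmod (Q w) \<le> C * norm w ^ (2 * k)"
   and hom: "\<And>r w. r > 0 \<Longrightarrow> Q (r *\<^sub>R w) = of_real r ^ (2 * k) * Q w" and t: "t > -1"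
  shows "\<exists>G. has_bochner_integral lborel (\<lambda>w. Q w * of_real (exp (- (norm w)\<^sup>2))) G \<and>
        has_bochner_integral \<nu> (\<lambda>w. Q w * of_real (rho w powr t))
         (of_real (Gamma (t + 1) / Gamma (real k + real CARD('n) + t + 1)) * G)"
proof -
  have hom': "Q (r *\<^sub>R w) = of_real (r ^ (2 * k)) * Q w" if "r > 0" for r w
   using hom[OF that] by simp
  obtain G1 where G1: "has_bochner_integral lborel (\<lambda>w. Re (Q w) * exp (- (norm w)\<^sup>2)) G1"
    "has_bochner_integral \<nu> (\<lambda>w. Re (Q w) * rho w powr t)
         (Gamma (t + 1) / Gamma (real k + real CARD('n) + t + 1) * G1)"
   using moments_real[of "\<lambda>w. Re (Q w)" C k t] t order_trans[OF abs_Re_le_cmod le] by (auto simp: hom')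
  obtain G2 where G2: "has_bochner_integral lborel (\<lambda>w. Im (Q w) * exp (- (norm w)\<^sup>2)) G2"
    "has_bochner_integral \<nu> (\<lambda>w. Im (Q w) * rho w powr t)
         (Gamma (t + 1) / Gamma (real k + real CARD('n) + t + 1) * G2)"
   using moments_real[of "\<lambda>w. Im (Q w)" C k t] t order_trans[OF abs_Im_le_cmod le] by (auto simp: hom')
  have eq: "of_real (Re (Q w) * x) + \<i> * of_real (Im (Q w) * x) = Q w * of_real x" for w x
   by (simp add: complex_eq_iff)
  have i: "has_bochner_integral M (\<lambda>w. \<i> * f w) (\<i> * x)" if "has_bochner_integral M f x"
   for M :: "(complex^'n) measure" and f x
   using that by (intro has_bochner_integral_mult_right) auto
  define c where "c = Gamma (t + 1) / Gamma (real k + real CARD('n) + t + 1)"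
  have "has_bochner_integral lborel (\<lambda>w. Q w * of_real (exp (- (norm w)\<^sup>2))) (of_real G1 + \<i> * of_real G2)"
   using has_bochner_integral_add[OF has_bochner_integral_of_real[OF G1(1)] i[OF has_bochner_integral_of_real[OF G2(1)]]]
   unfolding eq .
  moreover have "has_bochner_integral \<nu> (\<lambda>w. Q w * of_real (rho w powr t)) (of_real (c * G1) + \<i> * of_real (c * G2))"
   using has_bochner_integral_add[OF has_bochner_integral_of_real[OF G1(2)] i[OF has_bochner_integral_of_real[OF G2(2)]]]
   unfolding eq c_def .
  moreover have "of_real (c * G1) + \<i> * of_real (c * G2) = of_real c * (of_real G1 + \<i> * of_real G2)"
   by (simp add: algebra_simps)
  ultimately show ?thesis
   unfolding c_def[symmetric] by (intro exI[of _ "of_real G1 + \<i> * of_real G2"] conjI) simp_all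
qed

section \<open>Homogeneous expansions\<close>

definition unity_root :: "nat \<Rightarrow> complex" where
  "unity_root m = cis (2 * pi / real m)"

text \<open>A discrete substitute for the Fourier coefficient \<open>\<integral> F(e\<^sup>i\<^sup>s) e\<^sup>-\<^sup>i\<^sup>k\<^sup>s ds / 2\<pi>\<close>.
  Being a finite sum, it preserves measurability and holomorphy in parameters and commutes with
  integrals, and it tends to the coefficient as \<open>m\<close> grows.\<close>

definition root_average :: "nat \<Rightarrow> nat \<Rightarrow> (complex \<Rightarrow> complex) \<Rightarrow> complex" where
  "root_average m k F = (\<Sum>j<m. F (unity_root m ^ j) * cnj (unity_root m ^ j) ^ k) / of_nat m"

lemma norm_unity_root [simp]: "cmod (unity_root m) = 1"
  by (simp add: unity_root_def)

lemma root_average_bound: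
  assumes "\<And>c. cmod c = 1 \<Longrightarrow> cmod (F c) \<le> B" "B \<ge> 0"
  shows "cmod (root_average m k F) \<le> B"
proof (cases "m = 0")
  case False
  have "cmod (\<Sum>j<m. F (unity_root m ^ j) * cnj (unity_root m ^ j) ^ k) \<le> (\<Sum>j<m. B)"
   by (intro order_trans[OF norm_sum] sum_mono) (auto simp: norm_mult norm_power intro!: assms)
  also have "\<dots> = real m * B" by simp
  finally show ?thesis using False by (simp add: root_average_def norm_divide field_simps)
qed (use assms in \<open>simp add: root_average_def\<close>)

lemma root_average_monomial:
  assumes "m > 0"
  shows "root_average m k (\<lambda>c. c ^ k) = 1"
   and "i < m \<Longrightarrow> k < m \<Longrightarrow> i \<noteq> k \<Longrightarrow> root_average m k (\<lambda>c. c ^ i) = 0"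
   and "cmod (root_average m k (\<lambda>c. c ^ i)) \<le> 1"
proof -
  have "(unity_root m ^ j) ^ k * cnj (unity_root m ^ j) ^ k = 1" for j
  proof -
   have "unity_root m ^ j * cnj (unity_root m ^ j) = 1"
    by (subst complex_norm_square[symmetric]) (simp add: norm_power)
   then show ?thesis by (metis power_mult_distrib power_one)
  qed
  then show "root_average m k (\<lambda>c. c ^ k) = 1" using assms by (simp add: root_average_def)
  show "cmod (root_average m k (\<lambda>c. c ^ i)) \<le> 1"
   by (rule root_average_bound) (auto simp: norm_power)
  assume *: "i < m" "k < m" "i \<noteq> k"
  define x where "x = unity_root m ^ i * cnj (unity_root m) ^ k"
  have x: "x = cis (2 * pi * ((real i - real k) / m))"
  proof -
   have "x = cis (real i * (2 * pi / real m) + real k * - (2 * pi / real m))"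
    unfolding x_def unity_root_def complex_cnj_power cis_cnj Complex.DeMoivre cis_mult ..
   also have "real i * (2 * pi / real m) + real k * - (2 * pi / real m) = 2 * pi * ((real i - real k) / m)"
    using assms by (simp add: field_simps)
   finally show ?thesis .
  qed
  have "x ^ m = cis (2 * pi * of_int (int i - int k))"
  proof -
   have "real m * (2 * pi * ((real i - real k) / m)) = 2 * pi * of_int (int i - int k)"
    using assms by (simp add: field_simps)
   then show ?thesis unfolding x Complex.DeMoivre by (rule arg_cong)
  qed
  also have "\<dots> = 1" by (rule cis_multiple_2pi) auto
  finally have xm: "x ^ m = 1" .
  have "x \<noteq> 1"
  proof
   assume "x = 1"
   then have "cos (2 * pi * ((real i - real k) / m)) = 1" by (simp add: x complex_eq_iff)
   then obtain l :: int where l: "2 * pi * ((real i - real k) / m) = of_int l * 2 * pi"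
    by (auto simp: cos_one_2pi_int)
   then have "(2 * pi) * ((real i - real k) / m) = (2 * pi) * of_int l" by (simp only: mult_ac)
   then have "(real i - real k) / m = of_int l" by (simp only: mult_cancel_left) simp
   then have "real i - real k = of_int l * real m" using assms by (simp add: field_simps)
   then have "real_of_int (int i - int k) = real_of_int (l * int m)" by simp
   then have eq: "int i - int k = l * int m" by (simp only: of_int_eq_iff)
   then have "l \<noteq> 0" using * by auto
   then have "\<bar>l * int m\<bar> \<ge> int m" by (auto simp: abs_mult mult_le_cancel_right1)
   with eq * show False by linarith
  qed
  then have "(\<Sum>j<m. x ^ j) = 0" using geometric_sum[of x m] xm by simp
  moreover have "(unity_root m ^ j) ^ i * cnj (unity_root m ^ j) ^ k = x ^ j" for j
   by (simp add: x_def power_mult_distrib flip: power_mult) (simp add: mult.commute)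
  ultimately show "root_average m k (\<lambda>c. c ^ i) = 0" by (simp add: root_average_def)
qed

text \<open>Averaging over \<open>m\<close>-th roots of unity kills all monomials of degree less than \<open>m\<close> except the
  \<open>k\<close>-th, so only the tail of the power series contributes.\<close>

lemma root_average_error:
  assumes sm: "summable (\<lambda>i. cmod (a i))" and F: "\<And>c. cmod c = 1 \<Longrightarrow> (\<lambda>i. a i * c ^ i) sums F c"
   and k: "k < m"
  shows "cmod (root_average m k F - a k) \<le> (\<Sum>i. cmod (a (i + m)))"
proof -
  define e where "e i = root_average m k (\<lambda>c. c ^ i)" for i
  have m: "m > 0" using k by simp
  have "(\<lambda>i. (\<Sum>j<m. (a i * (unity_root m ^ j) ^ i) * cnj (unity_root m ^ j) ^ k) / of_nat m)
    sums root_average m k F"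
   unfolding root_average_def by (intro sums_divide sums_sum sums_mult2 F) (simp add: norm_power)
  also have "(\<lambda>i. (\<Sum>j<m. (a i * (unity_root m ^ j) ^ i) * cnj (unity_root m ^ j) ^ k) / of_nat m) = (\<lambda>i. a i * e i)"
   by (simp add: e_def root_average_def sum_distrib_left mult_ac)
  finally have "(\<lambda>i. a i * e i - (if i = k then a i else 0)) sums (root_average m k F - a k)"
   by (intro sums_diff sums_single)
  moreover have vanish: "(\<Sum>i<m. a i * e i - (if i = k then a i else 0)) = 0"
   using root_average_monomial(1,2)[OF m] k by (intro sum.neutral) (auto simp: e_def)
  moreover have "i + m \<noteq> k" for i using k by simp
  ultimately have s: "(\<lambda>i. a (i + m) * e (i + m)) sums (root_average m k F - a k)"
   using k sums_iff_shift[of "\<lambda>i. a i * e i - (if i = k then a i else 0)" m "root_average m k F - a k"]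
    vanish by simp
  have e1: "cmod (e i) \<le> 1" for i unfolding e_def by (rule root_average_monomial(3)[OF m])
  have le: "cmod (a (i + m) * e (i + m)) \<le> cmod (a (i + m))" for i
   using mult_left_mono[OF e1[of "i + m"], of "cmod (a (i + m))"] by (simp add: norm_mult)
  have sm': "summable (\<lambda>i. cmod (a (i + m)))" using sm by (rule summable_ignore_initial_segment)
  have sme: "summable (\<lambda>i. cmod (a (i + m) * e (i + m)))"
   using le by (intro summable_comparison_test'[OF sm', of 0]) auto
  show ?thesis unfolding sums_unique[OF s]
   using summable_norm[OF sme] suminf_le[OF le sme sm'] by linarith
qed

lemma root_average_tendsto:
  assumes sm: "summable (\<lambda>i. cmod (a i))" and F: "\<And>c. cmod c = 1 \<Longrightarrow> (\<lambda>i. a i * c ^ i) sums F c"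
  shows "(\<lambda>m. root_average m k F) \<longlonglongrightarrow> a k"
proof -
  have "(\<lambda>m. (\<Sum>i. cmod (a i)) - (\<Sum>i<m. cmod (a i))) \<longlonglongrightarrow> (\<Sum>i. cmod (a i)) - (\<Sum>i. cmod (a i))"
   by (intro tendsto_intros summable_LIMSEQ sm)
  also have "(\<lambda>m. (\<Sum>i. cmod (a i)) - (\<Sum>i<m. cmod (a i))) = (\<lambda>m. \<Sum>i. cmod (a (i + m)))"
   using suminf_minus_initial_segment[OF sm] by simp
  finally have "(\<lambda>m. \<Sum>i. cmod (a (i + m))) \<longlonglongrightarrow> 0" by simp
  then have "(\<lambda>m. root_average m k F - a k) \<longlonglongrightarrow> 0"
   by (rule Lim_null_comparison[rotated])
    (auto intro!: eventually_sequentiallyI[of "Suc k"] root_average_error[OF sm F])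
  then show ?thesis by (simp add: LIM_zero_iff)
qed

text \<open>The \<open>k\<close>-th term of the homogeneous expansion of \<open>g\<close>. It only looks at the slice through the
  origin and \<open>u\<close>, and is therefore defined for all \<open>u\<close>, not only in the ball.\<close>

definition hom_part :: "(complex^'n \<Rightarrow> complex) \<Rightarrow> nat \<Rightarrow> complex^'n \<Rightarrow> complex" where
  "hom_part g k u = (deriv ^^ k) (\<lambda>c. g (c *s u)) 0 / fact k"

definition slice_holomorphic :: "(complex^'n \<Rightarrow> complex) \<Rightarrow> bool" where
  "slice_holomorphic g \<longleftrightarrow> (\<forall>u. (\<lambda>c. g (c *s u)) holomorphic_on {c. cmod c * norm u < 1})"

lemma slice_ball:
  assumes "cmod c * norm (u :: complex^'n) < 1"
  obtains r where "cmod c < r" "ball 0 r \<subseteq> {c. cmod c * norm u < 1}"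
proof (cases "u = 0")
  case False
  then show ?thesis using assms by (intro that[of "1 / norm u"]) (auto simp: field_simps)
qed (use that[of "cmod c + 1"] in auto)

lemma hom_part_sums:
  assumes "slice_holomorphic g" "cmod c * norm u < 1"
  shows "(\<lambda>k. hom_part g k u * c ^ k) sums g (c *s u)"
proof -
  obtain r where r: "cmod c < r" "ball 0 r \<subseteq> {c. cmod c * norm u < 1}" using slice_ball[OF assms(2)] .
  then have "(\<lambda>c. g (c *s u)) holomorphic_on ball 0 r"
   using assms(1) holomorphic_on_subset unfolding slice_holomorphic_def by blast
  from holomorphic_power_series[OF this, of c] show ?thesis using r by (simp add: hom_part_def)
qed

lemma hom_part_summable:
  assumes "slice_holomorphic g" "cmod c * norm u < 1"
  shows "summable (\<lambda>k. cmod (hom_part g k u * c ^ k))"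
proof -
  obtain r where r: "cmod c < r" "ball 0 r \<subseteq> {c. cmod c * norm u < 1}" using slice_ball[OF assms(2)] .
  define d where "d = (cmod c + r) / 2"
  have d: "cmod c < d" "d < r" "d > 0" using r(1) norm_ge_zero[of c] unfolding d_def by (auto simp del: norm_ge_zero)
  then have "summable (\<lambda>k. hom_part g k u * of_real d ^ k)"
   using r(2) subsetD[OF r(2), of "of_real d"] by (intro sums_summable[OF hom_part_sums[OF assms(1)]]) auto
  then show ?thesis using d by (intro powser_insidea) auto
qed

lemma hom_part_smult:
  assumes g: "slice_holomorphic g"
  shows "hom_part g k (c *s u) = c ^ k * hom_part g k u"
proof -
  have "(deriv ^^ k) (\<lambda>x. (\<lambda>d. g (d *s u)) (c * x)) 0 = c ^ k * (deriv ^^ k) (\<lambda>d. g (d *s u)) (c * 0)"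
  proof (rule higher_deriv_compose_linear[where S = "{x. cmod x * norm (c *s u) < 1}"])
   show "(\<lambda>d. g (d *s u)) holomorphic_on {d. cmod d * norm u < 1}"
    using g by (simp add: slice_holomorphic_def)
  qed (auto simp: norm_vec_smult norm_mult mult_ac intro!: open_Collect_less continuous_intros)
  then show ?thesis by (simp add: hom_part_def mult.commute vector_smult_assoc)
qed

lemma hom_part_Cauchy:
  assumes g: "slice_holomorphic g" and r: "0 < r" "r < 1" and B: "\<And>w. norm w \<le> r \<Longrightarrow> cmod (g w) \<le> B"
  shows "cmod (hom_part g k u) \<le> B * (norm u / r) ^ k"
proof (cases "u = 0")
  case True
  have "hom_part g k u = hom_part g k (0 *s u)" using True by simp
  also have "\<dots> = 0 ^ k * hom_part g k u" by (rule hom_part_smult[OF g])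
  finally have *: "hom_part g k u = 0 ^ k * hom_part g k u" .
  have "cmod (g 0) \<le> B" using r by (intro B) auto
  then have "k = 0 \<Longrightarrow> cmod (hom_part g k u) \<le> B" using True by (simp add: hom_part_def)
  then show ?thesis using * True by (cases k) auto
next
  case False
  define s where "s = r / norm u"
  have s: "s > 0" "s * norm u = r" using False r by (auto simp: s_def)
  have sub: "cball 0 s \<subseteq> {c. cmod c * norm u < 1}"
  proof
   fix c :: complex assume "c \<in> cball 0 s"
   then have "cmod c * norm u \<le> s * norm u" by (intro mult_right_mono) auto
   then show "c \<in> {c. cmod c * norm u < 1}" using s r by simp
  qed
  have hol: "(\<lambda>c. g (c *s u)) holomorphic_on cball 0 s"
   using g sub holomorphic_on_subset unfolding slice_holomorphic_def by blast
  have "cmod ((deriv ^^ k) (\<lambda>c. g (c *s u)) 0) \<le> fact k * B / s ^ k"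
  proof (rule Cauchy_inequality)
   show "(\<lambda>c. g (c *s u)) holomorphic_on ball 0 s" using hol holomorphic_on_subset ball_subset_cball by blast
   show "continuous_on (cball 0 s) (\<lambda>c. g (c *s u))" using hol by (rule holomorphic_on_imp_continuous_on)
   show "cmod (g (x *s u)) \<le> B" if "cmod (0 - x) = s" for x
    using that s by (intro B) (simp add: norm_vec_smult)
  qed (use s in auto)
  then show ?thesis using s False r by (simp add: hom_part_def norm_divide s_def power_divide field_simps)
qed

lemma smult_ball_measurable [measurable]:
  "cmod c = 1 \<Longrightarrow> (\<lambda>w :: complex^'n. c *s w) \<in> \<nu> \<rightarrow>\<^sub>M \<nu>"
  unfolding ball_measure_def
  by (rule measurable_restrict_space3)
   (auto simp: norm_vec_smult intro!: borel_measurable_continuous_onI linear_continuous_on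
    linear_conv_bounded_linear[THEN iffD1] linear_vec_smult)

lemma smult_of_real: "complex_of_real r *s u = r *\<^sub>R (u :: complex^'n)"
  by (simp add: vec_eq_iff complex_eq_iff)

lemma root_average_measurable:
  assumes "\<And>c. cmod c = 1 \<Longrightarrow> (\<lambda>w. F w c) \<in> borel_measurable M"
  shows "(\<lambda>w. root_average m k (F w)) \<in> borel_measurable M"
proof -
  have [measurable]: "(\<lambda>w. F w (unity_root m ^ j)) \<in> borel_measurable M" for j
   by (rule assms) (simp add: norm_power)
  show ?thesis unfolding root_average_def by measurable
qed

lemma hom_part_tendsto:
  assumes "slice_holomorphic g" "norm u < 1"
  shows "(\<lambda>m. root_average m k (\<lambda>c. g (c *s u))) \<longlonglongrightarrow> hom_part g k u"
  using hom_part_summable[of g 1 u] hom_part_sums[of g _ u] assms by (intro root_average_tendsto) auto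

text \<open>On the ball the homogeneous part is a limit of measurable averages; homogeneity transports this
  to the whole space through the map that scales every point into the ball.\<close>

lemma hom_part_measurable:
  fixes g :: "complex^'n \<Rightarrow> complex"
  assumes g: "slice_holomorphic g" and [measurable]: "g \<in> borel_measurable \<nu>"
  shows "hom_part g k \<in> borel_measurable borel"
proof -
  have 1: "hom_part g k \<in> borel_measurable \<nu>"
  proof (rule borel_measurable_LIMSEQ_metric)
   show "(\<lambda>u. root_average m k (\<lambda>c. g (c *s u))) \<in> borel_measurable \<nu>" for m
    by (rule root_average_measurable) measurable
   show "(\<lambda>m. root_average m k (\<lambda>c. g (c *s u))) \<longlonglongrightarrow> hom_part g k u" if "u \<in> space \<nu>" for u
    using hom_part_tendsto[OF g] that by simp
  qed
  define sc where "sc = (\<lambda>u :: complex^'n. complex_of_real (1 / (1 + norm u)) *s u)"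
  have sc_eq: "sc u = (1 / (1 + norm u)) *\<^sub>R u" for u :: "complex^'n"
   unfolding sc_def by (rule smult_of_real)
  have sc: "sc \<in> borel \<rightarrow>\<^sub>M \<nu>"
   unfolding ball_measure_def
  proof (rule measurable_restrict_space2)
   show "sc \<in> space borel \<rightarrow> ball 0 1"
    unfolding sc_eq by (auto simp: add_pos_nonneg)
   show "sc \<in> borel \<rightarrow>\<^sub>M lborel" unfolding sc_eq[abs_def] by simp
  qed
  have "hom_part g k u = of_real (1 + norm u) ^ k * hom_part g k (sc u)" for u :: "complex^'n"
  proof -
   have "1 + norm u \<noteq> 0" using norm_ge_zero[of u] by linarith
   then have "complex_of_real (1 + norm u) \<noteq> 0" by (simp only: of_real_eq_0_iff not_False_eq_True)
   then have "complex_of_real (1 + norm u) *s sc u = u"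
    unfolding sc_def by (simp add: vec_eq_iff)
   then show ?thesis using hom_part_smult[OF g, of k "of_real (1 + norm u)" "sc u"] by simp
  qed
  then have eq: "hom_part g k = (\<lambda>u. of_real (1 + norm u) ^ k * hom_part g k (sc u))" by (rule ext)
  have [measurable]: "(\<lambda>u. hom_part g k (sc u)) \<in> borel_measurable borel"
   using measurable_compose[OF sc 1] .
  show ?thesis by (subst eq) measurable
qed

text \<open>Holomorphy along all complex lines together with local boundedness. This is what can be checked
  for the functions constructed by integrals and series; it amounts to total differentiability.\<close>

definition line_holomorphic :: "(complex^'n \<Rightarrow> complex) \<Rightarrow> bool" where
  "line_holomorphic g \<longleftrightarrow>
    (\<forall>z v. (\<lambda>c. g (z + c *s v)) holomorphic_on {c. norm (z + c *s v) < 1}) \<and>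
    (\<forall>r<1. \<exists>B. \<forall>w. norm w \<le> r \<longrightarrow> cmod (g w) \<le> B)"

lemma line_holomorphic_imp_slice: "line_holomorphic g \<Longrightarrow> slice_holomorphic g"
  unfolding line_holomorphic_def slice_holomorphic_def
  by (metis (no_types, lifting) add_0 norm_vec_smult Collect_cong holomorphic_cong)

lemma continuous_smult_line: "continuous_on A (\<lambda>c. z + c *s (v :: complex^'n))"
proof -
  have "linear (\<lambda>c. c *s v)"
   by (rule linearI) (simp_all add: vec_eq_iff algebra_simps)
  then have "continuous_on A (\<lambda>c. c *s v)"
   by (intro linear_continuous_on linear_conv_bounded_linear[THEN iffD1])
  then show ?thesis by (intro continuous_intros)
qed

text \<open>The homogeneous part is a polynomial. It is enough here that it is entire along complex lines:
  after rescaling into a small ball it is a uniform limit of the root averages of \<open>g\<close>, which are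
  holomorphic along lines.\<close>

lemma hom_part_line_entire:
  assumes g: "line_holomorphic g"
  shows "(\<lambda>c. hom_part g k (z + c *s v)) holomorphic_on UNIV"
proof -
  note sl = line_holomorphic_imp_slice[OF g]
  obtain B where B: "\<And>w. norm w \<le> 1/2 \<Longrightarrow> cmod (g w) \<le> B"
  proof -
   have "(1/2 :: real) < 1" by simp
   then show ?thesis using g that unfolding line_holomorphic_def by blast
  qed
  have B0: "B \<ge> 0" using B[of 0] norm_ge_zero[of "g 0"] by (simp del: norm_ge_zero)
  have "(\<lambda>c. hom_part g k (z + c *s v)) holomorphic_on ball 0 R" if R: "R > 0" for R
  proof -
   define e where "e = 1 / (4 * (norm z + R * norm v + 1))"
   have pos: "norm z + R * norm v + 1 > 0" using R by (simp add: add_nonneg_pos)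
   have e: "e > 0" using pos by (simp add: e_def)
   have small: "norm (of_real e *s (z + c *s v)) \<le> 1/4" if "cmod c < R" for c
   proof -
    have "norm (z + c *s v) \<le> norm z + cmod c * norm v"
     by (metis norm_triangle_ineq norm_vec_smult)
    also have "\<dots> \<le> norm z + R * norm v + 1" using that by (simp add: mult_right_mono less_imp_le add_increasing2)
    finally have "e * norm (z + c *s v) \<le> e * (norm z + R * norm v + 1)" using e by (intro mult_left_mono) auto
    also have "\<dots> = 1/4" using pos by (simp add: e_def)
    finally show ?thesis unfolding smult_of_real using e by simp
   qed
   define A where "A m c = root_average m k (\<lambda>d. g (d *s (of_real e *s (z + c *s v))))" for m c
   have "(\<lambda>c. hom_part g k (of_real e *s (z + c *s v))) holomorphic_on ball 0 R"
   proof (rule holomorphic_uniform_sequence[where f = A])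
    fix m
    have "(\<lambda>c. g (d *s (of_real e *s (z + c *s v)))) holomorphic_on ball 0 R" if d: "cmod d = 1" for d
    proof -
     have eq: "d *s (of_real e *s (z + c *s v)) = (d * of_real e) *s z + c *s ((d * of_real e) *s v)" for c
      by (simp add: vec_eq_iff algebra_simps)
     have "(\<lambda>c. g ((d * of_real e) *s z + c *s ((d * of_real e) *s v))) holomorphic_on
       {c. norm ((d * of_real e) *s z + c *s ((d * of_real e) *s v)) < 1}"
      using g unfolding line_holomorphic_def by blast
     then show ?thesis unfolding eq
     proof (rule holomorphic_on_subset, intro subsetI CollectI)
      fix c :: complex assume "c \<in> ball 0 R"
      then have "norm (d *s (of_real e *s (z + c *s v))) < 1"
       using small[of c] d unfolding norm_vec_smult[of d] by simp
      then show "norm ((d * of_real e) *s z + c *s ((d * of_real e) *s v)) < 1" unfolding eq .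
     qed
    qed
    then show "A m holomorphic_on ball 0 R"
     unfolding A_def[abs_def] root_average_def by (auto intro!: holomorphic_intros simp: norm_power)
   next
    fix x :: complex assume "x \<in> ball 0 R"
    then obtain d where d: "d > 0" "cball x d \<subseteq> ball 0 R"
     using open_contains_cball[of "ball (0::complex) R"] open_ball by blast
    have err: "cmod (A m c - hom_part g k (of_real e *s (z + c *s v))) \<le> 2 * B * (1/2) ^ m"
     if c: "cmod c < R" and m: "k < m" for m c
    proof -
     let ?u = "of_real e *s (z + c *s v)"
     have u: "norm ?u \<le> 1/4" by (rule small[OF c])
     have hp: "cmod (hom_part g i ?u) \<le> B * (1/2) ^ i" for i
     proof -
      have "cmod (hom_part g i ?u) \<le> B * (norm ?u / (1/2)) ^ i"
       by (rule hom_part_Cauchy[OF sl]) (use B in auto)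
      also have "\<dots> \<le> B * (1/2) ^ i" using u B0 by (intro mult_left_mono power_mono) auto
      finally show ?thesis .
     qed
     have gs: "(\<lambda>i. B * (1/2) ^ (i + m)) sums (B * (1/2)^m * 2)"
      using sums_mult[OF geometric_sums[of "1/2 :: real"], of "B * (1/2)^m"] by (simp add: power_add mult_ac)
     have "cmod (A m c - hom_part g k ?u) \<le> (\<Sum>i. cmod (hom_part g (i + m) ?u))"
      unfolding A_def
      using hom_part_summable[OF sl, of 1 ?u] hom_part_sums[OF sl, of _ ?u] u m
      by (intro root_average_error) auto
     also have "\<dots> \<le> (\<Sum>i. B * (1/2) ^ (i + m))"
      using hp by (intro suminf_le sums_summable[OF gs] summable_comparison_test'[OF sums_summable[OF gs], of 0]) simp_all
     also have "\<dots> = 2 * B * (1/2) ^ m" using gs by (simp add: sums_iff)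
     finally show ?thesis .
    qed
    have "uniform_limit (cball x d) A (\<lambda>c. hom_part g k (of_real e *s (z + c *s v))) sequentially"
    proof (rule uniform_limitI)
     fix \<epsilon> :: real assume "\<epsilon> > 0"
     have "(\<lambda>m. 2 * B * (1/2) ^ m) \<longlonglongrightarrow> 2 * B * (0::real)"
      by (intro tendsto_intros LIMSEQ_power_zero) auto
     then have "eventually (\<lambda>m. 2 * B * (1/2) ^ m < \<epsilon>) sequentially"
      using \<open>\<epsilon> > 0\<close> by (intro order_tendstoD) auto
     then show "\<forall>\<^sub>F m in sequentially. \<forall>c\<in>cball x d. dist (A m c) (hom_part g k (of_real e *s (z + c *s v))) < \<epsilon>"
      using eventually_gt_at_top[of k]
     proof eventually_elim
      case (elim m)
      then show ?case using err[of _ m] d by (fastforce simp: dist_norm)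
     qed
    qed
    then show "\<exists>d>0. cball x d \<subseteq> ball 0 R \<and> uniform_limit (cball x d) A (\<lambda>c. hom_part g k (of_real e *s (z + c *s v))) sequentially"
     using d by blast
   qed simp
   then have "(\<lambda>c. of_real e ^ k * hom_part g k (z + c *s v)) holomorphic_on ball 0 R"
    by (simp only: hom_part_smult[OF sl])
   then have "(\<lambda>c. (1 / of_real e ^ k) * (of_real e ^ k * hom_part g k (z + c *s v))) holomorphic_on ball 0 R"
    by (rule holomorphic_on_mult[OF holomorphic_on_const])
   then show ?thesis using e by simp
  qed
  then have "(\<lambda>c. hom_part g k (z + c *s v)) field_differentiable at c" for c
   using holomorphic_on_imp_differentiable_at[of _ "ball 0 (cmod c + 1)" c] by (simp add: add_nonneg_pos)
  then show ?thesis by (simp add: holomorphic_on_def)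
qed

section \<open>The reproducing property in Fock space\<close>

lemma integrable_gaussian: "integrable lborel (\<lambda>u :: complex^'n. exp (- (norm u)\<^sup>2))"
  using moments_nonneg[of "\<lambda>_ :: complex^'n. 1" 1 0 0] by (auto simp: has_bochner_integral_iff)

definition gauss_const :: "'n::finite itself \<Rightarrow> real" where
  "gauss_const _ = (\<integral>u. exp (- (norm (u :: complex^'n))\<^sup>2) \<partial>lborel)"

lemma gauss_const_pos: "gauss_const TYPE('n::finite) > 0"
proof -
  have "gauss_const TYPE('n) \<noteq> 0"
  proof
   assume "gauss_const TYPE('n) = 0"
   then have "AE u in (lborel :: (complex^'n) measure). exp (- (norm u)\<^sup>2) = 0"
    unfolding gauss_const_def by (subst (asm) integral_nonneg_eq_0_iff_AE) (auto intro: integrable_gaussian)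
   then have "AE u in (lborel :: (complex^'n) measure). False" by simp
   then have "emeasure lborel (UNIV :: (complex^'n) set) = 0"
    using AE_iff_measurable[of UNIV "lborel :: (complex^'n) measure" "\<lambda>_. False"] by simp
   then show False by (simp add: emeasure_lborel_UNIV)
  qed
  moreover have "gauss_const TYPE('n) \<ge> 0" unfolding gauss_const_def by (intro integral_nonneg_AE) auto
  ultimately show ?thesis by simp
qed

lemma integrable_exp_gaussian:
  "integrable lborel (\<lambda>u :: complex^'n. exp (a * norm u) * exp (- (norm u)\<^sup>2))"
proof -
  have *: "(\<integral>\<^sup>+u. ennreal (exp (- (norm (u :: complex^'n))\<^sup>2 / 2)) \<partial>lborel) =
    ennreal (sqrt 2 ^ (2 * CARD('n))) * (\<integral>\<^sup>+u. ennreal (exp (- (norm (sqrt 2 *\<^sub>R (u :: complex^'n)))\<^sup>2 / 2)) \<partial>lborel)"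
   by (rule nn_integral_lborel_scale) auto
  have "(\<integral>\<^sup>+u. ennreal (exp (- (norm (sqrt 2 *\<^sub>R (u :: complex^'n)))\<^sup>2 / 2)) \<partial>lborel) =
    (\<integral>\<^sup>+u. ennreal (exp (- (norm (u :: complex^'n))\<^sup>2)) \<partial>lborel)"
   by (simp add: power_mult_distrib)
  also have "\<dots> < \<infinity>"
   using integrable_gaussian[where 'n='n] by (simp add: integrable_iff_bounded)
  finally have "(\<integral>\<^sup>+u. ennreal (exp (- (norm (u :: complex^'n))\<^sup>2 / 2)) \<partial>lborel) < \<infinity>"
   unfolding * infinity_ennreal_def ennreal_mult_less_top by auto
  then have 1: "integrable lborel (\<lambda>u :: complex^'n. exp (a\<^sup>2 / 2) * exp (- (norm u)\<^sup>2 / 2))"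
   by (intro integrable_mult_right) (simp add: integrable_iff_bounded)
  show ?thesis
  proof (rule Bochner_Integration.integrable_bound[OF 1])
   show "AE u in lborel. norm (exp (a * norm u) * exp (- (norm u)\<^sup>2)) \<le> norm (exp (a\<^sup>2 / 2) * exp (- (norm (u :: complex^'n))\<^sup>2 / 2))"
   proof (rule AE_I2)
    fix u :: "complex^'n"
    have "0 \<le> (norm u - a)\<^sup>2" by simp
    then have "a * norm u + - (norm u)\<^sup>2 \<le> a\<^sup>2 / 2 + - (norm u)\<^sup>2 / 2"
     by (simp add: power2_eq_square algebra_simps)
    then show "norm (exp (a * norm u) * exp (- (norm u)\<^sup>2)) \<le> norm (exp (a\<^sup>2 / 2) * exp (- (norm u)\<^sup>2 / 2))"
     by (simp flip: exp_add)
   qed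
  qed simp
qed

lemma entire_sums:
  assumes "f holomorphic_on (UNIV :: complex set)"
  shows "(\<lambda>n. (deriv ^^ n) f 0 / fact n * c ^ n) sums f c"
   and "summable (\<lambda>n. cmod ((deriv ^^ n) f 0 / fact n))"
proof -
  have *: "(\<lambda>n. (deriv ^^ n) f 0 / fact n * c ^ n) sums f c" for c
   using holomorphic_power_series[of f 0 "cmod c + 1" c] holomorphic_on_subset[OF assms]
   by (simp add: add_nonneg_pos)
  show "(\<lambda>n. (deriv ^^ n) f 0 / fact n * c ^ n) sums f c" by (rule *)
  show "summable (\<lambda>n. cmod ((deriv ^^ n) f 0 / fact n))"
   using powser_insidea[OF sums_summable[OF *[of 2]], of 1] by simp
qed

lemma smult_borel_measurable [measurable]: "(\<lambda>w :: complex^'n. c *s w) \<in> borel \<rightarrow>\<^sub>M borel"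
  by (intro borel_measurable_continuous_onI linear_continuous_on linear_conv_bounded_linear[THEN iffD1] linear_vec_smult)

text \<open>Rotation invariance lets \<open>G\<close> be replaced by its average over roots of unity, and this average
  tends to \<open>G 0\<close> because \<open>G\<close> is entire on each line through the origin.\<close>

lemma gaussian_mean_value:
  fixes G :: "complex^'n \<Rightarrow> complex"
  assumes [measurable]: "G \<in> borel_measurable borel"
   and entire: "\<And>u. (\<lambda>c. G (c *s u)) holomorphic_on UNIV"
   and bound: "\<And>u. cmod (G u) \<le> C * exp (a * norm u)"
  shows "(\<integral>u. G u * of_real (exp (- (norm u)\<^sup>2)) \<partial>lborel) = G 0 * of_real (gauss_const TYPE('n))"
proof -
  define A where "A m u = root_average m 0 (\<lambda>c. G (c *s u))" for m u
  have C: "C \<ge> 0" using order_trans[OF norm_ge_zero bound[of 0]] by simp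
  have wint: "integrable lborel (\<lambda>u :: complex^'n. C * (exp (a * norm u) * exp (- (norm u)\<^sup>2)))"
   by (intro integrable_mult_right integrable_exp_gaussian)
  have intG: "integrable lborel (\<lambda>u. G (c *s u) * of_real (exp (- (norm u)\<^sup>2)))" if "cmod c = 1" for c
  proof (rule Bochner_Integration.integrable_bound[OF wint])
   show "AE u in lborel. norm (G (c *s u) * of_real (exp (- (norm u)\<^sup>2))) \<le> norm (C * (exp (a * norm u) * exp (- (norm u)\<^sup>2)))"
    using C bound[of "c *s _"] that by (intro AE_I2) (simp add: norm_mult norm_vec_smult mult.assoc[symmetric] mult_right_mono)
  qed measurable
  have rot: "(\<integral>u. G (c *s u) * of_real (exp (- (norm u)\<^sup>2)) \<partial>lborel) = (\<integral>u. G u * of_real (exp (- (norm u)\<^sup>2)) \<partial>lborel)"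
   if "cmod c = 1" for c
   using integral_lborel_rotate[OF that, of "\<lambda>u. G u * of_real (exp (- (norm u)\<^sup>2))"] that
   by (simp add: norm_vec_smult)
  have avg: "(\<integral>u. A m u * of_real (exp (- (norm u)\<^sup>2)) \<partial>lborel) = (\<integral>u. G u * of_real (exp (- (norm u)\<^sup>2)) \<partial>lborel)"
   if "m > 0" for m
  proof -
   have "(\<integral>u. A m u * of_real (exp (- (norm u)\<^sup>2)) \<partial>lborel) =
     (\<integral>u. (\<Sum>j<m. G (unity_root m ^ j *s u) * of_real (exp (- (norm u)\<^sup>2))) / of_nat m \<partial>lborel)"
    by (simp add: A_def root_average_def sum_distrib_right)
   also have "\<dots> = (\<Sum>j<m. \<integral>u. G (unity_root m ^ j *s u) * of_real (exp (- (norm u)\<^sup>2)) \<partial>lborel) / of_nat m"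
    by (subst integral_divide_zero, subst Bochner_Integration.integral_sum) (auto intro!: intG simp: norm_power)
   also have "\<dots> = (\<integral>u. G u * of_real (exp (- (norm u)\<^sup>2)) \<partial>lborel)"
    using that by (simp add: rot norm_power)
   finally show ?thesis .
  qed
  have "(\<lambda>m. \<integral>u. A m u * of_real (exp (- (norm u)\<^sup>2)) \<partial>lborel) \<longlonglongrightarrow> (\<integral>u. G 0 * of_real (exp (- (norm (u :: complex^'n))\<^sup>2)) \<partial>lborel)"
  proof (rule integral_dominated_convergence[OF _ _ wint])
   show "(\<lambda>u. A m u * of_real (exp (- (norm u)\<^sup>2))) \<in> borel_measurable lborel" for m
   proof -
    have [measurable]: "A m \<in> borel_measurable borel"
     unfolding A_def[abs_def] by (rule root_average_measurable) measurable
    show ?thesis by measurable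
   qed
   show "AE u in lborel. (\<lambda>m. A m u * of_real (exp (- (norm u)\<^sup>2))) \<longlonglongrightarrow> G 0 * of_real (exp (- (norm u)\<^sup>2))"
   proof (intro AE_I2 tendsto_mult tendsto_const)
    fix u
    have "A m u = root_average m 0 (\<lambda>c. G (c *s u))" for m by (simp add: A_def)
    then show "(\<lambda>m. A m u) \<longlonglongrightarrow> G 0"
     using root_average_tendsto[OF entire_sums(2)[OF entire[of u]] entire_sums(1)[OF entire[of u]], of 0]
     by simp
   qed
   show "AE u in lborel. norm (A m u * of_real (exp (- (norm u)\<^sup>2))) \<le> C * (exp (a * norm u) * exp (- (norm u)\<^sup>2))" for m
   proof (intro AE_I2)
    fix u
    have "cmod (A m u) \<le> C * exp (a * norm u)"
     unfolding A_def using C bound[of "_ *s u"] by (intro root_average_bound) (auto simp: norm_vec_smult, metis mult_1 norm_vec_smult)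
    then show "norm (A m u * of_real (exp (- (norm u)\<^sup>2))) \<le> C * (exp (a * norm u) * exp (- (norm u)\<^sup>2))"
     by (simp add: norm_mult mult.assoc[symmetric])
   qed
  qed measurable
  then have "(\<lambda>m. \<integral>u. A m u * of_real (exp (- (norm u)\<^sup>2)) \<partial>lborel) \<longlonglongrightarrow> G 0 * of_real (gauss_const TYPE('n))"
   by (simp add: gauss_const_def)
  moreover have "(\<lambda>m. \<integral>u. A m u * of_real (exp (- (norm u)\<^sup>2)) \<partial>lborel) \<longlonglongrightarrow> (\<integral>u. G u * of_real (exp (- (norm u)\<^sup>2)) \<partial>lborel)"
   by (rule tendsto_eventually) (auto intro!: eventually_sequentiallyI[of 1] avg)
  ultimately show ?thesis using LIMSEQ_unique by blast
qed

text \<open>Translating the Gaussian by \<open>z\<close> turns the integrand into \<open>P (z + u) exp (- \<langle>u, z\<rangle>)\<close> times the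
  Gaussian, and the mean value property applies.\<close>

lemma fock_reproducing:
  fixes P :: "complex^'n \<Rightarrow> complex"
  assumes [measurable]: "P \<in> borel_measurable borel"
   and line: "\<And>z v. (\<lambda>c. P (z + c *s v)) holomorphic_on UNIV"
   and bound: "\<And>u. cmod (P u) \<le> C * norm u ^ k"
  shows "(\<integral>u. P u * exp (cdot z u) * of_real (exp (- (norm u)\<^sup>2)) \<partial>lborel) = of_real (gauss_const TYPE('n)) * P z"
proof -
  define G where "G u = P (z + u) * exp (- cdot (z + u) z)" for u :: "complex^'n"
  have C: "C \<ge> 0" using order_trans[OF norm_ge_zero bound[of "axis undefined 1"]] by (simp add: norm_axis_1)
  have [measurable]: "G \<in> borel_measurable borel" unfolding G_def[abs_def] by measurable
  have "(\<integral>u. G u * of_real (exp (- (norm u)\<^sup>2)) \<partial>lborel) = G 0 * of_real (gauss_const TYPE('n))"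
  proof (rule gaussian_mean_value)
   show "(\<lambda>c. G (c *s u)) holomorphic_on UNIV" for u
    unfolding G_def cdot_add_left cdot_smult_left by (intro holomorphic_intros line)
   fix u :: "complex^'n"
   define N where "N = norm z + norm u"
   have N: "norm (z + u) \<le> N" "N \<ge> 0" by (simp_all add: N_def norm_triangle_ineq)
   have "N ^ k \<le> exp N ^ k" using exp_ge_add_one_self[of N] N by (intro power_mono) linarith+
   then have 1: "cmod (P (z + u)) \<le> C * exp (real k * N)"
    using bound[of "z + u"] N C by (simp add: exp_of_nat_mult) (meson mult_left_mono norm_ge_zero order_trans power_mono)
   have "cmod (exp (- cdot (z + u) z)) \<le> exp (cmod (- cdot (z + u) z))" by (rule norm_exp)
   also have "\<dots> \<le> exp (N * norm z)"
    using order_trans[OF norm_cdot_le mult_right_mono[OF N(1) norm_ge_zero[of z]]] by simp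
   finally have "cmod (G u) \<le> (C * exp (real k * N)) * exp (N * norm z)"
    unfolding G_def norm_mult using 1 by (intro mult_mono) (use C in auto)
   also have "\<dots> = C * exp (real k * norm z + norm z * norm z) * exp ((real k + norm z) * norm u)"
    by (simp add: N_def algebra_simps flip: exp_add)
   finally show "cmod (G u) \<le> C * exp (real k * norm z + norm z * norm z) * exp ((real k + norm z) * norm u)" .
  qed simp
  also have "G 0 = P z * exp (- of_real ((norm z)\<^sup>2))" by (simp add: G_def cdot_self)
  also have "(\<integral>u. G u * of_real (exp (- (norm u)\<^sup>2)) \<partial>lborel) = (\<integral>u. G u * of_real (exp (- (norm u)\<^sup>2)) \<partial>distr lborel borel ((+) (- z)))"
   by (simp add: lborel_distr_plus)
  also have "\<dots> = (\<integral>u. G (-z + u) * of_real (exp (- (norm (-z + u))\<^sup>2)) \<partial>lborel)"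
   by (rule integral_distr) simp_all
  also have "\<dots> = (\<integral>u. exp (- of_real ((norm z)\<^sup>2)) * (P u * exp (cdot z u) * of_real (exp (- (norm u)\<^sup>2))) \<partial>lborel)"
  proof (rule Bochner_Integration.integral_cong[OF refl])
   fix u :: "complex^'n"
   have n2: "complex_of_real ((norm (-z + u))\<^sup>2) = of_real ((norm u)\<^sup>2) + of_real ((norm z)\<^sup>2) - cdot u z - cdot z u"
   proof -
    have "complex_of_real ((norm (u - z))\<^sup>2) = cdot (u - z) (u - z)" by (simp add: cdot_self)
    also have "\<dots> = cdot u u + cdot z z - cdot u z - cdot z u"
     by (simp add: cdot_def algebra_simps sum.distrib sum_subtractf)
    finally show ?thesis by (simp add: cdot_self)
   qed
   have "G (-z + u) * of_real (exp (- (norm (-z + u))\<^sup>2)) = P u * (exp (- cdot u z) * exp (- of_real ((norm (-z + u))\<^sup>2)))"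
    by (simp add: G_def exp_of_real[symmetric])
   also have "exp (- cdot u z) * exp (- of_real ((norm (-z + u))\<^sup>2)) = exp (- of_real ((norm z)\<^sup>2)) * (exp (cdot z u) * exp (- of_real ((norm u)\<^sup>2)))"
    unfolding n2 mult_exp_exp by (rule arg_cong[of _ _ exp]) simp
   finally show "G (-z + u) * of_real (exp (- (norm (-z + u))\<^sup>2)) = exp (- of_real ((norm z)\<^sup>2)) * (P u * exp (cdot z u) * of_real (exp (- (norm u)\<^sup>2)))"
    by (simp add: exp_of_real[symmetric])
  qed
  also have "\<dots> = exp (- of_real ((norm z)\<^sup>2)) * (\<integral>u. P u * exp (cdot z u) * of_real (exp (- (norm u)\<^sup>2)) \<partial>lborel)"
   by (rule integral_mult_right_zero)
  finally show ?thesis by simp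
qed

text \<open>Only the part of \<open>exp \<langle>z, u\<rangle>\<close> of degree \<open>k\<close> pairs with \<open>P\<close>, since the Gaussian is invariant
  under rotations. This extracts the degree \<open>k\<close> term of the Fock reproducing formula.\<close>

lemma fock_homogeneous:
  fixes P :: "complex^'n \<Rightarrow> complex"
  assumes [measurable]: "P \<in> borel_measurable borel"
   and line: "\<And>z v. (\<lambda>c. P (z + c *s v)) holomorphic_on UNIV"
   and bound: "\<And>u. cmod (P u) \<le> C * norm u ^ k" and hom: "\<And>c u. P (c *s u) = c ^ k * P u"
  shows "(\<integral>u. P u * cdot z u ^ k * of_real (exp (- (norm u)\<^sup>2)) \<partial>lborel) = of_real (gauss_const TYPE('n) * fact k) * P z"
proof -
  have C: "C \<ge> 0" using order_trans[OF norm_ge_zero bound[of "axis undefined 1"]] by (simp add: norm_axis_1)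
  define A where "A m u = root_average m k (\<lambda>c. exp (c * cdot z u))" for m u
  define wd where "wd u = C * (exp ((real k + norm z) * norm u) * exp (- (norm u)\<^sup>2))" for u :: "complex^'n"
  have wint: "integrable lborel wd" unfolding wd_def[abs_def]
   by (intro integrable_mult_right integrable_exp_gaussian)
  have dom: "cmod (P u * x * of_real (exp (- (norm u)\<^sup>2))) \<le> wd u" if "cmod x \<le> exp (norm z * norm u)" for u x
  proof -
   have "norm u ^ k \<le> exp (norm u) ^ k" using exp_ge_add_one_self[of "norm u"] by (intro power_mono) (linarith, simp)
   then have "cmod (P u) \<le> C * exp (real k * norm u)"
    using bound[of u] C by (simp add: exp_of_nat_mult) (meson mult_left_mono order_trans)
   then have "cmod (P u) * cmod x \<le> (C * exp (real k * norm u)) * exp (norm z * norm u)"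
    using that C by (intro mult_mono) auto
   also have "\<dots> = C * exp ((real k + norm z) * norm u)" by (simp add: algebra_simps flip: exp_add)
   finally show ?thesis unfolding wd_def by (simp add: norm_mult mult.assoc[symmetric])
  qed
  have expb: "cmod (exp (c * cdot z u)) \<le> exp (norm z * norm u)" if "cmod c = 1" for c u
   using order_trans[OF norm_exp[of "c * cdot z u"], of "exp (norm z * norm u)"] norm_cdot_le[of z u] that
   by (simp add: norm_mult)
  have intE: "integrable lborel (\<lambda>u. P u * exp (c * cdot z u) * of_real (exp (- (norm u)\<^sup>2)))" if "cmod c = 1" for c
  proof (rule Bochner_Integration.integrable_bound[OF wint])
   show "AE u in lborel. norm (P u * exp (c * cdot z u) * of_real (exp (- (norm u)\<^sup>2))) \<le> norm (wd u)"
    using dom[OF expb[OF that]] by (intro AE_I2) (smt (verit) real_norm_def)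
  qed measurable
  have avg: "(\<integral>u. P u * A m u * of_real (exp (- (norm u)\<^sup>2)) \<partial>lborel) = of_real (gauss_const TYPE('n)) * P z"
   if m: "m > 0" for m
  proof -
   have "(\<integral>u. P u * A m u * of_real (exp (- (norm u)\<^sup>2)) \<partial>lborel) =
     (\<integral>u. (\<Sum>j<m. (P u * exp (unity_root m ^ j * cdot z u) * of_real (exp (- (norm u)\<^sup>2))) * cnj (unity_root m ^ j) ^ k) / of_nat m \<partial>lborel)"
    by (simp add: A_def root_average_def sum_distrib_right sum_distrib_left mult_ac)
   also have "\<dots> = (\<Sum>j<m. (\<integral>u. P u * exp (unity_root m ^ j * cdot z u) * of_real (exp (- (norm u)\<^sup>2)) \<partial>lborel) * cnj (unity_root m ^ j) ^ k) / of_nat m"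
    by (subst integral_divide_zero, subst Bochner_Integration.integral_sum)
     (auto intro!: intE integrable_mult_left simp: norm_power)
   also have "\<dots> = (\<Sum>j<m. (of_real (gauss_const TYPE('n)) * P z) * ((unity_root m ^ j) ^ k * cnj (unity_root m ^ j) ^ k)) / of_nat m"
   proof -
    have "(\<integral>u. P u * exp (c * cdot z u) * of_real (exp (- (norm u)\<^sup>2)) \<partial>lborel) = of_real (gauss_const TYPE('n)) * (c ^ k * P z)" for c
     using fock_reproducing[OF assms(1) line bound, of "c *s z"] by (simp add: cdot_smult_left hom)
    then show ?thesis by (simp only:) (simp add: mult_ac)
   qed
   also have "\<dots> = (of_real (gauss_const TYPE('n)) * P z) * root_average m k (\<lambda>c. c ^ k)"
    by (simp add: root_average_def sum_distrib_left)
   finally show ?thesis using root_average_monomial(1)[OF m] by simp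
  qed
  have "(\<lambda>m. \<integral>u. P u * A m u * of_real (exp (- (norm u)\<^sup>2)) \<partial>lborel) \<longlonglongrightarrow>
    (\<integral>u. P u * (cdot z u ^ k / fact k) * of_real (exp (- (norm u)\<^sup>2)) \<partial>lborel)"
  proof (rule integral_dominated_convergence[OF _ _ wint])
   show "(\<lambda>u. P u * A m u * of_real (exp (- (norm u)\<^sup>2))) \<in> borel_measurable lborel" for m
   proof -
    have [measurable]: "A m \<in> borel_measurable borel"
     unfolding A_def[abs_def] by (rule root_average_measurable) measurable
    show ?thesis by measurable
   qed
   show "AE u in lborel. (\<lambda>m. P u * A m u * of_real (exp (- (norm u)\<^sup>2))) \<longlonglongrightarrow> P u * (cdot z u ^ k / fact k) * of_real (exp (- (norm u)\<^sup>2))"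
   proof (intro AE_I2 tendsto_mult tendsto_const)
    fix u
    show "(\<lambda>m. A m u) \<longlonglongrightarrow> cdot z u ^ k / fact k"
     unfolding A_def
    proof (rule root_average_tendsto)
     show "summable (\<lambda>i. cmod (cdot z u ^ i / fact i))"
      using summable_norm_exp[of "cdot z u"] by (simp add: scaleR_conv_of_real norm_mult norm_divide field_simps)
     show "(\<lambda>i. cdot z u ^ i / fact i * c ^ i) sums exp (c * cdot z u)" for c
      using exp_converges[of "c * cdot z u"] by (simp add: scaleR_conv_of_real power_mult_distrib field_simps)
    qed
   qed
   show "AE u in lborel. norm (P u * A m u * of_real (exp (- (norm u)\<^sup>2))) \<le> wd u" for m
    unfolding A_def using expb by (intro AE_I2 dom root_average_bound) auto
  qed measurable
  moreover have "(\<lambda>m. \<integral>u. P u * A m u * of_real (exp (- (norm u)\<^sup>2)) \<partial>lborel) \<longlonglongrightarrow> of_real (gauss_const TYPE('n)) * P z"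
   by (rule tendsto_eventually) (auto intro!: eventually_sequentiallyI[of 1] avg)
  ultimately have "(\<integral>u. P u * (cdot z u ^ k / fact k) * of_real (exp (- (norm u)\<^sup>2)) \<partial>lborel) = of_real (gauss_const TYPE('n)) * P z"
   using LIMSEQ_unique by blast
  moreover have "(\<integral>u. P u * (cdot z u ^ k / fact k) * of_real (exp (- (norm u)\<^sup>2)) \<partial>lborel) =
    (\<integral>u. (P u * cdot z u ^ k * of_real (exp (- (norm u)\<^sup>2))) / fact k \<partial>lborel)"
   by (simp add: field_simps)
  ultimately show ?thesis by (simp add: field_simps)
qed

text \<open>Up to normalization, the reciprocals of the coefficients of the Bergman kernel for the weight
  \<open>(1 - \<bar>w\<bar>\<^sup>2)\<^sup>t\<close> as a power series in \<open>\<langle>z, w\<rangle>\<close>.\<close>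

definition ball_moment :: "'n::finite itself \<Rightarrow> real \<Rightarrow> nat \<Rightarrow> real" where
  "ball_moment _ t k = gauss_const TYPE('n) * fact k * Gamma (t + 1) / Gamma (real k + real CARD('n) + t + 1)"

text \<open>The Fock space identity, transported to the ball by comparing moments.\<close>

lemma moment_formula_homogeneous:
  fixes g :: "complex^'n \<Rightarrow> complex"
  assumes g: "line_holomorphic g" and [measurable]: "g \<in> borel_measurable \<nu>" and t: "t > -1"
  shows "(\<integral>w. hom_part g k w * cdot z w ^ k * of_real (rho w powr t) \<partial>\<nu>) = of_real (ball_moment TYPE('n) t k) * hom_part g k z"
   and "integrable \<nu> (\<lambda>w. hom_part g k w * cdot z w ^ k * of_real (rho w powr t))"
   and "\<exists>C. \<forall>u. cmod (hom_part g k u) \<le> C * norm u ^ k"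
proof -
  note sl = line_holomorphic_imp_slice[OF g]
  have [measurable]: "hom_part g k \<in> borel_measurable borel" by (rule hom_part_measurable[OF sl]) measurable
  have "(1/2 :: real) < 1" by simp
  then obtain B where B: "\<And>w. norm w \<le> 1/2 \<Longrightarrow> cmod (g w) \<le> B"
   using g unfolding line_holomorphic_def by blast
  define C where "C = B * 2 ^ k"
  have bound: "cmod (hom_part g k u) \<le> C * norm u ^ k" for u
   using hom_part_Cauchy[OF sl, of "1/2" B k u] B by (simp add: C_def power_mult_distrib mult_ac)
  then show "\<exists>C. \<forall>u. cmod (hom_part g k u) \<le> C * norm u ^ k" by blast
  have C: "C \<ge> 0" using order_trans[OF norm_ge_zero bound[of "axis undefined 1"]] by (simp add: norm_axis_1)
  define Q where "Q w = hom_part g k w * cdot z w ^ k" for w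
  have "\<exists>G. has_bochner_integral lborel (\<lambda>w. Q w * of_real (exp (- (norm w)\<^sup>2))) G \<and>
        has_bochner_integral \<nu> (\<lambda>w. Q w * of_real (rho w powr t))
         (of_real (Gamma (t + 1) / Gamma (real k + real CARD('n) + t + 1)) * G)"
  proof (rule homogeneous_moments[OF _ _ _ t])
   show "Q \<in> borel_measurable borel" unfolding Q_def[abs_def] by measurable
   fix w :: "complex^'n"
   have "cmod (Q w) \<le> (C * norm w ^ k) * (norm z * norm w) ^ k"
    unfolding Q_def norm_mult norm_power using C by (intro mult_mono bound power_mono norm_cdot_le) auto
   also have "\<dots> = (C * norm z ^ k) * norm w ^ (2 * k)" by (simp add: power_mult_distrib mult_2 power_add)
   finally show "cmod (Q w) \<le> (C * norm z ^ k) * norm w ^ (2 * k)" .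
   show "Q (r *\<^sub>R w) = of_real r ^ (2 * k) * Q w" if "r > 0" for r
    unfolding Q_def smult_of_real[symmetric] hom_part_smult[OF sl] cdot_smult_right
    by (simp add: power_mult_distrib mult_2 power_add)
  qed
  then obtain G where G: "has_bochner_integral lborel (\<lambda>w. Q w * of_real (exp (- (norm w)\<^sup>2))) G"
    "has_bochner_integral \<nu> (\<lambda>w. Q w * of_real (rho w powr t))
         (of_real (Gamma (t + 1) / Gamma (real k + real CARD('n) + t + 1)) * G)" by blast
  have "G = of_real (gauss_const TYPE('n) * fact k) * hom_part g k z"
   using fock_homogeneous[of "hom_part g k" C k z] hom_part_line_entire[OF g] bound hom_part_smult[OF sl]
    has_bochner_integral_integral_eq[OF G(1)] by (simp add: Q_def)
  then show "(\<integral>w. hom_part g k w * cdot z w ^ k * of_real (rho w powr t) \<partial>\<nu>) = of_real (ball_moment TYPE('n) t k) * hom_part g k z"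
   using has_bochner_integral_integral_eq[OF G(2)] by (simp add: Q_def ball_moment_def)
  show "integrable \<nu> (\<lambda>w. hom_part g k w * cdot z w ^ k * of_real (rho w powr t))"
   using G(2) by (auto simp: has_bochner_integral_iff Q_def)
qed

lemma norm_cdot_less:
  assumes "norm w < 1"
  shows "cmod (cdot z w) \<le> norm z"
  using norm_cdot_le[of z w] mult_left_mono[of "norm w" 1 "norm z"] assms by simp

text \<open>Parts of degree other than \<open>k\<close> are orthogonal to \<open>\<langle>z, w\<rangle>\<^sup>k\<close> on every ball, by rotation
  invariance. On a smaller ball \<open>g\<close> is bounded, which justifies exchanging limit and integral.\<close>

lemma moment_formula_truncated:
  fixes g :: "complex^'n \<Rightarrow> complex"
  assumes g: "line_holomorphic g" and [measurable]: "g \<in> borel_measurable \<nu>"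
   and int: "integrable \<nu> (\<lambda>w. of_real (rho w powr t) * g w)" and t: "t > -1" and r: "r < 1"
  shows "(\<integral>w. indicator (ball 0 r) w * (of_real (rho w powr t) * g w * cdot z w ^ k) \<partial>\<nu>) =
    (\<integral>w. indicator (ball 0 r) w * (hom_part g k w * cdot z w ^ k * of_real (rho w powr t)) \<partial>\<nu>)"
proof -
  note sl = line_holomorphic_imp_slice[OF g]
  have [measurable]: "hom_part g k \<in> borel_measurable borel" by (rule hom_part_measurable[OF sl]) measurable
  obtain B where B: "\<And>w. norm w \<le> r \<Longrightarrow> cmod (g w) \<le> B"
   using g r unfolding line_holomorphic_def by blast
  have [measurable]: "ball (0::complex^'n) r \<in> sets borel" by simp
  define h where "h w = indicator (ball 0 r) w * (of_real (rho w powr t) * cdot z w ^ k)" for w :: "complex^'n"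
  define A where "A m w = root_average m k (\<lambda>c. g (c *s w))" for m w
  have [measurable]: "h \<in> borel_measurable borel" unfolding h_def[abs_def] by measurable
  have int1: "integrable \<nu> (\<lambda>w. of_real (rho w powr t) :: complex)"
   using moment_formula_homogeneous(2)[of "\<lambda>_. 1" t 0] t
   by (auto simp: line_holomorphic_def hom_part_def intro!: exI[of _ 1])
  have intt: "integrable \<nu> (\<lambda>w :: complex^'n. rho w powr t)"
   using integrable_norm[OF int1] by simp
  define wd where "wd w = (norm z ^ k * max B 0) * rho w powr t" for w :: "complex^'n"
  have wint: "integrable \<nu> wd" unfolding wd_def[abs_def] by (intro integrable_mult_right intt)
  have hb: "cmod (h w * x) \<le> wd w" if "norm w < 1" "norm w < r \<Longrightarrow> cmod x \<le> max B 0" for w x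
  proof (cases "norm w < r")
   case True
   have "rho w powr t * cmod (cdot z w) ^ k * cmod x \<le> rho w powr t * norm z ^ k * max B 0"
    using that True by (intro mult_mono power_mono norm_cdot_less) auto
   then show ?thesis using True by (simp add: h_def wd_def norm_mult norm_power mult_ac)
  qed (simp add: h_def wd_def)
  have intg: "integrable \<nu> (\<lambda>w. h w * g (c *s w))" if "cmod c = 1" for c
  proof (rule Bochner_Integration.integrable_bound[OF wint])
   have "(\<lambda>w. g (c *s w)) \<in> borel_measurable \<nu>"
    by (rule measurable_compose[OF smult_ball_measurable[OF that] assms(2)])
   then show "(\<lambda>w. h w * g (c *s w)) \<in> borel_measurable \<nu>" by measurable
   have "norm (h w * g (c *s w)) \<le> wd w" if "norm w < 1" for w
    using B[of "c *s w"] \<open>cmod c = 1\<close> by (intro hb that) (simp add: norm_vec_smult le_max_iff_disj)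
   moreover have "wd w \<ge> 0" for w by (simp add: wd_def)
   ultimately show "AE w in \<nu>. norm (h w * g (c *s w)) \<le> norm (wd w)"
    by (intro AE_I2) auto
  qed
  have rot: "(\<integral>w. h w * g (c *s w) \<partial>\<nu>) * cnj c ^ k = (\<integral>w. h w * g w \<partial>\<nu>)" if c: "cmod c = 1" for c
  proof -
   have hc: "h (c *s w) = cnj c ^ k * h w" for w
    using c by (simp add: h_def norm_vec_smult cdot_smult_right power_mult_distrib indicator_def)
   have "(\<integral>w. h w * g w \<partial>\<nu>) = (\<integral>w. h (c *s w) * g (c *s w) \<partial>\<nu>)"
    by (subst integral_ball_rotate[OF c, symmetric]) simp_all
   also have "\<dots> = (\<integral>w. h w * g (c *s w) * cnj c ^ k \<partial>\<nu>)"
    by (simp add: hc mult_ac)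
   also have "\<dots> = (\<integral>w. h w * g (c *s w) \<partial>\<nu>) * cnj c ^ k"
    by (rule integral_mult_left_zero)
   finally show ?thesis by simp
  qed
  have avg: "(\<integral>w. h w * A m w \<partial>\<nu>) = (\<integral>w. h w * g w \<partial>\<nu>)" if "m > 0" for m
  proof -
   have "(\<integral>w. h w * A m w \<partial>\<nu>) =
     (\<integral>w. (\<Sum>j<m. (h w * g (unity_root m ^ j *s w)) * cnj (unity_root m ^ j) ^ k) / of_nat m \<partial>\<nu>)"
    by (simp add: A_def root_average_def sum_distrib_left mult_ac)
   also have "\<dots> = (\<Sum>j<m. (\<integral>w. h w * g (unity_root m ^ j *s w) \<partial>\<nu>) * cnj (unity_root m ^ j) ^ k) / of_nat m"
    by (subst integral_divide_zero, subst Bochner_Integration.integral_sum)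
     (auto intro!: intg integrable_mult_left simp: norm_power)
   also have "\<dots> = (\<integral>w. h w * g w \<partial>\<nu>)"
    using that by (subst rot) (auto simp: norm_power)
   finally show ?thesis .
  qed
  have "(\<lambda>m. \<integral>w. h w * A m w \<partial>\<nu>) \<longlonglongrightarrow> (\<integral>w. h w * hom_part g k w \<partial>\<nu>)"
  proof (rule integral_dominated_convergence[OF _ _ wint])
   show "(\<lambda>w. h w * A m w) \<in> borel_measurable \<nu>" for m
   proof -
    have [measurable]: "A m \<in> borel_measurable \<nu>"
     unfolding A_def[abs_def]
     by (rule root_average_measurable) (use measurable_compose[OF smult_ball_measurable] in simp)
    show ?thesis by measurable
   qed
   show "AE w in \<nu>. (\<lambda>m. h w * A m w) \<longlonglongrightarrow> h w * hom_part g k w"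
    unfolding A_def using hom_part_tendsto[OF sl] by (intro AE_I2 tendsto_intros) simp
   show "AE w in \<nu>. norm (h w * A m w) \<le> wd w" for m
    unfolding A_def using B by (intro AE_I2 hb root_average_bound) (auto simp: norm_vec_smult intro!: le_max_iff_disj[THEN iffD2])
  qed measurable
  moreover have "(\<lambda>m. \<integral>w. h w * A m w \<partial>\<nu>) \<longlonglongrightarrow> (\<integral>w. h w * g w \<partial>\<nu>)"
   by (rule tendsto_eventually) (auto intro!: eventually_sequentiallyI[of 1] avg)
  ultimately have "(\<integral>w. h w * g w \<partial>\<nu>) = (\<integral>w. h w * hom_part g k w \<partial>\<nu>)"
   using LIMSEQ_unique by blast
  then show ?thesis by (simp add: h_def mult_ac)
qed

lemma indicator_ball_tendsto:
  assumes "norm (w :: complex^'n) < 1"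
  shows "(\<lambda>i. indicator (ball 0 (1 - 1 / real (Suc i))) w * x) \<longlonglongrightarrow> (x :: complex)"
proof (rule tendsto_eventually)
  have "(\<lambda>i. 1 - 1 / real (Suc i)) \<longlonglongrightarrow> 1 - 0"
   by (intro tendsto_intros LIMSEQ_Suc[OF lim_1_over_n])
  then have "\<forall>\<^sub>F i in sequentially. norm w < 1 - 1 / real (Suc i)"
   using assms by (intro order_tendstoD) auto
  then show "\<forall>\<^sub>F i in sequentially. indicator (ball 0 (1 - 1 / real (Suc i))) w * x = x"
   by eventually_elim simp
qed

lemma moment_formula:
  fixes g :: "complex^'n \<Rightarrow> complex"
  assumes g: "line_holomorphic g" and [measurable]: "g \<in> borel_measurable \<nu>"
   and int: "integrable \<nu> (\<lambda>w. of_real (rho w powr t) * g w)" and t: "t > -1"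
  shows "(\<integral>w. of_real (rho w powr t) * g w * cdot z w ^ k \<partial>\<nu>) = of_real (ball_moment TYPE('n) t k) * hom_part g k z"
   and "integrable \<nu> (\<lambda>w. of_real (rho w powr t) * g w * cdot z w ^ k)"
proof -
  have [measurable]: "ball (0::complex^'n) r \<in> sets borel" for r by simp
  have [measurable]: "hom_part g k \<in> borel_measurable borel"
   by (rule hom_part_measurable[OF line_holomorphic_imp_slice[OF g]]) measurable
  show int2: "integrable \<nu> (\<lambda>w. of_real (rho w powr t) * g w * cdot z w ^ k)"
  proof (rule Bochner_Integration.integrable_bound)
   show "integrable \<nu> (\<lambda>w. of_real (norm z ^ k) * (of_real (rho w powr t) * g w))"
    by (intro integrable_mult_right int)
   show "AE w in \<nu>. norm (of_real (rho w powr t) * g w * cdot z w ^ k) \<le> norm (of_real (norm z ^ k) * (of_real (rho w powr t) * g w))"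
   proof (rule AE_I2)
    fix w :: "complex^'n" assume "w \<in> space \<nu>"
    then have "cmod (cdot z w) ^ k \<le> norm z ^ k" by (intro power_mono norm_cdot_less) auto
    then have "norm (of_real (rho w powr t) * g w) * cmod (cdot z w) ^ k \<le> norm (of_real (rho w powr t) * g w) * norm z ^ k"
     by (rule mult_left_mono) simp
    then show "norm (of_real (rho w powr t) * g w * cdot z w ^ k) \<le> norm (of_real (norm z ^ k) * (of_real (rho w powr t) * g w))"
     by (simp add: norm_mult norm_power mult_ac)
   qed
  qed measurable
  have lim: "(\<lambda>i. \<integral>w. indicator (ball 0 (1 - 1 / real (Suc i))) w * F w \<partial>\<nu>) \<longlonglongrightarrow> (\<integral>w. F w \<partial>\<nu>)"
   if F: "integrable \<nu> F" for F :: "complex^'n \<Rightarrow> complex"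
  proof (rule integral_dominated_convergence[OF _ _ integrable_norm[OF F]])
   show "AE w in \<nu>. (\<lambda>i. indicator (ball 0 (1 - 1 / real (Suc i))) w * F w) \<longlonglongrightarrow> F w"
    by (intro AE_I2 indicator_ball_tendsto) simp
   show "AE w in \<nu>. norm (indicator (ball 0 (1 - 1 / real (Suc i))) w * F w) \<le> norm (F w)" for i
    by (intro AE_I2) (simp add: indicator_def)
  qed (use borel_measurable_integrable[OF F] in measurable)
  have "(\<lambda>i. \<integral>w. indicator (ball 0 (1 - 1 / real (Suc i))) w * (of_real (rho w powr t) * g w * cdot z w ^ k) \<partial>\<nu>)
   \<longlonglongrightarrow> (\<integral>w. hom_part g k w * cdot z w ^ k * of_real (rho w powr t) \<partial>\<nu>)"
  proof -
   have eq: "(\<integral>w. indicator (ball 0 (1 - 1 / real (Suc i))) w * (of_real (rho w powr t) * g w * cdot z w ^ k) \<partial>\<nu>)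
    = (\<integral>w. indicator (ball 0 (1 - 1 / real (Suc i))) w * (hom_part g k w * cdot z w ^ k * of_real (rho w powr t)) \<partial>\<nu>)" for i
    by (rule moment_formula_truncated[OF g _ int t]) auto
   show ?thesis unfolding eq by (rule lim, rule moment_formula_homogeneous(2)[OF g _ t]) simp
  qed
  from LIMSEQ_unique[OF this lim[OF int2]]
  show "(\<integral>w. of_real (rho w powr t) * g w * cdot z w ^ k \<partial>\<nu>) = of_real (ball_moment TYPE('n) t k) * hom_part g k z"
   using moment_formula_homogeneous(1)[OF g _ t, of k z] by simp
qed

text \<open>A function integrable against the weight may be integrated term by term against any kernel
  whose coefficient series converges absolutely in the open disc; every kernel below is
  evaluated through this identity.\<close>

lemma integral_kernel_series:
  fixes g :: "complex^'n \<Rightarrow> complex" and l :: "nat \<Rightarrow> complex"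
  assumes g: "line_holomorphic g" and [measurable]: "g \<in> borel_measurable \<nu>"
   and int: "integrable \<nu> (\<lambda>w. of_real (rho w powr t) * g w)" and t: "t > -1"
   and l: "\<And>x. 0 \<le> x \<Longrightarrow> x < 1 \<Longrightarrow> summable (\<lambda>k. cmod (l k) * x ^ k)" and z: "norm z < 1"
  shows "(\<lambda>k. l k * of_real (ball_moment TYPE('n) t k) * hom_part g k z) sums
    (\<integral>w. of_real (rho w powr t) * g w * (\<Sum>k. l k * cdot z w ^ k) \<partial>\<nu>)"
proof -
  define h where "h w = of_real (rho w powr t) * g w" for w
  have inth: "integrable \<nu> h" using int by (simp add: h_def[abs_def])
  have le: "norm (h w * (l k * cdot z w ^ k)) \<le> cmod (l k) * norm z ^ k * cmod (h w)" if "norm w < 1" for w k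
   using that power_mono[OF norm_cdot_less[OF that, of z] norm_ge_zero, of k]
   by (simp add: norm_mult norm_power) (metis mult.commute mult.left_commute mult_left_mono norm_ge_zero)
  have sm: "summable (\<lambda>k. cmod (l k) * norm z ^ k)" by (rule l) (use z in auto)
  have sm1: "summable (\<lambda>k. norm (h w * (l k * cdot z w ^ k)))" if "norm w < 1" for w
   using summable_comparison_test'[OF summable_mult2[OF sm, of "cmod (h w)"], of 0 "\<lambda>k. norm (h w * (l k * cdot z w ^ k))"] le[OF that]
   by simp
  have inti: "integrable \<nu> (\<lambda>w. h w * (l k * cdot z w ^ k))" for k
   using integrable_mult_right[OF moment_formula(2)[OF g _ int t, of z k], of "l k"]
   by (simp add: h_def mult_ac)
  have "(\<lambda>k. \<integral>w. h w * (l k * cdot z w ^ k) \<partial>\<nu>) sums (\<integral>w. (\<Sum>k. h w * (l k * cdot z w ^ k)) \<partial>\<nu>)"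
  proof (rule sums_integral[OF inti])
   show "AE w in \<nu>. summable (\<lambda>k. norm (h w * (l k * cdot z w ^ k)))"
    using sm1 by (intro AE_I2) simp
   show "summable (\<lambda>k. \<integral>w. norm (h w * (l k * cdot z w ^ k)) \<partial>\<nu>)"
   proof (rule summable_comparison_test'[OF summable_mult2[OF sm, of "\<integral>w. cmod (h w) \<partial>\<nu>"], of 0])
    fix k
    have "(\<integral>w. norm (h w * (l k * cdot z w ^ k)) \<partial>\<nu>) \<le> (\<integral>w. cmod (l k) * norm z ^ k * cmod (h w) \<partial>\<nu>)"
     using le inth inti by (intro integral_mono integrable_norm integrable_mult_right) auto
    then show "norm (\<integral>w. norm (h w * (l k * cdot z w ^ k)) \<partial>\<nu>) \<le> cmod (l k) * norm z ^ k * (\<integral>w. cmod (h w) \<partial>\<nu>)"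
     by (simp add: integral_nonneg_AE)
   qed
  qed
  also have "(\<lambda>k. \<integral>w. h w * (l k * cdot z w ^ k) \<partial>\<nu>) = (\<lambda>k. l k * of_real (ball_moment TYPE('n) t k) * hom_part g k z)"
  proof
   fix k
   have "(\<integral>w. h w * (l k * cdot z w ^ k) \<partial>\<nu>) = (\<integral>w. l k * (of_real (rho w powr t) * g w * cdot z w ^ k) \<partial>\<nu>)"
    by (simp add: h_def mult_ac)
   also have "\<dots> = l k * of_real (ball_moment TYPE('n) t k) * hom_part g k z"
    by (simp add: moment_formula(1)[OF g _ int t])
   finally show "(\<integral>w. h w * (l k * cdot z w ^ k) \<partial>\<nu>) = l k * of_real (ball_moment TYPE('n) t k) * hom_part g k z" .
  qed
  also have "(\<integral>w. (\<Sum>k. h w * (l k * cdot z w ^ k)) \<partial>\<nu>) = (\<integral>w. h w * (\<Sum>k. l k * cdot z w ^ k) \<partial>\<nu>)"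
  proof (rule Bochner_Integration.integral_cong[OF refl])
   fix w :: "complex^'n" assume "w \<in> space \<nu>"
   then have w: "norm w < 1" by simp
   have "summable (\<lambda>k. norm (l k * cdot z w ^ k))"
    by (rule summable_comparison_test'[OF sm, of 0])
     (use power_mono[OF norm_cdot_less[OF w, of z] norm_ge_zero] in \<open>simp add: norm_mult norm_power mult_left_mono\<close>)
   from suminf_mult[OF summable_norm_cancel[OF this]]
   show "(\<Sum>k. h w * (l k * cdot z w ^ k)) = h w * (\<Sum>k. l k * cdot z w ^ k)" by simp
  qed
  finally show ?thesis by (simp add: h_def)
qed

section \<open>The Forelli--Rudin estimate\<close>

lemma hom_part_eqI:
  assumes "e > 0" "\<And>c. cmod c < e \<Longrightarrow> (\<lambda>k. b k * c ^ k) sums g (c *s u)"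
  shows "hom_part g k u = b k"
proof -
  have "(\<lambda>c. g (c *s u)) has_fps_expansion Abs_fps b"
  proof (rule has_fps_expansionI)
   have "eventually (\<lambda>c. c \<in> ball 0 e) (nhds (0::complex))"
    using assms(1) by (intro eventually_nhds_in_open) auto
   then show "\<forall>\<^sub>F c in nhds 0. (\<lambda>n. fps_nth (Abs_fps b) n * c ^ n) sums g (c *s u)"
    by eventually_elim (simp add: assms(2))
  qed
  from fps_nth_fps_expansion[OF this, of k] show ?thesis by (simp add: hom_part_def)
qed

text \<open>Logarithmic convexity of the Gamma function, which compares the coefficients in the
  Forelli--Rudin series with binomial ones.\<close>

lemma Gamma_squared_le:
  assumes "x > 0" "y > 0"
  shows "Gamma ((x + y) / 2) ^ 2 \<le> Gamma x * Gamma (y :: real)"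
proof -
  have "(ln \<circ> Gamma) ((1/2) *\<^sub>R x + (1/2) *\<^sub>R y) \<le> (1/2) * (ln \<circ> Gamma) x + (1/2) * (ln \<circ> Gamma) y"
   using convex_onD[OF log_convex_Gamma_real, of "1/2" x y] assms by simp
  then have "2 * ln (Gamma ((x + y) / 2)) \<le> ln (Gamma x) + ln (Gamma y)"
   by (simp add: add_divide_distrib)
  moreover have "Gamma x > 0" "Gamma y > 0" "Gamma ((x + y) / 2) > 0"
   using assms by (auto intro!: Gamma_real_pos)
  ultimately have "ln (Gamma ((x + y) / 2) ^ 2) \<le> ln (Gamma x * Gamma y)"
   by (simp add: ln_mult ln_realpow)
  then show ?thesis using \<open>Gamma x > 0\<close> \<open>Gamma y > 0\<close> \<open>Gamma ((x + y) / 2) > 0\<close> by (simp add: ln_le_cancel_iff)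
qed

lemma pochhammer_pos_Gamma:
  "s > 0 \<Longrightarrow> pochhammer s k = Gamma (s + real k) / Gamma (s::real)"
  by (intro pochhammer_Gamma) (auto elim!: nonpos_Ints_cases)

lemma binomial_series_complex:
  assumes "cmod x < 1"
  shows "(\<lambda>k. complex_of_real (pochhammer s k / fact k) * x ^ k) sums (1 - x) powr (- of_real s)"
proof -
  have "(\<lambda>k. ((- of_real s) gchoose k) * (- x) ^ k) sums (1 + (- x)) powr (- of_real s)"
   by (rule gen_binomial_complex) (use assms in simp)
  moreover have "((- complex_of_real s) gchoose k) * (- x) ^ k = complex_of_real (pochhammer s k / fact k) * x ^ k" for k
  proof -
   have "(- 1) ^ k * (- x) ^ k = x ^ k" by (simp flip: power_mult_distrib)
   then show ?thesis
    by (simp add: gbinomial_pochhammer pochhammer_of_real)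
  qed
  ultimately show ?thesis by simp
qed

lemma binomial_series_real:
  fixes x s :: real
  assumes "\<bar>x\<bar> < 1"
  shows "(\<lambda>k. pochhammer s k / fact k * x ^ k) sums (1 - x) powr (- s)"
proof -
  have "(\<lambda>k. ((- s) gchoose k) * (- x) ^ k) sums (1 + (- x)) powr (- s)"
   by (rule gen_binomial_real) (use assms in simp)
  moreover have "((- s) gchoose k) * (- x) ^ k = pochhammer s k / fact k * x ^ k" for k
  proof -
   have "(- 1) ^ k * (- x) ^ k = x ^ k" by (simp flip: power_mult_distrib)
   then show ?thesis
    by (simp add: gbinomial_pochhammer)
  qed
  ultimately show ?thesis by simp
qed

lemma norm_cdot_less_1: "norm z < 1 \<Longrightarrow> norm w < 1 \<Longrightarrow> cmod (cdot z w) < 1"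
  using norm_cdot_less[of w z] by linarith

lemma Re_one_minus_pos: "cmod x < 1 \<Longrightarrow> Re (1 - x) > 0"
  using complex_Re_le_cmod[of x] by simp

lemma integrable_rho_powr:
  assumes "t > -1" shows "integrable \<nu> (\<lambda>w :: complex^'n. rho w powr t)"
proof -
  have "integrable \<nu> (\<lambda>w :: complex^'n. of_real (rho w powr t) :: complex)"
   using moment_formula_homogeneous(2)[of "\<lambda>_. 1" t 0] assms
   by (auto simp: line_holomorphic_def hom_part_def intro!: exI[of _ 1])
  from integrable_norm[OF this] show ?thesis by simp
qed

lemma ball_moment_pos: "t > -1 \<Longrightarrow> ball_moment TYPE('n::finite) t k > 0"
  using gauss_const_pos[where 'n='n] by (simp add: ball_moment_def)

text \<open>Writing the kernel as \<open>\<bar>(1 - \<langle>z, w\<rangle>)\<^sup>-\<^sup>s\<bar>\<^sup>2\<close> with \<open>2 s = n + 1 + t + c\<close> and expanding one factor, the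
  integral becomes a power series in \<open>\<bar>z\<bar>\<^sup>2\<close> with positive coefficients. Logarithmic convexity of
  the Gamma function bounds these by the coefficients of \<open>(1 - \<bar>z\<bar>\<^sup>2)\<^sup>-\<^sup>c\<close>.\<close>

theorem forelli_rudin:
  assumes t: "t > -1" and c: "c > 0"
  shows "\<exists>C>0. \<forall>z :: complex^'n. norm z < 1 \<longrightarrow>
   (\<integral>\<^sup>+w. ennreal (rho w powr t * cmod (1 - cdot z w) powr (- (real CARD('n) + 1 + t + c))) \<partial>\<nu>)
    \<le> ennreal (C * rho z powr (- c))"
proof -
  define s where "s = (real CARD('n) + 1 + t + c) / 2"
  have s: "s > 0" "2 * s = real CARD('n) + 1 + t + c" using t c by (simp_all add: s_def)
  define a where "a k = pochhammer s k / fact k" for k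
  have a: "a k \<ge> 0" for k using s by (simp add: a_def pochhammer_nonneg)
  define C where "C = gauss_const TYPE('n) * Gamma (t + 1) * Gamma c / Gamma s ^ 2"
  have Cpos: "C > 0" unfolding C_def using gauss_const_pos[where 'n='n] s t c
   by (intro divide_pos_pos mult_pos_pos zero_less_power Gamma_real_pos) auto
  show ?thesis
  proof (intro exI[of _ C] conjI allI impI)
   fix z :: "complex^'n" assume z: "norm z < 1"
   define g where "g w = (1 - cdot w z) powr (- of_real s)" for w
   have gle: "cmod (g w) \<le> (1 - norm z) powr (- s)" if "norm w < 1" for w
   proof -
    have "1 - norm z \<le> 1 - cmod (cdot z w)" using norm_cdot_less[OF that, of z] by simp
    also have "\<dots> \<le> cmod (1 - cdot w z)"
     using norm_triangle_ineq2[of 1 "cdot w z"] by (metis cnj_cdot complex_mod_cnj norm_one)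
    finally have "cmod (1 - cdot w z) powr (- s) \<le> (1 - norm z) powr (- s)"
     using z s by (intro powr_mono2') auto
    then show ?thesis by (simp add: g_def norm_powr_real_powr')
   qed
   have lh: "line_holomorphic (\<lambda>w. if norm w < 1 then g w else 0)"
    unfolding line_holomorphic_def
   proof (intro conjI allI impI)
    fix u v :: "complex^'n"
    have "(\<lambda>c. (1 - cdot (u + c *s v) z) powr (- of_real s)) holomorphic_on {c. norm (u + c *s v) < 1}"
     unfolding cdot_add_left cdot_smult_left
    proof (intro holomorphic_intros)
     fix c assume "c \<in> {c. norm (u + c *s v) < 1}"
     then have "Re (1 - cdot (u + c *s v) z) > 0" using z by (intro Re_one_minus_pos norm_cdot_less_1) auto
     then show "1 - (cdot u z + c * cdot v z) \<notin> \<real>\<^sub>\<le>\<^sub>0"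
      by (auto simp: cdot_add_left cdot_smult_left complex_nonpos_Reals_iff)
    qed
    then show "(\<lambda>c. if norm (u + c *s v) < 1 then g (u + c *s v) else 0) holomorphic_on {c. norm (u + c *s v) < 1}"
     by (rule holomorphic_transform) (simp add: g_def)
   next
    fix r :: real
    have "cmod (if norm w < 1 then g w else 0) \<le> (1 - norm z) powr (- s)" for w using gle[of w] by simp
    then show "\<exists>B. \<forall>w. norm w \<le> r \<longrightarrow> cmod (if norm w < 1 then g w else 0) \<le> B" by blast
   qed
   have [measurable]: "(\<lambda>w. if norm w < 1 then g w else 0) \<in> borel_measurable \<nu>"
    unfolding g_def by measurable
   have hp: "hom_part (\<lambda>w. if norm w < 1 then g w else 0) k z = of_real (a k * (norm z) ^ (2 * k))" for k
   proof -
    have "hom_part (\<lambda>w. if norm w < 1 then g w else 0) k z = of_real (a k) * cdot z z ^ k"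
    proof (rule hom_part_eqI[of 1])
     fix c :: complex assume c: "cmod c < 1"
     have n: "norm (c *s z) < 1" using c z mult_strict_mono'[of "cmod c" 1 "norm z" 1] by (simp add: norm_vec_smult)
     show "(\<lambda>k. of_real (a k) * cdot z z ^ k * c ^ k) sums (if norm (c *s z) < 1 then g (c *s z) else 0)"
      using binomial_series_complex[OF norm_cdot_less_1[OF n z], of s] n
      by (simp add: g_def a_def cdot_smult_left power_mult_distrib mult_ac)
    qed simp
    then show ?thesis by (simp add: cdot_self power_mult)
   qed
   have bd: "cmod (of_real (rho w powr t) * (if norm w < 1 then g w else 0)) \<le> (1 - norm z) powr (- s) * rho w powr t" if "norm w < 1" for w
    using gle[OF that] that by (simp add: norm_mult mult.commute mult_right_mono)
   have intg: "integrable \<nu> (\<lambda>w. of_real (rho w powr t) * (if norm w < 1 then g w else 0))"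
   proof (rule Bochner_Integration.integrable_bound)
    show "integrable \<nu> (\<lambda>w :: complex^'n. (1 - norm z) powr (- s) * rho w powr t)"
     by (intro integrable_mult_right integrable_rho_powr t)
    show "AE w in \<nu>. norm (of_real (rho w powr t) * (if norm w < 1 then g w else 0)) \<le> norm ((1 - norm z) powr (- s) * rho w powr t)"
     using bd by (intro AE_I2) (simp add: order_trans[OF _ abs_ge_self])
   qed measurable
   have sa: "summable (\<lambda>k. cmod (of_real (a k)) * x ^ k)" if "0 \<le> x" "x < 1" for x
    unfolding norm_of_real abs_of_nonneg[OF a] unfolding a_def
    using sums_summable[OF binomial_series_real[of x s]] that by simp
   have "(\<lambda>k. of_real (a k) * of_real (ball_moment TYPE('n) t k) * hom_part (\<lambda>w. if norm w < 1 then g w else 0) k z) sums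
     (\<integral>w. of_real (rho w powr t) * (if norm w < 1 then g w else 0) * (\<Sum>k. of_real (a k) * cdot z w ^ k) \<partial>\<nu>)"
    by (rule integral_kernel_series[OF lh _ intg t sa z]) measurable
   also have "(\<integral>w. of_real (rho w powr t) * (if norm w < 1 then g w else 0) * (\<Sum>k. of_real (a k) * cdot z w ^ k) \<partial>\<nu>) =
     (\<integral>w. of_real (rho w powr t * cmod (1 - cdot z w) powr (- (2 * s))) \<partial>\<nu>)"
   proof (rule Bochner_Integration.integral_cong[OF refl])
    fix w :: "complex^'n" assume "w \<in> space \<nu>"
    then have w: "norm w < 1" by simp
    have x: "cmod (cdot z w) < 1" by (rule norm_cdot_less_1[OF z w])
    have F: "(\<Sum>k. of_real (a k) * cdot z w ^ k) = (1 - cdot z w) powr (- of_real s)"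
     using binomial_series_complex[OF x, of s] by (simp add: a_def sums_iff)
    have "g w = cnj ((1 - cdot z w) powr (- of_real s))"
     using Re_one_minus_pos[OF x] by (subst cnj_powr) (auto simp: g_def cnj_cdot)
    then have "g w * (1 - cdot z w) powr (- of_real s) = of_real ((cmod ((1 - cdot z w) powr (- of_real s)))\<^sup>2)"
     unfolding complex_norm_square by (simp only: mult.commute)
    also have "(cmod ((1 - cdot z w) powr (- of_real s)))\<^sup>2 = cmod (1 - cdot z w) powr (- (2 * s))"
     by (simp add: norm_powr_real_powr' power2_eq_square flip: powr_add)
    finally show "of_real (rho w powr t) * (if norm w < 1 then g w else 0) * (\<Sum>k. of_real (a k) * cdot z w ^ k) =
      of_real (rho w powr t * cmod (1 - cdot z w) powr (- (2 * s)))"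
     unfolding F using w by simp
   qed
   also have "\<dots> = of_real (\<integral>w. rho w powr t * cmod (1 - cdot z w) powr (- (2 * s)) \<partial>\<nu>)"
    by (rule integral_complex_of_real)
   finally have "(\<lambda>k. complex_of_real (a k * ball_moment TYPE('n) t k * (a k * norm z ^ (2 * k)))) sums
     of_real (\<integral>w. rho w powr t * cmod (1 - cdot z w) powr (- (2 * s)) \<partial>\<nu>)"
    by (simp only: hp of_real_mult)
   then have S: "(\<lambda>k. a k * ball_moment TYPE('n) t k * (a k * norm z ^ (2 * k))) sums
     (\<integral>w. rho w powr t * cmod (1 - cdot z w) powr (- (2 * s)) \<partial>\<nu>)"
    by (simp only: sums_of_real_iff)
   have z2: "\<bar>(norm z)\<^sup>2\<bar> < 1" using z by (simp add: abs_square_less_1)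
   have T: "(\<lambda>k. C * (pochhammer c k / fact k * ((norm z)\<^sup>2) ^ k)) sums (C * rho z powr (- c))"
    by (intro sums_mult binomial_series_real z2)
   have le: "a k * ball_moment TYPE('n) t k * (a k * norm z ^ (2 * k)) \<le> C * (pochhammer c k / fact k * ((norm z)\<^sup>2) ^ k)" for k
   proof -
    let ?A = "real k + real CARD('n) + t + 1"
    have pos: "Gamma ?A > 0" "Gamma s > 0" "Gamma c > 0" "Gamma (c + real k) > 0" "Gamma (t + 1) > 0"
     using t s c by (auto intro!: Gamma_real_pos)
    have "Gamma (s + real k) ^ 2 = Gamma ((?A + (c + real k)) / 2) ^ 2"
     by (rule arg_cong[of _ _ "\<lambda>x. Gamma x ^ 2"]) (use s in simp)
    also have "\<dots> \<le> Gamma ?A * Gamma (c + real k)" using t c by (intro Gamma_squared_le) auto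
    finally have G: "Gamma (s + real k) ^ 2 / Gamma ?A \<le> Gamma (c + real k)"
     using pos by (simp add: field_simps)
    have "a k * ball_moment TYPE('n) t k * a k =
      (gauss_const TYPE('n) * Gamma (t + 1) / (Gamma s ^ 2 * fact k)) * (Gamma (s + real k) ^ 2 / Gamma ?A)"
     using pos by (simp add: a_def ball_moment_def pochhammer_pos_Gamma[OF s(1)] field_simps power2_eq_square)
    also have "\<dots> \<le> (gauss_const TYPE('n) * Gamma (t + 1) / (Gamma s ^ 2 * fact k)) * Gamma (c + real k)"
     using pos gauss_const_pos[where 'n='n] by (intro mult_left_mono G) auto
    also have "\<dots> = C * (pochhammer c k / fact k)"
     using pos by (simp add: C_def pochhammer_pos_Gamma[OF c] field_simps)
    finally have "a k * ball_moment TYPE('n) t k * a k * norm z ^ (2 * k) \<le> C * (pochhammer c k / fact k) * norm z ^ (2 * k)"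
     by (rule mult_right_mono) simp
    then show ?thesis by (simp only: power_mult[symmetric] mult_ac)
   qed
   have I: "(\<integral>w. rho w powr t * cmod (1 - cdot z w) powr (- (2 * s)) \<partial>\<nu>) \<le> C * rho z powr (- c)"
    using sums_le[OF le S T] .
   have "integrable \<nu> (\<lambda>w. rho w powr t * cmod (1 - cdot z w) powr (- (2 * s)))"
   proof (rule Bochner_Integration.integrable_bound)
    show "integrable \<nu> (\<lambda>w :: complex^'n. (1 - norm z) powr (- (2 * s)) * rho w powr t)"
     by (intro integrable_mult_right integrable_rho_powr t)
    show "AE w in \<nu>. norm (rho w powr t * cmod (1 - cdot z w) powr (- (2 * s))) \<le> norm ((1 - norm z) powr (- (2 * s)) * rho w powr t)"
    proof (rule AE_I2)
     fix w :: "complex^'n" assume "w \<in> space \<nu>"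
     then have "1 - norm z \<le> 1 - cmod (cdot z w)" using norm_cdot_less[of w z] by simp
     also have "\<dots> \<le> cmod (1 - cdot z w)"
      using norm_triangle_ineq2[of 1 "cdot z w"] by simp
     finally have "cmod (1 - cdot z w) powr (- (2 * s)) \<le> (1 - norm z) powr (- (2 * s))"
      using z s(1) by (intro powr_mono2') auto
     then show "norm (rho w powr t * cmod (1 - cdot z w) powr (- (2 * s))) \<le> norm ((1 - norm z) powr (- (2 * s)) * rho w powr t)"
      by (simp add: mult.commute mult_left_mono)
    qed
   qed measurable
   then have "(\<integral>\<^sup>+w. ennreal (rho w powr t * cmod (1 - cdot z w) powr (- (2 * s))) \<partial>\<nu>)
     = ennreal (\<integral>w. rho w powr t * cmod (1 - cdot z w) powr (- (2 * s)) \<partial>\<nu>)"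
    by (intro nn_integral_eq_integral) auto
   also have "\<dots> \<le> ennreal (C * rho z powr (- c))" by (rule ennreal_leI[OF I])
   finally show "(\<integral>\<^sup>+w. ennreal (rho w powr t * cmod (1 - cdot z w) powr (- (real CARD('n) + 1 + t + c))) \<partial>\<nu>)
    \<le> ennreal (C * rho z powr (- c))" unfolding s(2) .
  qed (rule Cpos)
qed

section \<open>Growth of kernels\<close>

text \<open>The power series with coefficients \<open>h\<close> grows at the boundary point \<open>1\<close> of the disc no faster
  than \<open>(1 - x)\<close> to the power \<open>- \<sigma>\<close>. Absolute convergence in the disc is part of the notion
  because the series is always evaluated at \<open>\<langle>z, w\<rangle>\<close> and integrated termwise.\<close>

definition kernel_order :: "(nat \<Rightarrow> complex) \<Rightarrow> nat \<Rightarrow> bool" where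
  "kernel_order h \<sigma> \<longleftrightarrow> (\<forall>x. 0 \<le> x \<and> x < 1 \<longrightarrow> summable (\<lambda>k. cmod (h k) * x ^ k)) \<and>
    (\<exists>C>0. \<forall>x. cmod x < 1 \<longrightarrow> cmod (\<Sum>k. h k * x ^ k) \<le> C / cmod (1 - x) ^ \<sigma>)"

lemma kernel_order_summable:
  assumes "kernel_order h \<sigma>" "cmod x < 1"
  shows "summable (\<lambda>k. cmod (h k * x ^ k))" "summable (\<lambda>k. h k * x ^ k)"
proof -
  show "summable (\<lambda>k. cmod (h k * x ^ k))"
   using assms by (simp add: kernel_order_def norm_mult norm_power)
  then show "summable (\<lambda>k. h k * x ^ k)" by (rule summable_norm_cancel)
qed

lemma one_minus_bounds:
  assumes "cmod x < 1"
  shows "0 < cmod (1 - x)" "cmod (1 - x) < 2"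
proof -
  show "0 < cmod (1 - x)" using assms by auto
  show "cmod (1 - x) < 2" using norm_triangle_ineq4[of 1 x] assms by simp
qed

lemma kernel_order_mono:
  assumes "kernel_order h \<sigma>" "\<sigma> \<le> \<tau>"
  shows "kernel_order h \<tau>"
proof -
  obtain C where C: "C > 0" "\<And>x. cmod x < 1 \<Longrightarrow> cmod (\<Sum>k. h k * x ^ k) \<le> C / cmod (1 - x) ^ \<sigma>"
   using assms(1) by (auto simp: kernel_order_def)
  have "cmod (\<Sum>k. h k * x ^ k) \<le> (C * 2 ^ (\<tau> - \<sigma>)) / cmod (1 - x) ^ \<tau>" if x: "cmod x < 1" for x
  proof -
   have "cmod (1 - x) ^ (\<tau> - \<sigma>) \<le> 2 ^ (\<tau> - \<sigma>)" using one_minus_bounds[OF x] by (intro power_mono) auto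
   moreover have "cmod (1 - x) ^ \<tau> = cmod (1 - x) ^ \<sigma> * cmod (1 - x) ^ (\<tau> - \<sigma>)"
    using assms(2) by (simp flip: power_add)
   ultimately have "C / cmod (1 - x) ^ \<sigma> \<le> (C * 2 ^ (\<tau> - \<sigma>)) / cmod (1 - x) ^ \<tau>"
    using one_minus_bounds[OF x] C(1) by (simp add: field_simps)
   then show ?thesis using C(2)[OF x] by linarith
  qed
  then show ?thesis using assms(1) C(1) unfolding kernel_order_def
   by (auto intro!: exI[of _ "C * 2 ^ (\<tau> - \<sigma>)"])
qed

lemma kernel_order_add:
  assumes "kernel_order h \<sigma>" "kernel_order g \<sigma>"
  shows "kernel_order (\<lambda>k. h k + g k) \<sigma>"
proof -
  obtain C where C: "C > 0" "\<And>x. cmod x < 1 \<Longrightarrow> cmod (\<Sum>k. h k * x ^ k) \<le> C / cmod (1 - x) ^ \<sigma>"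
   using assms(1) by (auto simp: kernel_order_def)
  obtain D where D: "D > 0" "\<And>x. cmod x < 1 \<Longrightarrow> cmod (\<Sum>k. g k * x ^ k) \<le> D / cmod (1 - x) ^ \<sigma>"
   using assms(2) by (auto simp: kernel_order_def)
  have "cmod (\<Sum>k. (h k + g k) * x ^ k) \<le> (C + D) / cmod (1 - x) ^ \<sigma>" if x: "cmod x < 1" for x
  proof -
   have "(\<Sum>k. (h k + g k) * x ^ k) = (\<Sum>k. h k * x ^ k) + (\<Sum>k. g k * x ^ k)"
    using suminf_add[OF kernel_order_summable(2)[OF assms(1) x] kernel_order_summable(2)[OF assms(2) x]]
    by (simp add: distrib_right)
   then show ?thesis using C(2)[OF x] D(2)[OF x] norm_triangle_ineq[of "\<Sum>k. h k * x ^ k" "\<Sum>k. g k * x ^ k"]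
    by (simp add: add_divide_distrib)
  qed
  moreover have "summable (\<lambda>k. cmod (h k + g k) * x ^ k)" if "0 \<le> x" "x < 1" for x
  proof (rule summable_comparison_test'[of "\<lambda>k. cmod (h k) * x ^ k + cmod (g k) * x ^ k" 0])
   show "summable (\<lambda>k. cmod (h k) * x ^ k + cmod (g k) * x ^ k)"
    using assms that by (intro summable_add) (auto simp: kernel_order_def)
   show "norm (cmod (h k + g k) * x ^ k) \<le> cmod (h k) * x ^ k + cmod (g k) * x ^ k" for k
    using that mult_right_mono[OF norm_triangle_ineq[of "h k" "g k"], of "x ^ k"] by (simp add: distrib_right)
  qed
  ultimately show ?thesis using C(1) D(1) unfolding kernel_order_def by (auto intro!: exI[of _ "C + D"])
qed

lemma kernel_order_scale:
  assumes "kernel_order h \<sigma>"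
  shows "kernel_order (\<lambda>k. c * h k) \<sigma>"
proof -
  obtain C where C: "C > 0" "\<And>x. cmod x < 1 \<Longrightarrow> cmod (\<Sum>k. h k * x ^ k) \<le> C / cmod (1 - x) ^ \<sigma>"
   using assms(1) by (auto simp: kernel_order_def)
  have "cmod (\<Sum>k. c * h k * x ^ k) \<le> ((cmod c + 1) * C) / cmod (1 - x) ^ \<sigma>" if x: "cmod x < 1" for x
  proof -
   have "(\<Sum>k. c * h k * x ^ k) = c * (\<Sum>k. h k * x ^ k)"
    using suminf_mult[OF kernel_order_summable(2)[OF assms x], of c] by (simp add: mult.assoc)
   moreover have "cmod c * cmod (\<Sum>k. h k * x ^ k) \<le> (cmod c + 1) * (C / cmod (1 - x) ^ \<sigma>)"
    using C(1) by (intro mult_mono C(2)[OF x]) auto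
   ultimately show ?thesis by (simp add: norm_mult)
  qed
  moreover have "summable (\<lambda>k. cmod (c * h k) * x ^ k)" if "0 \<le> x" "x < 1" for x
   using summable_mult[of "\<lambda>k. cmod (h k) * x ^ k" "cmod c"] assms that by (simp add: kernel_order_def norm_mult mult.assoc)
  ultimately show ?thesis using C(1) unfolding kernel_order_def
   by (auto intro!: exI[of _ "(cmod c + 1) * C"] mult_pos_pos add_nonneg_pos)
qed

lemma kernel_order_binomial:
  "kernel_order (\<lambda>k. of_real (pochhammer (real S) k / fact k)) S"
proof -
  have "cmod (\<Sum>k. of_real (pochhammer (real S) k / fact k) * x ^ k) \<le> 1 / cmod (1 - x) ^ S" if x: "cmod x < 1" for x
   using binomial_series_complex[OF x, of "real S"] one_minus_bounds[OF x]
   by (simp add: sums_iff norm_powr_real_powr' powr_minus powr_realpow divide_inverse norm_inverse norm_power)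
  moreover have "summable (\<lambda>k. cmod (of_real (pochhammer (real S) k / fact k)) * x ^ k)" if "0 \<le> x" "x < 1" for x
   using sums_summable[OF binomial_series_real[of x "real S"]] that
   by (simp add: pochhammer_nonneg norm_divide abs_of_nonneg[OF pochhammer_nonneg] pochhammer_of_nat abs_divide)
  ultimately show ?thesis unfolding kernel_order_def by (auto intro!: exI[of _ 1])
qed

lemma kernel_order_drop_constant:
  assumes "kernel_order h \<sigma>"
  shows "kernel_order (\<lambda>k. if k = 0 then 0 else h k) \<sigma>"
proof -
  have "kernel_order (\<lambda>k. if k = 0 then - h 0 else 0) 0"
  proof -
   have "(\<Sum>k. (if k = 0 then - h 0 else 0) * x ^ k) = - h 0" for x
    using sums_single[of 0 "\<lambda>k. - h 0 * x ^ k"] by (simp add: sums_iff if_distrib[of "\<lambda>a. a * _"] cong: if_cong)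
   moreover have "summable (\<lambda>k. cmod (if k = 0 then - h 0 else 0) * x ^ k)" for x
    by (rule summable_finite[of "{0}"]) auto
   ultimately show ?thesis unfolding kernel_order_def by (auto intro!: exI[of _ "cmod (h 0) + 1"] add_nonneg_pos)
  qed
  from kernel_order_add[OF assms kernel_order_mono[OF this, of \<sigma>]]
  have "kernel_order (\<lambda>k. h k + (if k = 0 then - h 0 else 0)) \<sigma>" by simp
  also have "(\<lambda>k. h k + (if k = 0 then - h 0 else 0)) = (\<lambda>k. if k = 0 then 0 else h k)" by auto
  finally show ?thesis .
qed

text \<open>The binomial coefficients satisfy \<open>k (S)\<^sub>k = S (S + 1)\<^sub>k - S (S)\<^sub>k\<close>, so a factor \<open>k\<close> raises the
  order by one.\<close>

lemma kernel_order_times_index: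
  "kernel_order (\<lambda>k. of_nat k ^ j * of_real (pochhammer (real S) k / fact k)) (S + j)"
proof (induction j arbitrary: S)
  case 0
  then show ?case using kernel_order_binomial[of S] by simp
next
  case (Suc j)
  have eq: "of_nat k ^ Suc j * of_real (pochhammer (real S) k / fact k) =
    of_nat S * (of_nat k ^ j * of_real (pochhammer (real (Suc S)) k / fact k)) +
    (- of_nat S) * (of_nat k ^ j * complex_of_real (pochhammer (real S) k / fact k))" for k
  proof -
   have "real S * pochhammer (real (Suc S)) k = pochhammer (real S) k * (real S + real k)"
    using pochhammer_rec[of "real S" k] pochhammer_Suc[of "real S" k] by (simp add: add.commute)
   then have "of_real (real S * pochhammer (real (Suc S)) k) = (complex_of_real (pochhammer (real S) k * (real S + real k)))"
    by (rule arg_cong)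
   then have "of_nat S * complex_of_real (pochhammer (real (Suc S)) k) = of_real (pochhammer (real S) k) * (of_nat S + of_nat k)"
    by (simp only: of_real_mult of_real_add of_real_of_nat_eq)
   then have "of_nat k ^ j * (of_nat S * complex_of_real (pochhammer (real (Suc S)) k)) =
     of_nat k ^ j * (of_real (pochhammer (real S) k) * (of_nat S + of_nat k))"
    by (simp only:)
   then show ?thesis by (simp add: field_simps)
  qed
  show ?case unfolding eq
   using Suc.IH[of "Suc S"] kernel_order_mono[OF Suc.IH[of S], of "Suc (S + j)"]
   by (intro kernel_order_add kernel_order_scale) simp_all
qed

text \<open>Dividing the \<open>k\<close>-th coefficient by \<open>k\<close> integrates the series along the segment from \<open>0\<close> to
  \<open>x\<close>, and \<open>\<integral>\<^sub>0\<^sup>1 \<bar>1 - t x\<bar>\<^sup>-\<^sup>\<sigma>\<^sup>-\<^sup>1 dt\<close> is of order \<open>\<bar>1 - x\<bar>\<^sup>-\<^sup>\<sigma>\<close> because \<open>\<bar>1 - t x\<bar>\<close> is comparable with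
  \<open>\<bar>1 - x\<bar> + 1 - t\<close>. The requirement \<open>\<sigma> \<ge> 1\<close> excludes the logarithmic case.\<close>

lemma kernel_order_divide_index:
  assumes h: "kernel_order h (Suc \<sigma>)" and h0: "h 0 = 0" and \<sigma>: "\<sigma> \<ge> 1"
  shows "kernel_order (\<lambda>k. h k / of_nat k) \<sigma>"
proof -
  obtain C where C: "C > 0" "\<And>x. cmod x < 1 \<Longrightarrow> cmod (\<Sum>k. h k * x ^ k) \<le> C / cmod (1 - x) ^ Suc \<sigma>"
   using h by (auto simp: kernel_order_def)
  define g where "g k = h k / of_nat k" for k
  have sm: "summable (\<lambda>k. cmod (g k) * x ^ k)" if x: "0 \<le> x" "x < 1" for x
  proof (rule summable_comparison_test'[of "\<lambda>k. cmod (h k) * x ^ k" 0])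
   show "summable (\<lambda>k. cmod (h k) * x ^ k)" using h x by (simp add: kernel_order_def)
   fix k
   have "cmod (h k) / real k \<le> cmod (h k)" by (cases k) (simp_all add: field_simps)
   then show "norm (cmod (g k) * x ^ k) \<le> cmod (h k) * x ^ k"
    using x mult_right_mono[of "cmod (h k) / real k" "cmod (h k)" "x ^ k"] by (simp add: g_def norm_divide abs_mult)
  qed
  have smg: "summable (\<lambda>k. g k * x ^ k)" if "cmod x < 1" for x
   using sm[of "cmod x"] that by (intro summable_norm_cancel[of "\<lambda>k. g k * x ^ k"]) (simp add: norm_mult norm_power)
  define q where "q y = (\<Sum>k. h (Suc k) * y ^ k)" for y
  have qh: "y * q y = (\<Sum>k. h k * y ^ k)" "summable (\<lambda>k. cmod (h (Suc k) * y ^ k))" if y: "cmod y < 1" for y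
  proof -
   show s: "summable (\<lambda>k. cmod (h (Suc k) * y ^ k))"
   proof (cases "y = 0")
    case True then show ?thesis by (intro summable_finite[of "{0}"]) auto
   next
    case False
    have "summable (\<lambda>k. cmod (h (Suc k) * y ^ Suc k) / cmod y)"
     using summable_ignore_initial_segment[OF kernel_order_summable(1)[OF h y], of 1]
     by (intro summable_divide) (simp only: One_nat_def add_Suc_right add_0_right)
    then show ?thesis using False by (simp add: norm_mult)
   qed
   have "(\<Sum>k. h k * y ^ k) = h 0 * y ^ 0 + (\<Sum>k. h (Suc k) * y ^ Suc k)"
    using suminf_split_head[OF kernel_order_summable(2)[OF h y]] by simp
   also have "(\<Sum>k. h (Suc k) * y ^ Suc k) = y * q y"
    unfolding q_def using suminf_mult[OF summable_norm_cancel[OF s], of y] by (simp add: mult_ac)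
   finally show "y * q y = (\<Sum>k. h k * y ^ k)" using h0 by simp
  qed
  have "summable (\<lambda>k. cmod (h (Suc k) * (1/2) ^ k))" using qh(2)[of "1/2"] by simp
  then have smhalf: "summable (\<lambda>k. cmod (h (Suc k)) * (1/2) ^ k)" by (simp add: norm_mult norm_power norm_divide)
  define B where "B = (\<Sum>k. cmod (h (Suc k)) * (1/2) ^ k)"
  have B: "B \<ge> 0" unfolding B_def by (intro suminf_nonneg smhalf) auto
  \<comment> \<open>\<open>q\<close> is the series divided by its variable: away from \<open>0\<close> it inherits the bound, near \<open>0\<close> it is bounded\<close>
  define D where "D = max (2 * C) (B * 2 ^ Suc \<sigma>)"
  have D: "D > 0" using C(1) by (simp add: D_def)
  have qb: "cmod (q y) \<le> D / cmod (1 - y) ^ Suc \<sigma>" if y: "cmod y < 1" for y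
  proof (cases "cmod y \<ge> 1/2")
   case True
   have "cmod y * cmod (q y) \<le> C / cmod (1 - y) ^ Suc \<sigma>" using C(2)[OF y] qh(1)[OF y] by (metis norm_mult)
   moreover have "1/2 * cmod (q y) \<le> cmod y * cmod (q y)" using True by (intro mult_right_mono) auto
   ultimately have "cmod (q y) \<le> 2 * C / cmod (1 - y) ^ Suc \<sigma>" by simp
   also have "\<dots> \<le> D / cmod (1 - y) ^ Suc \<sigma>" by (intro divide_right_mono) (auto simp: D_def)
   finally show ?thesis .
  next
   case False
   have "cmod (q y) \<le> (\<Sum>k. cmod (h (Suc k) * y ^ k))" unfolding q_def by (rule summable_norm[OF qh(2)[OF y]])
   also have "\<dots> \<le> B" unfolding B_def
   proof (rule suminf_le[OF _ qh(2)[OF y] smhalf])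
    fix k
    have "cmod y ^ k \<le> (1/2) ^ k" using False by (intro power_mono) auto
    then show "cmod (h (Suc k) * y ^ k) \<le> cmod (h (Suc k)) * (1/2) ^ k"
     unfolding norm_mult norm_power by (rule mult_left_mono) simp
   qed
   also have "B \<le> D / cmod (1 - y) ^ Suc \<sigma>"
   proof -
    have "B * cmod (1 - y) ^ Suc \<sigma> \<le> B * 2 ^ Suc \<sigma>" using B one_minus_bounds[OF y] by (intro mult_left_mono power_mono) auto
    also have "\<dots> \<le> D" by (simp add: D_def)
    finally show ?thesis using one_minus_bounds[OF y] by (simp add: field_simps)
   qed
   finally show ?thesis .
  qed
  \<comment> \<open>the \<open>3\<close> comes from \<open>\<bar>1 - x\<bar> + 1 - t \<le> 3 \<bar>1 - t x\<bar>\<close>\<close>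
  define E where "E = D * 3 ^ Suc \<sigma> / real \<sigma>"
  have E: "E > 0" using D \<sigma> by (simp add: E_def)
  have main: "cmod (\<Sum>k. g k * x ^ k) \<le> E / cmod (1 - x) ^ \<sigma>" if x: "cmod x < 1" for x
  proof -
   define a where "a = cmod (1 - x)"
   have a: "a > 0" using one_minus_bounds[OF x] by (simp add: a_def)
   define \<phi> where "\<phi> t = (\<Sum>k. g k * (of_real t * x) ^ k)" for t
   define \<psi> where "\<psi> t = E / (a + 1 - t) ^ \<sigma>" for t :: real
   have tx: "cmod (of_real t * x) < 1" if "0 \<le> t" "t \<le> 1" for t
    using that x mult_right_mono[of t 1 "cmod x"] by (simp add: norm_mult)
   have d\<phi>: "(\<phi> has_vector_derivative (x * q (of_real t * x))) (at t)" if t: "0 \<le> t" "t \<le> 1" for t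
   proof -
    have "((\<lambda>y. \<Sum>k. g k * y ^ k) has_field_derivative (\<Sum>k. diffs g k * (of_real t * x) ^ k)) (at (of_real t * x))"
     by (rule termdiffs_strong'[of 1, OF smg tx[OF t]])
    also have "diffs g = (\<lambda>k. h (Suc k))" by (simp add: diffs_def g_def fun_eq_iff del: of_nat_Suc)
    finally have d: "((\<lambda>y. \<Sum>k. g k * y ^ k) has_field_derivative q (of_real t * x)) (at (of_real t * x))" by (simp add: q_def)
    have lin: "((\<lambda>t. of_real t * x) has_vector_derivative x) (at t)"
     unfolding scaleR_conv_of_real[symmetric]
     using has_vector_derivative_scaleR[OF DERIV_ident has_vector_derivative_const] by simp
    from field_vector_diff_chain_at[OF lin d]
    have "((\<lambda>y. \<Sum>k. g k * y ^ k) \<circ> (\<lambda>t. of_real t * x) has_vector_derivative x * q (of_real t * x)) (at t)"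
     .
    then show ?thesis by (simp add: \<phi>_def[abs_def] comp_def)
   qed
   have d\<psi>: "(\<psi> has_vector_derivative (D * 3 ^ Suc \<sigma> / (a + 1 - t) ^ Suc \<sigma>)) (at t)" if t: "0 \<le> t" "t \<le> 1" for t
   proof -
    have nz: "a + 1 - t \<noteq> 0" using a t by simp
    have "(\<psi> has_real_derivative (E * (real \<sigma> * (a + 1 - t) ^ (\<sigma> - 1)) / ((a + 1 - t) ^ \<sigma> * (a + 1 - t) ^ \<sigma>))) (at t)"
     unfolding \<psi>_def using nz by (auto intro!: derivative_eq_intros simp: power2_eq_square)
    also have "E * (real \<sigma> * (a + 1 - t) ^ (\<sigma> - 1)) / ((a + 1 - t) ^ \<sigma> * (a + 1 - t) ^ \<sigma>) = D * 3 ^ Suc \<sigma> / (a + 1 - t) ^ Suc \<sigma>"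
    proof -
     obtain \<tau> where "\<sigma> = Suc \<tau>" using \<sigma> by (cases \<sigma>) auto
     define u where "u = a + 1 - t"
     have u: "u \<noteq> 0" using nz by (simp add: u_def)
     have K: "E * real \<sigma> = D * 3 ^ Suc \<sigma>" using \<sigma> by (simp add: E_def)
     have "u ^ \<sigma> * u ^ \<sigma> = u ^ (\<sigma> - 1) * u ^ Suc \<sigma>"
      using \<open>\<sigma> = Suc \<tau>\<close> by (simp add: mult_ac)
     then have "E * (real \<sigma> * u ^ (\<sigma> - 1)) / (u ^ \<sigma> * u ^ \<sigma>) = (u ^ (\<sigma> - 1) * (E * real \<sigma>)) / (u ^ (\<sigma> - 1) * u ^ Suc \<sigma>)"
      by (simp only: mult_ac)
     also have "\<dots> = (E * real \<sigma>) / u ^ Suc \<sigma>"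
      by (rule mult_divide_mult_cancel_left) (use u in simp)
     finally show ?thesis unfolding K u_def .
    qed
    finally show ?thesis by (simp add: has_real_derivative_iff_has_vector_derivative)
   qed
   have "norm (\<phi> 1 - \<phi> 0) \<le> \<psi> 1 - \<psi> 0"
   proof (rule differentiable_bound_general)
    show "continuous_on {0..1} \<phi>"
     using d\<phi> by (intro continuous_at_imp_continuous_on ballI has_vector_derivative_continuous) auto
    show "continuous_on {0..1} \<psi>"
     using d\<psi> by (intro continuous_at_imp_continuous_on ballI has_vector_derivative_continuous) auto
    fix t :: real assume t: "0 < t" "t < 1"
    show "(\<phi> has_vector_derivative (x * q (of_real t * x))) (at t)" using d\<phi> t by simp
    show "(\<psi> has_vector_derivative (D * 3 ^ Suc \<sigma> / (a + 1 - t) ^ Suc \<sigma>)) (at t)" using d\<psi> t by simp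
    let ?y = "of_real t * x"
    have y: "cmod ?y < 1" using tx t by simp
    \<comment> \<open>both \<open>1 - t\<close> and the distance from \<open>x\<close> to \<open>t x\<close> are at most \<open>\<bar>1 - t x\<bar>\<close>\<close>
    have "1 - t \<le> 1 - cmod ?y" using t x by (simp add: norm_mult mult_left_le)
    also have "\<dots> \<le> cmod (1 - ?y)" using norm_triangle_ineq2[of 1 ?y] by simp
    finally have 1: "1 - t \<le> cmod (1 - ?y)" .
    have "a \<le> cmod (1 - ?y) + cmod (?y - x)" unfolding a_def using norm_triangle_ineq[of "1 - ?y" "?y - x"] by simp
    also have "?y - x = - (of_real (1 - t) * x)" by (simp add: algebra_simps)
    also have "cmod (- (of_real (1 - t) * x)) \<le> 1 - t"
     unfolding norm_minus_cancel norm_mult norm_of_real using t x by (simp add: mult_left_le)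
    finally have 2: "a + 1 - t \<le> 3 * cmod (1 - ?y)" using 1 by simp
    have "norm (x * q ?y) \<le> 1 * (D / cmod (1 - ?y) ^ Suc \<sigma>)"
     unfolding norm_mult using x by (intro mult_mono qb[OF y]) auto
    also have "\<dots> \<le> D * 3 ^ Suc \<sigma> / (a + 1 - t) ^ Suc \<sigma>"
    proof -
     have le: "(a + 1 - t) ^ Suc \<sigma> \<le> (3 * cmod (1 - ?y)) ^ Suc \<sigma>" using 2 a t by (intro power_mono) auto
     have pos: "(a + 1 - t) ^ Suc \<sigma> > 0" using a t by (intro zero_less_power) auto
     have pos': "(3 * cmod (1 - ?y)) ^ Suc \<sigma> > 0"
      using one_minus_bounds[OF y] by (intro zero_less_power) auto
     have "1 * (D / cmod (1 - ?y) ^ Suc \<sigma>) = D * 3 ^ Suc \<sigma> / (3 * cmod (1 - ?y)) ^ Suc \<sigma>"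
      unfolding power_mult_distrib by (simp del: power_Suc)
     also have "\<dots> \<le> D * 3 ^ Suc \<sigma> / (a + 1 - t) ^ Suc \<sigma>"
      using D by (intro divide_left_mono[OF le] mult_pos_pos[OF pos' pos]) simp
     finally show ?thesis .
    qed
    finally show "norm (x * q ?y) \<le> D * 3 ^ Suc \<sigma> / (a + 1 - t) ^ Suc \<sigma>" .
   qed simp
   moreover have "\<phi> 0 = 0"
   proof -
    have "g 0 = 0" by (simp add: g_def)
    then show ?thesis using powser_zero[of g] by (simp add: \<phi>_def)
   qed
   moreover have "\<psi> 0 \<ge> 0" "\<psi> 1 = E / a ^ \<sigma>" using E a by (simp_all add: \<psi>_def)
   ultimately show ?thesis by (simp add: \<phi>_def a_def)
  qed
  show ?thesis unfolding kernel_order_def g_def[symmetric] using sm main E by blast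
qed

lemma kernel_order_divide_power:
  assumes "kernel_order h (\<sigma> + N)" "h 0 = 0" "\<sigma> \<ge> 1"
  shows "kernel_order (\<lambda>k. h k / of_nat k ^ N) \<sigma>"
  using assms(1,3)
proof (induction N arbitrary: \<sigma>)
  case (Suc N)
  have "kernel_order (\<lambda>k. h k / of_nat k ^ N) (Suc \<sigma>)" by (rule Suc.IH) (use Suc.prems in simp_all)
  then have "kernel_order (\<lambda>k. h k / of_nat k ^ N / of_nat k) \<sigma>"
   using assms(2) Suc.prems(2) by (intro kernel_order_divide_index) auto
  then show ?case by (simp add: mult.commute)
qed simp

text \<open>The coefficients of the kernel that recovers \<open>R\<^sup>M f\<close> from \<open>(1 - \<bar>w\<bar>\<^sup>2)\<^sup>b\<^sup>+\<^sup>N R\<^sup>N f\<close>: the moment in the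
  denominator inverts the weighted integral, and \<open>k\<^sup>M / k\<^sup>N\<close> undoes \<open>N\<close> radial derivatives and
  applies \<open>M\<close>. The constant term is lost by differentiation and is restored separately.\<close>

definition repr_coeff :: "'n::finite itself \<Rightarrow> nat \<Rightarrow> nat \<Rightarrow> nat \<Rightarrow> nat \<Rightarrow> complex" where
  "repr_coeff _ b N M k =
    (if k = 0 then 0 else of_nat k ^ M / (of_nat k ^ N * of_real (ball_moment TYPE('n) (real (b + N)) k)))"

text \<open>For integer weights \<open>b + N\<close> the reciprocal moments are, up to a constant, binomial coefficients, so
  the closure
  properties above apply; the order does not depend on \<open>N\<close>.\<close>

lemma repr_coeff_order: "kernel_order (repr_coeff TYPE('n::finite) b N M) (CARD('n) + 1 + b + M)"
proof -
  let ?S = "CARD('n) + 1 + b + N"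
  define c where "c = Gamma (real ?S) / (gauss_const TYPE('n) * Gamma (real (b + N) + 1))"
  have inv: "1 / ball_moment TYPE('n) (real (b + N)) k = c * (pochhammer (real ?S) k / fact k)" for k
   by (subst pochhammer_pos_Gamma) (auto simp: ball_moment_def c_def Gamma_eq_zero_iff add_ac field_simps elim!: nonpos_Ints_cases)
  have eq: "repr_coeff TYPE('n) b N M = (\<lambda>k. (if k = 0 then 0 else of_real c * (of_nat k ^ M * of_real (pochhammer (real ?S) k / fact k))) / of_nat k ^ N)"
  proof
   fix k
   have "repr_coeff TYPE('n) b N M k = (if k = 0 then 0 else of_nat k ^ M * of_real (1 / ball_moment TYPE('n) (real (b + N)) k)) / of_nat k ^ N"
    by (simp add: repr_coeff_def)
   then show "repr_coeff TYPE('n) b N M k = (if k = 0 then 0 else of_real c * (of_nat k ^ M * of_real (pochhammer (real ?S) k / fact k))) / of_nat k ^ N"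
    unfolding inv by simp
  qed
  have "kernel_order (\<lambda>k. if k = 0 then 0 else of_real c * (of_nat k ^ M * of_real (pochhammer (real ?S) k / fact k))) (?S + M)"
   by (intro kernel_order_drop_constant kernel_order_scale kernel_order_times_index)
  then show ?thesis unfolding eq by (intro kernel_order_divide_power) (auto simp: add_ac)
qed

lemma ball_measure_ident [measurable]: "(\<lambda>x. x) \<in> \<nu> \<rightarrow>\<^sub>M borel"
  by (rule borel_imp_ball_measurable) simp

lemma measurable_fst_ball [measurable]: "fst \<in> (\<nu> \<Otimes>\<^sub>M N) \<rightarrow>\<^sub>M borel"
  using measurable_compose[OF measurable_fst ball_measure_ident] .

lemma measurable_snd_ball [measurable]: "snd \<in> (N \<Otimes>\<^sub>M \<nu>) \<rightarrow>\<^sub>M borel"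
  using measurable_compose[OF measurable_snd ball_measure_ident] .

section \<open>The Schur test\<close>

lemma one_minus_cdot_ge: "norm w < 1 \<Longrightarrow> 1 - norm z \<le> cmod (1 - cdot z w)"
  using norm_cdot_less[of w z] norm_triangle_ineq2[of 1 "cdot z w"] by simp

text \<open>Schur's test with the test function \<open>(1 - \<bar>w\<bar>\<^sup>2)\<^sup>\<sigma>\<close>: Hoelder's inequality separates the kernel
  from \<open>\<phi>\<close>, and both resulting integrals of the kernel are estimated by Forelli--Rudin. The
  condition on \<open>b\<close> makes this estimate applicable to the second one.\<close>

lemma schur_estimate:
  fixes b k :: nat and p \<alpha> :: real
  assumes p: "p \<ge> 1" and pk: "p * real k + \<alpha> > -1" and b: "real b > \<alpha> + real k * (p - 1)"
  shows "\<exists>C>0. \<forall>(\<phi> :: complex^'n \<Rightarrow> real) X. \<phi> \<in> borel_measurable \<nu> \<longrightarrow> (\<forall>w. \<phi> w \<ge> 0) \<longrightarrow> X \<ge> 0 \<longrightarrow>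
    (\<integral>\<^sup>+w. ennreal (\<phi> w powr p * rho w powr \<alpha>) \<partial>\<nu>) \<le> ennreal X \<longrightarrow>
    (\<forall>z. norm z < 1 \<longrightarrow> integrable \<nu> (\<lambda>w. \<phi> w * rho w ^ b / cmod (1 - cdot z w) ^ (CARD('n) + 1 + b + k))) \<and>
    (\<integral>\<^sup>+z. ennreal ((rho z ^ k * (\<integral>w. \<phi> w * rho w ^ b / cmod (1 - cdot z w) ^ (CARD('n) + 1 + b + k) \<partial>\<nu>)) powr p * rho z powr \<alpha>) \<partial>\<nu>)
     \<le> ennreal (C * X)"
proof -
  \<comment> \<open>any \<open>\<delta> > 0\<close> with \<open>\<delta> < 1\<close> and \<open>\<delta> (p - 1) < p k + \<alpha> + 1\<close> serves; the exponents \<open>t2\<close>, \<open>c2\<close> are then admissible\<close>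
  define \<delta> where "\<delta> = min (1/2) ((p * real k + \<alpha> + 1) / (2 * p))"
  have \<delta>: "0 < \<delta>" "\<delta> < 1" using pk p by (auto simp: \<delta>_def)
  define \<sigma> where "\<sigma> = \<delta> - real k"
  define e where "e = real CARD('n) + 1 + real b + real k"
  let ?q = "\<lambda>(z :: complex^'n) (w :: complex^'n). cmod (1 - cdot z w) powr (- e)"
  define t2 where "t2 = real k + \<alpha> - \<sigma> * (p - 1)"
  define c2 where "c2 = real b - \<alpha> + \<sigma> * (p - 1)"
  have dp: "\<delta> * (p - 1) < p * real k + \<alpha> + 1"
  proof -
   have "\<delta> * (p - 1) \<le> (p * real k + \<alpha> + 1) / (2 * p) * (p - 1)"
    using p by (intro mult_right_mono) (auto simp: \<delta>_def)
   also have "\<dots> = (p * real k + \<alpha> + 1) * ((p - 1) / (2 * p))" by simp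
   also have "\<dots> < (p * real k + \<alpha> + 1) * 1" using pk p by (intro mult_strict_left_mono) (auto simp: field_simps)
   finally show ?thesis by simp
  qed
  have t2: "t2 > -1" using dp by (simp add: t2_def \<sigma>_def algebra_simps)
  have c2: "c2 > 0"
  proof -
   have "\<delta> * (p - 1) \<ge> 0" using \<delta> p by simp
   then show ?thesis using b by (simp add: c2_def \<sigma>_def algebra_simps)
  qed
  have t1: "real b - \<sigma> > -1" using \<delta> by (simp add: \<sigma>_def)
  obtain C1 where C1: "C1 > 0" "\<And>z :: complex^'n. norm z < 1 \<Longrightarrow>
    (\<integral>\<^sup>+w. ennreal (rho w powr (real b - \<sigma>) * ?q z w) \<partial>\<nu>) \<le> ennreal (C1 * rho z powr (- \<delta>))"
  proof -
   have "real CARD('n) + 1 + (real b - \<sigma>) + \<delta> = e" by (simp add: e_def \<sigma>_def)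
   then show ?thesis using forelli_rudin[OF t1 \<delta>(1), where 'n='n] that by auto
  qed
  obtain C2 where C2: "C2 > 0" "\<And>z :: complex^'n. norm z < 1 \<Longrightarrow>
    (\<integral>\<^sup>+w. ennreal (rho w powr t2 * ?q z w) \<partial>\<nu>) \<le> ennreal (C2 * rho z powr (- c2))"
  proof -
   have "real CARD('n) + 1 + t2 + c2 = e" by (simp add: e_def t2_def c2_def)
   then show ?thesis using forelli_rudin[OF t2 c2, where 'n='n] that by auto
  qed
  define C where "C = C1 powr (p - 1) * C2"
  have e_powr: "1 / cmod (1 - cdot z w) ^ (CARD('n) + 1 + b + k) = ?q z w"
   if "norm z < 1" "norm w < 1" for z w :: "complex^'n"
  proof -
   have "cmod (1 - cdot z w) > 0" using one_minus_cdot_ge[OF that(2), of z] that(1) by linarith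
   then have "cmod (1 - cdot z w) powr real (CARD('n) + 1 + b + k) = cmod (1 - cdot z w) ^ (CARD('n) + 1 + b + k)"
    by (rule powr_realpow)
   moreover have "e = real (CARD('n) + 1 + b + k)" by (simp add: e_def)
   ultimately show ?thesis by (simp only: powr_minus inverse_eq_divide)
  qed
  show ?thesis
  proof (intro exI[of _ C] conjI allI impI)
   show "C > 0" using C1 C2 by (simp add: C_def)
  next
   fix \<phi> :: "complex^'n \<Rightarrow> real" and X
   assume \<phi>[measurable]: "\<phi> \<in> borel_measurable \<nu>" and \<phi>0: "\<forall>w. \<phi> w \<ge> 0" and X0: "X \<ge> 0"
    and X: "(\<integral>\<^sup>+w. ennreal (\<phi> w powr p * rho w powr \<alpha>) \<partial>\<nu>) \<le> ennreal X"
   let ?J = "\<lambda>z w. \<phi> w * rho w ^ b / cmod (1 - cdot z w) ^ (CARD('n) + 1 + b + k)"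
   let ?u = "\<lambda>w. \<phi> w powr p * rho w powr (\<sigma> * (p - 1) + real b)"
   define Y where "Y z = (\<integral>\<^sup>+w. ennreal (?u w * ?q z w) \<partial>\<nu>)" for z
   have e0: "e \<ge> 0" by (simp add: e_def)
   have Yfin: "Y z < \<infinity>" if z: "norm z < 1" for z
   proof -
    have "Y z \<le> (\<integral>\<^sup>+w. ennreal ((1 - norm z) powr (- e)) * ennreal (\<phi> w powr p * rho w powr \<alpha>) \<partial>\<nu>)"
     unfolding Y_def
    proof (rule nn_integral_mono)
     fix w :: "complex^'n" assume "w \<in> space \<nu>"
     then have w: "norm w < 1" by simp
     have "rho w powr (\<sigma> * (p - 1) + real b) \<le> rho w powr \<alpha>"
      using c2 rho_pos[OF w] by (intro powr_mono') (auto simp: c2_def)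
     moreover have "?q z w \<le> (1 - norm z) powr (- e)"
      using one_minus_cdot_ge[OF w, of z] z e0 by (intro powr_mono2') auto
     ultimately have "?u w * ?q z w \<le>
       \<phi> w powr p * rho w powr \<alpha> * (1 - norm z) powr (- e)"
      by (intro mult_mono) auto
     then show "ennreal (?u w * ?q z w)
      \<le> ennreal ((1 - norm z) powr (- e)) * ennreal (\<phi> w powr p * rho w powr \<alpha>)"
      by (subst ennreal_mult'[symmetric]) (auto intro!: ennreal_leI simp: mult_ac)
    qed
    also have "\<dots> = ennreal ((1 - norm z) powr (- e)) * (\<integral>\<^sup>+w. ennreal (\<phi> w powr p * rho w powr \<alpha>) \<partial>\<nu>)"
     by (rule nn_integral_cmult) measurable
    also have "\<dots> \<le> ennreal ((1 - norm z) powr (- e)) * ennreal X" by (intro mult_left_mono X) simp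
    also have "\<dots> < \<infinity>" by (simp add: ennreal_mult_less_top)
    finally show ?thesis .
   qed
   have J: "integrable \<nu> (\<lambda>w. ?J z w) \<and>
     (\<integral>w. ?J z w \<partial>\<nu>) powr p
      \<le> (C1 * rho z powr (- \<delta>)) powr (p - 1) * enn2real (Y z)" if z: "norm z < 1" for z
   proof -
    have eq: "(\<phi> w * rho w powr \<sigma>) * (rho w powr (real b - \<sigma>) * ?q z w) =
      ?J z w" if w: "norm w < 1" for w
    proof -
     have "rho w powr \<sigma> * rho w powr (real b - \<sigma>) = rho w ^ b"
      using rho_pos[OF w] by (simp add: powr_realpow flip: powr_add)
     then show ?thesis using e_powr[OF z w] by (simp add: divide_inverse mult_ac)
    qed
    have "integrable \<nu> (\<lambda>w. (\<phi> w * rho w powr \<sigma>) * (rho w powr (real b - \<sigma>) * ?q z w)) \<and>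
     (\<integral>w. (\<phi> w * rho w powr \<sigma>) * (rho w powr (real b - \<sigma>) * ?q z w) \<partial>\<nu>) powr p
      \<le> (C1 * rho z powr (- \<delta>)) powr (p - 1) * enn2real (Y z)"
    proof (rule integral_power_le[OF p])
     show "(\<integral>\<^sup>+w. ennreal (rho w powr (real b - \<sigma>) * ?q z w) \<partial>\<nu>) \<le> ennreal (C1 * rho z powr (- \<delta>))"
      by (rule C1(2)[OF z])
     show "C1 * rho z powr (- \<delta>) > 0" using C1(1) rho_pos[OF z] by simp
     have "(\<integral>\<^sup>+w. ennreal ((\<phi> w * rho w powr \<sigma>) powr p * (rho w powr (real b - \<sigma>) * ?q z w)) \<partial>\<nu>) = Y z"
      unfolding Y_def
     proof (rule nn_integral_cong)
      fix w :: "complex^'n" assume "w \<in> space \<nu>"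
      then have w: "rho w > 0" by (intro rho_pos) simp
      have "(\<phi> w * rho w powr \<sigma>) powr p * (rho w powr (real b - \<sigma>) * ?q z w) =
        \<phi> w powr p * (rho w powr (\<sigma> * p) * rho w powr (real b - \<sigma>)) * ?q z w"
       using \<phi>0 by (simp add: powr_mult powr_powr mult_ac)
      also have "rho w powr (\<sigma> * p) * rho w powr (real b - \<sigma>) = rho w powr (\<sigma> * (p - 1) + real b)"
       by (simp add: algebra_simps flip: powr_add)
      finally show "ennreal ((\<phi> w * rho w powr \<sigma>) powr p * (rho w powr (real b - \<sigma>) * ?q z w)) =
       ennreal (?u w * ?q z w)" by simp
     qed
     then show "(\<integral>\<^sup>+w. ennreal ((\<phi> w * rho w powr \<sigma>) powr p * (rho w powr (real b - \<sigma>) * ?q z w)) \<partial>\<nu>) \<le> ennreal (enn2real (Y z))"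
      using Yfin[OF z] by simp
    qed (use \<phi>0 in auto)
    moreover have "integrable \<nu> (\<lambda>w. (\<phi> w * rho w powr \<sigma>) * (rho w powr (real b - \<sigma>) * ?q z w)) \<longleftrightarrow>
      integrable \<nu> (\<lambda>w. ?J z w)"
     by (rule Bochner_Integration.integrable_cong[OF refl eq]) simp
    moreover have "(\<integral>w. (\<phi> w * rho w powr \<sigma>) * (rho w powr (real b - \<sigma>) * ?q z w) \<partial>\<nu>) =
      (\<integral>w. ?J z w \<partial>\<nu>)"
     by (rule Bochner_Integration.integral_cong[OF refl eq]) simp
    ultimately show ?thesis by simp
   qed
   show "integrable \<nu> (\<lambda>w. ?J z w)" if "norm z < 1" for z
    using J[OF that] by blast
   let ?I = "\<lambda>z. \<integral>w. ?J z w \<partial>\<nu>"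
   have I0: "?I z \<ge> 0" for z
   proof (intro integral_nonneg_AE AE_I2)
    fix w :: "complex^'n" assume "w \<in> space \<nu>"
    then have "rho w > 0" by (intro rho_pos) simp
    then show "0 \<le> ?J z w" using \<phi>0 by simp
   qed
   interpret pair_sigma_finite "\<nu> :: (complex^'n) measure" "\<nu> :: (complex^'n) measure"
    by (simp add: pair_sigma_finite_def ball_measure.sigma_finite_measure_axioms)
   have "(\<integral>\<^sup>+z. ennreal ((rho z ^ k * ?I z) powr p * rho z powr \<alpha>) \<partial>\<nu>) \<le>
     (\<integral>\<^sup>+z. ennreal (C1 powr (p - 1)) * (ennreal (rho z powr t2) * Y z) \<partial>\<nu>)"
   proof (rule nn_integral_mono)
    fix z :: "complex^'n" assume "z \<in> space \<nu>"
    then have z: "norm z < 1" by simp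
    note rz = rho_pos[OF z]
    have "(rho z ^ k * ?I z) powr p * rho z powr \<alpha> = rho z powr (real k * p + \<alpha>) * ?I z powr p"
     using rz I0[of z] by (simp add: powr_mult powr_powr powr_add flip: powr_realpow)
    also have "\<dots> \<le> rho z powr (real k * p + \<alpha>) * ((C1 * rho z powr (- \<delta>)) powr (p - 1) * enn2real (Y z))"
     using J[OF z] by (intro mult_left_mono) auto
    also have "\<dots> = C1 powr (p - 1) * ((rho z powr (real k * p + \<alpha>) * rho z powr (- \<delta> * (p - 1))) * enn2real (Y z))"
     using C1(1) by (simp add: powr_mult powr_powr mult_ac)
    also have "rho z powr (real k * p + \<alpha>) * rho z powr (- \<delta> * (p - 1)) = rho z powr t2"
     by (simp add: t2_def \<sigma>_def algebra_simps flip: powr_add)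
    finally have "ennreal ((rho z ^ k * ?I z) powr p * rho z powr \<alpha>) \<le> ennreal (C1 powr (p - 1) * (rho z powr t2 * enn2real (Y z)))"
     by (rule ennreal_leI)
    also have "\<dots> = ennreal (C1 powr (p - 1)) * (ennreal (rho z powr t2) * Y z)"
     using Yfin[OF z] by (simp add: ennreal_mult)
    finally show "ennreal ((rho z ^ k * ?I z) powr p * rho z powr \<alpha>) \<le> ennreal (C1 powr (p - 1)) * (ennreal (rho z powr t2) * Y z)" .
   qed
   also have "\<dots> = (\<integral>\<^sup>+z. \<integral>\<^sup>+w. ennreal (C1 powr (p - 1)) * (ennreal (rho z powr t2) *
      ennreal (?u w * ?q z w)) \<partial>\<nu> \<partial>\<nu>)"
    unfolding Y_def by (simp add: nn_integral_cmult)
   also have "\<dots> = (\<integral>\<^sup>+w. \<integral>\<^sup>+z. ennreal (C1 powr (p - 1)) * (ennreal (rho z powr t2) *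
      ennreal (?u w * ?q z w)) \<partial>\<nu> \<partial>\<nu>)"
    by (rule Fubini'[symmetric]) measurable
   also have "\<dots> = (\<integral>\<^sup>+w. ennreal (C1 powr (p - 1) * (?u w)) *
     (\<integral>\<^sup>+z. ennreal (rho z powr t2 * ?q w z) \<partial>\<nu>) \<partial>\<nu>)"
   proof (rule nn_integral_cong)
    fix w :: "complex^'n"
    have sw: "cmod (1 - cdot z w) = cmod (1 - cdot w z)" for z
     by (metis cnj_cdot complex_cnj_diff complex_cnj_one complex_mod_cnj)
    have "(\<integral>\<^sup>+z. ennreal (C1 powr (p - 1)) * (ennreal (rho z powr t2) *
      ennreal (?u w * ?q z w)) \<partial>\<nu>) =
      (\<integral>\<^sup>+z. ennreal (C1 powr (p - 1) * (?u w)) * ennreal (rho z powr t2 * ?q w z) \<partial>\<nu>)"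
     by (intro nn_integral_cong) (simp add: sw ennreal_mult[symmetric] mult_ac)
    also have "\<dots> = ennreal (C1 powr (p - 1) * (?u w)) *
     (\<integral>\<^sup>+z. ennreal (rho z powr t2 * ?q w z) \<partial>\<nu>)"
     by (rule nn_integral_cmult) measurable
    finally show "(\<integral>\<^sup>+z. ennreal (C1 powr (p - 1)) * (ennreal (rho z powr t2) *
      ennreal (?u w * ?q z w)) \<partial>\<nu>) = \<dots>" .
   qed
   also have "\<dots> \<le> (\<integral>\<^sup>+w. ennreal C * ennreal (\<phi> w powr p * rho w powr \<alpha>) \<partial>\<nu>)"
   proof (rule nn_integral_mono)
    fix w :: "complex^'n" assume "w \<in> space \<nu>"
    then have w: "norm w < 1" by simp
    have "ennreal (C1 powr (p - 1) * (?u w)) *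
     (\<integral>\<^sup>+z. ennreal (rho z powr t2 * ?q w z) \<partial>\<nu>)
     \<le> ennreal (C1 powr (p - 1) * (?u w)) * ennreal (C2 * rho w powr (- c2))"
     by (intro mult_left_mono C2(2)[OF w]) simp
    also have "\<dots> = ennreal (C * (\<phi> w powr p * (rho w powr (\<sigma> * (p - 1) + real b) * rho w powr (- c2))))"
     using C2(1) by (simp add: C_def ennreal_mult[symmetric] mult_ac)
    also have "rho w powr (\<sigma> * (p - 1) + real b) * rho w powr (- c2) = rho w powr \<alpha>"
     by (simp add: c2_def flip: powr_add)
    also have "ennreal (C * (\<phi> w powr p * rho w powr \<alpha>)) = ennreal C * ennreal (\<phi> w powr p * rho w powr \<alpha>)"
     using C1 C2 by (simp add: ennreal_mult C_def)
    finally show "ennreal (C1 powr (p - 1) * (?u w)) *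
     (\<integral>\<^sup>+z. ennreal (rho z powr t2 * ?q w z) \<partial>\<nu>) \<le> ennreal C * ennreal (\<phi> w powr p * rho w powr \<alpha>)" .
   qed
   also have "\<dots> = ennreal C * (\<integral>\<^sup>+w. ennreal (\<phi> w powr p * rho w powr \<alpha>) \<partial>\<nu>)"
    by (rule nn_integral_cmult) measurable
   also have "\<dots> \<le> ennreal C * ennreal X" by (intro mult_left_mono X) simp
   also have "\<dots> = ennreal (C * X)" using X0 C1 C2 by (simp add: ennreal_mult C_def)
   finally show "(\<integral>\<^sup>+z. ennreal ((rho z ^ k * ?I z) powr p * rho z powr \<alpha>) \<partial>\<nu>) \<le> ennreal (C * X)" .
  qed
qed

section \<open>Holomorphic functions and radial derivatives\<close>

lemma holomorphic_ball_bounds: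
  assumes h: "h holomorphic_on ball 0 R" and R: "R > 0" and B: "\<And>x. cmod x < R \<Longrightarrow> cmod (h x) \<le> B"
  shows "cmod (deriv h 0) \<le> 2 * B / R"
   and "cmod t \<le> R / 4 \<Longrightarrow> cmod (h t - h 0) \<le> 4 * B * cmod t / R"
   and "cmod t \<le> R / 4 \<Longrightarrow> cmod (h t - h 0 - t * deriv h 0) \<le> 8 * B * (cmod t)\<^sup>2 / R\<^sup>2"
proof -
  define a where "a k = (deriv ^^ k) h 0 / fact k" for k
  have B0: "B \<ge> 0" using order_trans[OF norm_ge_zero B[of 0]] R by simp
  have sub: "cball 0 (R/2) \<subseteq> ball (0::complex) R" using R by auto
  have hc: "h holomorphic_on cball 0 (R/2)" by (rule holomorphic_on_subset[OF h sub])
  have a: "cmod (a k) \<le> B / (R/2) ^ k" for k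
  proof -
   have "cmod ((deriv ^^ k) h 0) \<le> fact k * B / (R/2) ^ k"
    by (rule Cauchy_inequality)
     (use hc R in \<open>auto intro!: B holomorphic_on_imp_continuous_on intro: holomorphic_on_subset\<close>)
   then show ?thesis by (simp add: a_def norm_divide field_simps)
  qed
  have a01: "a 0 = h 0" "a 1 = deriv h 0" by (simp_all add: a_def)
  show "cmod (deriv h 0) \<le> 2 * B / R" using a[of 1] unfolding a01(2) by (simp add: mult.commute)
  assume t: "cmod t \<le> R / 4"
  define x where "x = cmod t / (R/2)"
  have x: "0 \<le> x" "x \<le> 1/2" using t R by (auto simp: x_def field_simps)
  have s: "(\<lambda>k. a k * t ^ k) sums h t"
   using holomorphic_power_series[OF h, of t] t R by (simp add: a_def)
  have ax: "cmod (a k * t ^ k) \<le> B * x ^ k" for k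
   using mult_right_mono[OF a[of k], of "cmod t ^ k"] by (simp add: norm_mult norm_power x_def power_divide mult_ac)
  have tail: "cmod (h t - (\<Sum>k<m. a k * t ^ k)) \<le> 2 * B * x ^ m" for m
  proof -
   have s': "(\<lambda>k. a (k + m) * t ^ (k + m)) sums (h t - (\<Sum>k<m. a k * t ^ k))"
    by (rule sums_split_initial_segment[OF s])
   have g: "(\<lambda>k. (B * x ^ m) * (1/2) ^ k) sums ((B * x ^ m) * 2)"
    using sums_mult[OF geometric_sums[of "1/2::real"], of "B * x ^ m"] by simp
   have le: "cmod (a (k + m) * t ^ (k + m)) \<le> (B * x ^ m) * (1/2) ^ k" for k
   proof -
    have "B * x ^ (k + m) \<le> B * (x ^ m * (1/2) ^ k)"
     unfolding power_add using x B0 by (subst mult.commute[of "x ^ k"]) (intro mult_left_mono power_mono; auto)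
    then show ?thesis using ax[of "k + m"] by (simp add: mult_ac)
   qed
   have sm: "summable (\<lambda>k. cmod (a (k + m) * t ^ (k + m)))"
    using le by (intro summable_comparison_test'[OF sums_summable[OF g], of 0]) simp
   show ?thesis
    using summable_norm[OF sm] suminf_le[OF le sm sums_summable[OF g]] g s' by (simp add: sums_iff)
  qed
  show "cmod (h t - h 0) \<le> 4 * B * cmod t / R"
   using tail[of 1] R by (simp add: a01 x_def field_simps)
  show "cmod (h t - h 0 - t * deriv h 0) \<le> 8 * B * (cmod t)\<^sup>2 / R\<^sup>2"
   using tail[of 2] R by (simp add: a01(1) a01(2)[unfolded One_nat_def] numeral_2_eq_2 x_def power2_eq_square field_simps)
qed

lemma ball_holomorphicD_line:
  assumes "f \<in> ball_holomorphic" "norm (z + c *s v) < 1"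
  shows "(\<lambda>c. f (z + c *s v)) field_differentiable at c"
proof -
  obtain D where D: "(f has_derivative D) (at (z + c *s v))" "\<And>c v. D (c *s v) = c * D v"
   using assms unfolding ball_holomorphic_def by fastforce
  have lin: "((\<lambda>c. z + c *s v) has_derivative (\<lambda>h. h *s v)) (at c)"
  proof -
   have "bounded_linear (\<lambda>c. c *s v)"
    unfolding linear_conv_bounded_linear[symmetric] by (rule linearI) (simp_all add: vec_eq_iff algebra_simps)
   then have "((\<lambda>c. c *s v) has_derivative (\<lambda>h. h *s v)) (at c)" by (rule bounded_linear_imp_has_derivative)
   then show ?thesis by (auto intro!: derivative_eq_intros)
  qed
  have "((\<lambda>c. f (z + c *s v)) has_derivative (\<lambda>h. D (h *s v))) (at c)"
   by (rule has_derivative_compose[OF lin D(1)])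
  then have "((\<lambda>c. f (z + c *s v)) has_field_derivative D v) (at c)"
   by (simp add: has_field_derivative_def D(2) mult.commute[of _ "D v"] fun_eq_iff)
  then show ?thesis unfolding field_differentiable_def by blast
qed

lemma ball_holomorphic_continuous: "f \<in> ball_holomorphic \<Longrightarrow> continuous_on (ball 0 1) f"
  unfolding ball_holomorphic_def
  by (auto intro!: continuous_at_imp_continuous_on dest: has_derivative_continuous)

lemma ball_holomorphic_imp_line:
  fixes f :: "complex^'n \<Rightarrow> complex"
  assumes f: "f \<in> ball_holomorphic"
  shows "line_holomorphic f"
  unfolding line_holomorphic_def
proof (intro conjI allI impI)
  show "(\<lambda>c. f (z + c *s v)) holomorphic_on {c. norm (z + c *s v) < 1}" for z v
   unfolding holomorphic_on_def
   using ball_holomorphicD_line[OF f] by (auto intro: field_differentiable_at_within)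
  fix r :: real assume r: "r < 1"
  have "compact (f ` cball 0 r)"
   by (intro compact_continuous_image continuous_on_subset[OF ball_holomorphic_continuous[OF f]]) (use r in auto)
  then have "bounded (f ` cball 0 r)" by (rule compact_imp_bounded)
  then obtain B where "\<forall>x\<in>f ` cball 0 r. cmod x \<le> B" unfolding bounded_iff by blast
  then show "\<exists>B. \<forall>w. norm w \<le> r \<longrightarrow> cmod (f w) \<le> B" by (intro exI[of _ B]) auto
qed

lemma ball_holomorphic_measurable [measurable_dest]:
  assumes "f \<in> ball_holomorphic" shows "f \<in> borel_measurable \<nu>"
  using borel_measurable_continuous_on_restrict[OF ball_holomorphic_continuous[OF assms]]
  by (simp cong: measurable_cong_sets add: sets_ball_measure)

text \<open>The derivative is assembled from the derivatives along complex lines. Cauchy estimates on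
  lines, uniform by local boundedness, control the second order remainder; additivity follows by
  comparing increments along \<open>v\<close>, \<open>w\<close> and \<open>v + w\<close> at scale \<open>t\<close> and letting \<open>t\<close> tend to \<open>0\<close>.\<close>

theorem line_holomorphic_imp_ball_holomorphic:
  fixes g :: "complex^'n \<Rightarrow> complex"
  assumes g: "line_holomorphic g" and out: "\<And>z. \<not> norm z < 1 \<Longrightarrow> g z = 0"
  shows "g \<in> ball_holomorphic"
proof -
  have "\<exists>D. (g has_derivative D) (at z) \<and> (\<forall>c v. D (c *s v) = c * D v)" if z: "norm z < 1" for z
  proof -
   define \<delta> where "\<delta> = (1 - norm z) / 2"
   have \<delta>: "\<delta> > 0" "norm z + \<delta> < 1" using z by (auto simp: \<delta>_def field_simps)
   obtain B where B: "\<And>w. norm w \<le> norm z + \<delta> \<Longrightarrow> cmod (g w) \<le> B"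
    using g \<delta>(2) unfolding line_holomorphic_def by blast
   have B0: "B \<ge> 0" using order_trans[OF norm_ge_zero B[of 0]] \<delta> by simp
   have tri: "norm (y + c *s v) \<le> norm y + cmod c * norm v" for y v c
    using norm_triangle_ineq[of y "c *s v"] by (simp add: norm_vec_smult)
   have hol: "(\<lambda>c. g (y + c *s v)) holomorphic_on ball 0 R" if "norm y + R * norm v \<le> norm z + \<delta>" for y v R
   proof -
    have "(\<lambda>c. g (y + c *s v)) holomorphic_on {c. norm (y + c *s v) < 1}"
     using g unfolding line_holomorphic_def by blast
    moreover have "norm (y + c *s v) < 1" if "cmod c < R" for c
    proof -
     have "cmod c * norm v \<le> R * norm v" using that by (intro mult_right_mono) auto
     then show ?thesis using tri[of y c v] \<open>norm y + R * norm v \<le> _\<close> \<delta>(2) by linarith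
    qed
    ultimately show ?thesis by (auto intro: holomorphic_on_subset)
   qed
   have bd: "cmod (g (y + c *s v)) \<le> B" if "norm y + R * norm v \<le> norm z + \<delta>" "cmod c < R" for y v R c
   proof (rule B)
    have "cmod c * norm v \<le> R * norm v" using that by (intro mult_right_mono) auto
    then show "norm (y + c *s v) \<le> norm z + \<delta>" using tri[of y c v] that by linarith
   qed
   have lip: "cmod (g (y + v) - g y) \<le> 8 * B / \<delta> * norm v" if y: "norm y \<le> norm z + \<delta> / 2" and v: "norm v \<le> \<delta> / 8" for y v
   proof (cases "v = 0")
    case False
    define R where "R = \<delta> / (2 * norm v)"
    have R: "R > 0" "1 \<le> R / 4" "R * norm v = \<delta> / 2" using False \<delta> v by (auto simp: R_def field_simps)
    have c: "norm y + R * norm v \<le> norm z + \<delta>" using y R(3) by simp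
    have "cmod (g (y + 1 *s v) - g (y + 0 *s v)) \<le> 4 * B * cmod 1 / R"
     by (rule holomorphic_ball_bounds(2)[OF hol[OF c] R(1) bd[OF c]]) (use R in auto)
    then show ?thesis using \<delta> False by (simp add: R_def field_simps)
   qed simp
   define D where "D v = deriv (\<lambda>c. g (z + c *s v)) 0" for v
   have fd: "(\<lambda>c. g (z + c *s v)) field_differentiable at 0" for v
   proof (cases "v = 0")
    case False
    have "(\<lambda>c. g (z + c *s v)) holomorphic_on ball 0 (\<delta> / norm v)"
     by (rule hol) (use False in auto)
    then show ?thesis by (rule holomorphic_on_imp_differentiable_at) (use False \<delta> in auto)
   qed simp
   have Dsmult: "D (a *s v) = a * D v" for a v
   proof -
    have "((\<lambda>c. g (z + c *s v)) has_field_derivative D v) (at (a * 0))"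
     using fd[of v] by (simp add: D_def field_differentiable_derivI)
    then have "((\<lambda>c. g (z + (a * c) *s v)) has_field_derivative D v * a) (at 0)"
     by (rule DERIV_chain2) (auto intro!: derivative_eq_intros)
    then show ?thesis unfolding D_def by (auto dest!: DERIV_imp_deriv simp: vector_smult_assoc mult.commute)
   qed
   have second: "cmod (g (z + v) - g z - D v) \<le> 8 * B / \<delta>\<^sup>2 * (norm v)\<^sup>2" if v: "norm v \<le> \<delta> / 4" for v
   proof (cases "v = 0")
    case True
    then show ?thesis using Dsmult[of 0 0] by simp
   next
    case False
    define R where "R = \<delta> / norm v"
    have R: "R > 0" "1 \<le> R / 4" "R * norm v = \<delta>" using False \<delta> v by (auto simp: R_def field_simps)
    have c: "norm z + R * norm v \<le> norm z + \<delta>" using R(3) by simp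
    have "cmod (g (z + 1 *s v) - g (z + 0 *s v) - 1 * deriv (\<lambda>c. g (z + c *s v)) 0) \<le> 8 * B * (cmod 1)\<^sup>2 / R\<^sup>2"
     by (rule holomorphic_ball_bounds(3)[OF hol[OF c] R(1) bd[OF c]]) (use R in auto)
    then show ?thesis using \<delta> False by (simp add: R_def D_def power_divide field_simps)
   qed
   have Dbound: "cmod (D v) \<le> norm v * (2 * B / \<delta>)" for v
   proof (cases "v = 0")
    case True
    then show ?thesis using Dsmult[of 0 0] by simp
   next
    case False
    define R where "R = \<delta> / norm v"
    have R: "R > 0" "R * norm v = \<delta>" using False \<delta> by (auto simp: R_def field_simps)
    have c: "norm z + R * norm v \<le> norm z + \<delta>" using R(2) by simp
    have "cmod (D v) \<le> 2 * B / R" unfolding D_def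
     by (rule holomorphic_ball_bounds(1)[OF hol[OF c] R(1) bd[OF c]])
    then show ?thesis by (simp add: R_def field_simps)
   qed
   have Dadd: "D (v + w) = D v + D w" for v w
   proof (cases "v = 0 \<or> w = 0")
    case True then show ?thesis using Dsmult[of 0 0] by auto
   next
    case False
    define K where "K = 128 * B / \<delta>\<^sup>2 * (norm v * norm w) + 8 * B / \<delta>\<^sup>2 * ((norm (v + w))\<^sup>2 + (norm v)\<^sup>2 + (norm w)\<^sup>2)"
    define s where "s = norm v + norm w"
    have s: "s > 0" using False by (simp add: s_def add_pos_pos)
    define t0 where "t0 = \<delta> / (16 * s)"
    have t0: "t0 > 0" using \<delta> s by (simp add: t0_def)
    have main: "cmod (D (v + w) - D v - D w) \<le> K * t" if t: "0 < t" "t \<le> t0" for t :: real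
    proof -
     have ts: "t * s \<le> \<delta> / 16" using t s by (simp add: t0_def field_simps)
     have tv: "t * norm v \<le> t * s" "t * norm w \<le> t * s" "t * norm (v + w) \<le> t * s"
      using t norm_triangle_ineq[of v w] by (auto simp: s_def intro!: mult_left_mono)
     define T where "T = complex_of_real t"
     have T: "cmod T = t" using t by (simp add: T_def)
     define k where "k c = g ((z + T *s v) + c *s w) - g (z + c *s w)" for c
     define R where "R = \<delta> / (4 * norm w)"
     have R: "R > 0" "t \<le> R / 4" "R * norm w = \<delta> / 4" using False \<delta> tv(2) ts by (auto simp: R_def field_simps)
     have c1: "norm (z + T *s v) + R * norm w \<le> norm z + \<delta>"
      using tri[of z T v, unfolded T] tv(1) ts R(3) \<delta> by linarith
     have c2: "norm z + R * norm w \<le> norm z + \<delta>" using R(3) \<delta> by simp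
     have kb: "cmod (k c) \<le> 8 * B / \<delta> * (t * norm v)" if "cmod c < R" for c
     proof -
      have "norm (z + c *s w) \<le> norm z + R * norm w"
       using tri[of z c w] mult_right_mono[OF less_imp_le[OF that] norm_ge_zero, of w] by linarith
      then have "cmod (g ((z + c *s w) + T *s v) - g (z + c *s w)) \<le> 8 * B / \<delta> * norm (T *s v)"
       using R(3) \<delta> tv(1) ts by (intro lip) (auto simp: norm_vec_smult T)
      then show ?thesis by (simp add: k_def add_ac norm_vec_smult T)
     qed
     have "cmod (k T - k 0) \<le> 4 * (8 * B / \<delta> * (t * norm v)) * cmod T / R"
      by (rule holomorphic_ball_bounds(2)[OF _ R(1) kb])
       (use R(2) T in \<open>auto simp: k_def[abs_def] intro!: holomorphic_on_diff hol c1 c2\<close>)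
     also have "\<dots> = t\<^sup>2 * (128 * B / \<delta>\<^sup>2 * (norm v * norm w))"
      using \<delta> False by (simp add: R_def T power2_eq_square field_simps)
     finally have k1: "cmod (k T - k 0) \<le> t\<^sup>2 * (128 * B / \<delta>\<^sup>2 * (norm v * norm w))" .
     have k_eq: "k T - k 0 = g (z + T *s (v + w)) - g (z + T *s w) - g (z + T *s v) + g z"
      by (simp add: k_def algebra_simps vector_add_ldistrib)
     have r: "cmod (g (z + T *s u) - g z - T * D u) \<le> t\<^sup>2 * (8 * B / \<delta>\<^sup>2 * (norm u)\<^sup>2)" if "t * norm u \<le> t * s" for u
      using second[of "T *s u"] that ts \<delta> by (simp add: norm_vec_smult T Dsmult power_mult_distrib mult_ac)
     define A where "A u = g (z + T *s u) - g z - T * D u" for u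
     have "T * (D (v + w) - D v - D w) = (k T - k 0) - A (v + w) + A v + A w"
      unfolding k_eq A_def by (simp add: algebra_simps)
     then have "t * cmod (D (v + w) - D v - D w) = cmod ((k T - k 0) - A (v + w) + A v + A w)"
      by (metis T norm_mult)
     also have "\<dots> \<le> cmod (k T - k 0) + cmod (A (v + w)) + cmod (A v) + cmod (A w)"
      by (smt (verit) norm_triangle_ineq norm_triangle_ineq4)
     also have "\<dots> \<le> t\<^sup>2 * K"
      using k1 r[OF tv(1)] r[OF tv(2)] r[OF tv(3)] by (simp add: K_def A_def algebra_simps)
     finally show ?thesis using t by (simp add: power2_eq_square mult_ac)
    qed
    have "((\<lambda>t. K * t) \<longlongrightarrow> K * 0) (at_right 0)" by (intro tendsto_intros)
    moreover have "\<forall>\<^sub>F t in at_right 0. cmod (D (v + w) - D v - D w) \<le> K * t"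
     unfolding eventually_at_right_field using t0 main by (intro exI[of _ t0]) auto
    ultimately have "cmod (D (v + w) - D v - D w) \<le> K * 0"
     by (intro tendsto_lowerbound) auto
    then show ?thesis by (simp add: algebra_simps)
   qed
   have bl: "bounded_linear D"
   proof (rule bounded_linear_intro)
    show "D (r *\<^sub>R x) = r *\<^sub>R D x" for r x
     using Dsmult[of "of_real r" x] by (simp add: smult_of_real scaleR_conv_of_real)
   qed (rule Dadd, rule Dbound)
   have "(g has_derivative D) (at z)"
   proof (rule has_derivativeI_sandwich[of "\<delta> / 4" _ _ _ _ "\<lambda>y. 8 * B / \<delta>\<^sup>2 * norm (y - z)"])
    show "((\<lambda>y. 8 * B / \<delta>\<^sup>2 * norm (y - z)) \<longlongrightarrow> 0) (at z)"
     using \<delta> by (auto intro!: tendsto_eq_intros)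
    fix y assume y: "y \<noteq> z" "dist y z < \<delta> / 4"
    have "cmod (g (z + (y - z)) - g z - D (y - z)) \<le> 8 * B / \<delta>\<^sup>2 * (norm (y - z))\<^sup>2"
     by (rule second) (use y in \<open>simp add: dist_norm\<close>)
    then show "norm (g y - g z - D (y - z)) / norm (y - z) \<le> 8 * B / \<delta>\<^sup>2 * norm (y - z)"
     using y by (simp add: divide_le_eq power2_eq_square mult_ac)
   qed (use \<delta> bl in auto)
   then show ?thesis using Dsmult by blast
  qed
  then show ?thesis using out by (auto simp: ball_holomorphic_def)
qed

lemma series_ball_holomorphic:
  fixes P :: "nat \<Rightarrow> complex^'n \<Rightarrow> complex"
  assumes entire: "\<And>k z v. (\<lambda>c. P k (z + c *s v)) holomorphic_on UNIV"
   and bound: "\<And>r. 0 < r \<Longrightarrow> r < 1 \<Longrightarrow> \<exists>M. summable M \<and> (\<forall>k u. norm u \<le> r \<longrightarrow> cmod (P k u) \<le> M k)"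
  shows "(\<lambda>z. if norm z < 1 then \<Sum>k. P k z else 0) \<in> ball_holomorphic"
proof (rule line_holomorphic_imp_ball_holomorphic)
  show "line_holomorphic (\<lambda>z. if norm z < 1 then \<Sum>k. P k z else 0)"
   unfolding line_holomorphic_def
  proof (intro conjI allI impI)
   fix z v :: "complex^'n"
   let ?S = "{c. norm (z + c *s v) < 1}"
   have opn: "open ?S" by (intro open_Collect_less continuous_on_norm continuous_on_const continuous_smult_line)
   have "(\<lambda>c. \<Sum>k. P k (z + c *s v)) holomorphic_on ?S"
   proof (rule holomorphic_uniform_sequence[OF opn, where f = "\<lambda>m c. \<Sum>k<m. P k (z + c *s v)"])
    show "(\<lambda>c. \<Sum>k<m. P k (z + c *s v)) holomorphic_on ?S" for m
     by (intro holomorphic_on_sum) (use entire holomorphic_on_subset in blast)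
    fix x assume x: "x \<in> ?S"
    define r where "r = (1 + norm (z + x *s v)) / 2"
    have r: "0 < r" "r < 1" "norm (z + x *s v) < r" using x by (auto simp: r_def add_pos_nonneg field_simps)
    obtain M where M: "summable M" "\<And>k u. norm u \<le> r \<Longrightarrow> cmod (P k u) \<le> M k" using bound r by blast
    have "open {c. norm (z + c *s v) < r}" by (intro open_Collect_less continuous_on_norm continuous_on_const continuous_smult_line)
    then obtain d where d: "d > 0" "cball x d \<subseteq> {c. norm (z + c *s v) < r}"
     using r(3) open_contains_cball by blast
    have "uniform_limit (cball x d) (\<lambda>m c. \<Sum>k<m. P k (z + c *s v)) (\<lambda>c. \<Sum>k. P k (z + c *s v)) sequentially"
     by (rule Weierstrass_m_test[OF _ M(1)]) (use d M(2) in fastforce)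
    then show "\<exists>d>0. cball x d \<subseteq> ?S \<and> uniform_limit (cball x d) (\<lambda>m c. \<Sum>k<m. P k (z + c *s v)) (\<lambda>c. \<Sum>k. P k (z + c *s v)) sequentially"
     using d r by (intro exI[of _ d]) (auto dest!: subsetD)
   qed
   then show "(\<lambda>c. if norm (z + c *s v) < 1 then \<Sum>k. P k (z + c *s v) else 0) holomorphic_on ?S"
    by (rule holomorphic_transform) simp
  next
   fix r :: real assume "r < 1"
   define r' where "r' = max r (1/2)"
   have r': "0 < r'" "r' < 1" "r \<le> r'" using \<open>r < 1\<close> by (auto simp: r'_def)
   obtain M where M: "summable M" "\<And>k u. norm u \<le> r' \<Longrightarrow> cmod (P k u) \<le> M k" using bound r' by blast
   have "cmod (if norm w < 1 then \<Sum>k. P k w else 0) \<le> suminf M" if "norm w \<le> r" for w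
   proof -
    have le: "cmod (P k w) \<le> M k" for k using M(2) that r' by simp
    have s: "summable (\<lambda>k. cmod (P k w))" using le by (intro summable_comparison_test'[OF M(1), of 0]) simp
    show ?thesis using summable_norm[OF s] suminf_le[OF le s M(1)] that \<open>r < 1\<close> by simp
   qed
   then show "\<exists>B. \<forall>w. norm w \<le> r \<longrightarrow> cmod (if norm w < 1 then \<Sum>k. P k w else 0) \<le> B" by blast
  qed
qed simp

lemma hom_part_dominated:
  assumes f: "line_holomorphic f" and r: "0 < r" "r < 1"
  shows "\<exists>M. summable M \<and> (\<forall>k u. norm u \<le> r \<longrightarrow> cmod (of_nat k ^ m * hom_part f k u) \<le> M k)"
proof -
  define r' where "r' = (1 + r) / 2"
  have r': "0 < r'" "r' < 1" "r < r'" using r by (auto simp: r'_def)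
  obtain B where B: "\<And>w. norm w \<le> r' \<Longrightarrow> cmod (f w) \<le> B"
   using f r' unfolding line_holomorphic_def by blast
  have B0: "B \<ge> 0" using order_trans[OF norm_ge_zero B[of 0]] r' by simp
  define x where "x = r / r'"
  have x: "0 < x" "x < 1" using r r' by (auto simp: x_def)
  show ?thesis
  proof (intro exI[of _ "\<lambda>k. B * (of_nat k ^ m * x ^ k)"] conjI allI impI)
   have "summable (\<lambda>k. real k ^ m * x ^ k)"
   proof -
    have "summable (\<lambda>k. cmod (of_nat k ^ m * of_real (pochhammer (real 1) k / fact k)) * x ^ k)"
     using kernel_order_times_index[of m 1] x unfolding kernel_order_def by auto
    then show ?thesis by (simp add: norm_mult norm_power pochhammer_same flip: pochhammer_fact)
   qed
   then show "summable (\<lambda>k. B * (of_nat k ^ m * x ^ k))" by (intro summable_mult)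
   fix k u assume u: "norm (u :: complex^'a) \<le> r"
   have "cmod (hom_part f k u) \<le> B * (norm u / r') ^ k"
    by (rule hom_part_Cauchy[OF line_holomorphic_imp_slice[OF f] r'(1,2) B])
   also have "\<dots> \<le> B * x ^ k" using u r' B0 by (intro mult_left_mono power_mono) (auto simp: x_def divide_right_mono)
   finally have "real k ^ m * cmod (hom_part f k u) \<le> real k ^ m * (B * x ^ k)"
    by (rule mult_left_mono) simp
   then show "cmod (of_nat k ^ m * hom_part f k u) \<le> B * (of_nat k ^ m * x ^ k)"
    by (simp add: norm_mult norm_power mult.left_commute)
  qed
qed

text \<open>\<open>R\<^sup>m f\<close> in terms of homogeneous parts, on which \<open>R\<close> acts as multiplication by the degree. It
  vanishes off the ball, so that it is again a member of the space of holomorphic functions.\<close>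

definition radial_power :: "nat \<Rightarrow> (complex^'n \<Rightarrow> complex) \<Rightarrow> complex^'n \<Rightarrow> complex" where
  "radial_power m f z = (if norm z < 1 then \<Sum>k. of_nat k ^ m * hom_part f k z else 0)"

lemma radial_power_ball_holomorphic:
  assumes f: "f \<in> ball_holomorphic" shows "radial_power m f \<in> ball_holomorphic"
proof -
  note lh = ball_holomorphic_imp_line[OF f]
  have "(\<lambda>z. if norm z < 1 then \<Sum>k. of_nat k ^ m * hom_part f k z else 0) \<in> ball_holomorphic"
   by (rule series_ball_holomorphic)
    (intro holomorphic_intros hom_part_line_entire[OF lh], rule hom_part_dominated[OF lh])
  then show ?thesis by (simp add: radial_power_def[abs_def])
qed

lemma radial_series_summable:
  assumes f: "line_holomorphic f" and z: "norm z < 1"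
  shows "summable (\<lambda>k. cmod (of_nat k ^ m * hom_part f k z))"
proof -
  define r where "r = max (norm z) (1/2)"
  have r: "0 < r" "r < 1" "norm z \<le> r" using z by (auto simp: r_def)
  obtain M where M: "summable M" "\<forall>k u. norm u \<le> r \<longrightarrow> cmod (of_nat k ^ m * hom_part f k u) \<le> M k"
   using hom_part_dominated[OF f r(1,2), of m] by blast
  show ?thesis using M r by (intro summable_comparison_test'[OF M(1), of 0]) simp
qed

lemma radial_power_sums:
  assumes f: "line_holomorphic f" and z: "norm z < 1"
  shows "(\<lambda>k. of_nat k ^ m * hom_part f k z) sums radial_power m f z"
  using summable_sums[OF summable_norm_cancel[OF radial_series_summable[OF assms]]] z by (simp add: radial_power_def)

lemma hom_part_series:
  fixes P :: "nat \<Rightarrow> complex^'n \<Rightarrow> complex"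
  assumes hom: "\<And>k c u. P k (c *s u) = c ^ k * P k u"
   and sums: "\<And>z. norm z < 1 \<Longrightarrow> (\<lambda>k. P k z) sums g z"
  shows "hom_part g k u = P k u"
proof (rule hom_part_eqI[of "1 / (norm u + 1)"])
  have pos: "norm u + 1 > 0" by (simp add: add_nonneg_pos)
  then show "1 / (norm u + 1) > 0" by simp
  fix c :: complex assume "cmod c < 1 / (norm u + 1)"
  then have "cmod c * (norm u + 1) < 1" using pos by (simp add: field_simps)
  moreover have "cmod c * norm u \<le> cmod c * (norm u + 1)" by (intro mult_left_mono) auto
  ultimately have "norm (c *s u) < 1" by (simp add: norm_vec_smult)
  from sums[OF this] show "(\<lambda>k. P k u * c ^ k) sums g (c *s u)" by (simp add: hom mult.commute)
qed

lemma hom_part_radial_power: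
  assumes f: "line_holomorphic f"
  shows "hom_part (radial_power m f) k u = of_nat k ^ m * hom_part f k u"
  by (rule hom_part_series[OF _ radial_power_sums[OF f]])
   (simp_all add: hom_part_smult[OF line_holomorphic_imp_slice[OF f]])

text \<open>Euler's identity: \<open>R f z\<close> is the derivative of \<open>c \<mapsto> f (c z)\<close> at \<open>c = 1\<close>.\<close>

lemma radial_deriv_eq_series:
  fixes f :: "complex^'n \<Rightarrow> complex"
  assumes f: "f \<in> ball_holomorphic" and z: "norm z < 1"
  shows "radial_deriv f z = (\<Sum>k. of_nat k * hom_part f k z)"
proof -
  note sl = line_holomorphic_imp_slice[OF ball_holomorphic_imp_line[OF f]]
  obtain D where D: "(f has_derivative D) (at z)" "\<And>c v. D (c *s v) = c * D v"
   using f z unfolding ball_holomorphic_def by fastforce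
  have line: "((\<lambda>c. f (z + c *s v)) has_field_derivative D v) (at 0)" for v
  proof -
   have "bounded_linear (\<lambda>c. c *s v)"
    unfolding linear_conv_bounded_linear[symmetric] by (rule linearI) (simp_all add: vec_eq_iff algebra_simps)
   then have "((\<lambda>c. z + c *s v) has_derivative (\<lambda>h. h *s v)) (at 0)"
    by (auto intro!: derivative_eq_intros bounded_linear_imp_has_derivative)
   moreover have "(f has_derivative D) (at (z + 0 *s v))" using D(1) by simp
   ultimately have "((\<lambda>c. f (z + c *s v)) has_derivative (\<lambda>h. D (h *s v))) (at 0)"
    by (rule has_derivative_compose)
   then show ?thesis by (simp add: has_field_derivative_def D(2) mult.commute[of _ "D v"] fun_eq_iff)
  qed
  have pd: "partial_deriv k f z = D (axis k 1)" for k
  proof -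
   have ax: "axis k t = t *s axis k 1" for t :: complex by (simp add: vec_eq_iff axis_def)
   have "partial_deriv k f z = deriv (\<lambda>t. f (z + t *s axis k 1)) 0"
    unfolding partial_deriv_def
    by (rule arg_cong2[where f = deriv], rule ext, rule arg_cong[OF ax, of "\<lambda>x. f (z + x)"], rule refl)
   then show ?thesis using DERIV_imp_deriv[OF line] by simp
  qed
  have linD: "linear D" using D(1) has_derivative_linear by blast
  have "radial_deriv f z = (\<Sum>k\<in>UNIV. D (z $ k *s axis k 1))"
   by (simp add: radial_deriv_def pd D(2))
  also have "\<dots> = D z" by (simp add: linear_sum[OF linD, symmetric] basis_expansion)
  finally have 1: "radial_deriv f z = D z" .
  obtain R where R: "1 < R" "ball 0 R \<subseteq> {c. cmod c * norm z < 1}" using slice_ball[of 1 z] z by auto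
  have sm: "summable (\<lambda>k. hom_part f k z * c ^ k)" if "cmod c < R" for c
   using hom_part_sums[OF sl, of c z] R(2) that by (auto simp: sums_iff)
  have "((\<lambda>c. \<Sum>k. hom_part f k z * c ^ k) has_field_derivative (\<Sum>k. diffs (\<lambda>k. hom_part f k z) k * 1 ^ k)) (at 1)"
   by (rule termdiffs_strong'[OF sm]) (use R in auto)
  moreover have "\<forall>\<^sub>F c in nhds 1. (\<Sum>k. hom_part f k z * c ^ k) = f (c *s z)"
  proof -
   have "\<forall>\<^sub>F c in nhds (1::complex). c \<in> ball 0 R" using R by (intro eventually_nhds_in_open) (auto simp: dist_norm)
   then show ?thesis by eventually_elim (use hom_part_sums[OF sl] R(2) in \<open>auto simp: sums_iff\<close>)
  qed
  ultimately have "((\<lambda>c. f (c *s z)) has_field_derivative (\<Sum>k. diffs (\<lambda>k. hom_part f k z) k * 1 ^ k)) (at 1)"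
   by (subst (asm) DERIV_cong_ev[OF refl _ refl])
  moreover have "((\<lambda>c. f (c *s z)) has_field_derivative D z) (at 1)"
  proof -
   have "((\<lambda>c. f (z + (c - 1) *s z)) has_field_derivative D z * 1) (at 1)"
    by (rule DERIV_chain2[of "\<lambda>c. f (z + c *s z)"]) (use line[of z] in \<open>auto intro!: derivative_eq_intros\<close>)
   then show ?thesis by (simp add: algebra_simps)
  qed
  ultimately have 2: "D z = (\<Sum>k. diffs (\<lambda>k. hom_part f k z) k * 1 ^ k)" by (rule DERIV_unique[symmetric])
  have "summable (\<lambda>k. diffs (\<lambda>k. hom_part f k z) k * 1 ^ k)"
   by (rule termdiff_converges[of _ R]) (use R sm in auto)
  from diffs_equiv[OF this] have "(\<lambda>k. of_nat k * hom_part f k z) sums (\<Sum>k. diffs (\<lambda>k. hom_part f k z) k * 1 ^ k)"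
   by simp
  with 1 2 show ?thesis by (simp add: sums_iff)
qed

lemma radial_deriv_cong:
  fixes f g :: "complex^'n \<Rightarrow> complex"
  assumes "\<And>z. norm z < 1 \<Longrightarrow> f z = g z" "norm z < 1"
  shows "radial_deriv f z = radial_deriv g z"
proof -
  have "partial_deriv k f z = partial_deriv k g z" for k
   unfolding partial_deriv_def
  proof (rule deriv_cong_ev)
   have ax: "axis k t = t *s axis k 1" for t :: complex by (simp add: vec_eq_iff axis_def)
   have "open {t :: complex. norm (z + t *s axis k 1) < 1}"
    by (intro open_Collect_less continuous_on_norm continuous_on_const continuous_smult_line)
   also have "{t :: complex. norm (z + t *s axis k 1) < 1} = {t. norm (z + axis k t) < 1}"
    by (rule Collect_cong) (rule arg_cong[OF ax, of "\<lambda>x. norm (z + x) < 1", symmetric])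
   finally have "open {t :: complex. norm (z + axis k t) < 1}" .
   moreover have "norm (z + axis k 0) < 1"
   proof -
    have "axis k (0 :: complex) = 0" by (simp add: axis_def vec_eq_iff)
    then show ?thesis using assms(2) by (metis add_0_right)
   qed
   ultimately have "\<forall>\<^sub>F t in nhds 0. t \<in> {t :: complex. norm (z + axis k t) < 1}"
    by (intro eventually_nhds_in_open) simp_all
   then show "\<forall>\<^sub>F t in nhds 0. f (z + axis k t) = g (z + axis k t)"
    by eventually_elim (simp add: assms(1))
  qed simp
  then show ?thesis by (simp add: radial_deriv_def)
qed

lemma radial_deriv_funpow:
  fixes f :: "complex^'n \<Rightarrow> complex"
  assumes f: "f \<in> ball_holomorphic" and z: "norm z < 1"
  shows "(radial_deriv ^^ m) f z = radial_power m f z"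
  using z
proof (induction m arbitrary: z)
  case 0
  have "(\<lambda>k. hom_part f k z) sums f z"
   using hom_part_sums[OF line_holomorphic_imp_slice[OF ball_holomorphic_imp_line[OF f]], of 1 z] 0 by simp
  then show ?case using 0 by (simp add: radial_power_def sums_iff)
next
  case (Suc m)
  have "(radial_deriv ^^ Suc m) f z = radial_deriv (radial_power m f) z"
   using radial_deriv_cong[OF Suc.IH Suc.prems] by simp
  also have "\<dots> = (\<Sum>k. of_nat k * hom_part (radial_power m f) k z)"
   by (rule radial_deriv_eq_series[OF radial_power_ball_holomorphic[OF f] Suc.prems])
  also have "\<dots> = radial_power (Suc m) f z"
   using Suc.prems by (simp add: radial_power_def hom_part_radial_power[OF ball_holomorphic_imp_line[OF f]] mult.assoc)
  finally show ?case .
qed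

lemma ball_holomorphic_lincomb:
  assumes f: "f \<in> ball_holomorphic" and g: "g \<in> ball_holomorphic"
  shows "(\<lambda>z. a * f z + b * g z) \<in> ball_holomorphic"
proof -
  have "\<exists>D. ((\<lambda>z. a * f z + b * g z) has_derivative D) (at z) \<and> (\<forall>c v. D (c *s v) = c * D v)" if z: "norm z < 1" for z
  proof -
   obtain D where D: "(f has_derivative D) (at z)" "\<And>c v. D (c *s v) = c * D v"
    using f z unfolding ball_holomorphic_def by fastforce
   obtain E where E: "(g has_derivative E) (at z)" "\<And>c v. E (c *s v) = c * E v"
    using g z unfolding ball_holomorphic_def by fastforce
   have "((\<lambda>z. a * f z + b * g z) has_derivative (\<lambda>v. a * D v + b * E v)) (at z)"
    by (intro has_derivative_add has_derivative_mult_right D(1) E(1))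
   then show ?thesis using D(2) E(2) by (intro exI[of _ "\<lambda>v. a * D v + b * E v"]) (auto simp: algebra_simps)
  qed
  then show ?thesis using f g by (auto simp: ball_holomorphic_def)
qed

lemma radial_power_lincomb:
  assumes f: "f \<in> ball_holomorphic" and g: "g \<in> ball_holomorphic"
  shows "radial_power m (\<lambda>z. a * f z + b * g z) z = a * radial_power m f z + b * radial_power m g z"
proof (cases "norm z < 1")
  case True
  note lf = ball_holomorphic_imp_line[OF f] and lg = ball_holomorphic_imp_line[OF g]
  have hp: "hom_part (\<lambda>z. a * f z + b * g z) k z = a * hom_part f k z + b * hom_part g k z" for k z
  proof (rule hom_part_series[where P = "\<lambda>k u. a * hom_part f k u + b * hom_part g k u"])
   show "(\<lambda>k. a * hom_part f k u + b * hom_part g k u) sums (a * f u + b * g u)" if "norm u < 1" for u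
    using hom_part_sums[OF line_holomorphic_imp_slice[OF lf], of 1 u] hom_part_sums[OF line_holomorphic_imp_slice[OF lg], of 1 u] that
    by (intro sums_add sums_mult) simp_all
  qed (simp add: hom_part_smult line_holomorphic_imp_slice lf lg algebra_simps)
  have "(\<lambda>k. of_nat k ^ m * hom_part (\<lambda>z. a * f z + b * g z) k z) sums (a * radial_power m f z + b * radial_power m g z)"
   using sums_add[OF sums_mult[OF radial_power_sums[OF lf True, of m], of a] sums_mult[OF radial_power_sums[OF lg True, of m], of b]]
   by (simp add: hp algebra_simps)
  then show ?thesis using True by (simp add: radial_power_def sums_iff)
qed (simp add: radial_power_def)

definition kernel_transform :: "(nat \<Rightarrow> complex) \<Rightarrow> (complex^'n \<Rightarrow> complex) \<Rightarrow> complex^'n \<Rightarrow> complex" where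
  "kernel_transform h \<Phi> z = (if norm z < 1 then \<integral>w. \<Phi> w * (\<Sum>k. h k * cdot z w ^ k) \<partial>\<nu> else 0)"

lemma kernel_transform_sums:
  fixes \<Phi> :: "complex^'n \<Rightarrow> complex"
  assumes \<Phi>: "integrable \<nu> \<Phi>" and h: "kernel_order h \<sigma>" and z: "norm z < 1"
  shows "(\<lambda>k. h k * (\<integral>w. \<Phi> w * cdot z w ^ k \<partial>\<nu>)) sums kernel_transform h \<Phi> z"
   and "integrable \<nu> (\<lambda>w. \<Phi> w * cdot z w ^ k)"
   and "cmod (h k * (\<integral>w. \<Phi> w * cdot z w ^ k \<partial>\<nu>)) \<le> cmod (h k) * norm z ^ k * (\<integral>w. cmod (\<Phi> w) \<partial>\<nu>)"
proof -
  have [measurable]: "\<Phi> \<in> borel_measurable \<nu>" using \<Phi> by simp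
  have le0: "norm (\<Phi> w * cdot z w ^ k) \<le> norm z ^ k * cmod (\<Phi> w)" if "norm w < 1" for w k
   using mult_right_mono[OF power_mono[OF norm_cdot_less[OF that, of z] norm_ge_zero, of k], of "cmod (\<Phi> w)"]
   by (simp add: norm_mult norm_power mult.commute)
  have inti: "integrable \<nu> (\<lambda>w. \<Phi> w * cdot z w ^ k)" for k
  proof (rule Bochner_Integration.integrable_bound)
   show "integrable \<nu> (\<lambda>w. norm z ^ k * cmod (\<Phi> w))" using \<Phi> by (intro integrable_mult_right integrable_norm)
   show "AE w in \<nu>. norm (\<Phi> w * cdot z w ^ k) \<le> norm (norm z ^ k * cmod (\<Phi> w))"
    using le0 by (intro AE_I2) (simp add: abs_mult)
  qed measurable
  then show "integrable \<nu> (\<lambda>w. \<Phi> w * cdot z w ^ k)" .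
  have nI: "(\<integral>w. norm (\<Phi> w * cdot z w ^ k) \<partial>\<nu>) \<le> norm z ^ k * (\<integral>w. cmod (\<Phi> w) \<partial>\<nu>)" for k
  proof -
   have "(\<integral>w. norm (\<Phi> w * cdot z w ^ k) \<partial>\<nu>) \<le> (\<integral>w. norm z ^ k * cmod (\<Phi> w) \<partial>\<nu>)"
    using le0 inti \<Phi> by (intro integral_mono integrable_norm integrable_mult_right) auto
   then show ?thesis by simp
  qed
  show "cmod (h k * (\<integral>w. \<Phi> w * cdot z w ^ k \<partial>\<nu>)) \<le> cmod (h k) * norm z ^ k * (\<integral>w. cmod (\<Phi> w) \<partial>\<nu>)"
   using mult_left_mono[OF order_trans[OF integral_norm_bound nI[of k]], of "cmod (h k)"] by (simp add: norm_mult mult.assoc)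
  have sm: "summable (\<lambda>k. cmod (h k) * norm z ^ k)" using h z by (simp add: kernel_order_def)
  have le: "norm (\<Phi> w * (h k * cdot z w ^ k)) \<le> cmod (h k) * norm z ^ k * cmod (\<Phi> w)" if "norm w < 1" for w k
   using mult_left_mono[OF le0[OF that, of k], of "cmod (h k)"] by (simp add: norm_mult mult_ac)
  have "(\<lambda>k. \<integral>w. \<Phi> w * (h k * cdot z w ^ k) \<partial>\<nu>) sums (\<integral>w. (\<Sum>k. \<Phi> w * (h k * cdot z w ^ k)) \<partial>\<nu>)"
  proof (rule sums_integral)
   show "integrable \<nu> (\<lambda>w. \<Phi> w * (h k * cdot z w ^ k))" for k
    using integrable_mult_right[OF inti[of k], of "h k"] by (simp add: mult_ac)
   show "AE w in \<nu>. summable (\<lambda>k. norm (\<Phi> w * (h k * cdot z w ^ k)))"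
    using le by (intro AE_I2 summable_comparison_test'[OF summable_mult2[OF sm], of 0]) auto
   show "summable (\<lambda>k. \<integral>w. norm (\<Phi> w * (h k * cdot z w ^ k)) \<partial>\<nu>)"
   proof (rule summable_comparison_test'[OF summable_mult2[OF sm, of "\<integral>w. cmod (\<Phi> w) \<partial>\<nu>"], of 0])
    fix k
    have "(\<integral>w. norm (\<Phi> w * (h k * cdot z w ^ k)) \<partial>\<nu>) = cmod (h k) * (\<integral>w. norm (\<Phi> w * cdot z w ^ k) \<partial>\<nu>)"
     by (simp add: norm_mult mult.left_commute flip: integral_mult_right_zero)
    also have "\<dots> \<le> cmod (h k) * (norm z ^ k * (\<integral>w. cmod (\<Phi> w) \<partial>\<nu>))" by (intro mult_left_mono nI) simp
    finally show "norm (\<integral>w. norm (\<Phi> w * (h k * cdot z w ^ k)) \<partial>\<nu>) \<le> cmod (h k) * norm z ^ k * (\<integral>w. cmod (\<Phi> w) \<partial>\<nu>)"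
     by (simp add: integral_nonneg_AE mult.assoc)
   qed
  qed
  also have "(\<lambda>k. \<integral>w. \<Phi> w * (h k * cdot z w ^ k) \<partial>\<nu>) = (\<lambda>k. h k * (\<integral>w. \<Phi> w * cdot z w ^ k \<partial>\<nu>))"
   by (simp add: mult.left_commute[of "\<Phi> _"])
  also have "(\<integral>w. (\<Sum>k. \<Phi> w * (h k * cdot z w ^ k)) \<partial>\<nu>) = kernel_transform h \<Phi> z"
  proof -
   have "(\<Sum>k. \<Phi> w * (h k * cdot z w ^ k)) = \<Phi> w * (\<Sum>k. h k * cdot z w ^ k)" if "norm w < 1" for w
    using suminf_mult[OF kernel_order_summable(2)[OF h norm_cdot_less_1[OF z that]]] by simp
   then show ?thesis using z by (auto simp: kernel_transform_def intro!: Bochner_Integration.integral_cong)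
  qed
  finally show "(\<lambda>k. h k * (\<integral>w. \<Phi> w * cdot z w ^ k \<partial>\<nu>)) sums kernel_transform h \<Phi> z" .
qed

lemma integral_cdot_power_homogeneous:
  "(\<integral>w. \<Phi> w * cdot (c *s u) w ^ k \<partial>\<nu>) = c ^ k * (\<integral>w. \<Phi> w * cdot u w ^ k \<partial>\<nu>)"
  by (simp add: cdot_smult_left power_mult_distrib mult.left_commute flip: integral_mult_right_zero)

text \<open>The transform of any integrable function has the homogeneous parts
  \<open>h k * \<integral> \<Phi>(w) \<langle>z, w\<rangle>\<^sup>k\<close>, so \<open>R\<close> acts on it by changing the coefficients only.\<close>

lemma kernel_transform_holomorphic:
  fixes \<Phi> :: "complex^'n \<Rightarrow> complex"
  assumes \<Phi>: "integrable \<nu> \<Phi>" and h: "kernel_order h \<sigma>"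
  shows "kernel_transform h \<Phi> \<in> ball_holomorphic"
   and "hom_part (kernel_transform h \<Phi>) k u = h k * (\<integral>w. \<Phi> w * cdot u w ^ k \<partial>\<nu>)"
proof -
  let ?P = "\<lambda>k u. h k * (\<integral>w. \<Phi> w * cdot u w ^ k \<partial>\<nu>)"
  have [measurable]: "\<Phi> \<in> borel_measurable \<nu>" using \<Phi> by simp
  show "hom_part (kernel_transform h \<Phi>) k u = ?P k u"
   using kernel_transform_sums(1)[OF assms] integral_cdot_power_homogeneous[of \<Phi>]
   by (intro hom_part_series[where P = ?P]) (auto simp: mult.left_commute)
  have "(\<lambda>z. if norm z < 1 then \<Sum>k. ?P k z else 0) \<in> ball_holomorphic"
  proof (rule series_ball_holomorphic)
   show "(\<lambda>c. ?P k (z + c *s v)) holomorphic_on UNIV" for k z v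
   proof -
    have intij: "integrable \<nu> (\<lambda>w. of_nat (k choose i) * (\<Phi> w * (cdot v w ^ i * cdot z w ^ (k - i))))" for i
    proof (rule Bochner_Integration.integrable_bound)
     show "integrable \<nu> (\<lambda>w. (real (k choose i) * (norm v ^ i * norm z ^ (k - i))) * cmod (\<Phi> w))"
      using \<Phi> by (intro integrable_mult_right integrable_norm)
     show "AE w in \<nu>. norm (of_nat (k choose i) * (\<Phi> w * (cdot v w ^ i * cdot z w ^ (k - i)))) \<le> norm ((real (k choose i) * (norm v ^ i * norm z ^ (k - i))) * cmod (\<Phi> w))"
     proof (rule AE_I2)
      fix w :: "complex^'n" assume "w \<in> space \<nu>"
      then have w: "norm w < 1" by simp
      have "cmod (cdot v w) ^ i * cmod (cdot z w) ^ (k - i) \<le> norm v ^ i * norm z ^ (k - i)"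
       by (intro mult_mono power_mono norm_cdot_less[OF w]) auto
      then have "(real (k choose i) * cmod (\<Phi> w)) * (cmod (cdot v w) ^ i * cmod (cdot z w) ^ (k - i)) \<le> (real (k choose i) * cmod (\<Phi> w)) * (norm v ^ i * norm z ^ (k - i))"
       by (rule mult_left_mono) simp
      then show "norm (of_nat (k choose i) * (\<Phi> w * (cdot v w ^ i * cdot z w ^ (k - i)))) \<le> norm ((real (k choose i) * (norm v ^ i * norm z ^ (k - i))) * cmod (\<Phi> w))"
       by (simp add: norm_mult norm_power abs_mult mult_ac)
     qed
    qed measurable
    have eq: "?P k (z + c *s v) = h k * (\<Sum>i\<le>k. c ^ i * (\<integral>w. of_nat (k choose i) * (\<Phi> w * (cdot v w ^ i * cdot z w ^ (k - i))) \<partial>\<nu>))" for c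
    proof -
     have "(\<integral>w. \<Phi> w * cdot (z + c *s v) w ^ k \<partial>\<nu>) =
      (\<integral>w. (\<Sum>i\<le>k. c ^ i * (of_nat (k choose i) * (\<Phi> w * (cdot v w ^ i * cdot z w ^ (k - i))))) \<partial>\<nu>)"
      unfolding cdot_add_left cdot_smult_left add.commute[of "cdot z _"] binomial_ring
      by (simp add: sum_distrib_left power_mult_distrib mult_ac)
     also have "\<dots> = (\<Sum>i\<le>k. c ^ i * (\<integral>w. of_nat (k choose i) * (\<Phi> w * (cdot v w ^ i * cdot z w ^ (k - i))) \<partial>\<nu>))"
      by (subst Bochner_Integration.integral_sum) (auto intro!: integrable_mult_right intij simp del: integral_mult_right_zero simp: integral_mult_right_zero[symmetric])
     finally show ?thesis by simp
    qed
    show ?thesis unfolding eq by (intro holomorphic_intros)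
   qed
   fix r :: real assume r: "0 < r" "r < 1"
   show "\<exists>M. summable M \<and> (\<forall>k u. norm u \<le> r \<longrightarrow> cmod (?P k u) \<le> M k)"
   proof (intro exI[of _ "\<lambda>k. cmod (h k) * r ^ k * (\<integral>w. cmod (\<Phi> w) \<partial>\<nu>)"] conjI allI impI)
    show "summable (\<lambda>k. cmod (h k) * r ^ k * (\<integral>w. cmod (\<Phi> w) \<partial>\<nu>))"
     using h r by (intro summable_mult2) (simp add: kernel_order_def)
    fix k u assume u: "norm (u :: complex^'n) \<le> r"
    then have "norm u < 1" using r by simp
    from kernel_transform_sums(3)[OF assms this, of k]
    also have "cmod (h k) * norm u ^ k * (\<integral>w. cmod (\<Phi> w) \<partial>\<nu>) \<le> cmod (h k) * r ^ k * (\<integral>w. cmod (\<Phi> w) \<partial>\<nu>)"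
     using u by (intro mult_right_mono mult_left_mono power_mono) (auto intro!: integral_nonneg_AE)
    finally show "cmod (?P k u) \<le> \<dots>" .
   qed
  qed
  also have "(\<lambda>z. if norm z < 1 then \<Sum>k. ?P k z else 0) = kernel_transform h \<Phi>"
  proof
   fix z show "(if norm z < 1 then \<Sum>k. ?P k z else 0) = kernel_transform h \<Phi> z"
    using kernel_transform_sums(1)[OF assms, of z] by (cases "norm z < 1") (simp_all add: sums_iff, simp add: kernel_transform_def)
  qed
  finally show "kernel_transform h \<Phi> \<in> ball_holomorphic" .
qed

lemma repr_coeff_shift: "of_nat k ^ m * repr_coeff TYPE('n::finite) b N M k = repr_coeff TYPE('n) b N (M + m) k"
  by (simp add: repr_coeff_def power_add)

lemma radial_power_kernel_transform:
  fixes \<Phi> :: "complex^'n \<Rightarrow> complex"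
  assumes \<Phi>: "integrable \<nu> \<Phi>" and z: "norm z < 1"
  shows "radial_power m (kernel_transform (repr_coeff TYPE('n) b N M) \<Phi>) z = kernel_transform (repr_coeff TYPE('n) b N (M + m)) \<Phi> z"
proof -
  have "(\<lambda>k. of_nat k ^ m * hom_part (kernel_transform (repr_coeff TYPE('n) b N M) \<Phi>) k z) sums kernel_transform (repr_coeff TYPE('n) b N (M + m)) \<Phi> z"
   using kernel_transform_sums(1)[OF \<Phi> repr_coeff_order z, of b N "M + m"]
   by (simp add: kernel_transform_holomorphic(2)[OF \<Phi> repr_coeff_order] mult.assoc[symmetric] repr_coeff_shift)
  then show ?thesis using z by (simp add: radial_power_def sums_iff)
qed

text \<open>Every homogeneous part of \<open>R\<^sup>N f\<close> is reproduced by the moment formula, and the coefficients of the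
  kernel are chosen to cancel moment and degree factors.\<close>

theorem radial_reproducing_formula:
  fixes f :: "complex^'n \<Rightarrow> complex"
  assumes f: "f \<in> ball_holomorphic"
   and int: "integrable \<nu> (\<lambda>w. of_real (rho w powr real (b + N)) * radial_power N f w)" and z: "norm z < 1"
  shows "radial_power M f z = (if M = 0 then f 0 else 0) +
    kernel_transform (repr_coeff TYPE('n) b N M) (\<lambda>w. of_real (rho w powr real (b + N)) * radial_power N f w) z"
proof -
  note lh = ball_holomorphic_imp_line[OF f]
  note g = radial_power_ball_holomorphic[OF f, of N]
  let ?l = "repr_coeff TYPE('n) b N M"
  have "(\<lambda>k. ?l k * of_real (ball_moment TYPE('n) (real (b + N)) k) * hom_part (radial_power N f) k z) sums
    (\<integral>w. of_real (rho w powr real (b + N)) * radial_power N f w * (\<Sum>k. ?l k * cdot z w ^ k) \<partial>\<nu>)"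
   by (rule integral_kernel_series[OF ball_holomorphic_imp_line[OF g] ball_holomorphic_measurable[OF g] int _ _ z])
    (use repr_coeff_order[where 'n='n, of b N M] in \<open>auto simp: kernel_order_def\<close>)
  then have 1: "(\<lambda>k. ?l k * of_real (ball_moment TYPE('n) (real (b + N)) k) * hom_part (radial_power N f) k z) sums
    kernel_transform ?l (\<lambda>w. of_real (rho w powr real (b + N)) * radial_power N f w) z"
   using z by (simp add: kernel_transform_def)
  have "(\<lambda>k. if k = 0 then (if M = 0 then f 0 else 0) else 0) sums (if M = 0 then f 0 else 0)"
   using sums_single[of 0 "\<lambda>_. if M = 0 then f 0 else 0"] by simp
  from sums_add[OF this 1]
  have 2: "(\<lambda>k. (if k = 0 then (if M = 0 then f 0 else 0) else 0) +
    ?l k * of_real (ball_moment TYPE('n) (real (b + N)) k) * hom_part (radial_power N f) k z) sums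
    ((if M = 0 then f 0 else 0) + kernel_transform ?l (\<lambda>w. of_real (rho w powr real (b + N)) * radial_power N f w) z)" .
  have "(if k = 0 then (if M = 0 then f 0 else 0) else 0) +
    ?l k * of_real (ball_moment TYPE('n) (real (b + N)) k) * hom_part (radial_power N f) k z = of_nat k ^ M * hom_part f k z" for k
  proof (cases "k = 0")
   case True
   have "hom_part f 0 z = f 0" by (simp add: hom_part_def)
   then show ?thesis using True by (simp add: repr_coeff_def power_0_left)
  next
   case False
   have "ball_moment TYPE('n) (real (b + N)) k > 0" by (rule ball_moment_pos) simp
   then show ?thesis using False by (simp add: repr_coeff_def hom_part_radial_power[OF lh] field_simps)
  qed
  with 2 have "(\<lambda>k. of_nat k ^ M * hom_part f k z) sums
    ((if M = 0 then f 0 else 0) + kernel_transform ?l (\<lambda>w. of_real (rho w powr real (b + N)) * radial_power N f w) z)" by simp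
  then show ?thesis using z by (simp add: radial_power_def sums_iff)
qed

section \<open>Weighted Lebesgue spaces and Bergman spaces\<close>

text \<open>The spaces are normed by unnormalized weights for all real \<open>\<alpha>\<close>; the constants of the measures
  \<open>dv\<^sub>\<alpha>\<close> are accounted for once, when the Bergman norm is compared with this one.\<close>

definition Lp_ball :: "real \<Rightarrow> real \<Rightarrow> (complex^'n \<Rightarrow> complex) set" where
  "Lp_ball p \<alpha> = {\<phi> \<in> borel_measurable \<nu>. integrable \<nu> (\<lambda>w. cmod (\<phi> w) powr p * rho w powr \<alpha>)}"

definition Lp_norm :: "real \<Rightarrow> real \<Rightarrow> (complex^'n \<Rightarrow> complex) \<Rightarrow> real" where
  "Lp_norm p \<alpha> \<phi> = (\<integral>w. cmod (\<phi> w) powr p * rho w powr \<alpha> \<partial>\<nu>) powr (1 / p)"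

lemma Lp_ball_measurable [measurable_dest]: "\<phi> \<in> Lp_ball p \<alpha> \<Longrightarrow> \<phi> \<in> borel_measurable \<nu>"
  by (simp add: Lp_ball_def)

lemma Lp_ball_integrable: "\<phi> \<in> Lp_ball p \<alpha> \<Longrightarrow> integrable \<nu> (\<lambda>w. cmod (\<phi> w) powr p * rho w powr \<alpha>)"
  by (simp add: Lp_ball_def)

lemma Lp_integral_nonneg: "0 \<le> (\<integral>w. cmod (\<phi> w) powr p * rho w powr \<alpha> \<partial>\<nu>)"
  by (intro integral_nonneg_AE AE_I2) simp

lemma Lp_norm_nonneg [simp]: "Lp_norm p \<alpha> \<phi> \<ge> 0"
  by (simp add: Lp_norm_def)

lemma Lp_norm_powr: "p > 0 \<Longrightarrow> Lp_norm p \<alpha> \<phi> powr p = (\<integral>w. cmod (\<phi> w) powr p * rho w powr \<alpha> \<partial>\<nu>)"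
  using Lp_integral_nonneg[of \<phi> p \<alpha>] by (simp add: Lp_norm_def powr_powr)

lemma Lp_norm_leI:
  assumes "p > 0" "K \<ge> 0" "(\<integral>w. cmod (\<phi> w) powr p * rho w powr \<alpha> \<partial>\<nu>) \<le> K powr p"
  shows "Lp_norm p \<alpha> \<phi> \<le> K"
proof -
  have "Lp_norm p \<alpha> \<phi> \<le> (K powr p) powr (1 / p)"
   unfolding Lp_norm_def using assms Lp_integral_nonneg by (intro powr_mono2) auto
  then show ?thesis using assms by (simp add: powr_powr)
qed

lemma Lp_ball_cong:
  assumes "\<And>w. norm w < 1 \<Longrightarrow> \<phi> w = \<psi> w"
  shows "\<phi> \<in> Lp_ball p \<alpha> \<longleftrightarrow> \<psi> \<in> Lp_ball p \<alpha>" and "Lp_norm p \<alpha> \<phi> = Lp_norm p \<alpha> \<psi>"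
proof -
  have 1: "\<phi> \<in> borel_measurable \<nu> \<longleftrightarrow> \<psi> \<in> borel_measurable \<nu>"
   by (rule measurable_cong) (simp add: assms)
  have 2: "integrable \<nu> (\<lambda>w. cmod (\<phi> w) powr p * rho w powr \<alpha>) \<longleftrightarrow> integrable \<nu> (\<lambda>w. cmod (\<psi> w) powr p * rho w powr \<alpha>)"
   by (rule Bochner_Integration.integrable_cong) (simp_all add: assms)
  show "\<phi> \<in> Lp_ball p \<alpha> \<longleftrightarrow> \<psi> \<in> Lp_ball p \<alpha>" unfolding Lp_ball_def using 1 2 by simp
  show "Lp_norm p \<alpha> \<phi> = Lp_norm p \<alpha> \<psi>"
   unfolding Lp_norm_def by (intro arg_cong2[of _ _ _ _ "(powr)"] Bochner_Integration.integral_cong) (simp_all add: assms)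
qed

lemma Lp_ball_mono:
  assumes p: "p > 0" and \<phi>: "\<phi> \<in> Lp_ball p \<alpha>" and [measurable]: "\<psi> \<in> borel_measurable \<nu>"
   and le: "\<And>w. norm w < 1 \<Longrightarrow> cmod (\<psi> w) \<le> cmod (\<phi> w)"
  shows "\<psi> \<in> Lp_ball p \<alpha>" and "Lp_norm p \<alpha> \<psi> \<le> Lp_norm p \<alpha> \<phi>"
proof -
  have le': "cmod (\<psi> w) powr p * rho w powr \<alpha> \<le> cmod (\<phi> w) powr p * rho w powr \<alpha>" if "norm w < 1" for w
   using le[OF that] p by (intro mult_right_mono powr_mono2) auto
  show 1: "\<psi> \<in> Lp_ball p \<alpha>"
   unfolding Lp_ball_def
  proof (intro CollectI conjI Bochner_Integration.integrable_bound[OF Lp_ball_integrable[OF \<phi>]])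
   show "AE w in \<nu>. norm (cmod (\<psi> w) powr p * rho w powr \<alpha>) \<le> norm (cmod (\<phi> w) powr p * rho w powr \<alpha>)"
    using le' by (intro AE_I2) simp
  qed measurable
  have "(\<integral>w. cmod (\<psi> w) powr p * rho w powr \<alpha> \<partial>\<nu>) \<le> (\<integral>w. cmod (\<phi> w) powr p * rho w powr \<alpha> \<partial>\<nu>)"
   using le' by (intro integral_mono Lp_ball_integrable[OF 1] Lp_ball_integrable[OF \<phi>]) simp
  then show "Lp_norm p \<alpha> \<psi> \<le> Lp_norm p \<alpha> \<phi>"
   unfolding Lp_norm_def using p Lp_integral_nonneg by (intro powr_mono2) auto
qed

lemma Lp_ball_scale:
  assumes p: "p > 0" and \<phi>: "\<phi> \<in> Lp_ball p \<alpha>"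
  shows "(\<lambda>w. c * \<phi> w) \<in> Lp_ball p \<alpha>" and "Lp_norm p \<alpha> (\<lambda>w. c * \<phi> w) = cmod c * Lp_norm p \<alpha> \<phi>"
proof -
  have [measurable]: "\<phi> \<in> borel_measurable \<nu>" using \<phi> by (rule Lp_ball_measurable)
  have eq: "cmod (c * \<phi> w) powr p * rho w powr \<alpha> = cmod c powr p * (cmod (\<phi> w) powr p * rho w powr \<alpha>)" for w
   by (simp add: norm_mult powr_mult mult.assoc)
  show "(\<lambda>w. c * \<phi> w) \<in> Lp_ball p \<alpha>"
   unfolding Lp_ball_def mem_Collect_eq eq using Lp_ball_integrable[OF \<phi>] by (auto intro!: integrable_mult_right)
  show "Lp_norm p \<alpha> (\<lambda>w. c * \<phi> w) = cmod c * Lp_norm p \<alpha> \<phi>"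
   unfolding Lp_norm_def eq using p Lp_integral_nonneg[of \<phi> p \<alpha>] by (simp add: powr_mult powr_powr)
qed

lemma powr_add_le:
  assumes "x \<ge> 0" "y \<ge> 0" "p > 0"
  shows "(x + y) powr p \<le> 2 powr p * (x powr p + y powr (p::real))"
proof -
  have "(x + y) powr p \<le> (2 * max x y) powr p" using assms by (intro powr_mono2) auto
  also have "\<dots> = 2 powr p * max x y powr p" using assms by (simp add: powr_mult)
  also have "\<dots> \<le> 2 powr p * (x powr p + y powr p)" by (intro mult_left_mono) (auto simp: max_def)
  finally show ?thesis .
qed

lemma add_powr_le:
  assumes "x \<ge> 0" "y \<ge> 0" "p \<ge> (1::real)"
  shows "x powr p + y powr p \<le> (x + y) powr p"
proof (cases "x + y = 0")
  case False
  then have s: "x + y > 0" using assms by linarith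
  have "x powr p + y powr p = x * x powr (p - 1) + y * y powr (p - 1)"
   using assms by (cases "x = 0"; cases "y = 0") (auto simp: powr_mult_base)
  also have "\<dots> \<le> x * (x + y) powr (p - 1) + y * (x + y) powr (p - 1)"
   using assms by (intro add_mono mult_left_mono powr_mono2) auto
  also have "\<dots> = (x + y) powr p" using s by (simp add: distrib_right[symmetric] powr_mult_base)
  finally show ?thesis .
next
  case True
  then have "x = 0" "y = 0" using assms by linarith+
  then show ?thesis by simp
qed

text \<open>The factor \<open>2\<close> is harmless, as constants never matter; it avoids Minkowski's inequality.\<close>

lemma Lp_ball_add:
  assumes p: "p \<ge> 1" and \<phi>: "\<phi> \<in> Lp_ball p \<alpha>" and \<psi>: "\<psi> \<in> Lp_ball p \<alpha>"
  shows "(\<lambda>w. \<phi> w + \<psi> w) \<in> Lp_ball p \<alpha>" and "Lp_norm p \<alpha> (\<lambda>w. \<phi> w + \<psi> w) \<le> 2 * (Lp_norm p \<alpha> \<phi> + Lp_norm p \<alpha> \<psi>)"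
proof -
  have [measurable]: "\<phi> \<in> borel_measurable \<nu>" "\<psi> \<in> borel_measurable \<nu>"
   using \<phi> \<psi> by (auto intro: Lp_ball_measurable)
  let ?g = "\<lambda>w. 2 powr p * (cmod (\<phi> w) powr p * rho w powr \<alpha> + cmod (\<psi> w) powr p * rho w powr \<alpha>)"
  have le: "cmod (\<phi> w + \<psi> w) powr p * rho w powr \<alpha> \<le> ?g w" for w
  proof -
   have "cmod (\<phi> w + \<psi> w) powr p \<le> (cmod (\<phi> w) + cmod (\<psi> w)) powr p"
    using p by (intro powr_mono2 norm_triangle_ineq) auto
   also have "\<dots> \<le> 2 powr p * (cmod (\<phi> w) powr p + cmod (\<psi> w) powr p)" using p by (intro powr_add_le) auto
   finally show ?thesis using mult_right_mono[of _ _ "rho w powr \<alpha>"] by (fastforce simp: algebra_simps)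
  qed
  have intg: "integrable \<nu> ?g"
   using Lp_ball_integrable[OF \<phi>] Lp_ball_integrable[OF \<psi>] by (intro integrable_mult_right Bochner_Integration.integrable_add)
  show 1: "(\<lambda>w. \<phi> w + \<psi> w) \<in> Lp_ball p \<alpha>"
   unfolding Lp_ball_def
  proof (intro CollectI conjI Bochner_Integration.integrable_bound[OF intg])
   show "AE w in \<nu>. norm (cmod (\<phi> w + \<psi> w) powr p * rho w powr \<alpha>) \<le> norm (?g w)"
    using le by (intro AE_I2) (smt (verit) mult_nonneg_nonneg powr_ge_zero real_norm_def)
  qed measurable
  show "Lp_norm p \<alpha> (\<lambda>w. \<phi> w + \<psi> w) \<le> 2 * (Lp_norm p \<alpha> \<phi> + Lp_norm p \<alpha> \<psi>)"
  proof (rule Lp_norm_leI)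
   have "(\<integral>w. cmod (\<phi> w + \<psi> w) powr p * rho w powr \<alpha> \<partial>\<nu>) \<le> (\<integral>w. ?g w \<partial>\<nu>)"
    using le by (intro integral_mono Lp_ball_integrable[OF 1] intg) auto
   also have "\<dots> = 2 powr p * (Lp_norm p \<alpha> \<phi> powr p + Lp_norm p \<alpha> \<psi> powr p)"
    using p Lp_ball_integrable[OF \<phi>] Lp_ball_integrable[OF \<psi>] by (simp add: Lp_norm_powr)
   also have "\<dots> \<le> 2 powr p * (Lp_norm p \<alpha> \<phi> + Lp_norm p \<alpha> \<psi>) powr p"
    using p by (intro mult_left_mono add_powr_le) auto
   also have "\<dots> = (2 * (Lp_norm p \<alpha> \<phi> + Lp_norm p \<alpha> \<psi>)) powr p" by (subst powr_mult) auto
   finally show "(\<integral>w. cmod (\<phi> w + \<psi> w) powr p * rho w powr \<alpha> \<partial>\<nu>) \<le> \<dots>" .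
  qed (use p in auto)
qed

lemma Lp_ball_const: "\<alpha> > -1 \<Longrightarrow> (\<lambda>_. c) \<in> Lp_ball p \<alpha>"
  unfolding Lp_ball_def by (auto intro!: integrable_mult_right integrable_rho_powr)

lemma Lp_nn_integral:
  assumes "\<phi> \<in> Lp_ball p \<alpha>"
  shows "(\<integral>\<^sup>+w. ennreal (cmod (\<phi> w) powr p * rho w powr \<alpha>) \<partial>\<nu>) = ennreal (\<integral>w. cmod (\<phi> w) powr p * rho w powr \<alpha> \<partial>\<nu>)"
  by (intro nn_integral_eq_integral Lp_ball_integrable assms) auto

text \<open>The function whose weighted \<open>L\<^sup>p\<close> norm defines the Bergman norm; multiplication by \<open>(1 - \<bar>z\<bar>\<^sup>2)\<^sup>k\<close>
  makes the weight \<open>\<alpha>\<close> independent of \<open>k\<close>.\<close>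

definition radial_data :: "nat \<Rightarrow> (complex^'n \<Rightarrow> complex) \<Rightarrow> complex^'n \<Rightarrow> complex" where
  "radial_data k f z = of_real (rho z ^ k) * radial_power k f z"

abbreviation weighted :: "nat \<Rightarrow> (complex^'n \<Rightarrow> complex) \<Rightarrow> complex^'n \<Rightarrow> complex" where
  "weighted b \<phi> \<equiv> \<lambda>w. of_real (rho w ^ b) * \<phi> w"

lemma weight_const_pos: "weight_const TYPE('n::finite) \<alpha> > 0"
proof (cases "\<alpha> > -1")
  case True
  have "(LINT z:ball (0::complex^'n) 1|lborel. (1 - (norm z)\<^sup>2) powr \<alpha>) = (\<integral>z. rho z powr \<alpha> \<partial>(\<nu> :: (complex^'n) measure))"
   by (simp add: ball_measure_def integral_restrict_space set_lebesgue_integral_def)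
  moreover have "(\<integral>z. rho z powr \<alpha> \<partial>(\<nu> :: (complex^'n) measure)) > 0"
  proof -
   have "(\<integral>z. rho z powr \<alpha> \<partial>(\<nu> :: (complex^'n) measure)) \<noteq> 0"
   proof
    assume "(\<integral>z. rho z powr \<alpha> \<partial>(\<nu> :: (complex^'n) measure)) = 0"
    then have "AE z in (\<nu> :: (complex^'n) measure). rho z powr \<alpha> = 0"
     using integral_nonneg_eq_0_iff_AE[OF integrable_rho_powr[OF True, where 'n='n]] by simp
    moreover have "AE z in (\<nu> :: (complex^'n) measure). rho z powr \<alpha> \<noteq> 0"
     by (intro AE_I2) (use rho_pos in fastforce)
    ultimately have "AE z in (\<nu> :: (complex^'n) measure). False" by eventually_elim simp
    then have "emeasure (\<nu> :: (complex^'n) measure) (space \<nu>) = 0"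
     using AE_iff_measurable[OF sets.top[of "\<nu> :: (complex^'n) measure"], of "\<lambda>_. False"]
     by (simp add: ball_def dist_norm)
    then have "emeasure lborel (ball (0::complex^'n) 1) = 0"
     by (simp add: ball_measure_def emeasure_restrict_space)
    then show False
     using less_imp_neq[OF unit_ball_vol_pos[of "real DIM(complex^'n)"]] by (simp add: emeasure_ball)
   qed
   moreover have "(\<integral>z. rho z powr \<alpha> \<partial>(\<nu> :: (complex^'n) measure)) \<ge> 0" by (intro integral_nonneg_AE AE_I2) simp
   ultimately show ?thesis by linarith
  qed
  ultimately show ?thesis using True by (simp add: weight_const_def)
qed (simp add: weight_const_def)

lemma weighted_volume_eq:
  "(weighted_volume \<alpha> :: (complex^'n) measure) = density \<nu> (\<lambda>z. ennreal (weight_const TYPE('n) \<alpha> * rho z powr \<alpha>))"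
  by (simp add: weighted_volume_def ball_measure_def)

lemma integrable_weighted_volume:
  fixes h :: "complex^'n \<Rightarrow> real"
  assumes [measurable]: "h \<in> borel_measurable \<nu>"
  shows "integrable (weighted_volume \<alpha>) h \<longleftrightarrow> integrable \<nu> (\<lambda>z. h z * rho z powr \<alpha>)"
   and "(\<integral>z. h z \<partial>weighted_volume \<alpha>) = weight_const TYPE('n) \<alpha> * (\<integral>z. h z * rho z powr \<alpha> \<partial>\<nu>)"
proof -
  note wc = weight_const_pos[where 'n='n, of \<alpha>]
  have eq: "(weight_const TYPE('n) \<alpha> * rho z powr \<alpha>) *\<^sub>R h z = weight_const TYPE('n) \<alpha> * (h z * rho z powr \<alpha>)" for z
   by simp
  have "integrable (weighted_volume \<alpha>) h \<longleftrightarrow> integrable \<nu> (\<lambda>z. weight_const TYPE('n) \<alpha> * (h z * rho z powr \<alpha>))"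
   unfolding weighted_volume_eq eq[symmetric] using wc by (subst integrable_density) auto
  also have "\<dots> \<longleftrightarrow> integrable \<nu> (\<lambda>z. h z * rho z powr \<alpha>)"
   using wc by simp
  finally show "integrable (weighted_volume \<alpha>) h \<longleftrightarrow> integrable \<nu> (\<lambda>z. h z * rho z powr \<alpha>)" .
  have "(\<integral>z. h z \<partial>weighted_volume \<alpha>) = (\<integral>z. weight_const TYPE('n) \<alpha> * (h z * rho z powr \<alpha>) \<partial>\<nu>)"
   unfolding weighted_volume_eq eq[symmetric] using wc by (subst integral_density) auto
  then show "(\<integral>z. h z \<partial>weighted_volume \<alpha>) = weight_const TYPE('n) \<alpha> * (\<integral>z. h z * rho z powr \<alpha> \<partial>\<nu>)"
   by simp
qed

lemma measurable_weighted_volume: "borel_measurable (weighted_volume \<alpha>) = borel_measurable \<nu>"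
  by (rule measurable_cong_sets) (simp_all add: weighted_volume_eq)

lemma radial_data_measurable:
  assumes "f \<in> ball_holomorphic" shows "radial_data k f \<in> borel_measurable \<nu>"
proof -
  have [measurable]: "radial_power k f \<in> borel_measurable \<nu>"
   by (rule ball_holomorphic_measurable[OF radial_power_ball_holomorphic[OF assms]])
  show ?thesis unfolding radial_data_def[abs_def] by measurable
qed

lemma bergman_space_iff:
  "f \<in> bergman_space p \<alpha> \<longleftrightarrow> f \<in> ball_holomorphic \<and> (\<exists>k::nat. p * real k + \<alpha> > -1 \<and> radial_data k f \<in> Lp_ball p \<alpha>)"
proof (cases "f \<in> ball_holomorphic")
  case True
  have "(\<lambda>z. complex_of_real ((1 - (norm z)\<^sup>2) ^ k) * (radial_deriv ^^ k) f z) \<in> Lp_fun p (weighted_volume \<alpha>) \<longleftrightarrow> radial_data k f \<in> Lp_ball p \<alpha>" for k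
  proof -
   let ?g = "\<lambda>z. complex_of_real ((1 - (norm z)\<^sup>2) ^ k) * (radial_deriv ^^ k) f z"
   have eq: "?g z = radial_data k f z" if "z \<in> space \<nu>" for z
    using that radial_deriv_funpow[OF True, of z k] by (simp add: radial_data_def)
   have sp: "space (weighted_volume \<alpha>) = space (\<nu> :: (complex^'a) measure)"
    by (simp add: weighted_volume_eq)
   have [measurable]: "radial_data k f \<in> borel_measurable \<nu>" by (rule radial_data_measurable[OF True])
   have g: "?g \<in> borel_measurable \<nu>"
    using measurable_cong[of \<nu> ?g "radial_data k f" borel] eq by simp
   have "integrable (weighted_volume \<alpha>) (\<lambda>z. norm (?g z) powr p) \<longleftrightarrow> integrable (weighted_volume \<alpha>) (\<lambda>z. cmod (radial_data k f z) powr p)"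
    by (rule Bochner_Integration.integrable_cong[OF refl]) (use eq sp in simp)
   also have "\<dots> \<longleftrightarrow> integrable \<nu> (\<lambda>z. cmod (radial_data k f z) powr p * rho z powr \<alpha>)"
    by (rule integrable_weighted_volume) measurable
   finally show ?thesis using g by (simp add: Lp_fun_def Lp_ball_def measurable_weighted_volume)
  qed
  then show ?thesis using True by (simp add: bergman_space_def)
qed (simp add: bergman_space_def)

lemma bergman_norm_eq:
  fixes f :: "complex^'n \<Rightarrow> complex"
  assumes f: "f \<in> ball_holomorphic"
  shows "bergman_norm p \<alpha> f = cmod (f 0) + weight_const TYPE('n) \<alpha> powr (1/p) * Lp_norm p \<alpha> (radial_data (bergman_order p \<alpha>) f)"
proof -
  define N where "N = bergman_order p \<alpha>"
  have [measurable]: "radial_data N f \<in> borel_measurable \<nu>" by (rule radial_data_measurable[OF f])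
  have "(LINT z|weighted_volume \<alpha>. (1 - (norm z)\<^sup>2) powr (p * real N) * norm ((radial_deriv ^^ N) f z) powr p) =
    (LINT z|weighted_volume \<alpha>. cmod (radial_data N f z) powr p)"
  proof (rule Bochner_Integration.integral_cong[OF refl])
   fix z :: "complex^'n" assume "z \<in> space (weighted_volume \<alpha>)"
   then have z: "norm z < 1" by (simp add: weighted_volume_eq)
   show "(1 - (norm z)\<^sup>2) powr (p * real N) * norm ((radial_deriv ^^ N) f z) powr p = cmod (radial_data N f z) powr p"
    using rho_pos[OF z] radial_deriv_funpow[OF f z, of N]
    by (simp add: radial_data_def norm_mult norm_power powr_mult powr_powr mult.commute flip: powr_realpow)
  qed
  also have "\<dots> = weight_const TYPE('n) \<alpha> * (\<integral>z. cmod (radial_data N f z) powr p * rho z powr \<alpha> \<partial>\<nu>)"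
   by (rule integrable_weighted_volume) measurable
  finally show ?thesis
   using weight_const_pos[where 'n='n, of \<alpha>] Lp_integral_nonneg
   by (simp add: bergman_norm_def Let_def N_def[symmetric] Lp_norm_def powr_mult)
qed

lemma bergman_norm_nonneg: "bergman_norm p \<alpha> f \<ge> 0"
  by (simp add: bergman_norm_def Let_def)

lemma bergman_order:
  assumes "p \<ge> 1" shows "p * real (bergman_order p \<alpha>) + \<alpha> > -1"
proof -
  obtain k :: nat where "real k > -1 - \<alpha>" using reals_Archimedean2 by blast
  moreover have "p * real k \<ge> 1 * real k" using assms by (intro mult_right_mono) auto
  ultimately have "p * real k + \<alpha> > -1" by linarith
  then show ?thesis unfolding bergman_order_def by (rule LeastI)
qed

text \<open>The kernel is dominated by a power of \<open>\<bar>1 - \<langle>z, w\<rangle>\<bar>\<close>, to which Schur's test applies.\<close>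

lemma kernel_transform_bounded:
  assumes p: "p \<ge> 1" and pk: "p * real k + \<alpha> > -1" and b: "real b > \<alpha> + real k * (p - 1)"
  shows "\<exists>C>0. \<forall>\<phi> \<in> (Lp_ball p \<alpha> :: (complex^'n \<Rightarrow> complex) set).
   (\<lambda>z. of_real (rho z ^ k) * kernel_transform (repr_coeff TYPE('n) b N k) (weighted b \<phi>) z) \<in> Lp_ball p \<alpha> \<and>
   Lp_norm p \<alpha> (\<lambda>z. of_real (rho z ^ k) * kernel_transform (repr_coeff TYPE('n) b N k) (weighted b \<phi>) z) \<le> C * Lp_norm p \<alpha> \<phi> \<and>
   integrable \<nu> (weighted b \<phi>)"
proof -
  let ?h = "repr_coeff TYPE('n) b N k"
  let ?e = "CARD('n) + 1 + b + k"
  let ?d = "\<lambda>(z :: complex^'n) (w :: complex^'n). cmod (1 - cdot z w) ^ ?e"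
  note h = repr_coeff_order[where 'n='n, of b N k]
  obtain D where D: "D > 0" "\<And>x. cmod x < 1 \<Longrightarrow> cmod (\<Sum>i. ?h i * x ^ i) \<le> D / cmod (1 - x) ^ ?e"
   using h unfolding kernel_order_def by blast
  obtain C where C: "C > 0" "\<And>(\<phi> :: complex^'n \<Rightarrow> real) X. \<phi> \<in> borel_measurable \<nu> \<Longrightarrow> (\<And>w. \<phi> w \<ge> 0) \<Longrightarrow> X \<ge> 0 \<Longrightarrow>
    (\<integral>\<^sup>+w. ennreal (\<phi> w powr p * rho w powr \<alpha>) \<partial>\<nu>) \<le> ennreal X \<Longrightarrow>
    (\<forall>z. norm z < 1 \<longrightarrow> integrable \<nu> (\<lambda>w. \<phi> w * rho w ^ b / ?d z w)) \<and>
    (\<integral>\<^sup>+z. ennreal ((rho z ^ k * (\<integral>w. \<phi> w * rho w ^ b / ?d z w \<partial>\<nu>)) powr p * rho z powr \<alpha>) \<partial>\<nu>)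
     \<le> ennreal (C * X)"
   using schur_estimate[OF assms, where 'n='n] by blast
  show ?thesis
  proof (intro exI[of _ "D * C powr (1/p)"] conjI ballI)
   show "D * C powr (1/p) > 0" using D C by simp
   fix \<phi> :: "complex^'n \<Rightarrow> complex" assume \<phi>: "\<phi> \<in> Lp_ball p \<alpha>"
   have [measurable]: "\<phi> \<in> borel_measurable \<nu>" using \<phi> by (rule Lp_ball_measurable)
   define X where "X = (\<integral>w. cmod (\<phi> w) powr p * rho w powr \<alpha> \<partial>\<nu>)"
   have X: "X \<ge> 0" unfolding X_def by (rule Lp_integral_nonneg)
   define I where "I z = (\<integral>w. (D * cmod (\<phi> w)) * rho w ^ b / ?d z w \<partial>\<nu>)" for z
   have DX: "(\<integral>\<^sup>+w. ennreal ((D * cmod (\<phi> w)) powr p * rho w powr \<alpha>) \<partial>\<nu>) \<le> ennreal (D powr p * X)"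
   proof -
    have "(\<integral>\<^sup>+w. ennreal ((D * cmod (\<phi> w)) powr p * rho w powr \<alpha>) \<partial>\<nu>) =
      (\<integral>\<^sup>+w. ennreal (D powr p) * ennreal (cmod (\<phi> w) powr p * rho w powr \<alpha>) \<partial>\<nu>)"
     using D(1) by (intro nn_integral_cong) (simp add: powr_mult ennreal_mult[symmetric] mult.assoc)
    also have "\<dots> = ennreal (D powr p) * ennreal X"
     by (subst nn_integral_cmult) (auto simp: X_def Lp_nn_integral[OF \<phi>])
    finally show ?thesis using X by (simp add: ennreal_mult)
   qed
   have S: "(\<forall>z. norm z < 1 \<longrightarrow> integrable \<nu> (\<lambda>w. (D * cmod (\<phi> w)) * rho w ^ b / ?d z w)) \<and>
    (\<integral>\<^sup>+z. ennreal ((rho z ^ k * I z) powr p * rho z powr \<alpha>) \<partial>\<nu>) \<le> ennreal (C * (D powr p * X))"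
    unfolding I_def by (rule C(2)) (use X D(1) DX in auto)
   have "integrable \<nu> (\<lambda>w. (D * cmod (\<phi> w)) * rho w ^ b / cmod (1 - cdot 0 w) ^ ?e)"
    using S by (simp only: norm_zero zero_less_one simp_thms)
   then have "integrable \<nu> (\<lambda>w. D * (cmod (\<phi> w) * rho w ^ b))" by (simp add: mult.assoc)
   then have int0: "integrable \<nu> (\<lambda>w. cmod (\<phi> w) * rho w ^ b)" using D(1) by simp
   show int\<Phi>: "integrable \<nu> (weighted b \<phi>)"
   proof (rule Bochner_Integration.integrable_bound[OF int0])
    show "AE w in \<nu>. norm (of_real (rho w ^ b) * \<phi> w) \<le> norm (cmod (\<phi> w) * rho w ^ b)"
     by (intro AE_I2) (simp only: norm_mult norm_of_real real_norm_def abs_mult abs_norm_cancel mult.commute order_refl)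
   qed measurable
   define F where "F = kernel_transform ?h (weighted b \<phi>)"
   have FI: "cmod (F z) \<le> I z" if z: "norm z < 1" for z
   proof -
    have "cmod (F z) = cmod (\<integral>w. of_real (rho w ^ b) * \<phi> w * (\<Sum>i. ?h i * cdot z w ^ i) \<partial>\<nu>)"
     using z by (simp add: F_def kernel_transform_def)
    also have "\<dots> \<le> (\<integral>w. cmod (of_real (rho w ^ b) * \<phi> w * (\<Sum>i. ?h i * cdot z w ^ i)) \<partial>\<nu>)"
     by (rule integral_norm_bound)
    also have "\<dots> \<le> I z"
     unfolding I_def
    proof (rule integral_mono')
     show "integrable \<nu> (\<lambda>w. (D * cmod (\<phi> w)) * rho w ^ b / ?d z w)" using S z by blast
     fix w :: "complex^'n" assume "w \<in> space \<nu>"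
     then have w: "norm w < 1" by simp
     note r = rho_pos[OF w]
     show "0 \<le> (D * cmod (\<phi> w)) * rho w ^ b / ?d z w" using r D(1) by simp
     have "cmod (of_real (rho w ^ b) * \<phi> w) * cmod (\<Sum>i. ?h i * cdot z w ^ i) \<le> (rho w ^ b * cmod (\<phi> w)) * (D / ?d z w)"
      using r D(1) by (intro mult_mono D(2) norm_cdot_less_1[OF z w]) (simp_all only: norm_mult norm_of_real abs_of_nonneg zero_le_power less_imp_le order_refl norm_ge_zero mult_nonneg_nonneg)
     then show "cmod (of_real (rho w ^ b) * \<phi> w * (\<Sum>i. ?h i * cdot z w ^ i)) \<le> (D * cmod (\<phi> w)) * rho w ^ b / ?d z w"
      by (simp only: norm_mult times_divide_eq_right mult_ac)
    qed
    finally show ?thesis .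
   qed
   have "F \<in> ball_holomorphic" unfolding F_def by (rule kernel_transform_holomorphic(1)[OF int\<Phi> h])
   then have [measurable]: "F \<in> borel_measurable \<nu>" by (rule ball_holomorphic_measurable)
   define G where "G z = of_real (rho z ^ k) * F z" for z
   have [measurable]: "G \<in> borel_measurable \<nu>" unfolding G_def[abs_def] by measurable
   have "(\<integral>\<^sup>+z. ennreal (cmod (G z) powr p * rho z powr \<alpha>) \<partial>\<nu>) \<le> (\<integral>\<^sup>+z. ennreal ((rho z ^ k * I z) powr p * rho z powr \<alpha>) \<partial>\<nu>)"
   proof (intro nn_integral_mono ennreal_leI mult_right_mono powr_mono2)
    fix z :: "complex^'n" assume "z \<in> space \<nu>"
    then have z: "norm z < 1" by simp
    have "cmod (G z) = rho z ^ k * cmod (F z)" unfolding G_def norm_mult norm_of_real using rho_pos[OF z] by simp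
    then show "cmod (G z) \<le> rho z ^ k * I z" using FI[OF z] rho_pos[OF z] by (simp add: mult_left_mono)
   qed (use p in auto)
   also have "\<dots> \<le> ennreal (C * (D powr p * X))" using S by blast
   finally have nn: "(\<integral>\<^sup>+z. ennreal (cmod (G z) powr p * rho z powr \<alpha>) \<partial>\<nu>) \<le> ennreal (C * (D powr p * X))" .
   have G: "G \<in> Lp_ball p \<alpha>"
    unfolding Lp_ball_def using nn by (auto intro!: integrableI_nonneg simp: less_top[symmetric] top_unique)
   have "(\<integral>z. cmod (G z) powr p * rho z powr \<alpha> \<partial>\<nu>) \<le> C * (D powr p * X)"
    using nn X C(1) D(1) by (subst integral_eq_nn_integral) (auto intro!: enn2real_leI)
   also have "\<dots> = (D * C powr (1/p) * Lp_norm p \<alpha> \<phi>) powr p"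
    using p C(1) D(1) Lp_norm_powr[of p \<alpha> \<phi>] by (simp add: powr_mult powr_powr X_def)
   finally have "Lp_norm p \<alpha> G \<le> D * C powr (1/p) * Lp_norm p \<alpha> \<phi>"
    using p C(1) D(1) by (intro Lp_norm_leI) auto
   with G show "(\<lambda>z. of_real (rho z ^ k) * kernel_transform ?h (weighted b \<phi>) z) \<in> Lp_ball p \<alpha>"
    "Lp_norm p \<alpha> (\<lambda>z. of_real (rho z ^ k) * kernel_transform ?h (weighted b \<phi>) z) \<le> D * C powr (1/p) * Lp_norm p \<alpha> \<phi>"
    unfolding G_def[abs_def] F_def by auto
  qed
qed

text \<open>Integrability against \<open>(1 - \<bar>w\<bar>\<^sup>2)\<^sup>b\<close> is all that the integral representation asks for, so one
  large \<open>b\<close> serves several spaces at once.\<close>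

lemma Lp_imp_L1:
  assumes p: "p \<ge> 1" and b: "real b \<ge> \<alpha>"
  shows "\<exists>C>0. \<forall>\<phi> \<in> (Lp_ball p \<alpha> :: (complex^'n \<Rightarrow> complex) set).
   integrable \<nu> (weighted b \<phi>) \<and>
   (\<integral>w. cmod (of_real (rho w ^ b) * \<phi> w) \<partial>\<nu>) \<le> C * Lp_norm p \<alpha> \<phi>"
proof -
  define K where "K = (\<integral>w. rho w powr real b \<partial>(\<nu> :: (complex^'n) measure)) + 1"
  have I0: "(\<integral>w. rho w powr real b \<partial>(\<nu> :: (complex^'n) measure)) \<ge> 0" by (intro integral_nonneg_AE AE_I2) simp
  then have K: "K > 0" unfolding K_def by linarith
  show ?thesis
  proof (intro exI[of _ "K powr ((p - 1) / p)"] conjI ballI)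
   show "K powr ((p - 1) / p) > 0" using K by simp
   fix \<phi> :: "complex^'n \<Rightarrow> complex" assume \<phi>: "\<phi> \<in> Lp_ball p \<alpha>"
   have [measurable]: "\<phi> \<in> borel_measurable \<nu>" using \<phi> by (rule Lp_ball_measurable)
   have J: "integrable \<nu> (\<lambda>w. cmod (\<phi> w) * rho w powr real b) \<and>
    (\<integral>w. cmod (\<phi> w) * rho w powr real b \<partial>\<nu>) powr p \<le> K powr (p - 1) * (Lp_norm p \<alpha> \<phi> powr p)"
   proof (rule integral_power_le[OF p])
    have "(\<integral>\<^sup>+w. ennreal (rho w powr real b) \<partial>(\<nu> :: (complex^'n) measure)) = ennreal (\<integral>w. rho w powr real b \<partial>(\<nu> :: (complex^'n) measure))"
     by (intro nn_integral_eq_integral integrable_rho_powr) auto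
    also have "\<dots> \<le> ennreal K" by (intro ennreal_leI) (simp add: K_def)
    finally show "(\<integral>\<^sup>+w. ennreal (rho w powr real b) \<partial>(\<nu> :: (complex^'n) measure)) \<le> ennreal K" .
    have "(\<integral>\<^sup>+w. ennreal (cmod (\<phi> w) powr p * rho w powr real b) \<partial>\<nu>) \<le> (\<integral>\<^sup>+w. ennreal (cmod (\<phi> w) powr p * rho w powr \<alpha>) \<partial>\<nu>)"
    proof (intro nn_integral_mono ennreal_leI mult_left_mono powr_mono')
     fix w :: "complex^'n" assume "w \<in> space \<nu>"
     then show "0 \<le> rho w" using rho_pos[of w] by simp
    qed (use b in auto)
    then show "(\<integral>\<^sup>+w. ennreal (cmod (\<phi> w) powr p * rho w powr real b) \<partial>\<nu>) \<le> ennreal (Lp_norm p \<alpha> \<phi> powr p)"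
     using p by (simp add: Lp_nn_integral[OF \<phi>] Lp_norm_powr)
   qed (use K in auto)
   have eq: "cmod (of_real (rho w ^ b) * \<phi> w) = cmod (\<phi> w) * rho w powr real b" if "norm w < 1" for w
    unfolding norm_mult norm_of_real using rho_pos[OF that] by (simp add: powr_realpow)
   show "integrable \<nu> (weighted b \<phi>)"
   proof (rule Bochner_Integration.integrable_bound[OF J[THEN conjunct1]])
    show "AE w in \<nu>. norm (of_real (rho w ^ b) * \<phi> w) \<le> norm (cmod (\<phi> w) * rho w powr real b)"
     by (intro AE_I2, subst eq) auto
   qed measurable
   have "(\<integral>w. cmod (of_real (rho w ^ b) * \<phi> w) \<partial>\<nu>) = (\<integral>w. cmod (\<phi> w) * rho w powr real b \<partial>\<nu>)"
    by (rule Bochner_Integration.integral_cong[OF refl eq]) simp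
   also have "\<dots> = ((\<integral>w. cmod (\<phi> w) * rho w powr real b \<partial>\<nu>) powr p) powr (1/p)"
   proof -
    have "(\<integral>w. cmod (\<phi> w) * rho w powr real b \<partial>\<nu>) \<ge> 0" by (intro integral_nonneg_AE AE_I2) simp
    then show ?thesis using p by (simp add: powr_powr)
   qed
   also have "\<dots> \<le> (K powr (p - 1) * (Lp_norm p \<alpha> \<phi> powr p)) powr (1/p)"
    using J p by (intro powr_mono2) auto
   also have "\<dots> = K powr ((p - 1) / p) * Lp_norm p \<alpha> \<phi>" using p K by (simp add: powr_mult powr_powr)
   finally show "(\<integral>w. cmod (of_real (rho w ^ b) * \<phi> w) \<partial>\<nu>) \<le> K powr ((p - 1) / p) * Lp_norm p \<alpha> \<phi>" .
  qed
qed

lemma kernel_transform_cong: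
  assumes "\<And>w. norm w < 1 \<Longrightarrow> \<Phi> w = \<Psi> w"
  shows "kernel_transform h \<Phi> = kernel_transform h \<Psi>"
  unfolding kernel_transform_def
  by (intro ext if_cong refl Bochner_Integration.integral_cong) (simp_all add: assms)

lemma repr_data_eq:
  assumes "norm w < 1"
  shows "of_real (rho w powr real (b + j)) * radial_power j f w = of_real (rho w ^ b) * radial_data j f w"
  using powr_realpow[OF rho_pos[OF assms], of "b + j"] by (simp add: radial_data_def power_add)

lemma radial_reproducing_data:
  fixes f :: "complex^'n \<Rightarrow> complex"
  assumes f: "f \<in> ball_holomorphic" and int: "integrable \<nu> (weighted b (radial_data j f))" and z: "norm z < 1"
  shows "radial_power M f z = (if M = 0 then f 0 else 0) +
    kernel_transform (repr_coeff TYPE('n) b j M) (weighted b (radial_data j f)) z"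
proof -
  have "integrable \<nu> (\<lambda>w. of_real (rho w powr real (b + j)) * radial_power j f w) \<longleftrightarrow> integrable \<nu> (weighted b (radial_data j f))"
   by (rule Bochner_Integration.integrable_cong[OF refl repr_data_eq]) simp
  with int have "integrable \<nu> (\<lambda>w. of_real (rho w powr real (b + j)) * radial_power j f w)" by simp
  from radial_reproducing_formula[OF f this z, of M]
  show ?thesis
   using kernel_transform_cong[of "\<lambda>w. of_real (rho w powr real (b + j)) * radial_power j f w"
    "\<lambda>w. of_real (rho w ^ b) * radial_data j f w" "repr_coeff TYPE('n) b j M"] repr_data_eq[of _ b j f] by simp
qed

text \<open>The independence of \<open>A\<^sup>p\<^sub>\<alpha>\<close> from the number of derivatives: the data of order \<open>M\<close> is an integral
  transform of the data of any order \<open>j\<close>, and the transform is bounded on \<open>L\<^sup>p\<close> when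
  \<open>p M + \<alpha> > -1\<close>. The term \<open>f 0\<close> accounts for \<open>M = 0\<close>, where constants are visible.\<close>

theorem radial_data_equivalence:
  assumes p: "p \<ge> 1" and pM: "p * real M + \<alpha> > -1"
  shows "\<exists>C>0. \<forall>f \<in> (ball_holomorphic :: (complex^'n \<Rightarrow> complex) set). radial_data j f \<in> Lp_ball p \<alpha> \<longrightarrow>
    radial_data M f \<in> Lp_ball p \<alpha> \<and> Lp_norm p \<alpha> (radial_data M f) \<le> C * (cmod (f 0) + Lp_norm p \<alpha> (radial_data j f))"
proof -
  obtain b :: nat where b: "real b > \<alpha> + real M * (p - 1)" using reals_Archimedean2 by blast
  obtain C where C: "C > 0" "\<And>\<phi> :: complex^'n \<Rightarrow> complex. \<phi> \<in> Lp_ball p \<alpha> \<Longrightarrow>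
   (\<lambda>z. of_real (rho z ^ M) * kernel_transform (repr_coeff TYPE('n) b j M) (weighted b \<phi>) z) \<in> Lp_ball p \<alpha> \<and>
   Lp_norm p \<alpha> (\<lambda>z. of_real (rho z ^ M) * kernel_transform (repr_coeff TYPE('n) b j M) (weighted b \<phi>) z) \<le> C * Lp_norm p \<alpha> \<phi> \<and>
   integrable \<nu> (weighted b \<phi>)"
   using kernel_transform_bounded[OF p pM b, where 'n='n, of j] by blast
  define K where "K = Lp_norm p \<alpha> (\<lambda>_ :: complex^'n. 1)"
  have K: "K \<ge> 0" by (simp add: K_def)
  show ?thesis
  proof (intro exI[of _ "2 * (K + C)"] conjI ballI impI)
   show "2 * (K + C) > 0" using K C(1) by simp
   fix f :: "complex^'n \<Rightarrow> complex" assume f: "f \<in> ball_holomorphic" and d: "radial_data j f \<in> Lp_ball p \<alpha>"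
   define T where "T z = of_real (rho z ^ M) * kernel_transform (repr_coeff TYPE('n) b j M) (weighted b (radial_data j f)) z" for z
   have T: "T \<in> Lp_ball p \<alpha>" "Lp_norm p \<alpha> T \<le> C * Lp_norm p \<alpha> (radial_data j f)"
    using C(2)[OF d] by (auto simp: T_def[abs_def])
   have rep: "radial_data M f z = (if M = 0 then f 0 else 0) + T z" if z: "norm z < 1" for z
    using radial_reproducing_data[OF f _ z, of b j M] C(2)[OF d] by (auto simp: radial_data_def T_def distrib_left)
   have "(\<lambda>z. (if M = 0 then f 0 else 0) + T z) \<in> Lp_ball p \<alpha> \<and> Lp_norm p \<alpha> (\<lambda>z. (if M = 0 then f 0 else 0) + T z) \<le> 2 * (K + C) * (cmod (f 0) + Lp_norm p \<alpha> (radial_data j f))"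
   proof (cases "M = 0")
    case True
    then have "\<alpha> > -1" using pM by simp
    then have 1: "(\<lambda>_. 1) \<in> (Lp_ball p \<alpha> :: (complex^'n \<Rightarrow> complex) set)" by (rule Lp_ball_const)
    have 2: "(\<lambda>_. f 0) \<in> (Lp_ball p \<alpha> :: (complex^'n \<Rightarrow> complex) set)" "Lp_norm p \<alpha> (\<lambda>_ :: complex^'n. f 0) = cmod (f 0) * K"
     using Lp_ball_scale[OF _ 1, of "f 0"] p by (simp_all add: K_def)
    have "Lp_norm p \<alpha> (\<lambda>z. f 0 + T z) \<le> 2 * (cmod (f 0) * K + C * Lp_norm p \<alpha> (radial_data j f))"
     using Lp_ball_add(2)[OF p 2(1) T(1)] T(2) 2(2) by simp
    also have "\<dots> \<le> 2 * (K + C) * (cmod (f 0) + Lp_norm p \<alpha> (radial_data j f))"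
     using K C(1) by (simp add: algebra_simps)
    finally show ?thesis using True Lp_ball_add(1)[OF p 2(1) T(1)] by simp
   next
    case False
    have "C * Lp_norm p \<alpha> (radial_data j f) \<le> 2 * (K + C) * (cmod (f 0) + Lp_norm p \<alpha> (radial_data j f))"
     using K C(1) by (simp add: algebra_simps)
    then show ?thesis using False T by simp
   qed
   then show "radial_data M f \<in> Lp_ball p \<alpha>" "Lp_norm p \<alpha> (radial_data M f) \<le> 2 * (K + C) * (cmod (f 0) + Lp_norm p \<alpha> (radial_data j f))"
    using Lp_ball_cong[of "radial_data M f" "\<lambda>z. (if M = 0 then f 0 else 0) + T z" p \<alpha>, OF rep] by simp_all
  qed
qed

text \<open>On compact subsets of the ball the kernel is bounded, so the \<open>L\<^sup>1\<close> norm of the data controls all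
  radial derivatives. This makes point evaluations continuous on every Bergman space.\<close>

lemma radial_power_local_bound:
  assumes p: "p \<ge> 1" and r: "r < 1"
  shows "\<exists>C>0. \<forall>f \<in> (ball_holomorphic :: (complex^'n \<Rightarrow> complex) set). radial_data j f \<in> Lp_ball p \<alpha> \<longrightarrow>
    (\<forall>z. norm z \<le> r \<longrightarrow> cmod (radial_power M f z) \<le> C * (cmod (f 0) + Lp_norm p \<alpha> (radial_data j f)))"
proof -
  obtain b :: nat where b: "real b > \<alpha>" using reals_Archimedean2 by blast
  obtain C where C: "C > 0" "\<And>\<phi> :: complex^'n \<Rightarrow> complex. \<phi> \<in> Lp_ball p \<alpha> \<Longrightarrow>
   integrable \<nu> (weighted b \<phi>) \<and>
   (\<integral>w. cmod (of_real (rho w ^ b) * \<phi> w) \<partial>\<nu>) \<le> C * Lp_norm p \<alpha> \<phi>"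
   using Lp_imp_L1[OF p, of \<alpha> b, where 'n='n] b by auto
  let ?h = "repr_coeff TYPE('n) b j M"
  let ?e = "CARD('n) + 1 + b + M"
  obtain D where D: "D > 0" "\<And>x. cmod x < 1 \<Longrightarrow> cmod (\<Sum>i. ?h i * x ^ i) \<le> D / cmod (1 - x) ^ ?e"
   using repr_coeff_order[where 'n='n, of b j M] unfolding kernel_order_def by blast
  define E where "E = D / (1 - r) ^ ?e"
  have E: "E > 0" using D r by (simp add: E_def)
  show ?thesis
  proof (intro exI[of _ "1 + E * C"] conjI ballI impI allI)
   show "1 + E * C > 0" using E C(1) by (simp add: add_pos_pos)
   fix f :: "complex^'n \<Rightarrow> complex" and z :: "complex^'n"
   assume f: "f \<in> ball_holomorphic" and d: "radial_data j f \<in> Lp_ball p \<alpha>" and z: "norm z \<le> r"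
   define \<Phi> where "\<Phi> w = of_real (rho w ^ b) * radial_data j f w" for w
   have \<Phi>: "integrable \<nu> \<Phi>" "(\<integral>w. cmod (\<Phi> w) \<partial>\<nu>) \<le> C * Lp_norm p \<alpha> (radial_data j f)"
    using C(2)[OF d] by (auto simp: \<Phi>_def[abs_def])
   have z1: "norm z < 1" using z r by simp
   have "cmod (kernel_transform ?h \<Phi> z) = cmod (\<integral>w. \<Phi> w * (\<Sum>i. ?h i * cdot z w ^ i) \<partial>\<nu>)"
    using z1 by (simp add: kernel_transform_def)
   also have "\<dots> \<le> (\<integral>w. cmod (\<Phi> w * (\<Sum>i. ?h i * cdot z w ^ i)) \<partial>\<nu>)" by (rule integral_norm_bound)
   also have "\<dots> \<le> (\<integral>w. E * cmod (\<Phi> w) \<partial>\<nu>)"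
   proof (rule integral_mono')
    show "integrable \<nu> (\<lambda>w. E * cmod (\<Phi> w))" using \<Phi>(1) by (intro integrable_mult_right integrable_norm)
    fix w :: "complex^'n" assume "w \<in> space \<nu>"
    then have w: "norm w < 1" by simp
    show "0 \<le> E * cmod (\<Phi> w)" using E by simp
    have "1 - r \<le> cmod (1 - cdot z w)" using one_minus_cdot_ge[OF w, of z] z by simp
    then have "(1 - r) ^ ?e \<le> cmod (1 - cdot z w) ^ ?e" using r by (intro power_mono) auto
    moreover have "(1 - r) ^ ?e > 0" using r by (intro zero_less_power) simp
    ultimately have "D / cmod (1 - cdot z w) ^ ?e \<le> E"
     unfolding E_def using D(1) by (intro divide_left_mono mult_pos_pos) linarith+
    then have "cmod (\<Sum>i. ?h i * cdot z w ^ i) \<le> E" using D(2)[OF norm_cdot_less_1[OF z1 w]] by linarith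
    then have "cmod (\<Phi> w) * cmod (\<Sum>i. ?h i * cdot z w ^ i) \<le> cmod (\<Phi> w) * E" by (rule mult_left_mono) simp
    then show "cmod (\<Phi> w * (\<Sum>i. ?h i * cdot z w ^ i)) \<le> E * cmod (\<Phi> w)" by (simp only: norm_mult mult.commute)
   qed
   also have "\<dots> = E * (\<integral>w. cmod (\<Phi> w) \<partial>\<nu>)" by simp
   also have "\<dots> \<le> E * (C * Lp_norm p \<alpha> (radial_data j f))" using E by (intro mult_left_mono \<Phi>(2)) simp
   finally have T: "cmod (kernel_transform ?h \<Phi> z) \<le> E * (C * Lp_norm p \<alpha> (radial_data j f))" .
   have "radial_power M f z = (if M = 0 then f 0 else 0) + kernel_transform ?h \<Phi> z"
    using radial_reproducing_data[OF f _ z1, of b j M] \<Phi>(1) unfolding \<Phi>_def[abs_def] by blast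
   then have "cmod (radial_power M f z) \<le> cmod (f 0) + cmod (kernel_transform ?h \<Phi> z)"
    using norm_triangle_ineq[of "f 0" "kernel_transform ?h \<Phi> z"] by (cases "M = 0") auto
   also have "\<dots> \<le> (1 + E * C) * (cmod (f 0) + Lp_norm p \<alpha> (radial_data j f))"
   proof -
    have "0 \<le> E * C * cmod (f 0)" using E C(1) by simp
    then show ?thesis using T Lp_norm_nonneg[of p \<alpha> "radial_data j f"] by (simp add: algebra_simps del: Lp_norm_nonneg)
   qed
   finally show "cmod (radial_power M f z) \<le> (1 + E * C) * (cmod (f 0) + Lp_norm p \<alpha> (radial_data j f))" .
  qed
qed

lemma bergman_imp_holomorphic: "f \<in> bergman_space p \<alpha> \<Longrightarrow> f \<in> ball_holomorphic"
  by (simp add: bergman_space_def)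

lemma bergman_order_data:
  fixes f :: "complex^'n \<Rightarrow> complex"
  assumes p: "p \<ge> 1" and f: "f \<in> bergman_space p \<alpha>"
  shows "radial_data (bergman_order p \<alpha>) f \<in> Lp_ball p \<alpha>"
   and "cmod (f 0) \<le> bergman_norm p \<alpha> f"
   and "weight_const TYPE('n) \<alpha> powr (1/p) * Lp_norm p \<alpha> (radial_data (bergman_order p \<alpha>) f) \<le> bergman_norm p \<alpha> f"
proof -
  obtain k where "radial_data k f \<in> Lp_ball p \<alpha>" using f by (auto simp: bergman_space_iff)
  then show "radial_data (bergman_order p \<alpha>) f \<in> Lp_ball p \<alpha>"
   using radial_data_equivalence[OF p bergman_order[OF p], where 'n='n, of k \<alpha>] bergman_imp_holomorphic[OF f] by blast
  show "cmod (f 0) \<le> bergman_norm p \<alpha> f"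
   and "weight_const TYPE('n) \<alpha> powr (1/p) * Lp_norm p \<alpha> (radial_data (bergman_order p \<alpha>) f) \<le> bergman_norm p \<alpha> f"
   using bergman_norm_eq[OF bergman_imp_holomorphic[OF f], of p \<alpha>] by simp_all
qed

lemma bergman_order_sum_le:
  assumes p: "p \<ge> 1"
  shows "\<exists>C>0. \<forall>f \<in> (bergman_space p \<alpha> :: (complex^'n \<Rightarrow> complex) set).
    cmod (f 0) + Lp_norm p \<alpha> (radial_data (bergman_order p \<alpha>) f) \<le> C * bergman_norm p \<alpha> f"
proof -
  define c where "c = weight_const TYPE('n) \<alpha> powr (1/p)"
  have c: "c > 0" using weight_const_pos[where 'n='n, of \<alpha>] by (simp add: c_def)
  show ?thesis
  proof (intro exI[of _ "1 + 1/c"] conjI ballI)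
   show "1 + 1/c > 0" using c by (simp add: add_pos_pos)
   fix f :: "complex^'n \<Rightarrow> complex" assume f: "f \<in> bergman_space p \<alpha>"
   from bergman_order_data(2,3)[OF p f]
   show "cmod (f 0) + Lp_norm p \<alpha> (radial_data (bergman_order p \<alpha>) f) \<le> (1 + 1/c) * bergman_norm p \<alpha> f"
    using c divide_right_mono[OF bergman_order_data(3)[OF p f] less_imp_le[OF c]]
    by (simp add: c_def[symmetric] distrib_right)
  qed
qed

lemma bergman_data_bound:
  assumes p: "p \<ge> 1" and pM: "p * real M + \<alpha> > -1"
  shows "\<exists>C>0. \<forall>f \<in> (bergman_space p \<alpha> :: (complex^'n \<Rightarrow> complex) set).
    radial_data M f \<in> Lp_ball p \<alpha> \<and> Lp_norm p \<alpha> (radial_data M f) \<le> C * bergman_norm p \<alpha> f"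
proof -
  obtain C where C: "C > 0" "\<And>f :: complex^'n \<Rightarrow> complex. f \<in> ball_holomorphic \<Longrightarrow> radial_data (bergman_order p \<alpha>) f \<in> Lp_ball p \<alpha> \<Longrightarrow>
    radial_data M f \<in> Lp_ball p \<alpha> \<and> Lp_norm p \<alpha> (radial_data M f) \<le> C * (cmod (f 0) + Lp_norm p \<alpha> (radial_data (bergman_order p \<alpha>) f))"
   using radial_data_equivalence[OF p pM, where 'n='n] by blast
  obtain D where D: "D > 0" "\<And>f :: complex^'n \<Rightarrow> complex. f \<in> bergman_space p \<alpha> \<Longrightarrow>
    cmod (f 0) + Lp_norm p \<alpha> (radial_data (bergman_order p \<alpha>) f) \<le> D * bergman_norm p \<alpha> f"
   using bergman_order_sum_le[OF p, where 'n='n] by blast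
  show ?thesis
  proof (intro exI[of _ "C * D"] conjI ballI)
   fix f :: "complex^'n \<Rightarrow> complex" assume f: "f \<in> bergman_space p \<alpha>"
   note c = C(2)[OF bergman_imp_holomorphic[OF f] bergman_order_data(1)[OF p f]]
   show "radial_data M f \<in> Lp_ball p \<alpha>" using c by blast
   show "Lp_norm p \<alpha> (radial_data M f) \<le> C * D * bergman_norm p \<alpha> f"
    using order_trans[OF c[THEN conjunct2] mult_left_mono[OF D(2)[OF f]]] C(1) by (simp add: mult.assoc)
  qed (use C D in simp)
qed

lemma bergman_local_bound:
  assumes p: "p \<ge> 1" and r: "r < 1"
  shows "\<exists>C>0. \<forall>f \<in> (bergman_space p \<alpha> :: (complex^'n \<Rightarrow> complex) set).
    \<forall>z. norm z \<le> r \<longrightarrow> cmod (radial_power M f z) \<le> C * bergman_norm p \<alpha> f"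
proof -
  obtain C where C: "C > 0" "\<And>(f :: complex^'n \<Rightarrow> complex) z. f \<in> ball_holomorphic \<Longrightarrow> radial_data (bergman_order p \<alpha>) f \<in> Lp_ball p \<alpha> \<Longrightarrow>
    norm z \<le> r \<Longrightarrow> cmod (radial_power M f z) \<le> C * (cmod (f 0) + Lp_norm p \<alpha> (radial_data (bergman_order p \<alpha>) f))"
   using radial_power_local_bound[OF p r, where 'n='n] by blast
  obtain D where D: "D > 0" "\<And>f :: complex^'n \<Rightarrow> complex. f \<in> bergman_space p \<alpha> \<Longrightarrow>
    cmod (f 0) + Lp_norm p \<alpha> (radial_data (bergman_order p \<alpha>) f) \<le> D * bergman_norm p \<alpha> f"
   using bergman_order_sum_le[OF p, where 'n='n] by blast
  show ?thesis
  proof (intro exI[of _ "C * D"] conjI ballI allI impI)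
   fix f :: "complex^'n \<Rightarrow> complex" and z :: "complex^'n" assume f: "f \<in> bergman_space p \<alpha>" and z: "norm z \<le> r"
   show "cmod (radial_power M f z) \<le> C * D * bergman_norm p \<alpha> f"
    using order_trans[OF C(2)[OF bergman_imp_holomorphic[OF f] bergman_order_data(1)[OF p f] z] mult_left_mono[OF D(2)[OF f]]] C(1)
    by (simp add: mult.assoc)
  qed (use C D in simp)
qed

text \<open>Membership and norm may be tested with any admissible number of derivatives; this allows the
  same number to be used for several spaces.\<close>

lemma bergman_from_data:
  assumes p: "p \<ge> 1" and pM: "p * real M + \<alpha> > -1"
  shows "\<exists>C>0. \<forall>f \<in> (ball_holomorphic :: (complex^'n \<Rightarrow> complex) set). radial_data M f \<in> Lp_ball p \<alpha> \<longrightarrow>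
    f \<in> bergman_space p \<alpha> \<and> bergman_norm p \<alpha> f \<le> C * (cmod (f 0) + Lp_norm p \<alpha> (radial_data M f))"
proof -
  obtain C where C: "C > 0" "\<And>f :: complex^'n \<Rightarrow> complex. f \<in> ball_holomorphic \<Longrightarrow> radial_data M f \<in> Lp_ball p \<alpha> \<Longrightarrow>
    Lp_norm p \<alpha> (radial_data (bergman_order p \<alpha>) f) \<le> C * (cmod (f 0) + Lp_norm p \<alpha> (radial_data M f))"
   using radial_data_equivalence[OF p bergman_order[OF p], where 'n='n] by blast
  define c where "c = weight_const TYPE('n) \<alpha> powr (1/p)"
  have c: "c > 0" using weight_const_pos[where 'n='n, of \<alpha>] by (simp add: c_def)
  show ?thesis
  proof (intro exI[of _ "1 + c * C"] conjI ballI impI)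
   show "1 + c * C > 0" using c C(1) by (simp add: add_pos_pos)
   fix f :: "complex^'n \<Rightarrow> complex" assume f: "f \<in> ball_holomorphic" and d: "radial_data M f \<in> Lp_ball p \<alpha>"
   show "f \<in> bergman_space p \<alpha>" unfolding bergman_space_iff using f d pM by blast
   have "bergman_norm p \<alpha> f \<le> cmod (f 0) + c * (C * (cmod (f 0) + Lp_norm p \<alpha> (radial_data M f)))"
    unfolding bergman_norm_eq[OF f] c_def[symmetric] using c by (intro add_left_mono mult_left_mono C(2)[OF f d]) simp
   then show "bergman_norm p \<alpha> f \<le> (1 + c * C) * (cmod (f 0) + Lp_norm p \<alpha> (radial_data M f))"
    using Lp_norm_nonneg[of p \<alpha> "radial_data M f"] by (simp add: algebra_simps del: Lp_norm_nonneg)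
  qed
qed

definition ball_constant :: "complex \<Rightarrow> complex^'n \<Rightarrow> complex" where
  "ball_constant c z = (if norm z < 1 then c else 0)"

lemma ball_constant_holomorphic: "ball_constant c \<in> ball_holomorphic"
proof -
  have "(ball_constant c has_derivative (\<lambda>_. 0)) (at z)" if "norm z < 1" for z :: "complex^'n"
  proof (rule has_derivative_transform_within_open[of "\<lambda>_. c" _ _ _ "ball 0 1"])
   show "((\<lambda>_ :: complex^'n. c) has_derivative (\<lambda>_. 0)) (at z)" by simp
  qed (use that in \<open>auto simp: ball_constant_def\<close>)
  then show ?thesis unfolding ball_holomorphic_def
   by (auto intro!: exI[of _ "\<lambda>_. 0"] simp: ball_constant_def)
qed

lemma radial_power_ball_constant:
  assumes "norm z < 1" shows "radial_power m (ball_constant c) z = (if m = 0 then c else 0)"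
proof -
  have hp: "hom_part (ball_constant c) k z = (if k = 0 then c else 0)" for k
   by (rule hom_part_series[where P = "\<lambda>k _. if k = 0 then c else 0"])
    (use sums_single[of 0 "\<lambda>_. c"] in \<open>auto simp: ball_constant_def\<close>)
  have "(\<lambda>k. if k = 0 then (if m = 0 then c else 0) else 0) sums (if m = 0 then c else 0)"
   using sums_single[of 0 "\<lambda>_. if m = 0 then c else 0"] by simp
  also have "(\<lambda>k. if k = 0 then (if m = 0 then c else 0) else 0) = (\<lambda>k. of_nat k ^ m * hom_part (ball_constant c) k z)"
   by (auto simp: hp fun_eq_iff)
  finally show ?thesis using assms by (simp add: radial_power_def sums_iff)
qed

text \<open>For large \<open>b\<close> a left inverse of \<open>f \<mapsto> (f 0, radial_data N f)\<close>. Through it every question on Bergman spaces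
  becomes one on weighted \<open>L\<^sup>p\<close> spaces.\<close>

definition bergman_operator :: "nat \<Rightarrow> nat \<Rightarrow> complex \<Rightarrow> (complex^'n \<Rightarrow> complex) \<Rightarrow> complex^'n \<Rightarrow> complex" where
  "bergman_operator b N c \<phi> z = ball_constant c z +
    kernel_transform (repr_coeff TYPE('n) b N 0) (weighted b \<phi>) z"

text \<open>The data of order \<open>bergman_order p \<alpha>\<close> of the result is \<open>c\<close>, if that order is \<open>0\<close>, plus a
  bounded transform of \<open>\<phi>\<close>. The order \<open>N\<close> that the operator inverts is arbitrary, which is
  essential: one operator acts on both endpoint spaces and on the intermediate one.\<close>

theorem bergman_operator_bounded:
  assumes p: "p \<ge> 1" and b: "real b > \<alpha> + real (bergman_order p \<alpha>) * (p - 1)"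
  shows "\<exists>C>0. \<forall>\<phi> \<in> (Lp_ball p \<alpha> :: (complex^'n \<Rightarrow> complex) set). \<forall>c.
   bergman_operator b N c \<phi> \<in> bergman_space p \<alpha> \<and> bergman_norm p \<alpha> (bergman_operator b N c \<phi>) \<le> C * (cmod c + Lp_norm p \<alpha> \<phi>)"
proof -
  define M where "M = bergman_order p \<alpha>"
  have pM: "p * real M + \<alpha> > -1" unfolding M_def by (rule bergman_order[OF p])
  obtain C where C: "C > 0" "\<And>\<phi> :: complex^'n \<Rightarrow> complex. \<phi> \<in> Lp_ball p \<alpha> \<Longrightarrow>
   (\<lambda>z. of_real (rho z ^ M) * kernel_transform (repr_coeff TYPE('n) b N M) (weighted b \<phi>) z) \<in> Lp_ball p \<alpha> \<and>
   Lp_norm p \<alpha> (\<lambda>z. of_real (rho z ^ M) * kernel_transform (repr_coeff TYPE('n) b N M) (weighted b \<phi>) z) \<le> C * Lp_norm p \<alpha> \<phi> \<and>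
   integrable \<nu> (weighted b \<phi>)"
   using kernel_transform_bounded[OF p pM b[folded M_def], where 'n='n, of N] by blast
  obtain E where E: "E > 0" "\<And>f :: complex^'n \<Rightarrow> complex. f \<in> ball_holomorphic \<Longrightarrow> radial_data M f \<in> Lp_ball p \<alpha> \<Longrightarrow>
    f \<in> bergman_space p \<alpha> \<and> bergman_norm p \<alpha> f \<le> E * (cmod (f 0) + Lp_norm p \<alpha> (radial_data M f))"
   using bergman_from_data[OF p pM, where 'n='n] by blast
  define K where "K = Lp_norm p \<alpha> (\<lambda>_ :: complex^'n. 1)"
  have K: "K \<ge> 0" by (simp add: K_def)
  define H where "H = E * (1 + 2 * (K + C))"
  have H: "H > 0" using E(1) K C(1) by (simp add: H_def add_pos_nonneg)
  show ?thesis
  proof (intro exI[of _ H] ballI allI conjI)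
   show "H > 0" by (rule H)
   fix \<phi> :: "complex^'n \<Rightarrow> complex" and c assume \<phi>: "\<phi> \<in> Lp_ball p \<alpha>"
   define F where "F = kernel_transform (repr_coeff TYPE('n) b N 0) (weighted b \<phi>)"
   define f where "f z = ball_constant c z + F z" for z
   have int: "integrable \<nu> (weighted b \<phi>)" using C(2)[OF \<phi>] by blast
   have F: "F \<in> ball_holomorphic" unfolding F_def by (rule kernel_transform_holomorphic(1)[OF int repr_coeff_order])
   have f: "f \<in> ball_holomorphic"
    using ball_holomorphic_lincomb[OF ball_constant_holomorphic F, of 1 c 1] by (simp add: f_def[abs_def])
   have F0: "F 0 = 0"
   proof -
    have "(\<Sum>k. repr_coeff TYPE('n) b N 0 k * cdot 0 w ^ k) = repr_coeff TYPE('n) b N 0 0" for w :: "complex^'n"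
     using powser_zero[of "repr_coeff TYPE('n) b N 0"] by simp
    then show ?thesis by (simp add: F_def kernel_transform_def repr_coeff_def)
   qed
   have f0: "f 0 = c" by (simp add: f_def F0 ball_constant_def)
   define T where "T z = of_real (rho z ^ M) * kernel_transform (repr_coeff TYPE('n) b N M) (weighted b \<phi>) z" for z
   have T: "T \<in> Lp_ball p \<alpha>" "Lp_norm p \<alpha> T \<le> C * Lp_norm p \<alpha> \<phi>"
    using C(2)[OF \<phi>] by (auto simp: T_def[abs_def])
   have rep: "radial_data M f z = (if M = 0 then c else 0) + T z" if z: "norm z < 1" for z
   proof -
    have "radial_power M f z = radial_power M (ball_constant c) z + radial_power M F z"
     using radial_power_lincomb[OF ball_constant_holomorphic F, of M 1 c 1 z] by (simp add: f_def[abs_def])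
    also have "\<dots> = (if M = 0 then c else 0) + kernel_transform (repr_coeff TYPE('n) b N M) (weighted b \<phi>) z"
     using radial_power_kernel_transform[OF int z, of M b N 0] by (simp add: radial_power_ball_constant[OF z] F_def)
    finally show ?thesis by (auto simp: radial_data_def T_def distrib_left)
   qed
   have "(\<lambda>z. (if M = 0 then c else 0) + T z) \<in> Lp_ball p \<alpha> \<and> Lp_norm p \<alpha> (\<lambda>z. (if M = 0 then c else 0) + T z) \<le> 2 * (K + C) * (cmod c + Lp_norm p \<alpha> \<phi>)"
   proof (cases "M = 0")
    case True
    then have "\<alpha> > -1" using pM by simp
    then have 1: "(\<lambda>_. 1) \<in> (Lp_ball p \<alpha> :: (complex^'n \<Rightarrow> complex) set)" by (rule Lp_ball_const)
    have 2: "(\<lambda>_. c) \<in> (Lp_ball p \<alpha> :: (complex^'n \<Rightarrow> complex) set)" "Lp_norm p \<alpha> (\<lambda>_ :: complex^'n. c) = cmod c * K"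
     using Lp_ball_scale[OF _ 1, of c] p by (simp_all add: K_def)
    have "Lp_norm p \<alpha> (\<lambda>z. c + T z) \<le> 2 * (cmod c * K + C * Lp_norm p \<alpha> \<phi>)"
     using Lp_ball_add(2)[OF p 2(1) T(1)] T(2) 2(2) by simp
    also have "\<dots> \<le> 2 * (K + C) * (cmod c + Lp_norm p \<alpha> \<phi>)"
     using K C(1) by (simp add: algebra_simps)
    finally show ?thesis using True Lp_ball_add(1)[OF p 2(1) T(1)] by simp
   next
    case False
    have "C * Lp_norm p \<alpha> \<phi> \<le> 2 * (K + C) * (cmod c + Lp_norm p \<alpha> \<phi>)"
     using K C(1) by (simp add: algebra_simps)
    then show ?thesis using False T by simp
   qed
   then have d: "radial_data M f \<in> Lp_ball p \<alpha>" "Lp_norm p \<alpha> (radial_data M f) \<le> 2 * (K + C) * (cmod c + Lp_norm p \<alpha> \<phi>)"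
    using Lp_ball_cong[of "radial_data M f" "\<lambda>z. (if M = 0 then c else 0) + T z" p \<alpha>, OF rep] by simp_all
   have "bergman_norm p \<alpha> f \<le> E * (cmod c + Lp_norm p \<alpha> (radial_data M f))" using E(2)[OF f d(1)] f0 by simp
   also have "\<dots> \<le> E * (cmod c + 2 * (K + C) * (cmod c + Lp_norm p \<alpha> \<phi>))" using E(1) d(2) by simp
   also have "\<dots> \<le> H * (cmod c + Lp_norm p \<alpha> \<phi>)" using E(1) by (simp add: H_def algebra_simps)
   finally have "bergman_norm p \<alpha> f \<le> H * (cmod c + Lp_norm p \<alpha> \<phi>)" .
   moreover have "f \<in> bergman_space p \<alpha>" using E(2)[OF f d(1)] by blast
   moreover have "f = bergman_operator b N c \<phi>" by (simp add: fun_eq_iff f_def F_def bergman_operator_def)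
   ultimately show "bergman_operator b N c \<phi> \<in> bergman_space p \<alpha>"
    "bergman_norm p \<alpha> (bergman_operator b N c \<phi>) \<le> H * (cmod c + Lp_norm p \<alpha> \<phi>)" by auto
  qed
qed

section \<open>Analytic families through the Bergman operator\<close>

lemma kernel_transform_lincomb:
  fixes \<Phi> \<Psi> :: "complex^'n \<Rightarrow> complex"
  assumes \<Phi>: "integrable \<nu> \<Phi>" and \<Psi>: "integrable \<nu> \<Psi>" and h: "kernel_order h \<sigma>"
  shows "kernel_transform h (\<lambda>w. a * \<Phi> w + a' * \<Psi> w) z = a * kernel_transform h \<Phi> z + a' * kernel_transform h \<Psi> z"
proof (cases "norm z < 1")
  case True
  have int: "integrable \<nu> (\<lambda>w. a * \<Phi> w + a' * \<Psi> w)" using \<Phi> \<Psi> by simp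
  have eq: "(\<integral>w. (a * \<Phi> w + a' * \<Psi> w) * cdot z w ^ k \<partial>\<nu>) =
    a * (\<integral>w. \<Phi> w * cdot z w ^ k \<partial>\<nu>) + a' * (\<integral>w. \<Psi> w * cdot z w ^ k \<partial>\<nu>)" for k
  proof -
   have "(\<integral>w. (a * \<Phi> w + a' * \<Psi> w) * cdot z w ^ k \<partial>\<nu>) =
    (\<integral>w. a * (\<Phi> w * cdot z w ^ k) + a' * (\<Psi> w * cdot z w ^ k) \<partial>\<nu>)"
    by (simp add: algebra_simps)
   then show ?thesis
    using kernel_transform_sums(2)[OF \<Phi> h True, of k] kernel_transform_sums(2)[OF \<Psi> h True, of k] by simp
  qed
  have "(\<lambda>k. h k * (\<integral>w. (a * \<Phi> w + a' * \<Psi> w) * cdot z w ^ k \<partial>\<nu>)) sums (a * kernel_transform h \<Phi> z + a' * kernel_transform h \<Psi> z)"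
   using sums_add[OF sums_mult[OF kernel_transform_sums(1)[OF \<Phi> h True], of a] sums_mult[OF kernel_transform_sums(1)[OF \<Psi> h True], of a']]
   by (simp only: eq) (simp add: algebra_simps)
  then show ?thesis using kernel_transform_sums(1)[OF int h True] by (rule sums_unique2[symmetric])
qed (simp add: kernel_transform_def)

lemma bergman_operator_lincomb:
  fixes \<phi> \<psi> :: "complex^'n \<Rightarrow> complex"
  assumes "integrable \<nu> (weighted b \<phi>)" "integrable \<nu> (weighted b \<psi>)"
  shows "bergman_operator b N (a * c + a' * c') (\<lambda>w. a * \<phi> w + a' * \<psi> w) z =
    a * bergman_operator b N c \<phi> z + a' * bergman_operator b N c' \<psi> z"
proof -
  have "kernel_transform (repr_coeff TYPE('n) b N 0) (\<lambda>w. of_real (rho w ^ b) * (a * \<phi> w + a' * \<psi> w)) z =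
   kernel_transform (repr_coeff TYPE('n) b N 0) (\<lambda>w. a * (of_real (rho w ^ b) * \<phi> w) + a' * (of_real (rho w ^ b) * \<psi> w)) z"
   by (simp add: algebra_simps)
  also have "\<dots> = a * kernel_transform (repr_coeff TYPE('n) b N 0) (weighted b \<phi>) z +
   a' * kernel_transform (repr_coeff TYPE('n) b N 0) (weighted b \<psi>) z"
   by (rule kernel_transform_lincomb[OF assms repr_coeff_order])
  finally show ?thesis by (simp add: bergman_operator_def ball_constant_def algebra_simps)
qed

lemma Lp_norm_dominated_tendsto:
  fixes \<psi> :: "complex \<Rightarrow> complex^'n \<Rightarrow> complex"
  assumes p: "p > 0" and A: "A \<in> Lp_ball p \<alpha>"
   and meas: "\<And>w. w \<in> S - {\<zeta>} \<Longrightarrow> \<psi> w \<in> borel_measurable \<nu>"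
   and le: "\<And>w z. w \<in> S - {\<zeta>} \<Longrightarrow> norm z < 1 \<Longrightarrow> cmod (\<psi> w z) \<le> K * cmod (A z)"
   and lim: "\<And>z. norm z < 1 \<Longrightarrow> ((\<lambda>w. \<psi> w z) \<longlongrightarrow> 0) (at \<zeta> within S)"
  shows "((\<lambda>w. Lp_norm p \<alpha> (\<psi> w)) \<longlongrightarrow> 0) (at \<zeta> within S)"
  unfolding tendsto_at_iff_sequentially comp_def
proof (intro allI impI)
  fix X :: "nat \<Rightarrow> complex" assume X: "\<forall>i. X i \<in> S - {\<zeta>}" "X \<longlonglongrightarrow> \<zeta>"
  have Am [measurable]: "A \<in> borel_measurable \<nu>" using A by (rule Lp_ball_measurable)
  have [measurable]: "\<psi> (X i) \<in> borel_measurable \<nu>" for i using meas X by blast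
  have KA: "(\<lambda>w. of_real (max K 0) * A w) \<in> Lp_ball p \<alpha>" by (rule Lp_ball_scale(1)[OF p A])
  have "(\<lambda>i. \<integral>z. cmod (\<psi> (X i) z) powr p * rho z powr \<alpha> \<partial>\<nu>) \<longlonglongrightarrow> (\<integral>z. 0 \<partial>(\<nu> :: (complex^'n) measure))"
  proof (rule integral_dominated_convergence[OF _ _ Lp_ball_integrable[OF KA]])
   show "AE z in \<nu>. (\<lambda>i. cmod (\<psi> (X i) z) powr p * rho z powr \<alpha>) \<longlonglongrightarrow> 0"
   proof (rule AE_I2)
    fix z :: "complex^'n" assume "z \<in> space \<nu>"
    then have "((\<lambda>w. \<psi> w z) \<longlongrightarrow> 0) (at \<zeta> within S)" by (intro lim) simp
    then have "(\<lambda>i. \<psi> (X i) z) \<longlonglongrightarrow> 0" using X unfolding tendsto_at_iff_sequentially comp_def by blast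
    then have "(\<lambda>i. cmod (\<psi> (X i) z)) \<longlonglongrightarrow> 0" by (rule tendsto_norm_zero)
    then have "(\<lambda>i. cmod (\<psi> (X i) z) powr p) \<longlonglongrightarrow> 0" using p by (intro tendsto_zero_powrI[OF _ tendsto_const]) auto
    then show "(\<lambda>i. cmod (\<psi> (X i) z) powr p * rho z powr \<alpha>) \<longlonglongrightarrow> 0" by (rule tendsto_mult_left_zero)
   qed
   show "AE z in \<nu>. norm (cmod (\<psi> (X i) z) powr p * rho z powr \<alpha>) \<le> cmod (of_real (max K 0) * A z) powr p * rho z powr \<alpha>" for i
   proof (rule AE_I2)
    fix z :: "complex^'n" assume "z \<in> space \<nu>"
    then have z: "norm z < 1" by simp
    have "cmod (\<psi> (X i) z) \<le> K * cmod (A z)" using X(1) z by (intro le) auto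
    also have "\<dots> \<le> max K 0 * cmod (A z)" by (intro mult_right_mono) auto
    finally have "cmod (\<psi> (X i) z) \<le> cmod (of_real (max K 0) * A z)" by (simp add: norm_mult)
    then have "cmod (\<psi> (X i) z) powr p * rho z powr \<alpha> \<le> cmod (of_real (max K 0) * A z) powr p * rho z powr \<alpha>"
     using p by (intro mult_right_mono powr_mono2) auto
    then show "norm (cmod (\<psi> (X i) z) powr p * rho z powr \<alpha>) \<le> cmod (of_real (max K 0) * A z) powr p * rho z powr \<alpha>" by simp
   qed
  qed measurable
  then have "(\<lambda>i. \<integral>z. cmod (\<psi> (X i) z) powr p * rho z powr \<alpha> \<partial>\<nu>) \<longlonglongrightarrow> 0" by simp
  then show "(\<lambda>i. Lp_norm p \<alpha> (\<psi> (X i))) \<longlonglongrightarrow> 0"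
   unfolding Lp_norm_def using p Lp_integral_nonneg by (intro tendsto_zero_powrI[OF _ tendsto_const]) auto
qed

lemma sum_norm_bdd_below:
  fixes nX nY :: "('a \<Rightarrow> complex) \<Rightarrow> real"
  assumes "\<And>f. nX f \<ge> 0" "\<And>f. nY f \<ge> 0"
  shows "bdd_below {nX g + nY h | g h. g \<in> X \<and> h \<in> Y \<and> f = (\<lambda>z. g z + h z)}"
  using assms by (intro bdd_belowI[of _ 0]) (auto intro!: add_nonneg_nonneg)

lemma sum_norm_le:
  assumes "\<And>f. nX f \<ge> 0" "\<And>f. nY f \<ge> 0" "g \<in> X" "h \<in> Y" "f = (\<lambda>z. g z + h z)"
  shows "sum_norm X nX Y nY f \<le> nX g + nY h"
  unfolding sum_norm_def using assms by (intro cInf_lower sum_norm_bdd_below) auto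

lemma sum_norm_nonneg:
  assumes "\<And>f. nX f \<ge> 0" "\<And>f. nY f \<ge> 0" "f \<in> sum_space X Y"
  shows "sum_norm X nX Y nY f \<ge> 0"
  unfolding sum_norm_def using assms by (intro cInf_greatest) (auto simp: sum_space_def intro!: add_nonneg_nonneg)

text \<open>On a boundary line the modulus of the family does not depend on the parameter, so its \<open>L\<^sup>p\<close> norm
  is constant there, and continuity is dominated convergence.\<close>

lemma operator_family_on_line:
  fixes \<phi> :: "complex \<Rightarrow> complex^'n \<Rightarrow> complex"
  assumes q: "q \<ge> 1" and C: "C > 0"
   and op: "\<And>(\<phi> :: complex^'n \<Rightarrow> complex) c. \<phi> \<in> Lp_ball q a \<Longrightarrow> bergman_operator b N c \<phi> \<in> bergman_space q a \<and>
    bergman_norm q a (bergman_operator b N c \<phi>) \<le> C * (cmod c + Lp_norm q a \<phi>)"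
   and A: "(\<lambda>w. complex_of_real (A w)) \<in> Lp_ball q a" "\<And>w. A w \<ge> 0"
   and m: "\<And>\<zeta>. \<phi> \<zeta> \<in> borel_measurable \<nu>" and eq: "\<And>\<zeta> z. \<zeta> \<in> S \<Longrightarrow> cmod (\<phi> \<zeta> z) = A z"
   and diff: "\<And>\<zeta> w. \<zeta> \<in> S \<Longrightarrow> \<zeta> \<in> S \<Longrightarrow> w \<in> S \<Longrightarrow> w \<in> S \<Longrightarrow>
    (\<lambda>z. F w z - F \<zeta> z) = bergman_operator b N 0 (\<lambda>z. \<phi> w z - \<phi> \<zeta> z)"
   and F: "\<And>\<zeta>. F \<zeta> = bergman_operator b N c (\<phi> \<zeta>)"
   and lim: "\<And>z \<zeta>. ((\<lambda>w. \<phi> w z - \<phi> \<zeta> z) \<longlongrightarrow> 0) (at \<zeta> within S)"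
  shows "bdd_cont_into S (bergman_space q a) (bergman_norm q a) F"
   and "\<zeta> \<in> S \<Longrightarrow> bergman_norm q a (F \<zeta>) \<le> C * (cmod c + Lp_norm q a (\<lambda>w. complex_of_real (A w)))"
proof -
  note [measurable] = m
  have mem: "\<phi> \<zeta> \<in> Lp_ball q a" "Lp_norm q a (\<phi> \<zeta>) \<le> Lp_norm q a (\<lambda>w. complex_of_real (A w))" if "\<zeta> \<in> S" for \<zeta>
   using Lp_ball_mono[OF _ A(1) m] q eq[OF that] A(2) by auto
  have bound: "bergman_norm q a (F \<zeta>) \<le> C * (cmod c + Lp_norm q a (\<lambda>w. complex_of_real (A w)))" if "\<zeta> \<in> S" for \<zeta>
   using op[OF mem(1)[OF that], of c] mem(2)[OF that] mult_left_mono[of "cmod c + Lp_norm q a (\<phi> \<zeta>)" "cmod c + Lp_norm q a (\<lambda>w. complex_of_real (A w))" C] C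
   unfolding F by linarith
  then show "\<zeta> \<in> S \<Longrightarrow> bergman_norm q a (F \<zeta>) \<le> C * (cmod c + Lp_norm q a (\<lambda>w. complex_of_real (A w)))" .
  show "bdd_cont_into S (bergman_space q a) (bergman_norm q a) F"
   unfolding bdd_cont_into_def
  proof (intro conjI ballI)
   fix \<zeta> assume z: "\<zeta> \<in> S"
   show "F \<zeta> \<in> bergman_space q a" unfolding F using op[OF mem(1)[OF z]] by blast
   have L: "((\<lambda>w. Lp_norm q a (\<lambda>z. \<phi> w z - \<phi> \<zeta> z)) \<longlongrightarrow> 0) (at \<zeta> within S)"
   proof (rule Lp_norm_dominated_tendsto[OF _ A(1), of _ _ _ 2])
    fix w z assume "w \<in> S - {\<zeta>}"
    then show "cmod (\<phi> w z - \<phi> \<zeta> z) \<le> 2 * cmod (complex_of_real (A z))"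
     using norm_triangle_ineq4[of "\<phi> w z" "\<phi> \<zeta> z"] eq[of w z] eq[OF z, of z] A(2)[of z] by simp
   qed (use q lim in auto)
   have "((\<lambda>w. C * (cmod 0 + Lp_norm q a (\<lambda>z. \<phi> w z - \<phi> \<zeta> z))) \<longlongrightarrow> 0) (at \<zeta> within S)"
    using L by (auto intro!: tendsto_eq_intros)
   then show "((\<lambda>w. bergman_norm q a (\<lambda>z. F w z - F \<zeta> z)) \<longlongrightarrow> 0) (at \<zeta> within S)"
   proof (rule Lim_null_comparison[rotated])
    have "norm (bergman_norm q a (\<lambda>z. F w z - F \<zeta> z)) \<le> C * (cmod 0 + Lp_norm q a (\<lambda>z. \<phi> w z - \<phi> \<zeta> z))" if w: "w \<in> S" for w
    proof -
     have "(\<lambda>z. \<phi> w z + (-1) * \<phi> \<zeta> z) \<in> Lp_ball q a"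
      using q by (intro Lp_ball_add(1) Lp_ball_scale(1) mem w z) auto
     then have "(\<lambda>z. \<phi> w z - \<phi> \<zeta> z) \<in> Lp_ball q a" by simp
     from op[OF this, of 0] show ?thesis using diff[OF z z w w] by (simp add: abs_of_nonneg[OF bergman_norm_nonneg])
    qed
    then show "\<forall>\<^sub>F w in at \<zeta> within S. norm (bergman_norm q a (\<lambda>z. F w z - F \<zeta> z)) \<le> C * (cmod 0 + Lp_norm q a (\<lambda>z. \<phi> w z - \<phi> \<zeta> z))"
     by (simp add: eventually_at_filter)
   qed
  qed (use bound in blast)
qed

text \<open>Two endpoint spaces with a common operator that is bounded from the respective \<open>L\<^sup>p\<close> spaces; both
  bounds carry the same constant.\<close>

locale bergman_couple =
  fixes p0 p1 \<alpha> \<beta> C :: real and b N :: nat and ty :: "'n::finite itself"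
  assumes p0: "p0 \<ge> 1" and p1: "p1 \<ge> 1" and b0: "real b \<ge> \<alpha>" and b1: "real b \<ge> \<beta>" and C: "C > 0"
   and op0: "\<And>(\<phi> :: complex^'n \<Rightarrow> complex) c. \<phi> \<in> Lp_ball p0 \<alpha> \<Longrightarrow>
    bergman_operator b N c \<phi> \<in> bergman_space p0 \<alpha> \<and>
    bergman_norm p0 \<alpha> (bergman_operator b N c \<phi>) \<le> C * (cmod c + Lp_norm p0 \<alpha> \<phi>)"
   and op1: "\<And>(\<phi> :: complex^'n \<Rightarrow> complex) c. \<phi> \<in> Lp_ball p1 \<beta> \<Longrightarrow>
    bergman_operator b N c \<phi> \<in> bergman_space p1 \<beta> \<and>
    bergman_norm p1 \<beta> (bergman_operator b N c \<phi>) \<le> C * (cmod c + Lp_norm p1 \<beta> \<phi>)"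
begin

abbreviation "X \<equiv> (bergman_space p0 \<alpha> :: (complex^'n \<Rightarrow> complex) set)"
abbreviation "Y \<equiv> (bergman_space p1 \<beta> :: (complex^'n \<Rightarrow> complex) set)"
abbreviation "nX \<equiv> (bergman_norm p0 \<alpha> :: (complex^'n \<Rightarrow> complex) \<Rightarrow> real)"
abbreviation "nY \<equiv> (bergman_norm p1 \<beta> :: (complex^'n \<Rightarrow> complex) \<Rightarrow> real)"
abbreviation "T \<equiv> (bergman_operator b N :: complex \<Rightarrow> (complex^'n \<Rightarrow> complex) \<Rightarrow> complex^'n \<Rightarrow> complex)"

lemma integrable0: "\<phi> \<in> Lp_ball p0 \<alpha> \<Longrightarrow> integrable \<nu> (\<lambda>w :: complex^'n. of_real (rho w ^ b) * \<phi> w)"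
  using Lp_imp_L1[OF p0 b0, where 'n='n] by blast

lemma integrable1: "\<phi> \<in> Lp_ball p1 \<beta> \<Longrightarrow> integrable \<nu> (\<lambda>w :: complex^'n. of_real (rho w ^ b) * \<phi> w)"
  using Lp_imp_L1[OF p1 b1, where 'n='n] by blast

text \<open>A function dominated by the larger of two majorants is cut along the set where the first
  majorant wins.\<close>

lemma split_dominated:
  fixes A0 A1 :: "complex^'n \<Rightarrow> real"
  assumes A0: "(\<lambda>w. complex_of_real (A0 w)) \<in> Lp_ball p0 \<alpha>" and A1: "(\<lambda>w. complex_of_real (A1 w)) \<in> Lp_ball p1 \<beta>"
   and nonneg: "\<And>w. A0 w \<ge> 0" "\<And>w. A1 w \<ge> 0" and K: "K \<ge> 0"
   and [measurable]: "A0 \<in> borel_measurable \<nu>" "A1 \<in> borel_measurable \<nu>" "\<psi> \<in> borel_measurable \<nu>"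
   and le: "\<And>w. norm w < 1 \<Longrightarrow> cmod (\<psi> w) \<le> K * max (A0 w) (A1 w)"
  defines "\<psi>0 \<equiv> \<lambda>w. if A1 w \<le> A0 w then \<psi> w else 0" and "\<psi>1 \<equiv> \<lambda>w. if A1 w \<le> A0 w then 0 else \<psi> w"
  shows "\<psi>0 \<in> Lp_ball p0 \<alpha>" "Lp_norm p0 \<alpha> \<psi>0 \<le> K * Lp_norm p0 \<alpha> (\<lambda>w. complex_of_real (A0 w))"
   and "\<psi>1 \<in> Lp_ball p1 \<beta>" "Lp_norm p1 \<beta> \<psi>1 \<le> K * Lp_norm p1 \<beta> (\<lambda>w. complex_of_real (A1 w))"
   and "T c \<psi> = (\<lambda>z. T c \<psi>0 z + T 0 \<psi>1 z)" "integrable \<nu> (weighted b \<psi>)"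
   and "\<And>w. norm w < 1 \<Longrightarrow> cmod (\<psi>0 w) \<le> K * A0 w" "\<And>w. norm w < 1 \<Longrightarrow> cmod (\<psi>1 w) \<le> K * A1 w"
proof -
  have [measurable]: "\<psi>0 \<in> borel_measurable \<nu>" "\<psi>1 \<in> borel_measurable \<nu>"
   unfolding \<psi>0_def \<psi>1_def by measurable
  show l0: "cmod (\<psi>0 w) \<le> K * A0 w" if "norm w < 1" for w
   using le[OF that] nonneg(1)[of w] K by (cases "A1 w \<le> A0 w") (simp_all add: \<psi>0_def max_absorb1)
  show l1: "cmod (\<psi>1 w) \<le> K * A1 w" if "norm w < 1" for w
   using le[OF that] nonneg(2)[of w] K by (cases "A1 w \<le> A0 w") (simp_all add: \<psi>1_def max_absorb2)
  have K0: "(\<lambda>w. complex_of_real K * complex_of_real (A0 w)) \<in> Lp_ball p0 \<alpha>" "(\<lambda>w. complex_of_real K * complex_of_real (A1 w)) \<in> Lp_ball p1 \<beta>"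
   using p0 p1 by (auto intro!: Lp_ball_scale A0 A1)
  have n0: "cmod (\<psi>0 w) \<le> cmod (complex_of_real K * complex_of_real (A0 w))" if "norm w < 1" for w
   using l0[OF that] nonneg[of w] K by (simp add: norm_mult)
  have n1: "cmod (\<psi>1 w) \<le> cmod (complex_of_real K * complex_of_real (A1 w))" if "norm w < 1" for w
   using l1[OF that] nonneg[of w] K by (simp add: norm_mult)
  show m0: "\<psi>0 \<in> Lp_ball p0 \<alpha>" by (rule Lp_ball_mono(1)[OF _ K0(1) _ n0]) (use p0 in auto)
  show m1: "\<psi>1 \<in> Lp_ball p1 \<beta>" by (rule Lp_ball_mono(1)[OF _ K0(2) _ n1]) (use p1 in auto)
  show "Lp_norm p0 \<alpha> \<psi>0 \<le> K * Lp_norm p0 \<alpha> (\<lambda>w. complex_of_real (A0 w))"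
   using Lp_ball_mono(2)[OF _ K0(1) _ n0] Lp_ball_scale(2)[OF _ A0, of "of_real K"] p0 K by simp
  show "Lp_norm p1 \<beta> \<psi>1 \<le> K * Lp_norm p1 \<beta> (\<lambda>w. complex_of_real (A1 w))"
   using Lp_ball_mono(2)[OF _ K0(2) _ n1] Lp_ball_scale(2)[OF _ A1, of "of_real K"] p1 K by simp
  have eq: "\<psi> = (\<lambda>w. 1 * \<psi>0 w + 1 * \<psi>1 w)" by (auto simp: \<psi>0_def \<psi>1_def)
  show "T c \<psi> = (\<lambda>z. T c \<psi>0 z + T 0 \<psi>1 z)"
   using bergman_operator_lincomb[OF integrable0[OF m0] integrable1[OF m1], of N 1 c 1 0] eq by auto
  have "integrable \<nu> (\<lambda>w. of_real (rho w ^ b) * \<psi>0 w + of_real (rho w ^ b) * \<psi>1 w)"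
   by (intro Bochner_Integration.integrable_add integrable0 integrable1 m0 m1)
  then show "integrable \<nu> (weighted b \<psi>)" by (subst eq) (simp add: distrib_left)
qed

text \<open>The decomposition that witnesses membership in the sum space depends on the majorants only and
  not on the parameter of a family.\<close>

lemma sum_norm_operator:
  fixes A0 A1 :: "complex^'n \<Rightarrow> real"
  assumes A0: "(\<lambda>w. complex_of_real (A0 w)) \<in> Lp_ball p0 \<alpha>" and A1: "(\<lambda>w. complex_of_real (A1 w)) \<in> Lp_ball p1 \<beta>"
   and nonneg: "\<And>w. A0 w \<ge> 0" "\<And>w. A1 w \<ge> 0" and K: "K \<ge> 0"
   and m: "A0 \<in> borel_measurable \<nu>" "A1 \<in> borel_measurable \<nu>" "\<psi> \<in> borel_measurable \<nu>"
   and le: "\<And>w. norm w < 1 \<Longrightarrow> cmod (\<psi> w) \<le> K * max (A0 w) (A1 w)"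
  shows "T c \<psi> \<in> sum_space X Y"
   and "sum_norm X nX Y nY (T c \<psi>) \<le> C * (cmod c + Lp_norm p0 \<alpha> (\<lambda>w. if A1 w \<le> A0 w then \<psi> w else 0)
     + Lp_norm p1 \<beta> (\<lambda>w. if A1 w \<le> A0 w then 0 else \<psi> w))"
proof -
  note s = split_dominated[OF A0 A1 nonneg K m le]
  note o0 = op0[OF s(1), of c] and o1 = op1[OF s(3), of 0]
  show "T c \<psi> \<in> sum_space X Y" unfolding sum_space_def using o0 o1 s(5)[of c] by blast
  have "sum_norm X nX Y nY (T c \<psi>) \<le> nX (T c (\<lambda>w. if A1 w \<le> A0 w then \<psi> w else 0)) + nY (T 0 (\<lambda>w. if A1 w \<le> A0 w then 0 else \<psi> w))"
   using o0 o1 by (intro sum_norm_le s(5)) (auto simp: bergman_norm_nonneg)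
  also have "\<dots> \<le> C * (cmod c + Lp_norm p0 \<alpha> (\<lambda>w. if A1 w \<le> A0 w then \<psi> w else 0))
    + C * (cmod 0 + Lp_norm p1 \<beta> (\<lambda>w. if A1 w \<le> A0 w then 0 else \<psi> w))"
   using o0 o1 by (intro add_mono) blast+
  finally show "sum_norm X nX Y nY (T c \<psi>) \<le> C * (cmod c + Lp_norm p0 \<alpha> (\<lambda>w. if A1 w \<le> A0 w then \<psi> w else 0)
     + Lp_norm p1 \<beta> (\<lambda>w. if A1 w \<le> A0 w then 0 else \<psi> w))" by (simp add: distrib_left)
qed

lemma sum_norm_operator_tendsto:
  fixes A0 A1 :: "complex^'n \<Rightarrow> real" and \<psi> :: "complex \<Rightarrow> complex^'n \<Rightarrow> complex"
  assumes A0: "(\<lambda>w. complex_of_real (A0 w)) \<in> Lp_ball p0 \<alpha>" and A1: "(\<lambda>w. complex_of_real (A1 w)) \<in> Lp_ball p1 \<beta>"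
   and nonneg: "\<And>w. A0 w \<ge> 0" "\<And>w. A1 w \<ge> 0" and K: "K \<ge> 0"
   and m [measurable]: "A0 \<in> borel_measurable \<nu>" "A1 \<in> borel_measurable \<nu>"
   and meas: "\<And>w. w \<in> S - {\<zeta>} \<Longrightarrow> \<psi> w \<in> borel_measurable \<nu>"
   and le: "\<And>w z. w \<in> S - {\<zeta>} \<Longrightarrow> norm z < 1 \<Longrightarrow> cmod (\<psi> w z) \<le> K * max (A0 z) (A1 z)"
   and lim: "\<And>z. norm z < 1 \<Longrightarrow> ((\<lambda>w. \<psi> w z) \<longlongrightarrow> 0) (at \<zeta> within S)"
  shows "((\<lambda>w. sum_norm X nX Y nY (T 0 (\<psi> w))) \<longlongrightarrow> 0) (at \<zeta> within S)"
proof -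
  define \<psi>0 where "\<psi>0 w = (\<lambda>z. if A1 z \<le> A0 z then \<psi> w z else 0)" for w
  define \<psi>1 where "\<psi>1 w = (\<lambda>z. if A1 z \<le> A0 z then 0 else \<psi> w z)" for w
  have s: "\<psi>0 w \<in> borel_measurable \<nu>" "\<psi>1 w \<in> borel_measurable \<nu>"
    "\<And>z. norm z < 1 \<Longrightarrow> cmod (\<psi>0 w z) \<le> K * A0 z" "\<And>z. norm z < 1 \<Longrightarrow> cmod (\<psi>1 w z) \<le> K * A1 z"
    if w: "w \<in> S - {\<zeta>}" for w
  proof -
   have [measurable]: "\<psi> w \<in> borel_measurable \<nu>" by (rule meas[OF w])
   show "\<psi>0 w \<in> borel_measurable \<nu>" "\<psi>1 w \<in> borel_measurable \<nu>"
    unfolding \<psi>0_def \<psi>1_def by measurable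
   show "\<And>z. norm z < 1 \<Longrightarrow> cmod (\<psi>0 w z) \<le> K * A0 z" "\<And>z. norm z < 1 \<Longrightarrow> cmod (\<psi>1 w z) \<le> K * A1 z"
    using split_dominated(7,8)[OF A0 A1 nonneg K m meas[OF w] le[OF w]] by (auto simp: \<psi>0_def \<psi>1_def)
  qed
  have lim': "((\<lambda>w. \<psi>0 w z) \<longlongrightarrow> 0) (at \<zeta> within S)" "((\<lambda>w. \<psi>1 w z) \<longlongrightarrow> 0) (at \<zeta> within S)" if "norm z < 1" for z
   using lim[OF that] by (cases "A1 z \<le> A0 z", simp_all add: \<psi>0_def \<psi>1_def)+
  have 0: "((\<lambda>w. Lp_norm p0 \<alpha> (\<psi>0 w)) \<longlongrightarrow> 0) (at \<zeta> within S)"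
   by (rule Lp_norm_dominated_tendsto[OF _ A0, of _ _ _ K])
    (use p0 s nonneg lim' in auto)
  have 1: "((\<lambda>w. Lp_norm p1 \<beta> (\<psi>1 w)) \<longlongrightarrow> 0) (at \<zeta> within S)"
   by (rule Lp_norm_dominated_tendsto[OF _ A1, of _ _ _ K])
    (use p1 s nonneg lim' in auto)
  have lim0: "((\<lambda>w. C * (cmod 0 + Lp_norm p0 \<alpha> (\<psi>0 w) + Lp_norm p1 \<beta> (\<psi>1 w))) \<longlongrightarrow> 0) (at \<zeta> within S)"
   using 0 1 by (auto intro!: tendsto_eq_intros)
  show ?thesis
  proof (rule Lim_null_comparison[OF _ lim0])
   have "norm (sum_norm X nX Y nY (T 0 (\<psi> w))) \<le> C * (cmod 0 + Lp_norm p0 \<alpha> (\<psi>0 w) + Lp_norm p1 \<beta> (\<psi>1 w))"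
    if w: "w \<in> S - {\<zeta>}" for w
   proof -
    note so = sum_norm_operator[OF A0 A1 nonneg K m meas[OF w] le[OF w], of 0]
    have "0 \<le> sum_norm X nX Y nY (T 0 (\<psi> w))"
     by (intro sum_norm_nonneg bergman_norm_nonneg so(1))
    then show ?thesis using so(2) by (simp add: \<psi>0_def \<psi>1_def)
   qed
   then show "\<forall>\<^sub>F w in at \<zeta> within S. norm (sum_norm X nX Y nY (T 0 (\<psi> w))) \<le> C * (cmod 0 + Lp_norm p0 \<alpha> (\<psi>0 w) + Lp_norm p1 \<beta> (\<psi>1 w))"
    by (simp add: eventually_at_filter)
  qed
qed

end

lemma convex_exp_le:
  assumes "0 \<le> x" "x \<le> 1"
  shows "exp ((1 - x) * a + x * b) \<le> max (exp a) (exp (b :: real))"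
proof -
  have "(1 - x) * a + x * b \<le> (1 - x) * max a b + x * max a b"
   using assms by (intro add_mono mult_left_mono) auto
  also have "\<dots> = max a b" by (simp add: algebra_simps)
  finally show ?thesis by (auto simp: max_def split: if_splits)
qed

text \<open>Strictly inside the strip the exponential gains the factor \<open>exp (- \<epsilon> \<bar>b - a\<bar>)\<close> over the larger
  endpoint, which absorbs the linear factor produced by differentiation.\<close>

lemma convex_exp_diff_le:
  assumes x: "\<epsilon> \<le> x" "x \<le> 1 - \<epsilon>" and \<epsilon>: "\<epsilon> > 0"
  shows "\<bar>b - a\<bar> * exp ((1 - x) * a + x * b) \<le> max (exp a) (exp (b :: real)) / \<epsilon>"
proof -
  have key: "y * exp (- \<epsilon> * y) \<le> 1 / \<epsilon>" if "y \<ge> 0" for y :: real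
  proof -
   have "\<epsilon> * y \<le> exp (\<epsilon> * y)" using exp_ge_add_one_self[of "\<epsilon> * y"] by linarith
   then show ?thesis using \<epsilon> by (simp add: exp_minus field_simps)
  qed
  define m where "m = max a b"
  have "(1 - x) * a + x * b \<le> m - \<epsilon> * \<bar>b - a\<bar>"
  proof (cases "a \<le> b")
   case True
   have "(1 - x) * a + x * b = b - (1 - x) * (b - a)" by (simp add: algebra_simps)
   moreover have "\<epsilon> * (b - a) \<le> (1 - x) * (b - a)" using x True by (intro mult_right_mono) auto
   ultimately show ?thesis using True by (simp add: m_def)
  next
   case False
   have "(1 - x) * a + x * b = a - x * (a - b)" by (simp add: algebra_simps)
   moreover have "\<epsilon> * (a - b) \<le> x * (a - b)" using x False by (intro mult_right_mono) auto
   ultimately show ?thesis using False by (simp add: m_def)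
  qed
  then have "\<bar>b - a\<bar> * exp ((1 - x) * a + x * b) \<le> \<bar>b - a\<bar> * exp (m + - \<epsilon> * \<bar>b - a\<bar>)"
   by (intro mult_left_mono) auto
  also have "\<dots> = exp m * (\<bar>b - a\<bar> * exp (- \<epsilon> * \<bar>b - a\<bar>))" unfolding exp_add by simp
  also have "\<dots> \<le> exp m * (1 / \<epsilon>)" by (intro mult_left_mono key) auto
  also have "exp m = max (exp a) (exp b)" by (auto simp: m_def max_def)
  finally show ?thesis by simp
qed

text \<open>The function \<open>s exp L0\<close> on the left line is moved to \<open>s exp L1\<close> on the right one. Exponents
  instead of powers keep the family entire in \<open>\<zeta>\<close> without any positivity assumptions.\<close>

definition calderon_family :: "('a \<Rightarrow> complex) \<Rightarrow> ('a \<Rightarrow> real) \<Rightarrow> ('a \<Rightarrow> real) \<Rightarrow> complex \<Rightarrow> 'a \<Rightarrow> complex" where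
  "calderon_family s L0 L1 \<zeta> w = s w * exp ((1 - \<zeta>) * of_real (L0 w) + \<zeta> * of_real (L1 w))"

lemma norm_calderon_family:
  "cmod (calderon_family s L0 L1 \<zeta> w) = cmod (s w) * exp ((1 - Re \<zeta>) * L0 w + Re \<zeta> * L1 w)"
  by (simp add: calderon_family_def norm_mult)

lemma calderon_family_le:
  assumes "0 \<le> Re \<zeta>" "Re \<zeta> \<le> 1"
  shows "cmod (calderon_family s L0 L1 \<zeta> w) \<le> max (cmod (s w) * exp (L0 w)) (cmod (s w) * exp (L1 w))"
  using mult_left_mono[OF convex_exp_le[OF assms, of "L0 w" "L1 w"], of "cmod (s w)"]
  by (simp add: norm_calderon_family max_mult_distrib_left)

lemma calderon_family_DERIV:
  "((\<lambda>\<zeta>. calderon_family s L0 L1 \<zeta> w) has_field_derivative of_real (L1 w - L0 w) * calderon_family s L0 L1 \<zeta> w) (at \<zeta> within S)"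
  unfolding calderon_family_def by (auto intro!: derivative_eq_intros simp: algebra_simps)

lemma calderon_family_DERIV_le:
  assumes "\<epsilon> \<le> Re \<zeta>" "Re \<zeta> \<le> 1 - \<epsilon>" "\<epsilon> > 0"
  shows "cmod (of_real (L1 w - L0 w) * calderon_family s L0 L1 \<zeta> w) \<le> (1 / \<epsilon>) * max (cmod (s w) * exp (L0 w)) (cmod (s w) * exp (L1 w))"
proof -
  have "cmod (of_real (L1 w - L0 w) * calderon_family s L0 L1 \<zeta> w) = cmod (s w) * (\<bar>L1 w - L0 w\<bar> * exp ((1 - Re \<zeta>) * L0 w + Re \<zeta> * L1 w))"
   unfolding norm_mult norm_of_real norm_calderon_family by (simp only: mult.left_commute)
  also have "\<dots> \<le> cmod (s w) * (max (exp (L0 w)) (exp (L1 w)) / \<epsilon>)"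
   by (intro mult_left_mono convex_exp_diff_le assms) simp
  also have "\<dots> = (1 / \<epsilon>) * (cmod (s w) * max (exp (L0 w)) (exp (L1 w)))" by simp
  also have "cmod (s w) * max (exp (L0 w)) (exp (L1 w)) = max (cmod (s w) * exp (L0 w)) (cmod (s w) * exp (L1 w))"
   by (simp add: max_mult_distrib_left)
  finally show ?thesis .
qed

lemma calderon_family_quotient_le:
  assumes "\<epsilon> \<le> Re \<zeta>" "Re \<zeta> \<le> 1 - \<epsilon>" "\<epsilon> \<le> Re \<xi>" "Re \<xi> \<le> 1 - \<epsilon>" "\<epsilon> > 0" "\<xi> \<noteq> \<zeta>"
  shows "cmod ((calderon_family s L0 L1 \<xi> w - calderon_family s L0 L1 \<zeta> w) / (\<xi> - \<zeta>) - of_real (L1 w - L0 w) * calderon_family s L0 L1 \<zeta> w)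
   \<le> (2 / \<epsilon>) * max (cmod (s w) * exp (L0 w)) (cmod (s w) * exp (L1 w))"
proof -
  let ?M = "(1 / \<epsilon>) * max (cmod (s w) * exp (L0 w)) (cmod (s w) * exp (L1 w))"
  have "convex {\<zeta>. \<epsilon> \<le> Re \<zeta> \<and> Re \<zeta> \<le> 1 - \<epsilon>}"
   using convex_Int[OF convex_halfspace_Re_ge[of \<epsilon>] convex_halfspace_Re_le[of "1 - \<epsilon>"]] by (simp add: Collect_conj_eq)
  then have "norm (calderon_family s L0 L1 \<xi> w - calderon_family s L0 L1 \<zeta> w) \<le> ?M * norm (\<xi> - \<zeta>)"
  proof (rule field_differentiable_bound[OF _ calderon_family_DERIV])
   fix z assume "z \<in> {\<zeta>. \<epsilon> \<le> Re \<zeta> \<and> Re \<zeta> \<le> 1 - \<epsilon>}"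
   then show "cmod (of_real (L1 w - L0 w) * calderon_family s L0 L1 z w) \<le> ?M"
    by (intro calderon_family_DERIV_le assms) auto
  qed (use assms in auto)
  then have "cmod ((calderon_family s L0 L1 \<xi> w - calderon_family s L0 L1 \<zeta> w) / (\<xi> - \<zeta>)) \<le> ?M"
   using assms(6) by (simp add: norm_divide divide_le_eq)
  moreover have "cmod (of_real (L1 w - L0 w) * calderon_family s L0 L1 \<zeta> w) \<le> ?M"
   by (rule calderon_family_DERIV_le) (use assms in auto)
  ultimately have "cmod ((calderon_family s L0 L1 \<xi> w - calderon_family s L0 L1 \<zeta> w) / (\<xi> - \<zeta>) - of_real (L1 w - L0 w) * calderon_family s L0 L1 \<zeta> w) \<le> ?M + ?M"
   by (intro order_trans[OF norm_triangle_ineq4] add_mono)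
  then show ?thesis by simp
qed

lemma closure_strip_subset: "closure strip \<subseteq> {\<zeta>. 0 \<le> Re \<zeta> \<and> Re \<zeta> \<le> 1}"
proof (rule closure_minimal)
  show "closed {\<zeta>. 0 \<le> Re \<zeta> \<and> Re \<zeta> \<le> 1}"
   using closed_Int[OF closed_halfspace_Re_ge[of 0] closed_halfspace_Re_le[of 1]] by (simp add: Collect_conj_eq)
qed (auto simp: strip_def)

lemma open_strip: "open strip"
  using open_Int[OF open_halfspace_Re_gt[of 0] open_halfspace_Re_lt[of 1]] by (simp add: Collect_conj_eq strip_def)

context bergman_couple begin

text \<open>Inside the strip the family is dominated by the larger of its two boundary moduli, its
  derivative and difference quotients by a multiple of this that is locally uniform in \<open>\<zeta>\<close>. Hence
  continuity and differentiability in the sum space follow from dominated convergence on the two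
  pieces where one of the moduli is the larger one.\<close>

theorem calderon_map:
  fixes s :: "complex^'n \<Rightarrow> complex" and L0 L1 :: "complex^'n \<Rightarrow> real" and c :: complex
  assumes [measurable]: "s \<in> borel_measurable \<nu>" "L0 \<in> borel_measurable \<nu>" "L1 \<in> borel_measurable \<nu>"
   and A0: "(\<lambda>w. complex_of_real (cmod (s w) * exp (L0 w))) \<in> Lp_ball p0 \<alpha>"
   and A1: "(\<lambda>w. complex_of_real (cmod (s w) * exp (L1 w))) \<in> Lp_ball p1 \<beta>"
  defines "F \<equiv> \<lambda>\<zeta>. T c (calderon_family s L0 L1 \<zeta>)"
  shows "analytic_into strip (sum_space X Y) (sum_norm X nX Y nY) F"
   and "bdd_cont_into (closure strip) (sum_space X Y) (sum_norm X nX Y nY) F"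
   and "bdd_cont_into left_line X nX F" and "bdd_cont_into right_line Y nY F"
   and "\<And>\<zeta>. \<zeta> \<in> left_line \<Longrightarrow> nX (F \<zeta>) \<le> C * (cmod c + Lp_norm p0 \<alpha> (\<lambda>w. complex_of_real (cmod (s w) * exp (L0 w))))"
   and "\<And>\<zeta>. \<zeta> \<in> right_line \<Longrightarrow> nY (F \<zeta>) \<le> C * (cmod c + Lp_norm p1 \<beta> (\<lambda>w. complex_of_real (cmod (s w) * exp (L1 w))))"
proof -
  define a0 where "a0 w = cmod (s w) * exp (L0 w)" for w
  define a1 where "a1 w = cmod (s w) * exp (L1 w)" for w
  have [measurable]: "a0 \<in> borel_measurable \<nu>" "a1 \<in> borel_measurable \<nu>"
   unfolding a0_def[abs_def] a1_def[abs_def] by measurable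
  have nonneg: "a0 w \<ge> 0" "a1 w \<ge> 0" for w by (simp_all add: a0_def a1_def)
  have A0': "(\<lambda>w. complex_of_real (a0 w)) \<in> Lp_ball p0 \<alpha>" and A1': "(\<lambda>w. complex_of_real (a1 w)) \<in> Lp_ball p1 \<beta>"
   using A0 A1 by (simp_all add: a0_def a1_def)
  define \<phi> where "\<phi> = calderon_family s L0 L1"
  have \<phi>m [measurable]: "\<phi> \<zeta> \<in> borel_measurable \<nu>" for \<zeta>
   unfolding \<phi>_def calderon_family_def[abs_def] by measurable
  have F: "F \<zeta> = T c (\<phi> \<zeta>)" for \<zeta> by (simp add: F_def \<phi>_def)
  have \<phi>le: "cmod (\<phi> \<zeta> w) \<le> max (a0 w) (a1 w)" if "0 \<le> Re \<zeta>" "Re \<zeta> \<le> 1" for \<zeta> w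
   unfolding \<phi>_def a0_def a1_def by (rule calderon_family_le[OF that])
  have int: "integrable \<nu> (\<lambda>w. of_real (rho w ^ b) * \<phi> \<zeta> w)" if "0 \<le> Re \<zeta>" "Re \<zeta> \<le> 1" for \<zeta>
   by (rule split_dominated(6)[OF A0' A1' nonneg, of 1]) (use \<phi>le[OF that] in auto)
  have diff: "(\<lambda>z. F w z - F \<zeta> z) = T 0 (\<lambda>z. \<phi> w z - \<phi> \<zeta> z)"
   if "0 \<le> Re \<zeta>" "Re \<zeta> \<le> 1" "0 \<le> Re w" "Re w \<le> 1" for w \<zeta>
   using bergman_operator_lincomb[OF int[OF that(3,4)] int[OF that(1,2)], of N 1 c "-1" c] by (auto simp: F)
  have difflim: "((\<lambda>w. \<phi> w z - \<phi> \<zeta> z) \<longlongrightarrow> 0) (at \<zeta> within S)" for z \<zeta> S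
  proof -
   have "((\<lambda>w. \<phi> w z) \<longlongrightarrow> \<phi> \<zeta> z) (at \<zeta> within S)"
    using DERIV_continuous[OF calderon_family_DERIV] unfolding \<phi>_def by (simp add: continuous_within)
   then show ?thesis by (rule LIM_zero)
  qed
  have diffle: "cmod (\<phi> w z - \<phi> \<zeta> z) \<le> 2 * max (a0 z) (a1 z)"
   if "0 \<le> Re \<zeta>" "Re \<zeta> \<le> 1" "0 \<le> Re w" "Re w \<le> 1" for w \<zeta> z
   using norm_triangle_ineq4[of "\<phi> w z" "\<phi> \<zeta> z"] \<phi>le[OF that(1,2), of z] \<phi>le[OF that(3,4), of z] by linarith
  show "bdd_cont_into (closure strip) (sum_space X Y) (sum_norm X nX Y nY) F"
   unfolding bdd_cont_into_def
  proof (intro conjI ballI)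
   fix \<zeta> assume "\<zeta> \<in> closure strip"
   then have z: "0 \<le> Re \<zeta>" "Re \<zeta> \<le> 1" using closure_strip_subset by auto
   show "F \<zeta> \<in> sum_space X Y" unfolding F
    by (rule sum_norm_operator(1)[OF A0' A1' nonneg, of 1]) (use \<phi>le[OF z] in auto)
   have "((\<lambda>w. sum_norm X nX Y nY (T 0 (\<lambda>z. \<phi> w z - \<phi> \<zeta> z))) \<longlongrightarrow> 0) (at \<zeta> within closure strip)"
    by (rule sum_norm_operator_tendsto[OF A0' A1' nonneg, of 2])
     (use z difflim closure_strip_subset in \<open>auto intro!: diffle\<close>)
   moreover have "\<forall>\<^sub>F w in at \<zeta> within closure strip. sum_norm X nX Y nY (T 0 (\<lambda>z. \<phi> w z - \<phi> \<zeta> z)) = sum_norm X nX Y nY (\<lambda>z. F w z - F \<zeta> z)"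
    unfolding eventually_at_filter using diff[OF z] closure_strip_subset by (intro always_eventually) (auto dest!: subsetD)
   ultimately show "((\<lambda>w. sum_norm X nX Y nY (\<lambda>z. F w z - F \<zeta> z)) \<longlongrightarrow> 0) (at \<zeta> within closure strip)"
    by (rule Lim_transform_eventually)
  next
   show "\<exists>M. \<forall>\<zeta>\<in>closure strip. sum_norm X nX Y nY (F \<zeta>) \<le> M"
   proof (intro exI ballI)
    fix \<zeta> assume "\<zeta> \<in> closure strip"
    then have z: "0 \<le> Re \<zeta>" "Re \<zeta> \<le> 1" using closure_strip_subset by auto
    have le: "cmod (\<phi> \<zeta> w) \<le> 1 * max (a0 w) (a1 w)" for w using \<phi>le[OF z] by simp
    note s = split_dominated[OF A0' A1' nonneg zero_le_one _ _ \<phi>m le]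
    have "sum_norm X nX Y nY (F \<zeta>) \<le> C * (cmod c + Lp_norm p0 \<alpha> (\<lambda>w. if a1 w \<le> a0 w then \<phi> \<zeta> w else 0)
     + Lp_norm p1 \<beta> (\<lambda>w. if a1 w \<le> a0 w then 0 else \<phi> \<zeta> w))" unfolding F
     by (rule sum_norm_operator(2)[OF A0' A1' nonneg zero_le_one _ _ \<phi>m le]) simp_all
    also have "\<dots> \<le> C * (cmod c + Lp_norm p0 \<alpha> (\<lambda>w. complex_of_real (a0 w)) + Lp_norm p1 \<beta> (\<lambda>w. complex_of_real (a1 w)))"
     using C s(2,4) by (intro mult_left_mono add_mono) auto
    finally show "sum_norm X nX Y nY (F \<zeta>) \<le> C * (cmod c + Lp_norm p0 \<alpha> (\<lambda>w. complex_of_real (a0 w)) + Lp_norm p1 \<beta> (\<lambda>w. complex_of_real (a1 w)))" .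
   qed
  qed
  show "analytic_into strip (sum_space X Y) (sum_norm X nX Y nY) F"
   unfolding analytic_into_def
  proof (intro ballI)
   fix \<zeta> assume "\<zeta> \<in> strip"
   then have z: "0 < Re \<zeta>" "Re \<zeta> < 1" by (auto simp: strip_def)
   define \<epsilon> where "\<epsilon> = min (Re \<zeta>) (1 - Re \<zeta>) / 2"
   have \<epsilon>: "\<epsilon> > 0" "2 * \<epsilon> \<le> Re \<zeta>" "Re \<zeta> \<le> 1 - 2 * \<epsilon>" using z by (auto simp: \<epsilon>_def)
   define \<psi> where "\<psi> w = of_real (L1 w - L0 w) * \<phi> \<zeta> w" for w
   have \<psi>m [measurable]: "\<psi> \<in> borel_measurable \<nu>" unfolding \<psi>_def[abs_def] by measurable
   have \<psi>le: "cmod (\<psi> w) \<le> (1 / \<epsilon>) * max (a0 w) (a1 w)" for w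
    unfolding \<psi>_def \<phi>_def a0_def a1_def by (rule calderon_family_DERIV_le) (use \<epsilon> in auto)
   have \<epsilon>i: "1 / \<epsilon> \<ge> 0" using \<epsilon> by simp
   have int\<psi>: "integrable \<nu> (weighted b \<psi>)"
    by (rule split_dominated(6)[OF A0' A1' nonneg \<epsilon>i]) (use \<psi>le in auto)
   define Q where "Q w z = (\<phi> w z - \<phi> \<zeta> z) / (w - \<zeta>) - \<psi> z" for w z
   have QT: "(\<lambda>z. (F w z - F \<zeta> z) / (w - \<zeta>) - T 0 \<psi> z) = T 0 (Q w)" if w: "w \<in> ball \<zeta> \<epsilon>" for w
   proof
    fix z
    have "\<bar>Re w - Re \<zeta>\<bar> \<le> cmod (w - \<zeta>)" using abs_Re_le_cmod[of "w - \<zeta>"] by simp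
    then have rw: "0 \<le> Re w" "Re w \<le> 1" using w \<epsilon> by (auto simp: dist_norm norm_minus_commute)
    have i1: "integrable \<nu> (\<lambda>z. of_real (rho z ^ b) * (\<phi> w z - \<phi> \<zeta> z))"
     using Bochner_Integration.integrable_diff[OF int[OF rw] int[of \<zeta>]] z by (simp add: right_diff_distrib)
    have "T 0 (Q w) z = T (1 / (w - \<zeta>) * 0 + (-1) * 0) (\<lambda>z. 1 / (w - \<zeta>) * (\<phi> w z - \<phi> \<zeta> z) + (-1) * \<psi> z) z"
     by (simp add: Q_def[abs_def])
    also have "\<dots> = 1 / (w - \<zeta>) * T 0 (\<lambda>z. \<phi> w z - \<phi> \<zeta> z) z + (-1) * T 0 \<psi> z"
     by (rule bergman_operator_lincomb[OF i1 int\<psi>])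
    also have "T 0 (\<lambda>z. \<phi> w z - \<phi> \<zeta> z) z = F w z - F \<zeta> z"
     using diff[of \<zeta> w] z rw by (metis less_imp_le)
    finally show "(F w z - F \<zeta> z) / (w - \<zeta>) - T 0 \<psi> z = T 0 (Q w) z" by simp
   qed
   show "\<exists>G\<in>sum_space X Y. ((\<lambda>w. sum_norm X nX Y nY (\<lambda>z. (F w z - F \<zeta> z) / (w - \<zeta>) - G z)) \<longlongrightarrow> 0) (at \<zeta>)"
   proof (intro bexI[of _ "T 0 \<psi>"])
    show "T 0 \<psi> \<in> sum_space X Y"
     by (rule sum_norm_operator(1)[OF A0' A1' nonneg \<epsilon>i]) (use \<psi>le in auto)
    have "((\<lambda>w. sum_norm X nX Y nY (T 0 (Q w))) \<longlongrightarrow> 0) (at \<zeta> within ball \<zeta> \<epsilon>)"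
    proof (rule sum_norm_operator_tendsto[OF A0' A1' nonneg, of "2 / \<epsilon>"])
     fix w assume w: "w \<in> ball \<zeta> \<epsilon> - {\<zeta>}"
     show "Q w \<in> borel_measurable \<nu>" unfolding Q_def[abs_def] by measurable
     fix z
     have "\<bar>Re w - Re \<zeta>\<bar> \<le> cmod (w - \<zeta>)" using abs_Re_le_cmod[of "w - \<zeta>"] by simp
     then have rw: "\<epsilon> \<le> Re w" "Re w \<le> 1 - \<epsilon>" using w \<epsilon> by (auto simp: dist_norm norm_minus_commute)
     show "cmod (Q w z) \<le> 2 / \<epsilon> * max (a0 z) (a1 z)"
      unfolding Q_def \<psi>_def \<phi>_def a0_def a1_def
      by (rule calderon_family_quotient_le) (use rw w \<epsilon> in auto)
    next
     fix z
     have "((\<lambda>w. (\<phi> w z - \<phi> \<zeta> z) / (w - \<zeta>)) \<longlongrightarrow> \<psi> z) (at \<zeta> within ball \<zeta> \<epsilon>)"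
      using calderon_family_DERIV[of s L0 L1 z \<zeta> "ball \<zeta> \<epsilon>"] unfolding has_field_derivative_iff \<phi>_def \<psi>_def .
     then show "((\<lambda>w. Q w z) \<longlongrightarrow> 0) (at \<zeta> within ball \<zeta> \<epsilon>)"
      unfolding Q_def by (rule LIM_zero)
    qed (use \<epsilon> in auto)
    then have "((\<lambda>w. sum_norm X nX Y nY (T 0 (Q w))) \<longlongrightarrow> 0) (at \<zeta>)"
     using \<epsilon> by (simp add: at_within_open[of \<zeta> "ball \<zeta> \<epsilon>"])
    moreover have "\<forall>\<^sub>F w in at \<zeta>. sum_norm X nX Y nY (T 0 (Q w)) = sum_norm X nX Y nY (\<lambda>z. (F w z - F \<zeta> z) / (w - \<zeta>) - T 0 \<psi> z)"
    proof -
     have "\<forall>\<^sub>F w in at \<zeta>. w \<in> ball \<zeta> \<epsilon>" using \<epsilon> by (intro eventually_at_in_open') auto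
     then show ?thesis by eventually_elim (simp only: QT)
    qed
    ultimately show "((\<lambda>w. sum_norm X nX Y nY (\<lambda>z. (F w z - F \<zeta> z) / (w - \<zeta>) - T 0 \<psi> z)) \<longlongrightarrow> 0) (at \<zeta>)"
     by (rule Lim_transform_eventually)
   qed
  qed
  have l0: "cmod (\<phi> \<zeta> z) = a0 z" if "\<zeta> \<in> left_line" for \<zeta> z
   using that by (simp add: \<phi>_def norm_calderon_family left_line_def a0_def)
  have l1: "cmod (\<phi> \<zeta> z) = a1 z" if "\<zeta> \<in> right_line" for \<zeta> z
   using that by (simp add: \<phi>_def norm_calderon_family right_line_def a1_def)
  have r0: "0 \<le> Re \<zeta>" "Re \<zeta> \<le> 1" if "\<zeta> \<in> left_line" for \<zeta> using that by (auto simp: left_line_def)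
  have r1: "0 \<le> Re \<zeta>" "Re \<zeta> \<le> 1" if "\<zeta> \<in> right_line" for \<zeta> using that by (auto simp: right_line_def)
  note left = operator_family_on_line[where \<phi> = \<phi> and S = left_line and F = F and c = c, OF p0 C op0 A0' nonneg(1) \<phi>m l0 diff[OF r0 r0] F difflim]
  note right = operator_family_on_line[where \<phi> = \<phi> and S = right_line and F = F and c = c, OF p1 C op1 A1' nonneg(2) \<phi>m l1 diff[OF r1 r1] F difflim]
  show "bdd_cont_into left_line X nX F" "bdd_cont_into right_line Y nY F" by (rule left(1) right(1); assumption)+
  show "\<And>\<zeta>. \<zeta> \<in> left_line \<Longrightarrow> nX (F \<zeta>) \<le> C * (cmod c + Lp_norm p0 \<alpha> (\<lambda>w. complex_of_real (cmod (s w) * exp (L0 w))))"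
   using left(2) by (simp add: a0_def)
  show "\<And>\<zeta>. \<zeta> \<in> right_line \<Longrightarrow> nY (F \<zeta>) \<le> C * (cmod c + Lp_norm p1 \<beta> (\<lambda>w. complex_of_real (cmod (s w) * exp (L1 w))))"
   using right(2) by (simp add: a1_def)
qed

end

section \<open>The three lines theorem\<close>

text \<open>Dividing by the exponential of the interpolated logarithms reduces to the bound \<open>1\<close> on both lines;
  the factor \<open>exp (\<epsilon> (\<zeta>\<^sup>2 - 1))\<close> then makes the function small at infinity, and the maximum principle
  on a large rectangle applies.\<close>

theorem three_lines:
  fixes \<phi> :: "complex \<Rightarrow> complex"
  assumes hol: "\<phi> holomorphic_on {\<zeta>. 0 < Re \<zeta> \<and> Re \<zeta> < 1}"
   and cont: "continuous_on {\<zeta>. 0 \<le> Re \<zeta> \<and> Re \<zeta> \<le> 1} \<phi>"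
   and bdd: "\<And>\<zeta>. 0 \<le> Re \<zeta> \<Longrightarrow> Re \<zeta> \<le> 1 \<Longrightarrow> cmod (\<phi> \<zeta>) \<le> B"
   and M0: "M0 > 0" "\<And>\<zeta>. Re \<zeta> = 0 \<Longrightarrow> cmod (\<phi> \<zeta>) \<le> M0"
   and M1: "M1 > 0" "\<And>\<zeta>. Re \<zeta> = 1 \<Longrightarrow> cmod (\<phi> \<zeta>) \<le> M1"
   and \<theta>: "0 < \<theta>" "\<theta> < 1"
  shows "cmod (\<phi> (of_real \<theta>)) \<le> M0 powr (1 - \<theta>) * M1 powr \<theta>"
proof -
  define g where "g \<zeta> = \<phi> \<zeta> * exp (- ((1 - \<zeta>) * of_real (ln M0) + \<zeta> * of_real (ln M1)))" for \<zeta>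
  have ng: "cmod (g \<zeta>) = cmod (\<phi> \<zeta>) * exp (- ((1 - Re \<zeta>) * ln M0 + Re \<zeta> * ln M1))" for \<zeta>
   by (simp add: g_def norm_mult)
  have B0: "B \<ge> 0" using order_trans[OF norm_ge_zero bdd[of 0]] by simp
  define K where "K = B * max (exp (- ln M0)) (exp (- ln M1))"
  have gK: "cmod (g \<zeta>) \<le> K" if "0 \<le> Re \<zeta>" "Re \<zeta> \<le> 1" for \<zeta>
  proof -
   have "exp (- ((1 - Re \<zeta>) * ln M0 + Re \<zeta> * ln M1)) \<le> max (exp (- ln M0)) (exp (- ln M1))"
    using convex_exp_le[OF that, of "- ln M0" "- ln M1"] by simp
   then show ?thesis unfolding ng K_def using bdd[OF that] B0 by (intro mult_mono) auto
  qed
  have K0: "K \<ge> 0" using B0 by (simp add: K_def le_max_iff_disj)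
  have g0: "cmod (g \<zeta>) \<le> 1" if "Re \<zeta> = 0 \<or> Re \<zeta> = 1" for \<zeta>
  proof -
   have "cmod (\<phi> \<zeta>) \<le> exp ((1 - Re \<zeta>) * ln M0 + Re \<zeta> * ln M1)" using that M0 M1 by auto
   then have "cmod (g \<zeta>) \<le> exp ((1 - Re \<zeta>) * ln M0 + Re \<zeta> * ln M1) * exp (- ((1 - Re \<zeta>) * ln M0 + Re \<zeta> * ln M1))"
    unfolding ng by (rule mult_right_mono) simp
   then show ?thesis by (simp flip: exp_add)
  qed
  have eps: "cmod (g (of_real \<theta>)) * exp (\<epsilon> * (\<theta>\<^sup>2 - 1)) \<le> 1" if \<epsilon>: "\<epsilon> > 0" for \<epsilon>
  proof -
   define h where "h \<zeta> = g \<zeta> * exp (of_real \<epsilon> * (\<zeta>\<^sup>2 - 1))" for \<zeta>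
   have nh: "cmod (h \<zeta>) = cmod (g \<zeta>) * exp (\<epsilon> * ((Re \<zeta>)\<^sup>2 - (Im \<zeta>)\<^sup>2 - 1))" for \<zeta>
    by (simp add: h_def norm_mult Re_power2)
   \<comment> \<open>chosen so that \<open>K exp (- \<epsilon> R\<^sup>2) \<le> 1\<close> on the horizontal sides\<close>
   define R where "R = sqrt (K / \<epsilon>) + 1"
   have R: "R > 0" "K / \<epsilon> \<le> R\<^sup>2"
   proof -
    have "K / \<epsilon> \<ge> 0" using K0 \<epsilon> by simp
    then have "sqrt (K / \<epsilon>) \<ge> 0" "(sqrt (K / \<epsilon>))\<^sup>2 = K / \<epsilon>" by (simp_all only: real_sqrt_ge_zero real_sqrt_pow2)
    then show "R > 0" "K / \<epsilon> \<le> R\<^sup>2" unfolding R_def power2_sum power_one mult_1_right by linarith+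
   qed
   define S where "S = cbox (Complex 0 (-R)) (Complex 1 R)"
   have S: "\<zeta> \<in> S \<longleftrightarrow> 0 \<le> Re \<zeta> \<and> Re \<zeta> \<le> 1 \<and> - R \<le> Im \<zeta> \<and> Im \<zeta> \<le> R" for \<zeta>
    by (simp add: S_def in_cbox_complex_iff)
   have iS: "\<zeta> \<in> interior S \<longleftrightarrow> 0 < Re \<zeta> \<and> Re \<zeta> < 1 \<and> - R < Im \<zeta> \<and> Im \<zeta> < R" for \<zeta>
    unfolding S_def by (simp add: in_box_complex_iff)
   have "cmod (h (of_real \<theta>)) \<le> 1"
   proof (rule maximum_modulus_frontier[of h S])
    show "h holomorphic_on interior S"
     unfolding h_def g_def by (intro holomorphic_intros holomorphic_on_subset[OF hol]) (auto simp: iS)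
    have "closure S = S" by (simp add: S_def)
    then show "continuous_on (closure S) h"
     unfolding h_def g_def by (auto intro!: continuous_intros continuous_on_subset[OF cont] simp: S)
    show "bounded S" by (simp add: S_def bounded_cbox)
    show "of_real \<theta> \<in> S" using \<theta> R by (simp add: S)
    fix \<zeta> assume "\<zeta> \<in> frontier S"
    then have z: "\<zeta> \<in> S" "\<zeta> \<notin> interior S" by (simp_all add: frontier_def \<open>closure S = S\<close>)
    then consider "Re \<zeta> = 0 \<or> Re \<zeta> = 1" | "\<bar>Im \<zeta>\<bar> = R" unfolding S iS by linarith
    then show "cmod (h \<zeta>) \<le> 1"
    proof cases
     case 1
     have "(Re \<zeta>)\<^sup>2 \<le> 1" using 1 by auto
     then have "(Re \<zeta>)\<^sup>2 - (Im \<zeta>)\<^sup>2 - 1 \<le> 0" using zero_le_power2[of "Im \<zeta>"] by linarith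
     then have "exp (\<epsilon> * ((Re \<zeta>)\<^sup>2 - (Im \<zeta>)\<^sup>2 - 1)) \<le> 1" using \<epsilon> by (simp add: mult_nonneg_nonpos)
     then have "cmod (h \<zeta>) \<le> 1 * 1" unfolding nh using g0[OF 1] by (intro mult_mono) auto
     then show ?thesis by simp
    next
     case 2
     have r: "0 \<le> Re \<zeta>" "Re \<zeta> \<le> 1" using z S by auto
     have "(Re \<zeta>)\<^sup>2 \<le> 1" using r by (simp add: power_le_one)
     moreover have "(Im \<zeta>)\<^sup>2 = R\<^sup>2" using 2 by (metis power2_abs)
     ultimately have "\<epsilon> * ((Re \<zeta>)\<^sup>2 - (Im \<zeta>)\<^sup>2 - 1) \<le> \<epsilon> * (- R\<^sup>2)" using \<epsilon> by (intro mult_left_mono) auto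
     then have "cmod (h \<zeta>) \<le> K * exp (- (\<epsilon> * R\<^sup>2))" unfolding nh using gK[OF r] K0 by (intro mult_mono) auto
     also have "\<dots> \<le> 1"
     proof -
      have "K \<le> \<epsilon> * R\<^sup>2" using R(2) \<epsilon> by (simp add: field_simps)
      also have "\<dots> \<le> exp (\<epsilon> * R\<^sup>2)" using exp_ge_add_one_self[of "\<epsilon> * R\<^sup>2"] by linarith
      finally show ?thesis by (simp add: exp_minus field_simps)
     qed
     finally show ?thesis .
    qed
   qed
   then show ?thesis by (simp add: nh)
  qed
  have "((\<lambda>\<epsilon>. cmod (g (of_real \<theta>)) * exp (\<epsilon> * (\<theta>\<^sup>2 - 1))) \<longlongrightarrow> cmod (g (of_real \<theta>)) * exp (0 * (\<theta>\<^sup>2 - 1))) (at_right 0)"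
   by (intro tendsto_intros)
  then have "cmod (g (of_real \<theta>)) * exp (0 * (\<theta>\<^sup>2 - 1)) \<le> 1"
   by (rule tendsto_upperbound) (auto simp: eventually_at_right_field intro!: exI[of _ 1] eps)
  then have "cmod (\<phi> (of_real \<theta>)) * exp (- ((1 - \<theta>) * ln M0 + \<theta> * ln M1)) \<le> 1" by (simp add: ng)
  moreover have "x \<le> exp a" if "x * exp (- a) \<le> 1" for x a :: real
   using that by (simp add: exp_minus field_simps)
  ultimately have "cmod (\<phi> (of_real \<theta>)) \<le> exp ((1 - \<theta>) * ln M0 + \<theta> * ln M1)" by blast
  also have "\<dots> = M0 powr (1 - \<theta>) * M1 powr \<theta>" using M0 M1 by (simp add: powr_def exp_add)
  finally show ?thesis .
qed

lemma closure_strip: "closure strip = {\<zeta>. 0 \<le> Re \<zeta> \<and> Re \<zeta> \<le> 1}"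
proof (rule antisym[OF closure_strip_subset], rule subsetI)
  fix \<zeta> :: complex assume z: "\<zeta> \<in> {\<zeta>. 0 \<le> Re \<zeta> \<and> Re \<zeta> \<le> 1}"
  have "\<exists>y\<in>strip. dist y \<zeta> < e" if e: "e > 0" for e
  proof -
   define t where "t = min (1/2) (e / (2 * (cmod (1/2 - \<zeta>) + 1)))"
   have t: "0 < t" "t < 1" using e by (auto simp: t_def add_nonneg_pos)
   define y where "y = \<zeta> + of_real t * (1/2 - \<zeta>)"
   have "Re y = (1 - t) * Re \<zeta> + t / 2" by (simp add: y_def algebra_simps)
   moreover have "(1 - t) * Re \<zeta> \<ge> 0" "(1 - t) * Re \<zeta> \<le> 1 - t" using z t mult_left_mono[of "Re \<zeta>" 1 "1 - t"] by auto
   ultimately have "0 < Re y" "Re y < 1" using t by linarith+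
   then have "y \<in> strip" by (simp add: strip_def)
   moreover have "dist y \<zeta> < e"
   proof -
    have "dist y \<zeta> = t * cmod (1/2 - \<zeta>)" using t by (simp add: y_def dist_norm norm_mult)
    also have "\<dots> \<le> e / (2 * (cmod (1/2 - \<zeta>) + 1)) * (cmod (1/2 - \<zeta>) + 1)"
     using e by (intro mult_mono) (auto simp: t_def)
    also have "\<dots> = e / 2"
    proof -
     have "cmod (1/2 - \<zeta>) + 1 \<noteq> 0" using norm_ge_zero[of "1/2 - \<zeta>"] by linarith
     then show ?thesis by (simp add: field_simps)
    qed
    finally show ?thesis using e by simp
   qed
   ultimately show ?thesis by blast
  qed
  then show "\<zeta> \<in> closure strip" by (simp add: closure_approachable)
qed

section \<open>Functionals of admissible families\<close>

lemma radial_data_lincomb: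
  assumes "f \<in> ball_holomorphic" "g \<in> ball_holomorphic"
  shows "radial_data m (\<lambda>z. a * f z + b * g z) z = a * radial_data m f z + b * radial_data m g z"
  using radial_power_lincomb[OF assms] by (simp add: radial_data_def algebra_simps)

lemma bergman_space_lincomb:
  assumes p: "p \<ge> 1" and f: "f \<in> bergman_space p \<alpha>" and g: "g \<in> bergman_space p \<alpha>"
  shows "(\<lambda>z. a * f z + b * g z) \<in> bergman_space p \<alpha>"
proof -
  note hf = bergman_imp_holomorphic[OF f] and hg = bergman_imp_holomorphic[OF g]
  let ?N = "bergman_order p \<alpha>"
  have "(\<lambda>z. a * radial_data ?N f z + b * radial_data ?N g z) \<in> Lp_ball p \<alpha>"
   using p by (intro Lp_ball_add(1) Lp_ball_scale(1) bergman_order_data(1) f g) auto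
  also have "(\<lambda>z. a * radial_data ?N f z + b * radial_data ?N g z) = radial_data ?N (\<lambda>z. a * f z + b * g z)"
   by (rule ext) (simp add: radial_data_lincomb[OF hf hg])
  finally show ?thesis unfolding bergman_space_iff using ball_holomorphic_lincomb[OF hf hg] bergman_order[OF p, of \<alpha>] by blast
qed

lemma sum_space_lincomb:
  assumes p: "p0 \<ge> 1" "p1 \<ge> 1"
   and f: "f \<in> sum_space (bergman_space p0 \<alpha>) (bergman_space p1 \<beta>)" and g: "g \<in> sum_space (bergman_space p0 \<alpha>) (bergman_space p1 \<beta>)"
  shows "(\<lambda>z. a * f z + b * g z) \<in> sum_space (bergman_space p0 \<alpha>) (bergman_space p1 \<beta>)"
proof -
  obtain f0 f1 where f: "f = (\<lambda>z. f0 z + f1 z)" "f0 \<in> bergman_space p0 \<alpha>" "f1 \<in> bergman_space p1 \<beta>" using f by (auto simp: sum_space_def)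
  obtain g0 g1 where g: "g = (\<lambda>z. g0 z + g1 z)" "g0 \<in> bergman_space p0 \<alpha>" "g1 \<in> bergman_space p1 \<beta>" using g by (auto simp: sum_space_def)
  have "(\<lambda>z. a * f z + b * g z) = (\<lambda>z. (a * f0 z + b * g0 z) + (a * f1 z + b * g1 z))"
   by (simp add: f g algebra_simps)
  then show ?thesis unfolding sum_space_def
   using bergman_space_lincomb[OF p(1) f(2) g(2), of a b] bergman_space_lincomb[OF p(2) f(3) g(3), of a b]
   by (intro CollectI exI conjI)
qed

lemma sum_space_holomorphic:
  assumes "f \<in> sum_space (bergman_space p0 \<alpha>) (bergman_space p1 \<beta>)"
  shows "f \<in> ball_holomorphic"
proof -
  obtain f0 f1 where f: "f = (\<lambda>z. f0 z + f1 z)" "f0 \<in> bergman_space p0 \<alpha>" "f1 \<in> bergman_space p1 \<beta>" using assms by (auto simp: sum_space_def)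
  show ?thesis using ball_holomorphic_lincomb[OF bergman_imp_holomorphic[OF f(2)] bergman_imp_holomorphic[OF f(3)], of 1 1] by (simp add: f)
qed

text \<open>Evaluations are continuous on both endpoint spaces, hence on the sum.\<close>

lemma sum_space_local_bound:
  assumes p: "p0 \<ge> 1" "p1 \<ge> 1" and r: "r < 1"
  shows "\<exists>C>0. \<forall>g \<in> sum_space (bergman_space p0 \<alpha>) (bergman_space p1 \<beta> :: (complex^'n \<Rightarrow> complex) set). \<forall>z. norm z \<le> r \<longrightarrow>
   cmod (radial_power M g z) \<le> C * sum_norm (bergman_space p0 \<alpha>) (bergman_norm p0 \<alpha>) (bergman_space p1 \<beta>) (bergman_norm p1 \<beta>) g"
proof -
  obtain C0 where C0: "C0 > 0" "\<And>(f :: complex^'n \<Rightarrow> complex) z. f \<in> bergman_space p0 \<alpha> \<Longrightarrow> norm z \<le> r \<Longrightarrow> cmod (radial_power M f z) \<le> C0 * bergman_norm p0 \<alpha> f"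
   using bergman_local_bound[OF p(1) r, where 'n='n] by blast
  obtain C1 where C1: "C1 > 0" "\<And>(f :: complex^'n \<Rightarrow> complex) z. f \<in> bergman_space p1 \<beta> \<Longrightarrow> norm z \<le> r \<Longrightarrow> cmod (radial_power M f z) \<le> C1 * bergman_norm p1 \<beta> f"
   using bergman_local_bound[OF p(2) r, where 'n='n] by blast
  define C where "C = max C0 C1"
  have C: "C > 0" using C0(1) by (simp add: C_def)
  show ?thesis
  proof (intro exI[of _ C] conjI ballI allI impI C)
   fix g :: "complex^'n \<Rightarrow> complex" and z :: "complex^'n"
   assume g: "g \<in> sum_space (bergman_space p0 \<alpha>) (bergman_space p1 \<beta>)" and z: "norm z \<le> r"
   have "cmod (radial_power M g z) / C \<le> sum_norm (bergman_space p0 \<alpha>) (bergman_norm p0 \<alpha>) (bergman_space p1 \<beta>) (bergman_norm p1 \<beta>) g"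
    unfolding sum_norm_def
   proof (rule cInf_greatest)
    show "{bergman_norm p0 \<alpha> g' + bergman_norm p1 \<beta> h |g' h. g' \<in> bergman_space p0 \<alpha> \<and> h \<in> bergman_space p1 \<beta> \<and> g = (\<lambda>z. g' z + h z)} \<noteq> {}"
     using g by (auto simp: sum_space_def)
    fix x assume "x \<in> {bergman_norm p0 \<alpha> g' + bergman_norm p1 \<beta> h |g' h. g' \<in> bergman_space p0 \<alpha> \<and> h \<in> bergman_space p1 \<beta> \<and> g = (\<lambda>z. g' z + h z)}"
    then obtain g0 g1 where g01: "x = bergman_norm p0 \<alpha> g0 + bergman_norm p1 \<beta> g1" "g0 \<in> bergman_space p0 \<alpha>" "g1 \<in> bergman_space p1 \<beta>" "g = (\<lambda>z. g0 z + g1 z)"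
     by blast
    have "radial_power M g z = radial_power M g0 z + radial_power M g1 z"
     using radial_power_lincomb[OF bergman_imp_holomorphic[OF g01(2)] bergman_imp_holomorphic[OF g01(3)], of M 1 1 z] by (simp add: g01(4))
    then have "cmod (radial_power M g z) \<le> cmod (radial_power M g0 z) + cmod (radial_power M g1 z)" using norm_triangle_ineq by metis
    also have "\<dots> \<le> C0 * bergman_norm p0 \<alpha> g0 + C1 * bergman_norm p1 \<beta> g1" by (intro add_mono C0(2) C1(2) g01 z)
    also have "\<dots> \<le> C * bergman_norm p0 \<alpha> g0 + C * bergman_norm p1 \<beta> g1"
     by (intro add_mono mult_right_mono bergman_norm_nonneg) (auto simp: C_def)
    finally show "cmod (radial_power M g z) / C \<le> x" using C by (simp add: g01(1) field_simps)
   qed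
   then show "cmod (radial_power M g z) \<le> C * sum_norm (bergman_space p0 \<alpha>) (bergman_norm p0 \<alpha>) (bergman_space p1 \<beta>) (bergman_norm p1 \<beta>) g"
    using C by (simp add: field_simps)
  qed
qed

lemma tendsto_integral_bounded:
  fixes f :: "complex \<Rightarrow> complex^'n \<Rightarrow> complex"
  assumes f: "\<And>w. w \<in> S - {\<zeta>} \<Longrightarrow> f w \<in> borel_measurable \<nu>" and g: "g \<in> borel_measurable \<nu>"
   and le: "\<And>w z. w \<in> S - {\<zeta>} \<Longrightarrow> norm z < 1 \<Longrightarrow> cmod (f w z) \<le> K"
   and lim: "\<And>z. norm z < 1 \<Longrightarrow> ((\<lambda>w. f w z) \<longlongrightarrow> g z) (at \<zeta> within S)"
  shows "((\<lambda>w. \<integral>z. f w z \<partial>\<nu>) \<longlongrightarrow> (\<integral>z. g z \<partial>\<nu>)) (at \<zeta> within S)"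
  unfolding tendsto_at_iff_sequentially comp_def
proof (intro allI impI)
  fix X :: "nat \<Rightarrow> complex" assume X: "\<forall>i. X i \<in> S - {\<zeta>}" "X \<longlonglongrightarrow> \<zeta>"
  show "(\<lambda>i. \<integral>z. f (X i) z \<partial>\<nu>) \<longlonglongrightarrow> (\<integral>z. g z \<partial>\<nu>)"
  proof (rule integral_dominated_convergence[where w = "\<lambda>_. K"])
   show "AE z in \<nu>. (\<lambda>i. f (X i) z) \<longlonglongrightarrow> g z"
    using lim X unfolding tendsto_at_iff_sequentially comp_def by (intro AE_I2) auto
   show "AE z in \<nu>. norm (f (X i) z) \<le> K" for i
    using le X by (intro AE_I2) auto
  qed (use f g X in auto)
qed

text \<open>A linear functional that is controlled by the norm of a function space turns a continuous or
  analytic family in that space into a continuous or analytic scalar function.\<close>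

lemma functional_of_family:
  fixes ev :: "('a \<Rightarrow> complex) \<Rightarrow> complex"
  assumes comb: "\<And>f g a b. f \<in> X \<Longrightarrow> g \<in> X \<Longrightarrow> (\<lambda>z. a * f z + b * g z) \<in> X"
   and lin: "\<And>f g a b. f \<in> X \<Longrightarrow> g \<in> X \<Longrightarrow> ev (\<lambda>z. a * f z + b * g z) = a * ev f + b * ev g"
   and bound: "\<And>g. g \<in> X \<Longrightarrow> cmod (ev g) \<le> c * nX g"
  shows functional_of_continuous_family:
    "bdd_cont_into S X nX F \<Longrightarrow> \<zeta> \<in> S \<Longrightarrow> ((\<lambda>w. ev (F w)) \<longlongrightarrow> ev (F \<zeta>)) (at \<zeta> within S)"
   and functional_of_quotient: "F w \<in> X \<Longrightarrow> F \<zeta> \<in> X \<Longrightarrow> G \<in> X \<Longrightarrow>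
    cmod ((ev (F w) - ev (F \<zeta>)) / (w - \<zeta>) - ev G) \<le> c * nX (\<lambda>z. (F w z - F \<zeta> z) / (w - \<zeta>) - G z)"
proof -
  show "((\<lambda>w. ev (F w)) \<longlongrightarrow> ev (F \<zeta>)) (at \<zeta> within S)" if F: "bdd_cont_into S X nX F" and z: "\<zeta> \<in> S"
  proof -
   have lim: "((\<lambda>w. c * nX (\<lambda>z. F w z - F \<zeta> z)) \<longlongrightarrow> 0) (at \<zeta> within S)"
    using F z unfolding bdd_cont_into_def by (auto intro!: tendsto_mult_right_zero)
   have "((\<lambda>w. ev (F w) - ev (F \<zeta>)) \<longlongrightarrow> 0) (at \<zeta> within S)"
   proof (rule Lim_null_comparison[OF _ lim])
    have "cmod (ev (F w) - ev (F \<zeta>)) \<le> c * nX (\<lambda>z. F w z - F \<zeta> z)" if w: "w \<in> S" for w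
    proof -
     have FF: "F w \<in> X" "F \<zeta> \<in> X" using F w z by (auto simp: bdd_cont_into_def)
     show ?thesis using bound[OF comb[OF FF, of 1 "-1"]] lin[OF FF, of 1 "-1"] by simp
    qed
    then show "\<forall>\<^sub>F w in at \<zeta> within S. norm (ev (F w) - ev (F \<zeta>)) \<le> c * nX (\<lambda>z. F w z - F \<zeta> z)"
     by (simp add: eventually_at_filter)
   qed
   then show ?thesis by (simp add: LIM_zero_iff)
  qed
  show "cmod ((ev (F w) - ev (F \<zeta>)) / (w - \<zeta>) - ev G) \<le> c * nX (\<lambda>z. (F w z - F \<zeta> z) / (w - \<zeta>) - G z)"
   if w: "F w \<in> X" "F \<zeta> \<in> X" and G: "G \<in> X"
  proof -
   have d: "(\<lambda>z. 1 * F w z + (-1) * F \<zeta> z) \<in> X" by (rule comb[OF w])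
   have eq: "(\<lambda>z. (F w z - F \<zeta> z) / (w - \<zeta>) - G z) = (\<lambda>z. (1 / (w - \<zeta>)) * (1 * F w z + (-1) * F \<zeta> z) + (-1) * G z)"
    by (simp add: fun_eq_iff)
   show ?thesis unfolding eq using bound[OF comb[OF d G, of "1 / (w - \<zeta>)" "-1"]] lin[OF d G, of "1 / (w - \<zeta>)" "-1"] lin[OF w, of 1 "-1"]
    by simp
  qed
qed

lemma pairing_integrable:
  fixes v \<psi> :: "complex^'n \<Rightarrow> complex"
  assumes [measurable]: "v \<in> borel_measurable \<nu>" "\<psi> \<in> borel_measurable \<nu>"
   and "\<And>z. norm z \<le> r \<Longrightarrow> cmod (v z) \<le> B" "\<And>z. norm z > r \<Longrightarrow> \<psi> z = 0" "\<And>z. cmod (\<psi> z) \<le> H"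
  shows "integrable \<nu> (\<lambda>z. v z * \<psi> z)" and "B \<ge> 0 \<Longrightarrow> cmod (v z * \<psi> z) \<le> B * H"
proof -
  have le: "cmod (v z * \<psi> z) \<le> max B 0 * H" for z
  proof (cases "norm z \<le> r")
   case True
   then show ?thesis using assms(3)[OF True] assms(5)[of z] unfolding norm_mult by (intro mult_mono) auto
  next
   case False
   have "H \<ge> 0" using order_trans[OF norm_ge_zero assms(5)[of z]] .
   then show ?thesis using assms(4)[of z] False by simp
  qed
  then show "integrable \<nu> (\<lambda>z. v z * \<psi> z)" by (intro ball_measure.integrable_const_bound[of _ "max B 0 * H"]) auto
  show "B \<ge> 0 \<Longrightarrow> cmod (v z * \<psi> z) \<le> B * H" using le[of z] by simp
qed

lemma calderon_quotient_locally_bounded: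
  assumes \<zeta>: "\<zeta> \<in> strip"
  shows "\<exists>d>0. \<exists>K\<ge>0. ball \<zeta> d \<subseteq> strip \<and> (\<forall>s L0 L1 \<xi> (z :: 'a) H. \<xi> \<in> ball \<zeta> d - {\<zeta>} \<longrightarrow> cmod (s z) * exp (L0 z) \<le> H \<longrightarrow> cmod (s z) * exp (L1 z) \<le> H \<longrightarrow>
    cmod ((calderon_family s L0 L1 \<xi> z - calderon_family s L0 L1 \<zeta> z) / (\<xi> - \<zeta>)) \<le> K * H)"
proof -
  define \<epsilon> where "\<epsilon> = min (Re \<zeta>) (1 - Re \<zeta>) / 2"
  have \<epsilon>: "\<epsilon> > 0" "2 * \<epsilon> \<le> Re \<zeta>" "Re \<zeta> \<le> 1 - 2 * \<epsilon>" using \<zeta> by (auto simp: \<epsilon>_def strip_def)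
  have near: "\<epsilon> \<le> Re \<xi>" "Re \<xi> \<le> 1 - \<epsilon>" if "\<xi> \<in> ball \<zeta> \<epsilon>" for \<xi>
   using abs_Re_le_cmod[of "\<zeta> - \<xi>"] that \<epsilon> by (auto simp: dist_norm)
  show ?thesis
  proof (rule exI[of _ \<epsilon>], intro conjI exI[of _ "3 / \<epsilon>"] allI impI)
   show "ball \<zeta> \<epsilon> \<subseteq> strip" using near \<epsilon> by (fastforce simp: strip_def)
   fix s :: "'a \<Rightarrow> complex" and L0 L1 :: "'a \<Rightarrow> real" and \<xi> z H
   assume x: "\<xi> \<in> ball \<zeta> \<epsilon> - {\<zeta>}" and H: "cmod (s z) * exp (L0 z) \<le> H" "cmod (s z) * exp (L1 z) \<le> H"
   let ?D = "of_real (L1 z - L0 z) * calderon_family s L0 L1 \<zeta> z"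
   let ?Q = "(calderon_family s L0 L1 \<xi> z - calderon_family s L0 L1 \<zeta> z) / (\<xi> - \<zeta>)"
   let ?m = "max (cmod (s z) * exp (L0 z)) (cmod (s z) * exp (L1 z))"
   have "cmod (?Q - ?D) \<le> (2 / \<epsilon>) * ?m" using \<epsilon> near x by (intro calderon_family_quotient_le) auto
   moreover have "cmod ?D \<le> (1 / \<epsilon>) * ?m" using \<epsilon> by (intro calderon_family_DERIV_le) auto
   moreover have "cmod ?Q \<le> cmod (?Q - ?D) + cmod ?D" using norm_triangle_ineq[of "?Q - ?D" ?D] by simp
   moreover have "(2 / \<epsilon>) * ?m + (1 / \<epsilon>) * ?m = (3 / \<epsilon>) * ?m" by (simp add: field_simps)
   moreover have "(3 / \<epsilon>) * ?m \<le> (3 / \<epsilon>) * H" using H \<epsilon> by (intro mult_left_mono) auto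
   ultimately show "cmod ?Q \<le> (3 / \<epsilon>) * H" by linarith
  qed (use \<epsilon> in auto)
qed

text \<open>Both factors of the integrand depend on the parameter; the test family is supported in a smaller
  ball, on which the values of an admissible family are controlled by the norm of the sum space.\<close>

lemma pairing_on_strip:
  fixes v :: "complex \<Rightarrow> complex^'n \<Rightarrow> complex" and s :: "complex^'n \<Rightarrow> complex"
  assumes v: "\<And>\<zeta>. \<zeta> \<in> closure strip \<Longrightarrow> v \<zeta> \<in> borel_measurable \<nu>"
   and B: "B \<ge> 0" "\<And>\<zeta> z. \<zeta> \<in> closure strip \<Longrightarrow> norm z \<le> r \<Longrightarrow> cmod (v \<zeta> z) \<le> B"
   and cont: "\<And>\<zeta> z. \<zeta> \<in> closure strip \<Longrightarrow> norm z \<le> r \<Longrightarrow> ((\<lambda>w. v w z) \<longlongrightarrow> v \<zeta> z) (at \<zeta> within closure strip)"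
   and deriv: "\<And>\<zeta>. \<zeta> \<in> strip \<Longrightarrow> \<exists>G \<in> borel_measurable \<nu>. \<exists>K d. d > 0 \<and> K \<ge> 0 \<and>
    (\<forall>z. norm z \<le> r \<longrightarrow> ((\<lambda>w. (v w z - v \<zeta> z) / (w - \<zeta>)) \<longlongrightarrow> G z) (at \<zeta>) \<and>
     (\<forall>w \<in> ball \<zeta> d - {\<zeta>}. cmod ((v w z - v \<zeta> z) / (w - \<zeta>)) \<le> K))"
   and m [measurable]: "s \<in> borel_measurable \<nu>" "L0 \<in> borel_measurable \<nu>" "L1 \<in> borel_measurable \<nu>"
   and supp: "\<And>z. norm z > r \<Longrightarrow> s z = 0"
   and H: "\<And>z. cmod (s z) * exp (L0 z) \<le> H" "\<And>z. cmod (s z) * exp (L1 z) \<le> H"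
  defines "\<phi> \<equiv> \<lambda>\<zeta>. \<integral>z. v \<zeta> z * calderon_family s L0 L1 \<zeta> z \<partial>\<nu>"
  shows "continuous_on (closure strip) \<phi>" and "\<phi> holomorphic_on strip"
   and "\<exists>K. \<forall>\<zeta>\<in>closure strip. cmod (\<phi> \<zeta>) \<le> K"
proof -
  have sub: "strip \<subseteq> closure strip" by (rule closure_subset)
  have cm [measurable]: "calderon_family s L0 L1 \<zeta> \<in> borel_measurable \<nu>" for \<zeta>
   unfolding calderon_family_def[abs_def] by measurable
  have c0: "calderon_family s L0 L1 \<zeta> z = 0" if "norm z > r" for \<zeta> z
   using supp[OF that] by (simp add: calderon_family_def)
  have cH: "cmod (calderon_family s L0 L1 \<zeta> z) \<le> H" if "\<zeta> \<in> closure strip" for \<zeta> z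
   using that calderon_family_le[of \<zeta> s L0 L1 z] H[of z] by (auto simp: closure_strip)
  have int: "integrable \<nu> (\<lambda>z. v w z * calderon_family s L0 L1 \<zeta> z)"
   "cmod (v w z * calderon_family s L0 L1 \<zeta> z) \<le> B * H" if "w \<in> closure strip" "\<zeta> \<in> closure strip" for w \<zeta> z
   using pairing_integrable[OF v[OF that(1)] cm B(2)[OF that(1)] c0 cH[OF that(2)]] B(1) by auto
  have H0: "H \<ge> 0" using order_trans[OF norm_ge_zero cH[of 0]] by (simp add: closure_strip)
  show "\<exists>K. \<forall>\<zeta>\<in>closure strip. cmod (\<phi> \<zeta>) \<le> K"
  proof (intro exI ballI)
   fix \<zeta> assume z: "\<zeta> \<in> closure strip"
   have "cmod (\<phi> \<zeta>) \<le> (\<integral>z. cmod (v \<zeta> z * calderon_family s L0 L1 \<zeta> z) \<partial>\<nu>)"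
    unfolding \<phi>_def by (rule integral_norm_bound)
   also have "\<dots> \<le> (\<integral>z. B * H \<partial>(\<nu> :: (complex^'n) measure))"
    using int(1)[OF z z] int(2)[OF z z] by (intro integral_mono integrable_norm) auto
   finally show "cmod (\<phi> \<zeta>) \<le> (\<integral>z. B * H \<partial>(\<nu> :: (complex^'n) measure))" .
  qed
  show "continuous_on (closure strip) \<phi>" unfolding continuous_on_def \<phi>_def
  proof (intro ballI tendsto_integral_bounded)
   fix \<zeta> assume z: "\<zeta> \<in> closure strip"
   show "(\<lambda>z. v w z * calderon_family s L0 L1 w z) \<in> borel_measurable \<nu>" if "w \<in> closure strip - {\<zeta>}" for w
    using v[of w] that by auto
   show "(\<lambda>z. v \<zeta> z * calderon_family s L0 L1 \<zeta> z) \<in> borel_measurable \<nu>" using v[OF z] by auto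
   show "cmod (v w z * calderon_family s L0 L1 w z) \<le> B * H" if "w \<in> closure strip - {\<zeta>}" for w z
    using int(2)[of w w z] that by auto
   show "((\<lambda>w. v w z * calderon_family s L0 L1 w z) \<longlongrightarrow> v \<zeta> z * calderon_family s L0 L1 \<zeta> z) (at \<zeta> within closure strip)" for z
   proof (cases "norm z \<le> r")
    case True
    have "((\<lambda>w. calderon_family s L0 L1 w z) \<longlongrightarrow> calderon_family s L0 L1 \<zeta> z) (at \<zeta> within closure strip)"
     unfolding calderon_family_def by (intro tendsto_intros)
    then show ?thesis using cont[OF z True] by (intro tendsto_mult)
   qed (simp add: c0)
  qed
  have "\<phi> field_differentiable at \<zeta>" if z: "\<zeta> \<in> strip" for \<zeta>
  proof -
   obtain G K d where G [measurable]: "G \<in> borel_measurable \<nu>" and d: "d > 0" and K: "K \<ge> 0"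
    and lim: "\<And>z. norm z \<le> r \<Longrightarrow> ((\<lambda>w. (v w z - v \<zeta> z) / (w - \<zeta>)) \<longlongrightarrow> G z) (at \<zeta>)"
    and bd: "\<And>z w. norm z \<le> r \<Longrightarrow> w \<in> ball \<zeta> d - {\<zeta>} \<Longrightarrow> cmod ((v w z - v \<zeta> z) / (w - \<zeta>)) \<le> K"
    using deriv[OF z] by blast
   obtain d' K' where d': "d' > 0" "K' \<ge> 0" "ball \<zeta> d' \<subseteq> strip"
    and bd': "\<And>w z. w \<in> ball \<zeta> d' - {\<zeta>} \<Longrightarrow> cmod ((calderon_family s L0 L1 w z - calderon_family s L0 L1 \<zeta> z) / (w - \<zeta>)) \<le> K' * H"
    using calderon_quotient_locally_bounded[OF z, where 'a = "complex^'n"] H by metis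
   define S where "S = ball \<zeta> (min d d')"
   have S: "w \<in> ball \<zeta> d - {\<zeta>}" "w \<in> ball \<zeta> d' - {\<zeta>}" "w \<in> closure strip" "w \<noteq> \<zeta>" if "w \<in> S - {\<zeta>}" for w
    using that d'(3) sub by (auto simp: S_def)
   have zc: "\<zeta> \<in> closure strip" using z sub by blast
   note [measurable] = v[OF zc]
   let ?f = "\<lambda>w z. (v w z * calderon_family s L0 L1 w z - v \<zeta> z * calderon_family s L0 L1 \<zeta> z) / (w - \<zeta>)"
   let ?g = "\<lambda>z. G z * calderon_family s L0 L1 \<zeta> z + v \<zeta> z * (of_real (L1 z - L0 z) * calderon_family s L0 L1 \<zeta> z)"
   have split: "?f w z = (v w z - v \<zeta> z) / (w - \<zeta>) * calderon_family s L0 L1 w z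
     + v \<zeta> z * ((calderon_family s L0 L1 w z - calderon_family s L0 L1 \<zeta> z) / (w - \<zeta>))" for w z
    by (simp add: diff_divide_distrib algebra_simps)
   have lim': "((\<lambda>w. \<integral>z. ?f w z \<partial>\<nu>) \<longlongrightarrow> (\<integral>z. ?g z \<partial>\<nu>)) (at \<zeta> within S)"
   proof (rule tendsto_integral_bounded)
    show "?f w \<in> borel_measurable \<nu>" if "w \<in> S - {\<zeta>}" for w
    proof -
     note [measurable] = v[OF S(3)[OF that]]
     show ?thesis by measurable
    qed
    show "cmod (?f w z) \<le> K * H + B * (K' * H)" if w: "w \<in> S - {\<zeta>}" for w z
    proof (cases "norm z \<le> r")
     case True
     have "cmod (?f w z) \<le> cmod ((v w z - v \<zeta> z) / (w - \<zeta>)) * cmod (calderon_family s L0 L1 w z)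
       + cmod (v \<zeta> z) * cmod ((calderon_family s L0 L1 w z - calderon_family s L0 L1 \<zeta> z) / (w - \<zeta>))"
      unfolding split norm_mult[symmetric] by (rule norm_triangle_ineq)
     also have "\<dots> \<le> K * H + B * (K' * H)"
      by (intro add_mono mult_mono bd[OF True] S[OF w] cH B bd' zc True norm_ge_zero K)
     finally show ?thesis .
    qed (use c0 K B(1) d'(2) H0 in simp)
    show "((\<lambda>w. ?f w z) \<longlongrightarrow> ?g z) (at \<zeta> within S)" for z
    proof (cases "norm z \<le> r")
     case True
     have "((\<lambda>w. calderon_family s L0 L1 w z) \<longlongrightarrow> calderon_family s L0 L1 \<zeta> z) (at \<zeta>)"
      unfolding calderon_family_def by (intro tendsto_intros)
     moreover have "((\<lambda>w. (calderon_family s L0 L1 w z - calderon_family s L0 L1 \<zeta> z) / (w - \<zeta>)) \<longlongrightarrow> of_real (L1 z - L0 z) * calderon_family s L0 L1 \<zeta> z) (at \<zeta>)"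
      using calderon_family_DERIV[of s L0 L1 z \<zeta> UNIV] by (simp add: has_field_derivative_iff)
     ultimately have "((\<lambda>w. (v w z - v \<zeta> z) / (w - \<zeta>) * calderon_family s L0 L1 w z
       + v \<zeta> z * ((calderon_family s L0 L1 w z - calderon_family s L0 L1 \<zeta> z) / (w - \<zeta>))) \<longlongrightarrow> ?g z) (at \<zeta>)"
      by (intro tendsto_intros lim[OF True])
     then have "((\<lambda>w. ?f w z) \<longlongrightarrow> ?g z) (at \<zeta>)"
      by (rule Lim_transform_eventually) (auto simp: eventually_at_filter split)
     then show ?thesis by (rule tendsto_within_subset) simp
    qed (simp add: c0)
   qed measurable
   have "((\<lambda>w. (\<phi> w - \<phi> \<zeta>) / (w - \<zeta>)) \<longlongrightarrow> (\<integral>z. ?g z \<partial>\<nu>)) (at \<zeta> within S)"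
   proof (rule Lim_transform_eventually[OF lim'])
    have "(\<integral>z. ?f w z \<partial>\<nu>) = (\<phi> w - \<phi> \<zeta>) / (w - \<zeta>)" if w: "w \<in> S - {\<zeta>}" for w
     unfolding \<phi>_def using int(1)[OF zc zc] int(1)[OF S(3)[OF w] S(3)[OF w]] by simp
    then show "\<forall>\<^sub>F w in at \<zeta> within S. (\<integral>z. ?f w z \<partial>\<nu>) = (\<phi> w - \<phi> \<zeta>) / (w - \<zeta>)"
     by (auto simp: eventually_at_filter)
   qed
   moreover have "at \<zeta> within S = at \<zeta>" unfolding S_def using d d' by (intro at_within_open) auto
   ultimately show ?thesis by (auto simp: field_differentiable_def has_field_derivative_iff)
  qed
  then show "\<phi> holomorphic_on strip" using open_strip by (simp add: holomorphic_on_def field_differentiable_at_within)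
qed

section \<open>Admissible families have values in the intermediate space\<close>

text \<open>The dual form of the \<open>L\<^sup>p\<close> norm: the exponents are those for which the function pairing
  extremally with \<open>v\<close> is \<open>V powr (1 - 1/p) * rho powr (\<alpha>/p)\<close> when \<open>V = \<bar>v\<bar> powr p * rho powr \<alpha>\<close>.\<close>

lemma pairing_le:
  fixes v \<psi> :: "complex^'n \<Rightarrow> complex" and V :: "complex^'n \<Rightarrow> real"
  assumes p: "p \<ge> 1" and v: "v \<in> Lp_ball p \<alpha>" and m [measurable]: "\<psi> \<in> borel_measurable \<nu>"
   and V: "integrable \<nu> V" "\<And>z. V z \<ge> 0" and A: "(\<integral>z. V z \<partial>\<nu>) = A" "A > 0"
   and le: "\<And>z. norm z < 1 \<Longrightarrow> cmod (\<psi> z) \<le> V z powr (1 - 1/p) * rho z powr (\<alpha>/p)"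
  shows "cmod (\<integral>z. v z * \<psi> z \<partial>\<nu>) \<le> A powr (1 - 1/p) * Lp_norm p \<alpha> v"
proof -
  have [measurable]: "v \<in> borel_measurable \<nu>" "V \<in> borel_measurable \<nu>"
   using v V(1) by (auto dest: Lp_ball_measurable)
  define \<phi> where "\<phi> z = cmod (v z) * rho z powr (\<alpha>/p) * V z powr (- 1/p)" for z
  have [measurable]: "\<phi> \<in> borel_measurable \<nu>" unfolding \<phi>_def by measurable
  have \<phi>V: "\<phi> z * V z = cmod (v z) * rho z powr (\<alpha>/p) * V z powr (1 - 1/p)" for z
  proof (cases "V z = 0")
   case False
   have "V z powr (- 1/p) * V z powr 1 = V z powr (1 - 1/p)" unfolding powr_add[symmetric] by simp
   then show ?thesis using V(2)[of z] False by (simp add: \<phi>_def mult.assoc)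
  qed simp
  have \<phi>p: "\<phi> z powr p * V z \<le> cmod (v z) powr p * rho z powr \<alpha>" for z
  proof (cases "V z = 0")
   case False
   then have "V z > 0" using V(2)[of z] by linarith
   have "\<phi> z powr p = cmod (v z) powr p * rho z powr \<alpha> * V z powr (- 1)" unfolding \<phi>_def powr_mult powr_powr using p by simp
   then show ?thesis using \<open>V z > 0\<close> by (simp add: powr_minus field_simps)
  qed simp
  have K: "(\<integral>\<^sup>+z. ennreal (V z) \<partial>\<nu>) \<le> ennreal A"
   using V A by (simp add: nn_integral_eq_integral)
  have X: "(\<integral>\<^sup>+z. ennreal (\<phi> z powr p * V z) \<partial>\<nu>) \<le> ennreal (Lp_norm p \<alpha> v powr p)"
  proof -
   have "(\<integral>\<^sup>+z. ennreal (\<phi> z powr p * V z) \<partial>\<nu>) \<le> (\<integral>\<^sup>+z. ennreal (cmod (v z) powr p * rho z powr \<alpha>) \<partial>\<nu>)"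
    by (intro nn_integral_mono ennreal_leI \<phi>p)
   also have "\<dots> = ennreal (Lp_norm p \<alpha> v powr p)" using p by (simp add: Lp_nn_integral[OF v] Lp_norm_powr)
   finally show ?thesis .
  qed
  have "integrable \<nu> (\<lambda>z. \<phi> z * V z) \<and> (\<integral>z. \<phi> z * V z \<partial>\<nu>) powr p \<le> A powr (p - 1) * Lp_norm p \<alpha> v powr p"
   by (rule integral_power_le[OF p _ _ _ _ K A(2) X]) (auto simp: \<phi>_def V(2))
  then have int: "integrable \<nu> (\<lambda>z. \<phi> z * V z)"
   and I: "(\<integral>z. \<phi> z * V z \<partial>\<nu>) powr p \<le> A powr (p - 1) * Lp_norm p \<alpha> v powr p" by auto
  have dom: "cmod (v z * \<psi> z) \<le> \<phi> z * V z" if "norm z < 1" for z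
   using mult_left_mono[OF le[OF that] norm_ge_zero[of "v z"]] unfolding \<phi>V norm_mult by (simp only: mult_ac)
  have int': "integrable \<nu> (\<lambda>z. v z * \<psi> z)"
   by (rule Bochner_Integration.integrable_bound[OF int]) (auto intro!: AE_I2 order_trans[OF dom])
  have I0: "(\<integral>z. \<phi> z * V z \<partial>\<nu>) \<ge> 0" by (intro integral_nonneg_AE AE_I2) (simp add: \<phi>_def V(2))
  have "cmod (\<integral>z. v z * \<psi> z \<partial>\<nu>) \<le> (\<integral>z. \<phi> z * V z \<partial>\<nu>)"
   by (rule Bochner_Integration.integral_norm_bound_integral[OF int' int]) (simp add: dom)
  also have "\<dots> = ((\<integral>z. \<phi> z * V z \<partial>\<nu>) powr p) powr (1/p)" using I0 p by (simp add: powr_powr)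
  also have "\<dots> \<le> (A powr (p - 1) * Lp_norm p \<alpha> v powr p) powr (1/p)" using I p by (intro powr_mono2) auto
  also have "\<dots> = A powr (1 - 1/p) * Lp_norm p \<alpha> v" using p A(2) by (simp add: powr_mult powr_powr diff_divide_distrib)
  finally show ?thesis .
qed

lemma powr_between_le:
  fixes x :: real
  assumes "0 < a" "a \<le> x" "x \<le> b"
  shows "x powr e \<le> a powr e + b powr e"
proof (cases "e \<ge> 0")
  case True
  then have "x powr e \<le> b powr e" using assms by (intro powr_mono2) auto
  then show ?thesis by (simp add: add_increasing)
next
  case False
  then have "x powr e \<le> a powr e" using assms by (intro powr_mono2') auto
  then show ?thesis by (simp add: add_increasing2)
qed

lemma interp_exponent:
  fixes p p0 p1 \<theta> :: real
  assumes "p0 \<ge> 1" "p1 \<ge> 1" "0 < \<theta>" "\<theta> < 1" "1 / p = (1 - \<theta>) / p0 + \<theta> / p1"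
  shows "p \<ge> 1"
proof -
  have "(1 - \<theta>) / p0 \<le> (1 - \<theta>) / 1" "\<theta> / p1 \<le> \<theta> / 1" using assms by (intro divide_left_mono; simp)+
  moreover have "(1 - \<theta>) / p0 > 0" "\<theta> / p1 > 0" using assms by auto
  ultimately have "1 / p \<le> 1" "1 / p > 0" using assms(5) by simp_all
  then show ?thesis by (simp add: field_simps split: if_splits)
qed

text \<open>The test function for which the pairing with \<open>h = radial_data M f\<close> is the integral of
  \<open>V = \<bar>h\<bar> powr p * rho powr \<gamma>\<close> is embedded into the analytic family whose boundary values are
  extremal for the two endpoint norms. The three lines theorem then bounds the integral of \<open>V\<close> by a
  power of itself that is smaller than one. Restricting to \<open>norm z \<le> r\<close> and \<open>\<bar>h z\<bar> \<ge> \<delta>\<close> makes all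
  these functions bounded.\<close>

lemma truncated_data_bound:
  fixes f :: "complex^'n \<Rightarrow> complex" and F :: "complex \<Rightarrow> complex^'n \<Rightarrow> complex"
  assumes p01: "p0 \<ge> 1" "p1 \<ge> 1" and \<theta>: "0 < \<theta>" "\<theta> < 1"
   and hp: "1 / p = (1 - \<theta>) / p0 + \<theta> / p1" and h\<gamma>: "\<gamma> / p = \<alpha> / p0 * (1 - \<theta>) + \<beta> / p1 * \<theta>"
   and D: "D > 0"
    "\<And>g :: complex^'n \<Rightarrow> complex. g \<in> bergman_space p0 \<alpha> \<Longrightarrow> radial_data M g \<in> Lp_ball p0 \<alpha> \<and> Lp_norm p0 \<alpha> (radial_data M g) \<le> D * bergman_norm p0 \<alpha> g"
    "\<And>g :: complex^'n \<Rightarrow> complex. g \<in> bergman_space p1 \<beta> \<Longrightarrow> radial_data M g \<in> Lp_ball p1 \<beta> \<and> Lp_norm p1 \<beta> (radial_data M g) \<le> D * bergman_norm p1 \<beta> g"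
   and F: "F \<in> interp_maps (bergman_space p0 \<alpha>) (bergman_norm p0 \<alpha>) (bergman_space p1 \<beta>) (bergman_norm p1 \<beta>) \<theta> f"
   and M': "M' > 0" "\<And>\<zeta>. \<zeta> \<in> left_line \<Longrightarrow> bergman_norm p0 \<alpha> (F \<zeta>) \<le> M'" "\<And>\<zeta>. \<zeta> \<in> right_line \<Longrightarrow> bergman_norm p1 \<beta> (F \<zeta>) \<le> M'"
   and r: "r < 1" and \<delta>: "\<delta> > 0"
  defines "V \<equiv> \<lambda>z. if norm z \<le> r \<and> \<delta> \<le> cmod (radial_data M f z) then cmod (radial_data M f z) powr p * rho z powr \<gamma> else 0"
  shows "(\<integral>\<^sup>+z. ennreal (V z) \<partial>\<nu>) \<le> ennreal ((D * M') powr p)"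
proof -
  define XY where "XY = sum_space (bergman_space p0 \<alpha>) (bergman_space p1 \<beta> :: (complex^'n \<Rightarrow> complex) set)"
  define nXY where "nXY = sum_norm (bergman_space p0 \<alpha>) (bergman_norm p0 \<alpha>) (bergman_space p1 \<beta> :: (complex^'n \<Rightarrow> complex) set) (bergman_norm p1 \<beta>)"
  have p: "p \<ge> 1" by (rule interp_exponent[OF p01 \<theta> hp])
  have FA: "analytic_into strip XY nXY F" and FC: "bdd_cont_into (closure strip) XY nXY F" and F\<theta>: "F (of_real \<theta>) = f"
   and FL: "bdd_cont_into left_line (bergman_space p0 \<alpha>) (bergman_norm p0 \<alpha>) F" and FR: "bdd_cont_into right_line (bergman_space p1 \<beta>) (bergman_norm p1 \<beta>) F"
   using F by (auto simp: interp_maps_def XY_def nXY_def)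
  have hol: "g \<in> ball_holomorphic" if "g \<in> XY" for g using that sum_space_holomorphic unfolding XY_def by blast
  have FXY: "F \<zeta> \<in> XY" if "\<zeta> \<in> closure strip" for \<zeta> using FC that by (auto simp: bdd_cont_into_def)
  have comb: "(\<lambda>z. a * f z + b * g z) \<in> XY" if "f \<in> XY" "g \<in> XY" for a b f g
   using sum_space_lincomb[OF p01] that unfolding XY_def by blast
  have lin: "radial_data M (\<lambda>z. a * f z + b * g z) z = a * radial_data M f z + b * radial_data M g z" if "f \<in> XY" "g \<in> XY" for a b f g z
   using radial_data_lincomb hol that by blast
  have \<rho>: "rho z > 0" "rho z \<le> 1" "1 - r\<^sup>2 \<le> rho z" if "norm z \<le> r" for z :: "complex^'n"
   using that r rho_pos[of z] power_mono[of "norm z" r 2] by auto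
  \<comment> \<open>the premise excludes negative \<open>r\<close>, for which there are no points \<open>z\<close>\<close>
  have r2: "1 - r\<^sup>2 > 0" if "norm z \<le> r" for z :: "complex^'n"
  proof -
   have "\<bar>r\<bar> < 1" using that r norm_ge_zero[of z] by linarith
   then show ?thesis by (simp add: abs_square_less_1)
  qed
  obtain Cr where Cr: "Cr > 0" "\<And>g z. g \<in> XY \<Longrightarrow> norm z \<le> r \<Longrightarrow> cmod (radial_power M g z) \<le> Cr * nXY g"
   using sum_space_local_bound[OF p01 r, where 'n='n] unfolding XY_def nXY_def by blast
  have bound: "cmod (radial_data M g z) \<le> Cr * nXY g" if g: "g \<in> XY" and z: "norm z \<le> r" for g z
  proof -
   have "cmod (radial_data M g z) = rho z ^ M * cmod (radial_power M g z)" using \<rho>(1)[OF z] unfolding radial_data_def norm_mult norm_of_real by simp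
   also have "\<dots> \<le> 1 * cmod (radial_power M g z)" using \<rho>[OF z] by (intro mult_right_mono power_le_one) auto
   finally show ?thesis using Cr(2)[OF g z] by simp
  qed
  define v where "v \<zeta> = radial_data M (F \<zeta>)" for \<zeta>
  define h where "h = radial_data M f"
  have \<theta>s: "complex_of_real \<theta> \<in> closure strip" using \<theta> by (simp add: closure_strip)
  have h_v: "h = v (of_real \<theta>)" by (simp add: h_def v_def F\<theta>)
  have v_meas: "v \<zeta> \<in> borel_measurable \<nu>" if "\<zeta> \<in> closure strip" for \<zeta>
   unfolding v_def by (intro radial_data_measurable hol FXY that)
  have h_meas [measurable]: "h \<in> borel_measurable \<nu>" unfolding h_v by (rule v_meas[OF \<theta>s])
  obtain M1 where M1: "\<And>\<zeta>. \<zeta> \<in> closure strip \<Longrightarrow> nXY (F \<zeta>) \<le> M1" using FC by (auto simp: bdd_cont_into_def)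
  define B where "B = Cr * max M1 0"
  have B0: "B \<ge> 0" using Cr(1) by (simp add: B_def)
  have vB: "cmod (v \<zeta> z) \<le> B" if "\<zeta> \<in> closure strip" "norm z \<le> r" for \<zeta> z
  proof -
   have "cmod (v \<zeta> z) \<le> Cr * nXY (F \<zeta>)" unfolding v_def by (rule bound[OF FXY[OF that(1)] that(2)])
   also have "\<dots> \<le> B" unfolding B_def using M1[OF that(1)] Cr(1) by (intro mult_left_mono) auto
   finally show ?thesis .
  qed
  have vcont: "((\<lambda>w. v w z) \<longlongrightarrow> v \<zeta> z) (at \<zeta> within closure strip)" if "\<zeta> \<in> closure strip" "norm z \<le> r" for \<zeta> z
   unfolding v_def
   by (rule functional_of_continuous_family[of XY "\<lambda>g. radial_data M g z" Cr nXY, OF comb lin bound[OF _ that(2)] FC that(1)])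
  have vder: "\<exists>G' \<in> borel_measurable \<nu>. \<exists>K d. d > 0 \<and> K \<ge> 0 \<and>
    (\<forall>z. norm z \<le> r \<longrightarrow> ((\<lambda>w. (v w z - v \<zeta> z) / (w - \<zeta>)) \<longlongrightarrow> G' z) (at \<zeta>) \<and>
     (\<forall>w \<in> ball \<zeta> d - {\<zeta>}. cmod ((v w z - v \<zeta> z) / (w - \<zeta>)) \<le> K))" if z: "\<zeta> \<in> strip" for \<zeta>
  proof -
   obtain G where G: "G \<in> XY" and lim: "((\<lambda>w. nXY (\<lambda>z. (F w z - F \<zeta> z) / (w - \<zeta>) - G z)) \<longlongrightarrow> 0) (at \<zeta>)"
    using FA z by (auto simp: analytic_into_def)
   obtain d1 where d1: "d1 > 0" "ball \<zeta> d1 \<subseteq> strip" using open_strip z by (meson open_contains_ball)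
   have "\<forall>\<^sub>F w in at \<zeta>. nXY (\<lambda>z. (F w z - F \<zeta> z) / (w - \<zeta>) - G z) < 1" using lim by (rule order_tendstoD) simp
   then obtain d2 where d2: "d2 > 0" "\<And>w. w \<noteq> \<zeta> \<Longrightarrow> dist w \<zeta> < d2 \<Longrightarrow> nXY (\<lambda>z. (F w z - F \<zeta> z) / (w - \<zeta>) - G z) < 1"
    by (auto simp: eventually_at)
   have cl: "ball \<zeta> d1 \<subseteq> closure strip" using d1(2) closure_subset by blast
   have quot: "cmod ((v w y - v \<zeta> y) / (w - \<zeta>) - radial_data M G y) \<le> Cr * nXY (\<lambda>z. (F w z - F \<zeta> z) / (w - \<zeta>) - G z)"
    if "norm y \<le> r" "w \<in> ball \<zeta> d1" for w y
    unfolding v_def using cl that d1(1)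
    by (intro functional_of_quotient[of XY "\<lambda>g. radial_data M g y" Cr nXY, OF comb lin bound[OF _ that(1)]] FXY G) auto
   show ?thesis
   proof (rule bexI[of _ "radial_data M G"], rule exI[of _ "Cr + max 0 (Cr * nXY G)"], rule exI[of _ "min d1 d2"],
     intro conjI allI impI)
    show "radial_data M G \<in> borel_measurable \<nu>" by (intro radial_data_measurable hol G)
    show "min d1 d2 > 0" using d1 d2 by simp
    show "0 \<le> Cr + max 0 (Cr * nXY G)" using Cr(1) by simp
    fix y :: "complex^'n" assume y: "norm y \<le> r"
    have "((\<lambda>w. (v w y - v \<zeta> y) / (w - \<zeta>) - radial_data M G y) \<longlongrightarrow> 0) (at \<zeta>)"
    proof (rule Lim_null_comparison[OF _ tendsto_mult_right_zero[OF lim, of Cr]])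
     have "\<forall>\<^sub>F w in at \<zeta>. w \<in> ball \<zeta> d1" using d1 by (intro eventually_at_in_open') auto
     then show "\<forall>\<^sub>F w in at \<zeta>. norm ((v w y - v \<zeta> y) / (w - \<zeta>) - radial_data M G y) \<le> Cr * nXY (\<lambda>z. (F w z - F \<zeta> z) / (w - \<zeta>) - G z)"
      by eventually_elim (rule quot[OF y])
    qed
    then show "((\<lambda>w. (v w y - v \<zeta> y) / (w - \<zeta>)) \<longlongrightarrow> radial_data M G y) (at \<zeta>)" by (rule LIM_zero_cancel)
    show "\<forall>w \<in> ball \<zeta> (min d1 d2) - {\<zeta>}. cmod ((v w y - v \<zeta> y) / (w - \<zeta>)) \<le> Cr + max 0 (Cr * nXY G)"
    proof
    fix w assume w: "w \<in> ball \<zeta> (min d1 d2) - {\<zeta>}"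
    then have "Cr * nXY (\<lambda>z. (F w z - F \<zeta> z) / (w - \<zeta>) - G z) \<le> Cr * 1"
     using d2(2)[of w] Cr(1) by (intro mult_left_mono) (auto simp: dist_commute less_imp_le)
    moreover have "cmod ((v w y - v \<zeta> y) / (w - \<zeta>)) \<le> cmod ((v w y - v \<zeta> y) / (w - \<zeta>) - radial_data M G y) + cmod (radial_data M G y)"
     using norm_triangle_ineq[of "(v w y - v \<zeta> y) / (w - \<zeta>) - radial_data M G y" "radial_data M G y"] by simp
    ultimately show "cmod ((v w y - v \<zeta> y) / (w - \<zeta>)) \<le> Cr + max 0 (Cr * nXY G)"
     using quot[OF y, of w] bound[OF G y] w by auto
    qed
   qed
  qed
  define K where "K z \<longleftrightarrow> norm z \<le> r \<and> \<delta> \<le> cmod (h z)" for z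
  have V: "V z = (if K z then cmod (h z) powr p * rho z powr \<gamma> else 0)" for z by (simp add: V_def K_def h_def)
  have V0: "V z \<ge> 0" for z by (simp add: V)
  \<comment> \<open>the logarithm of \<open>V\<close> where \<open>V\<close> does not vanish\<close>
  define U where "U z = p * ln (cmod (h z)) + \<gamma> * ln (rho z)" for z
  have VU: "V z = exp (U z)" "V z > 0" if "K z" for z
  proof -
   have "cmod (h z) > 0" "rho z > 0" using that \<delta> \<rho>(1)[of z] by (auto simp: K_def)
   then show "V z = exp (U z)" using that by (simp add: V U_def powr_def exp_add)
   then show "V z > 0" by simp
  qed
  \<comment> \<open>the extremal exponents; at \<open>\<theta>\<close> they combine to \<open>1 - 1/p\<close> and \<open>\<gamma>/p\<close>\<close>
  define L where "L q a z = (1 - 1/q) * U z + (a/q) * ln (rho z)" for q a z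
  define s where "s z = (if K z then cnj (sgn (h z)) else 0)" for z
  have eL: "cmod (s z) * exp (L q a z) = V z powr (1 - 1/q) * rho z powr (a/q)" for q a z
  proof (cases "K z")
   case True
   have "h z \<noteq> 0" "rho z > 0" using True \<delta> \<rho>(1)[of z] by (auto simp: K_def)
   then show ?thesis using True VU[OF True] by (simp add: s_def norm_sgn L_def powr_def exp_add)
  qed (simp add: s_def V)
  have [measurable]: "Measurable.pred \<nu> K" unfolding K_def[abs_def] by measurable
  have [measurable]: "U \<in> borel_measurable \<nu>" unfolding U_def[abs_def] by measurable
  have [measurable]: "V \<in> borel_measurable \<nu>" unfolding V[abs_def] by measurable
  have [measurable]: "(\<lambda>z. cnj (sgn (h z))) \<in> borel_measurable \<nu>"
   unfolding sgn_eq
   by (intro measurable_compose[OF _ borel_measurable_continuous_onI[of cnj]] borel_measurable_divide h_meas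
     measurable_compose[OF _ borel_measurable_of_real] measurable_compose[OF _ borel_measurable_norm] continuous_intros)
  have [measurable]: "s \<in> borel_measurable \<nu>" unfolding s_def[abs_def] by measurable
  have [measurable]: "L q a \<in> borel_measurable \<nu>" for q a unfolding L_def[abs_def] by measurable
  have bdd: "\<exists>H\<ge>0. \<forall>z. V z powr e * rho z powr a \<le> H" for e a
  proof -
   let ?H = "(\<delta> powr (p * e) + B powr (p * e)) * ((1 - r\<^sup>2) powr (\<gamma> * e + a) + 1 powr (\<gamma> * e + a))"
   have "V z powr e * rho z powr a \<le> ?H" for z
   proof (cases "K z")
    case True
    then have z: "norm z \<le> r" "\<delta> \<le> cmod (h z)" by (auto simp: K_def)
    have "V z powr e * rho z powr a = cmod (h z) powr (p * e) * rho z powr (\<gamma> * e + a)"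
     using True \<rho>(1)[OF z(1)] by (simp add: V powr_mult powr_powr powr_add)
    also have "\<dots> \<le> ?H"
     using z \<delta> \<rho>[OF z(1)] r2[OF z(1)] vB[OF \<theta>s z(1)] by (intro mult_mono powr_between_le) (auto simp: h_v)
    finally show ?thesis .
   qed (simp add: V)
   then show ?thesis by (intro exI[of _ "?H"]) auto
  qed
  obtain H0 where H0: "H0 \<ge> 0" "\<And>z. cmod (s z) * exp (L p0 \<alpha> z) \<le> H0" using bdd unfolding eL by metis
  obtain H1 where H1: "H1 \<ge> 0" "\<And>z. cmod (s z) * exp (L p1 \<beta> z) \<le> H1" using bdd unfolding eL by metis
  define H where "H = max H0 H1"
  have H: "cmod (s z) * exp (L p0 \<alpha> z) \<le> H" "cmod (s z) * exp (L p1 \<beta> z) \<le> H" for z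
   using H0(2)[of z] H1(2)[of z] by (auto simp: H_def)
  have s0: "s z = 0" if "norm z > r" for z using that by (auto simp: s_def K_def)
  define \<psi> where "\<psi> = calderon_family s (L p0 \<alpha>) (L p1 \<beta>)"
  have \<psi>m [measurable]: "\<psi> \<zeta> \<in> borel_measurable \<nu>" for \<zeta>
   unfolding \<psi>_def calderon_family_def[abs_def] by measurable
  define \<phi> where "\<phi> \<zeta> = (\<integral>z. v \<zeta> z * \<psi> \<zeta> z \<partial>\<nu>)" for \<zeta>
  have pair: "continuous_on (closure strip) \<phi>" "\<phi> holomorphic_on strip" "\<exists>K. \<forall>\<zeta>\<in>closure strip. cmod (\<phi> \<zeta>) \<le> K"
   using pairing_on_strip[of v B r s "L p0 \<alpha>" "L p1 \<beta>" H, OF v_meas B0 vB vcont vder _ _ _ s0 H] unfolding \<phi>_def[abs_def] \<psi>_def by auto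
  obtain HV where HV: "HV \<ge> 0" "\<And>z. V z powr 1 * rho z powr 0 \<le> HV" using bdd by metis
  have iV: "integrable \<nu> V"
  proof (rule ball_measure.integrable_const_bound[of _ HV])
   have "V z \<le> HV" if "norm z < 1" for z using HV(2)[of z] V0[of z] rho_pos[OF that] by (simp split: if_splits)
   then show "AE z in \<nu>. norm (V z) \<le> HV" using V0 by (intro AE_I2) simp
  qed measurable
  define A where "A = (\<integral>z. V z \<partial>\<nu>)"
  have A0: "A \<ge> 0" unfolding A_def using V0 by (intro integral_nonneg_AE AE_I2) auto
  have nnA: "(\<integral>\<^sup>+z. ennreal (V z) \<partial>\<nu>) = ennreal A" unfolding A_def using V0 by (intro nn_integral_eq_integral iV AE_I2) auto
  show ?thesis
  proof (cases "A = 0")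
   case True
   then show ?thesis by (simp add: nnA)
  next
   case False
   then have A: "A > 0" using A0 by simp
   have boundary: "cmod (\<phi> \<zeta>) \<le> A powr (1 - 1/q) * (D * M')"
    if q: "q \<ge> 1" and d: "v \<zeta> \<in> Lp_ball q a \<and> Lp_norm q a (v \<zeta>) \<le> D * x" and x: "x \<le> M'"
     and \<psi>: "\<And>z. cmod (\<psi> \<zeta> z) = cmod (s z) * exp (L q a z)" for \<zeta> q a x
   proof -
    have "cmod (\<phi> \<zeta>) \<le> A powr (1 - 1/q) * Lp_norm q a (v \<zeta>)"
     unfolding \<phi>_def by (rule pairing_le[OF q conjunct1[OF d] \<psi>m iV V0 A_def[symmetric] A]) (simp add: \<psi> eL)
    also have "\<dots> \<le> A powr (1 - 1/q) * (D * M')"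
     by (intro mult_left_mono order_trans[OF conjunct2[OF d] mult_left_mono[OF x less_imp_le[OF D(1)]]]) auto
    finally show ?thesis .
   qed
   have left: "cmod (\<phi> \<zeta>) \<le> A powr (1 - 1/p0) * (D * M')" if z: "Re \<zeta> = 0" for \<zeta>
   proof (rule boundary[OF p01(1), of _ \<alpha>])
    show "v \<zeta> \<in> Lp_ball p0 \<alpha> \<and> Lp_norm p0 \<alpha> (v \<zeta>) \<le> D * bergman_norm p0 \<alpha> (F \<zeta>)"
     unfolding v_def using FL z by (intro D(2)) (auto simp: bdd_cont_into_def left_line_def)
   qed (use z M'(2) in \<open>auto simp: left_line_def \<psi>_def norm_calderon_family\<close>)
   have right: "cmod (\<phi> \<zeta>) \<le> A powr (1 - 1/p1) * (D * M')" if z: "Re \<zeta> = 1" for \<zeta>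
   proof (rule boundary[OF p01(2), of _ \<beta>])
    show "v \<zeta> \<in> Lp_ball p1 \<beta> \<and> Lp_norm p1 \<beta> (v \<zeta>) \<le> D * bergman_norm p1 \<beta> (F \<zeta>)"
     unfolding v_def using FR z by (intro D(3)) (auto simp: bdd_cont_into_def right_line_def)
   qed (use z M'(3) in \<open>auto simp: right_line_def \<psi>_def norm_calderon_family\<close>)
   have mid: "\<phi> (of_real \<theta>) = of_real A"
   proof -
    have "h z * \<psi> (of_real \<theta>) z = of_real (V z)" for z
    proof (cases "K z")
     case True
     have hz: "cmod (h z) > 0" using True \<delta> by (auto simp: K_def)
     have "cnj (sgn (h z)) * h z = of_real (cmod (h z))"
      using hz by (simp add: sgn_eq complex_norm_square[symmetric] power2_eq_square field_simps)
     then have "h z * \<psi> (of_real \<theta>) z = of_real (cmod (h z)) * exp (of_real ((1 - \<theta>) * L p0 \<alpha> z + \<theta> * L p1 \<beta> z))"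
      using True by (simp add: \<psi>_def calderon_family_def s_def mult_ac)
     also have "\<dots> = of_real (exp (ln (cmod (h z)) + ((1 - \<theta>) * L p0 \<alpha> z + \<theta> * L p1 \<beta> z)))"
      using hz by (simp add: exp_add exp_of_real[symmetric])
     also have "ln (cmod (h z)) + ((1 - \<theta>) * L p0 \<alpha> z + \<theta> * L p1 \<beta> z) = U z"
     proof -
      have "(1 - \<theta>) * L p0 \<alpha> z + \<theta> * L p1 \<beta> z = (1 - ((1 - \<theta>) / p0 + \<theta> / p1)) * U z + (\<alpha> / p0 * (1 - \<theta>) + \<beta> / p1 * \<theta>) * ln (rho z)"
       by (simp add: L_def algebra_simps)
      also have "\<dots> = (1 - 1/p) * U z + (\<gamma>/p) * ln (rho z)" by (simp only: hp h\<gamma>)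
      also have "\<dots> = U z - ln (cmod (h z))" using p by (simp add: U_def field_simps)
      finally show ?thesis by simp
     qed
     finally show ?thesis using VU[OF True] by simp
    qed (simp add: V \<psi>_def calderon_family_def s_def)
    then show ?thesis by (simp add: \<phi>_def h_v[symmetric] A_def)
   qed
   obtain B' where B': "\<And>\<zeta>. \<zeta> \<in> closure strip \<Longrightarrow> cmod (\<phi> \<zeta>) \<le> B'" using pair(3) by blast
   have DM: "D * M' > 0" using D(1) M'(1) by simp
   have "cmod (\<phi> (of_real \<theta>)) \<le> (A powr (1 - 1/p0) * (D * M')) powr (1 - \<theta>) * (A powr (1 - 1/p1) * (D * M')) powr \<theta>"
    by (rule three_lines[where B = B', OF _ _ _ _ left _ right \<theta>])
     (use pair(1) pair(2)[unfolded strip_def] B' A DM in \<open>simp_all add: closure_strip\<close>)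
   then have "A \<le> (A powr (1 - 1/p0) * (D * M')) powr (1 - \<theta>) * (A powr (1 - 1/p1) * (D * M')) powr \<theta>"
    using A by (simp add: mid)
   also have "\<dots> = A powr ((1 - 1/p0) * (1 - \<theta>) + (1 - 1/p1) * \<theta>) * (D * M') powr ((1 - \<theta>) + \<theta>)"
    unfolding powr_mult[of "A powr _" "D * M'"] powr_powr powr_add by (simp only: mult_ac)
   also have "(1 - 1/p0) * (1 - \<theta>) + (1 - 1/p1) * \<theta> = 1 - 1/p" using hp by (simp add: algebra_simps)
   finally have "A powr (1 - 1/p) * A powr (1/p) \<le> A powr (1 - 1/p) * (D * M')"
    using A DM by (simp flip: powr_add)
   then have "A powr (1/p) \<le> D * M'" using A by simp
   then have "(A powr (1/p)) powr p \<le> (D * M') powr p" using p by (intro powr_mono2) auto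
   then have "A \<le> (D * M') powr p" using A p by (simp add: powr_powr)
   then show ?thesis by (simp add: nnA ennreal_leI)
  qed
qed

text \<open>The value at the origin is not controlled by radial derivatives; it is bounded by the norms on both
  lines, and the three lines theorem applies to it directly.\<close>

lemma interp_maps_value_at_0:
  fixes F :: "complex \<Rightarrow> complex^'n \<Rightarrow> complex"
  assumes p01: "p0 \<ge> 1" "p1 \<ge> 1" and \<theta>: "0 < \<theta>" "\<theta> < 1"
   and F: "F \<in> interp_maps (bergman_space p0 \<alpha>) (bergman_norm p0 \<alpha>) (bergman_space p1 \<beta>) (bergman_norm p1 \<beta>) \<theta> f"
   and M': "M' > 0" "\<And>\<zeta>. \<zeta> \<in> left_line \<Longrightarrow> bergman_norm p0 \<alpha> (F \<zeta>) \<le> M'" "\<And>\<zeta>. \<zeta> \<in> right_line \<Longrightarrow> bergman_norm p1 \<beta> (F \<zeta>) \<le> M'"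
  shows "cmod (f 0) \<le> M'"
proof -
  define XY where "XY = sum_space (bergman_space p0 \<alpha>) (bergman_space p1 \<beta> :: (complex^'n \<Rightarrow> complex) set)"
  define nXY where "nXY = sum_norm (bergman_space p0 \<alpha>) (bergman_norm p0 \<alpha>) (bergman_space p1 \<beta> :: (complex^'n \<Rightarrow> complex) set) (bergman_norm p1 \<beta>)"
  have FA: "analytic_into strip XY nXY F" and FC: "bdd_cont_into (closure strip) XY nXY F" and F\<theta>: "F (of_real \<theta>) = f"
   and FL: "bdd_cont_into left_line (bergman_space p0 \<alpha>) (bergman_norm p0 \<alpha>) F" and FR: "bdd_cont_into right_line (bergman_space p1 \<beta>) (bergman_norm p1 \<beta>) F"
   using F by (auto simp: interp_maps_def XY_def nXY_def)
  have FXY: "F \<zeta> \<in> XY" if "\<zeta> \<in> closure strip" for \<zeta> using FC that by (auto simp: bdd_cont_into_def)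
  have comb: "(\<lambda>z. a * f z + b * g z) \<in> XY" if "f \<in> XY" "g \<in> XY" for a b f g
   using sum_space_lincomb[OF p01] that unfolding XY_def by blast
  obtain C where C: "C > 0" "\<And>g z. g \<in> XY \<Longrightarrow> norm z \<le> 0 \<Longrightarrow> cmod (radial_power 0 g z) \<le> C * nXY g"
   using sum_space_local_bound[OF p01 zero_less_one, where 'n='n] unfolding XY_def nXY_def by blast
  have bound: "cmod (g 0) \<le> C * nXY g" if "g \<in> XY" for g
  proof -
   have "g \<in> ball_holomorphic" using that sum_space_holomorphic unfolding XY_def by blast
   from radial_deriv_funpow[OF this, of 0 0] C(2)[OF that, of 0] show ?thesis by simp
  qed
  note fam = functional_of_family[of XY "\<lambda>g. g 0" C nXY, OF comb refl bound]
  obtain M1 where M1: "\<And>\<zeta>. \<zeta> \<in> closure strip \<Longrightarrow> nXY (F \<zeta>) \<le> M1" using FC by (auto simp: bdd_cont_into_def)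
  have "(\<lambda>\<zeta>. F \<zeta> 0) field_differentiable at \<zeta>" if z: "\<zeta> \<in> strip" for \<zeta>
  proof -
   obtain G where G: "G \<in> XY" and lim: "((\<lambda>w. nXY (\<lambda>z. (F w z - F \<zeta> z) / (w - \<zeta>) - G z)) \<longlongrightarrow> 0) (at \<zeta>)"
    using FA z by (auto simp: analytic_into_def)
   have "((\<lambda>w. (F w 0 - F \<zeta> 0) / (w - \<zeta>) - G 0) \<longlongrightarrow> 0) (at \<zeta>)"
   proof (rule Lim_null_comparison[OF _ tendsto_mult_right_zero[OF lim, of C]])
    have "\<forall>\<^sub>F w in at \<zeta>. w \<in> strip" using open_strip z by (intro eventually_at_in_open') auto
    then show "\<forall>\<^sub>F w in at \<zeta>. norm ((F w 0 - F \<zeta> 0) / (w - \<zeta>) - G 0) \<le> C * nXY (\<lambda>z. (F w z - F \<zeta> z) / (w - \<zeta>) - G z)"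
    proof eventually_elim
     case (elim w)
     then show ?case using z closure_subset[of strip] by (intro fam(2) FXY G) auto
    qed
   qed
   then show ?thesis unfolding field_differentiable_def has_field_derivative_iff by (blast intro: LIM_zero_cancel)
  qed
  then have hol: "(\<lambda>\<zeta>. F \<zeta> 0) holomorphic_on strip" by (simp add: holomorphic_on_def field_differentiable_at_within)
  have cont: "continuous_on (closure strip) (\<lambda>\<zeta>. F \<zeta> 0)" unfolding continuous_on_def using fam(1)[OF _ _ _ FC] by blast
  have bdd: "cmod (F \<zeta> 0) \<le> C * M1" if "\<zeta> \<in> closure strip" for \<zeta>
   using bound[OF FXY[OF that]] mult_left_mono[OF M1[OF that], of C] C(1) by linarith
  have l: "cmod (F \<zeta> 0) \<le> M'" if "Re \<zeta> = 0" for \<zeta>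
  proof -
   have "\<zeta> \<in> left_line" using that by (simp add: left_line_def)
   then show ?thesis using bergman_order_data(2)[OF p01(1), of "F \<zeta>" \<alpha>] M'(2)[of \<zeta>] FL by (force simp: bdd_cont_into_def)
  qed
  have r: "cmod (F \<zeta> 0) \<le> M'" if "Re \<zeta> = 1" for \<zeta>
  proof -
   have "\<zeta> \<in> right_line" using that by (simp add: right_line_def)
   then show ?thesis using bergman_order_data(2)[OF p01(2), of "F \<zeta>" \<beta>] M'(3)[of \<zeta>] FR by (force simp: bdd_cont_into_def)
  qed
  have "cmod (F (of_real \<theta>) 0) \<le> M' powr (1 - \<theta>) * M' powr \<theta>"
   by (rule three_lines[where B = "C * M1", OF _ _ _ M'(1) l M'(1) r \<theta>])
    (use hol[unfolded strip_def] cont bdd M'(1) in \<open>simp_all add: closure_strip\<close>)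
  then show ?thesis using M'(1) by (simp add: F\<theta> flip: powr_add)
qed

text \<open>Letting the truncations grow, Fatou's lemma turns the uniform bound for the truncated data into a
  bound for the data of \<open>f\<close>.\<close>

theorem interp_maps_imp_bergman:
  assumes p01: "p0 \<ge> 1" "p1 \<ge> 1" and \<theta>: "0 < \<theta>" "\<theta> < 1"
   and hp: "1 / p = (1 - \<theta>) / p0 + \<theta> / p1" and h\<gamma>: "\<gamma> / p = \<alpha> / p0 * (1 - \<theta>) + \<beta> / p1 * \<theta>"
  shows "\<exists>E>0. \<forall>(f :: complex^'n \<Rightarrow> complex) F M'. F \<in> interp_maps (bergman_space p0 \<alpha>) (bergman_norm p0 \<alpha>) (bergman_space p1 \<beta>) (bergman_norm p1 \<beta>) \<theta> f
   \<longrightarrow> M' > 0 \<longrightarrow> (\<forall>\<zeta>\<in>left_line. bergman_norm p0 \<alpha> (F \<zeta>) \<le> M') \<longrightarrow> (\<forall>\<zeta>\<in>right_line. bergman_norm p1 \<beta> (F \<zeta>) \<le> M')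
   \<longrightarrow> f \<in> bergman_space p \<gamma> \<and> bergman_norm p \<gamma> f \<le> E * M'"
proof -
  have p: "p \<ge> 1" by (rule interp_exponent[OF p01 \<theta> hp])
  \<comment> \<open>one order of differentiation that is admissible for all three spaces\<close>
  obtain M :: nat where M: "real M > \<bar>\<alpha>\<bar> + \<bar>\<beta>\<bar> + \<bar>\<gamma>\<bar>" using reals_Archimedean2 by blast
  have big: "q * real M + a > -1" if "q \<ge> 1" "\<bar>a\<bar> \<le> \<bar>\<alpha>\<bar> + \<bar>\<beta>\<bar> + \<bar>\<gamma>\<bar>" for q a :: real
   using that M mult_right_mono[of 1 q "real M"] by linarith
  obtain D0 where D0: "D0 > 0" "\<And>g :: complex^'n \<Rightarrow> complex. g \<in> bergman_space p0 \<alpha> \<Longrightarrow> radial_data M g \<in> Lp_ball p0 \<alpha> \<and> Lp_norm p0 \<alpha> (radial_data M g) \<le> D0 * bergman_norm p0 \<alpha> g"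
   using bergman_data_bound[OF p01(1) big[OF p01(1), of \<alpha>], where 'n='n] by auto
  obtain D1 where D1: "D1 > 0" "\<And>g :: complex^'n \<Rightarrow> complex. g \<in> bergman_space p1 \<beta> \<Longrightarrow> radial_data M g \<in> Lp_ball p1 \<beta> \<and> Lp_norm p1 \<beta> (radial_data M g) \<le> D1 * bergman_norm p1 \<beta> g"
   using bergman_data_bound[OF p01(2) big[OF p01(2), of \<beta>], where 'n='n] by auto
  obtain C where C: "C > 0" "\<And>f :: complex^'n \<Rightarrow> complex. f \<in> ball_holomorphic \<Longrightarrow> radial_data M f \<in> Lp_ball p \<gamma> \<Longrightarrow>
    f \<in> bergman_space p \<gamma> \<and> bergman_norm p \<gamma> f \<le> C * (cmod (f 0) + Lp_norm p \<gamma> (radial_data M f))"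
   using bergman_from_data[OF p big[OF p, of \<gamma>], where 'n='n] by auto
  define D where "D = max D0 D1"
  have D: "D > 0" "D0 * bergman_norm p0 \<alpha> g \<le> D * bergman_norm p0 \<alpha> g" "D1 * bergman_norm p1 \<beta> g \<le> D * bergman_norm p1 \<beta> g" for g :: "complex^'n \<Rightarrow> complex"
   using D0(1) by (auto simp: D_def intro!: mult_right_mono bergman_norm_nonneg)
  show ?thesis
  proof (intro exI[of _ "C * (1 + D)"] conjI allI impI)
   show "C * (1 + D) > 0" using C(1) D(1) by simp
   fix f :: "complex^'n \<Rightarrow> complex" and F M'
   assume F: "F \<in> interp_maps (bergman_space p0 \<alpha>) (bergman_norm p0 \<alpha>) (bergman_space p1 \<beta>) (bergman_norm p1 \<beta>) \<theta> f"
    and M': "M' > 0" "\<forall>\<zeta>\<in>left_line. bergman_norm p0 \<alpha> (F \<zeta>) \<le> M'" "\<forall>\<zeta>\<in>right_line. bergman_norm p1 \<beta> (F \<zeta>) \<le> M'"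
   have f: "f \<in> ball_holomorphic"
   proof -
    have "F (of_real \<theta>) \<in> sum_space (bergman_space p0 \<alpha>) (bergman_space p1 \<beta>)" "F (of_real \<theta>) = f"
     using F \<theta> by (auto simp: interp_maps_def bdd_cont_into_def closure_strip)
    then show ?thesis using sum_space_holomorphic by blast
   qed
   define h where "h = radial_data M f"
   have [measurable]: "h \<in> borel_measurable \<nu>" unfolding h_def by (rule radial_data_measurable[OF f])
   define V where "V i z = (if norm z \<le> 1 - 1 / real (Suc i) \<and> 1 / real (Suc i) \<le> cmod (h z) then cmod (h z) powr p * rho z powr \<gamma> else 0)" for i z
   have [measurable]: "V i \<in> borel_measurable \<nu>" for i unfolding V_def[abs_def] by measurable
   have bound: "(\<integral>\<^sup>+z. ennreal (V i z) \<partial>\<nu>) \<le> ennreal ((D * M') powr p)" for i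
    unfolding V_def h_def
    by (rule truncated_data_bound[OF p01 \<theta> hp h\<gamma> D(1) _ _ F M'(1)])
     (use D0(2) D1(2) D(2,3) M'(2,3) order_trans in \<open>fastforce+\<close>)
   have lim: "(\<lambda>i. V i z) \<longlonglongrightarrow> cmod (h z) powr p * rho z powr \<gamma>" if z: "norm z < 1" for z
   proof (cases "h z = 0")
    case True
    then show ?thesis by (simp add: V_def)
   next
    case False
    have "(\<lambda>i. 1 / real (Suc i)) \<longlonglongrightarrow> 0" using LIMSEQ_inverse_real_of_nat by (simp add: inverse_eq_divide)
    then have "\<forall>\<^sub>F i in sequentially. 1 / real (Suc i) < min (1 - norm z) (cmod (h z))"
     by (rule order_tendstoD) (use z False in simp)
    then have "\<forall>\<^sub>F i in sequentially. V i z = cmod (h z) powr p * rho z powr \<gamma>"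
     by eventually_elim (simp add: V_def)
    then show ?thesis by (rule tendsto_eventually)
   qed
   have nn: "(\<integral>\<^sup>+z. ennreal (cmod (h z) powr p * rho z powr \<gamma>) \<partial>\<nu>) \<le> ennreal ((D * M') powr p)"
   proof -
    have "(\<integral>\<^sup>+z. ennreal (cmod (h z) powr p * rho z powr \<gamma>) \<partial>\<nu>) = (\<integral>\<^sup>+z. liminf (\<lambda>i. ennreal (V i z)) \<partial>\<nu>)"
    proof (rule nn_integral_cong)
     fix z :: "complex^'n" assume "z \<in> space \<nu>"
     then have "(\<lambda>i. ennreal (V i z)) \<longlonglongrightarrow> ennreal (cmod (h z) powr p * rho z powr \<gamma>)" by (intro tendsto_ennrealI lim) simp
     then show "ennreal (cmod (h z) powr p * rho z powr \<gamma>) = liminf (\<lambda>i. ennreal (V i z))" by (simp add: lim_imp_Liminf)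
    qed
    also have "\<dots> \<le> liminf (\<lambda>i. \<integral>\<^sup>+z. ennreal (V i z) \<partial>\<nu>)" by (rule nn_integral_liminf) measurable
    also have "\<dots> \<le> limsup (\<lambda>i. \<integral>\<^sup>+z. ennreal (V i z) \<partial>\<nu>)" by (rule Liminf_le_Limsup) simp
    also have "\<dots> \<le> ennreal ((D * M') powr p)" by (rule Limsup_bounded) (simp add: bound)
    finally show ?thesis .
   qed
   have hL: "h \<in> Lp_ball p \<gamma>" unfolding Lp_ball_def
    using nn by (auto intro!: integrableI_nonneg simp: top_unique less_top[symmetric])
   have "Lp_norm p \<gamma> h \<le> D * M'"
   proof (rule Lp_norm_leI)
    show "(\<integral>w. cmod (h w) powr p * rho w powr \<gamma> \<partial>\<nu>) \<le> (D * M') powr p"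
     using nn unfolding Lp_nn_integral[OF hL] by simp
   qed (use p D(1) M'(1) in auto)
   moreover have "cmod (f 0) \<le> M'" using M'(2,3) by (intro interp_maps_value_at_0[OF p01 \<theta> F M'(1)]) auto
   ultimately have "C * (cmod (f 0) + Lp_norm p \<gamma> h) \<le> C * (M' + D * M')" using C(1) by (intro mult_left_mono add_mono) auto
   also have "\<dots> = C * (1 + D) * M'" by (simp add: algebra_simps)
   finally show "bergman_norm p \<gamma> f \<le> C * (1 + D) * M'" using C(2)[OF f hL[unfolded h_def]] unfolding h_def by linarith
   show "f \<in> bergman_space p \<gamma>" using C(2)[OF f hL[unfolded h_def]] by blast
  qed
qed

section \<open>Admissible families through a given function\<close>

text \<open>The power of \<open>\<bar>g\<bar>\<close> and the weights are those that move \<open>g\<close> isometrically between the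
  spaces, up to the scalar \<open>t'\<close> that makes the norm independent of the exponent. The value \<open>t' = 1\<close> only
  serves to have a positive number when \<open>g\<close> vanishes.\<close>

lemma weighted_modulus_Lp:
  fixes g :: "complex^'n \<Rightarrow> complex" and a p q \<gamma> t t' :: real
  assumes p: "p > 0" and q: "q > 0" and g: "g \<in> Lp_ball p \<gamma>"
   and t: "t = Lp_norm p \<gamma> g" and t': "t' = (if t = 0 then 1 else t)"
  defines "L \<equiv> \<lambda>z. (p/q) * ln (cmod (g z)) + ((\<gamma> - a)/q) * ln (rho z) + (1 - p/q) * ln t'"
  shows "(\<lambda>z. complex_of_real (cmod (sgn (g z)) * exp (L z))) \<in> Lp_ball q a"
   and "Lp_norm q a (\<lambda>z. complex_of_real (cmod (sgn (g z)) * exp (L z))) \<le> t"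
proof -
  have [measurable]: "g \<in> borel_measurable \<nu>" using g by (rule Lp_ball_measurable)
  have t0: "t \<ge> 0" "t' > 0" by (auto simp: t t' less_le)
  have eq: "cmod (complex_of_real (cmod (sgn (g z)) * exp (L z))) powr q * rho z powr a = t' powr (q - p) * (cmod (g z) powr p * rho z powr \<gamma>)"
   if "norm z < 1" for z
  proof (cases "g z = 0")
   case False
   have "rho z > 0" using rho_pos[OF that] .
   have "L z * q = p * ln (cmod (g z)) + (\<gamma> - a) * ln (rho z) + (q - p) * ln t'"
    using q by (simp add: L_def distrib_right) (simp add: field_simps)
   then have "exp (L z) powr q = cmod (g z) powr p * rho z powr (\<gamma> - a) * t' powr (q - p)"
    using False \<open>rho z > 0\<close> t0 by (simp add: powr_def exp_add mult.commute)
   moreover have "rho z powr (\<gamma> - a) * rho z powr a = rho z powr \<gamma>" by (simp flip: powr_add)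
   ultimately show ?thesis using False unfolding norm_of_real by (simp add: norm_sgn mult_ac)
  qed simp
  have int: "integrable \<nu> (\<lambda>z. t' powr (q - p) * (cmod (g z) powr p * rho z powr \<gamma>))"
   using Lp_ball_integrable[OF g] by simp
  have [measurable]: "L \<in> borel_measurable \<nu>" unfolding L_def by measurable
  have "(\<lambda>z. complex_of_real (cmod (sgn (g z)) * exp (L z))) \<in> borel_measurable \<nu>"
   unfolding norm_sgn by measurable
  moreover have "integrable \<nu> (\<lambda>z. cmod (complex_of_real (cmod (sgn (g z)) * exp (L z))) powr q * rho z powr a)"
   using int by (subst Bochner_Integration.integrable_cong[OF refl eq]) auto
  ultimately show "(\<lambda>z. complex_of_real (cmod (sgn (g z)) * exp (L z))) \<in> Lp_ball q a" by (simp add: Lp_ball_def)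
  show "Lp_norm q a (\<lambda>z. complex_of_real (cmod (sgn (g z)) * exp (L z))) \<le> t"
  proof (rule Lp_norm_leI[OF q t0(1)])
   have "(\<integral>z. cmod (complex_of_real (cmod (sgn (g z)) * exp (L z))) powr q * rho z powr a \<partial>\<nu>)
     = (\<integral>z. t' powr (q - p) * (cmod (g z) powr p * rho z powr \<gamma>) \<partial>\<nu>)"
    by (rule Bochner_Integration.integral_cong[OF refl eq]) simp
   also have "\<dots> = t' powr (q - p) * t powr p" by (simp add: t Lp_norm_powr[OF p])
   also have "\<dots> \<le> t powr q" unfolding t' by (auto simp flip: powr_add)
   finally show "(\<integral>z. cmod (complex_of_real (cmod (sgn (g z)) * exp (L z))) powr q * rho z powr a \<partial>\<nu>) \<le> t powr q" .
  qed
qed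

text \<open>The data of \<open>f\<close> is embedded into the Calderon family whose boundary values have the norm of the
  data, and the Bergman operator maps this family to one through \<open>f\<close>.\<close>

theorem bergman_imp_interp_maps:
  assumes p01: "p0 \<ge> 1" "p1 \<ge> 1" and \<theta>: "0 < \<theta>" "\<theta> < 1"
   and hp: "1 / p = (1 - \<theta>) / p0 + \<theta> / p1" and h\<gamma>: "\<gamma> / p = \<alpha> / p0 * (1 - \<theta>) + \<beta> / p1 * \<theta>"
  shows "\<exists>C>0. \<forall>f \<in> (bergman_space p \<gamma> :: (complex^'n \<Rightarrow> complex) set).
   \<exists>F \<in> interp_maps (bergman_space p0 \<alpha>) (bergman_norm p0 \<alpha>) (bergman_space p1 \<beta>) (bergman_norm p1 \<beta>) \<theta> f.
    (\<forall>\<zeta>\<in>left_line. bergman_norm p0 \<alpha> (F \<zeta>) \<le> C * bergman_norm p \<gamma> f) \<and>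
    (\<forall>\<zeta>\<in>right_line. bergman_norm p1 \<beta> (F \<zeta>) \<le> C * bergman_norm p \<gamma> f)"
proof -
  have p: "p \<ge> 1" by (rule interp_exponent[OF p01 \<theta> hp])
  define N where "N = bergman_order p \<gamma>"
  define N0 where "N0 = real (bergman_order p0 \<alpha>) * (p0 - 1)"
  define N1 where "N1 = real (bergman_order p1 \<beta>) * (p1 - 1)"
  have N01: "N0 \<ge> 0" "N1 \<ge> 0" using p01 by (simp_all add: N0_def N1_def)
  obtain b :: nat where "real b > max (\<alpha> + N0) (max (\<beta> + N1) \<gamma>)" using reals_Archimedean2 by blast
  then have b: "real b > \<alpha> + N0" "real b > \<beta> + N1" "real b > \<gamma>" by auto
  obtain C0 where C0: "C0 > 0" "\<And>(\<phi> :: complex^'n \<Rightarrow> complex) c. \<phi> \<in> Lp_ball p0 \<alpha> \<Longrightarrow> bergman_operator b N c \<phi> \<in> bergman_space p0 \<alpha> \<and>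
    bergman_norm p0 \<alpha> (bergman_operator b N c \<phi>) \<le> C0 * (cmod c + Lp_norm p0 \<alpha> \<phi>)"
   using bergman_operator_bounded[OF p01(1) b(1)[unfolded N0_def], of N, where 'n='n] by blast
  obtain C1 where C1: "C1 > 0" "\<And>(\<phi> :: complex^'n \<Rightarrow> complex) c. \<phi> \<in> Lp_ball p1 \<beta> \<Longrightarrow> bergman_operator b N c \<phi> \<in> bergman_space p1 \<beta> \<and>
    bergman_norm p1 \<beta> (bergman_operator b N c \<phi>) \<le> C1 * (cmod c + Lp_norm p1 \<beta> \<phi>)"
   using bergman_operator_bounded[OF p01(2) b(2)[unfolded N1_def], of N, where 'n='n] by blast
  define C where "C = max C0 C1"
  have C: "C > 0" "\<And>x. x \<ge> 0 \<Longrightarrow> C0 * x \<le> C * x" "\<And>x. x \<ge> 0 \<Longrightarrow> C1 * x \<le> C * x"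
   using C0(1) by (auto simp: C_def intro!: mult_right_mono)
  interpret bergman_couple p0 p1 \<alpha> \<beta> C b N "TYPE('n)"
  proof
   show "bergman_operator b N c \<phi> \<in> bergman_space p0 \<alpha> \<and> bergman_norm p0 \<alpha> (bergman_operator b N c \<phi>) \<le> C * (cmod c + Lp_norm p0 \<alpha> \<phi>)"
    if "\<phi> \<in> Lp_ball p0 \<alpha>" for \<phi> :: "complex^'n \<Rightarrow> complex" and c
    using C0(2)[OF that, of c] C(2)[of "cmod c + Lp_norm p0 \<alpha> \<phi>"] by force
   show "bergman_operator b N c \<phi> \<in> bergman_space p1 \<beta> \<and> bergman_norm p1 \<beta> (bergman_operator b N c \<phi>) \<le> C * (cmod c + Lp_norm p1 \<beta> \<phi>)"
    if "\<phi> \<in> Lp_ball p1 \<beta>" for \<phi> :: "complex^'n \<Rightarrow> complex" and c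
    using C1(2)[OF that, of c] C(3)[of "cmod c + Lp_norm p1 \<beta> \<phi>"] by force
  qed (use p01 b N01 C in auto)
  define w where "w = weight_const TYPE('n) \<gamma> powr (1/p)"
  have w: "w > 0" using weight_const_pos[where 'n='n, of \<gamma>] by (simp add: w_def)
  show ?thesis
  proof (intro exI[of _ "C * (1 + 1 / w)"] conjI ballI)
   show "C * (1 + 1 / w) > 0" using C(1) w by (simp add: add_pos_pos)
   fix f :: "complex^'n \<Rightarrow> complex" assume f: "f \<in> bergman_space p \<gamma>"
   note hol = bergman_imp_holomorphic[OF f]
   define g where "g = radial_data N f"
   have g: "g \<in> Lp_ball p \<gamma>" unfolding g_def N_def by (rule bergman_order_data(1)[OF p f])
   have [measurable]: "g \<in> borel_measurable \<nu>" using g by (rule Lp_ball_measurable)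
   define t where "t = Lp_norm p \<gamma> g"
   define t' where "t' = (if t = 0 then 1 else t)"
   define s where "s z = sgn (g z)" for z
   define L where "L q a z = (p/q) * ln (cmod (g z)) + ((\<gamma> - a)/q) * ln (rho z) + (1 - p/q) * ln t'" for q a z
   have [measurable]: "s \<in> borel_measurable \<nu>" "L q a \<in> borel_measurable \<nu>" for q a
    unfolding s_def[abs_def] L_def[abs_def] sgn_eq by measurable
   have A: "(\<lambda>z. complex_of_real (cmod (s z) * exp (L q a z))) \<in> Lp_ball q a"
    "Lp_norm q a (\<lambda>z. complex_of_real (cmod (s z) * exp (L q a z))) \<le> t" if "q > 0" for q a
    using weighted_modulus_Lp[OF _ that g t_def t'_def, of a] p unfolding s_def L_def by auto
   have A0: "(\<lambda>z. complex_of_real (cmod (s z) * exp (L p0 \<alpha> z))) \<in> Lp_ball p0 \<alpha>"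
    "Lp_norm p0 \<alpha> (\<lambda>z. complex_of_real (cmod (s z) * exp (L p0 \<alpha> z))) \<le> t" using A[of p0 \<alpha>] p01 by auto
   have A1: "(\<lambda>z. complex_of_real (cmod (s z) * exp (L p1 \<beta> z))) \<in> Lp_ball p1 \<beta>"
    "Lp_norm p1 \<beta> (\<lambda>z. complex_of_real (cmod (s z) * exp (L p1 \<beta> z))) \<le> t" using A[of p1 \<beta>] p01 by auto
   define F where "F \<zeta> = T (f 0) (calderon_family s (L p0 \<alpha>) (L p1 \<beta>) \<zeta>)" for \<zeta>
   have "s \<in> borel_measurable \<nu>" "L p0 \<alpha> \<in> borel_measurable \<nu>" "L p1 \<beta> \<in> borel_measurable \<nu>" by measurable
   note cm = calderon_map[OF this A0(1) A1(1), where c = "f 0", folded F_def]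
   have mid: "calderon_family s (L p0 \<alpha>) (L p1 \<beta>) (of_real \<theta>) z = g z" for z
   proof (cases "g z = 0")
    case False
    have "(1 - \<theta>) * L p0 \<alpha> z + \<theta> * L p1 \<beta> z = p * ((1 - \<theta>) / p0 + \<theta> / p1) * ln (cmod (g z))
      + (\<gamma> * ((1 - \<theta>) / p0 + \<theta> / p1) - (\<alpha> / p0 * (1 - \<theta>) + \<beta> / p1 * \<theta>)) * ln (rho z)
      + (1 - p * ((1 - \<theta>) / p0 + \<theta> / p1)) * ln t'"
     by (simp add: L_def algebra_simps diff_divide_distrib)
    also have "\<dots> = ln (cmod (g z))" unfolding hp[symmetric] h\<gamma>[symmetric] using p by simp
    finally have "(1 - \<theta>) * L p0 \<alpha> z + \<theta> * L p1 \<beta> z = ln (cmod (g z))" .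
    moreover have "calderon_family s (L p0 \<alpha>) (L p1 \<beta>) (of_real \<theta>) z = s z * of_real (exp ((1 - \<theta>) * L p0 \<alpha> z + \<theta> * L p1 \<beta> z))"
     by (simp add: calderon_family_def exp_of_real[symmetric])
    ultimately show ?thesis using False by (simp add: s_def sgn_eq)
   qed (simp add: calderon_family_def s_def)
   have f_eq: "T (f 0) g = f"
   proof
    fix z
    have i: "integrable \<nu> (weighted b (radial_data N f))"
     using Lp_imp_L1[OF p less_imp_le[OF b(3)], where 'n='n] g unfolding g_def by blast
    show "T (f 0) g z = f z"
    proof (cases "norm z < 1")
     case True
     then show ?thesis using radial_reproducing_data[OF hol i True, of 0] radial_deriv_funpow[OF hol, of z 0]
      by (simp add: bergman_operator_def ball_constant_def g_def)
    next
     case False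
     then have "f z = 0" using hol by (simp add: ball_holomorphic_def)
     then show ?thesis using False by (simp add: bergman_operator_def ball_constant_def kernel_transform_def)
    qed
   qed
   have F\<theta>: "F (of_real \<theta>) = f" unfolding F_def using f_eq mid by (simp add: ext[OF mid])
   have Fmap: "F \<in> interp_maps X nX Y nY \<theta> f" unfolding interp_maps_def using cm(1-4) F\<theta> by simp
   have bound: "C * (cmod (f 0) + x) \<le> C * (1 + 1 / w) * bergman_norm p \<gamma> f" if "x \<le> t" for x
   proof -
    have "w * t \<le> bergman_norm p \<gamma> f" unfolding w_def t_def g_def N_def by (rule bergman_order_data(3)[OF p f])
    then have "t \<le> (1 / w) * bergman_norm p \<gamma> f" using w by (simp add: field_simps)
    then have "cmod (f 0) + x \<le> (1 + 1 / w) * bergman_norm p \<gamma> f"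
     using bergman_order_data(2)[OF p f] that by (simp add: distrib_right)
    then show ?thesis using C(1) by (simp add: mult.assoc)
   qed
   show "\<exists>F \<in> interp_maps X nX Y nY \<theta> f. (\<forall>\<zeta>\<in>left_line. nX (F \<zeta>) \<le> C * (1 + 1 / w) * bergman_norm p \<gamma> f) \<and>
     (\<forall>\<zeta>\<in>right_line. nY (F \<zeta>) \<le> C * (1 + 1 / w) * bergman_norm p \<gamma> f)"
    using Fmap order_trans[OF cm(5) bound[OF A0(2)]] order_trans[OF cm(6) bound[OF A1(2)]] by blast
  qed
qed

section \<open>The interpolation theorem\<close>

lemma interp_norm_le:
  fixes nX nY :: "('a \<Rightarrow> complex) \<Rightarrow> real"
  assumes nonneg: "\<And>f. nX f \<ge> 0" and F: "F \<in> interp_maps X nX Y nY \<theta> f"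
   and le: "\<And>\<zeta>. \<zeta> \<in> left_line \<Longrightarrow> nX (F \<zeta>) \<le> K" "\<And>\<zeta>. \<zeta> \<in> right_line \<Longrightarrow> nY (F \<zeta>) \<le> K"
  shows "interp_norm X nX Y nY \<theta> f \<le> K"
proof -
  have ne: "left_line \<noteq> {}" "right_line \<noteq> {}" by (auto simp: left_line_def right_line_def intro: exI[of _ 0] exI[of _ 1])
  have "interp_norm X nX Y nY \<theta> f \<le> max (SUP \<zeta>\<in>left_line. nX (F \<zeta>)) (SUP \<zeta>\<in>right_line. nY (F \<zeta>))"
   unfolding interp_norm_def
  proof (rule cINF_lower[OF _ F], rule bdd_belowI2[of _ 0])
   fix G assume "G \<in> interp_maps X nX Y nY \<theta> f"
   then have "bdd_above ((\<lambda>\<zeta>. nX (G \<zeta>)) ` left_line)" by (auto simp: interp_maps_def bdd_cont_into_def bdd_above_def)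
   moreover obtain \<zeta> where "\<zeta> \<in> left_line" using ne by blast
   ultimately have "nX (G \<zeta>) \<le> (SUP \<zeta>\<in>left_line. nX (G \<zeta>))" by (rule cSUP_upper[rotated])
   then show "0 \<le> max (SUP \<zeta>\<in>left_line. nX (G \<zeta>)) (SUP \<zeta>\<in>right_line. nY (G \<zeta>))"
    using nonneg[of "G \<zeta>"] by linarith
  qed
  also have "\<dots> \<le> K" using le ne by (intro max.boundedI cSUP_least) auto
  finally show ?thesis .
qed

text \<open>The positive \<open>K\<close> is an arbitrary common bound for the two lines. Taking it slightly larger than the
  suprema covers the case in which both vanish.\<close>

lemma interp_norm_ge:
  fixes nX nY :: "('a \<Rightarrow> complex) \<Rightarrow> real"
  assumes nonneg: "\<And>f. nX f \<ge> 0" and ne: "interp_maps X nX Y nY \<theta> f \<noteq> {}" and E: "E > 0"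
   and ge: "\<And>F K. F \<in> interp_maps X nX Y nY \<theta> f \<Longrightarrow> K > 0 \<Longrightarrow> \<forall>\<zeta>\<in>left_line. nX (F \<zeta>) \<le> K \<Longrightarrow>
    \<forall>\<zeta>\<in>right_line. nY (F \<zeta>) \<le> K \<Longrightarrow> k \<le> E * K"
  shows "k / E \<le> interp_norm X nX Y nY \<theta> f"
  unfolding interp_norm_def
proof (rule cINF_greatest[OF ne])
  fix F assume F: "F \<in> interp_maps X nX Y nY \<theta> f"
  let ?m = "max (SUP \<zeta>\<in>left_line. nX (F \<zeta>)) (SUP \<zeta>\<in>right_line. nY (F \<zeta>))"
  have "bdd_above ((\<lambda>\<zeta>. nX (F \<zeta>)) ` left_line)" "bdd_above ((\<lambda>\<zeta>. nY (F \<zeta>)) ` right_line)"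
   using F by (auto simp: interp_maps_def bdd_cont_into_def bdd_above_def)
  then have le: "\<zeta> \<in> left_line \<Longrightarrow> nX (F \<zeta>) \<le> ?m" "\<zeta> \<in> right_line \<Longrightarrow> nY (F \<zeta>) \<le> ?m" for \<zeta>
   by (auto intro: max.coboundedI1 max.coboundedI2 cSUP_upper)
  have "(0::complex) \<in> left_line" by (simp add: left_line_def)
  from le(1)[OF this] have m0: "?m \<ge> 0" using nonneg[of "F 0"] by linarith
  show "k / E \<le> ?m"
  proof (rule field_le_epsilon)
   fix e :: real assume e: "e > 0"
   have "k \<le> E * (?m + e)" using le e m0 add_increasing2[OF less_imp_le[OF e]]
    by (intro ge[OF F] ballI add_nonneg_pos) blast+
   then show "k / E \<le> ?m + e" using E by (simp add: field_simps)
  qed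
qed

theorem theorem36:
  fixes \<alpha> \<beta> \<gamma> p\<^sub>0 p\<^sub>1 p \<theta> :: real
  assumes "1 \<le> p\<^sub>0" and "p\<^sub>0 \<le> p\<^sub>1"
    and "0 < \<theta>" and "\<theta> < 1"
    and "1 / p = (1 - \<theta>) / p\<^sub>0 + \<theta> / p\<^sub>1"
    and "\<gamma> / p = \<alpha> / p\<^sub>0 * (1 - \<theta>) + \<beta> / p\<^sub>1 * \<theta>"
  shows "interp_space (bergman_space p\<^sub>0 \<alpha>) (bergman_norm p\<^sub>0 \<alpha>)
             (bergman_space p\<^sub>1 \<beta>) (bergman_norm p\<^sub>1 \<beta>) \<theta>
           = (bergman_space p \<gamma> :: (complex^'n \<Rightarrow> complex) set) \<and>
         equivalent_norms_on (bergman_space p \<gamma> :: (complex^'n \<Rightarrow> complex) set)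
           (interp_norm (bergman_space p\<^sub>0 \<alpha>) (bergman_norm p\<^sub>0 \<alpha>)
             (bergman_space p\<^sub>1 \<beta>) (bergman_norm p\<^sub>1 \<beta>) \<theta>)
           (bergman_norm p \<gamma>)"
proof -
  let ?X = "bergman_space p\<^sub>0 \<alpha> :: (complex^'n \<Rightarrow> complex) set" and ?Y = "bergman_space p\<^sub>1 \<beta> :: (complex^'n \<Rightarrow> complex) set"
  let ?nX = "bergman_norm p\<^sub>0 \<alpha> :: (complex^'n \<Rightarrow> complex) \<Rightarrow> real" and ?nY = "bergman_norm p\<^sub>1 \<beta> :: (complex^'n \<Rightarrow> complex) \<Rightarrow> real"
  have p1: "1 \<le> p\<^sub>1" using assms(1,2) by linarith
  note hyps = assms(1) p1 assms(3-6)
  obtain C where C: "C > 0" and CF: "\<And>f. f \<in> bergman_space p \<gamma> \<Longrightarrow> \<exists>F \<in> interp_maps ?X ?nX ?Y ?nY \<theta> f.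
    (\<forall>\<zeta>\<in>left_line. ?nX (F \<zeta>) \<le> C * bergman_norm p \<gamma> f) \<and> (\<forall>\<zeta>\<in>right_line. ?nY (F \<zeta>) \<le> C * bergman_norm p \<gamma> f)"
   using bergman_imp_interp_maps[OF hyps, where 'n='n] by blast
  obtain E where E: "E > 0" and EF: "\<And>f F K. F \<in> interp_maps ?X ?nX ?Y ?nY \<theta> f \<Longrightarrow> K > 0 \<Longrightarrow>
    \<forall>\<zeta>\<in>left_line. ?nX (F \<zeta>) \<le> K \<Longrightarrow> \<forall>\<zeta>\<in>right_line. ?nY (F \<zeta>) \<le> K \<Longrightarrow>
    f \<in> bergman_space p \<gamma> \<and> bergman_norm p \<gamma> f \<le> E * K"
   using interp_maps_imp_bergman[OF hyps, where 'n='n] by blast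
  have maps: "f \<in> bergman_space p \<gamma>" if F: "F \<in> interp_maps ?X ?nX ?Y ?nY \<theta> f" for f F
  proof -
   obtain K0 K1 where K: "\<forall>\<zeta>\<in>left_line. ?nX (F \<zeta>) \<le> K0" "\<forall>\<zeta>\<in>right_line. ?nY (F \<zeta>) \<le> K1"
    using F by (auto simp: interp_maps_def bdd_cont_into_def)
   have "\<forall>\<zeta>\<in>left_line. ?nX (F \<zeta>) \<le> max 1 (max K0 K1)" "\<forall>\<zeta>\<in>right_line. ?nY (F \<zeta>) \<le> max 1 (max K0 K1)"
    using K by (auto intro: max.coboundedI2 max.coboundedI1)
   then show ?thesis using EF[OF F, of "max 1 (max K0 K1)"] by auto
  qed
  have space: "interp_space ?X ?nX ?Y ?nY \<theta> = bergman_space p \<gamma>"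
  proof
   show "interp_space ?X ?nX ?Y ?nY \<theta> \<subseteq> bergman_space p \<gamma>" using maps by (auto simp: interp_space_def)
   show "bergman_space p \<gamma> \<subseteq> interp_space ?X ?nX ?Y ?nY \<theta>"
    using CF bergman_imp_holomorphic unfolding interp_space_def by blast
  qed
  have "(1 / E) * bergman_norm p \<gamma> f \<le> interp_norm ?X ?nX ?Y ?nY \<theta> f \<and> interp_norm ?X ?nX ?Y ?nY \<theta> f \<le> C * bergman_norm p \<gamma> f"
   if f: "f \<in> bergman_space p \<gamma>" for f
  proof
   obtain F where F: "F \<in> interp_maps ?X ?nX ?Y ?nY \<theta> f"
    "\<forall>\<zeta>\<in>left_line. ?nX (F \<zeta>) \<le> C * bergman_norm p \<gamma> f" "\<forall>\<zeta>\<in>right_line. ?nY (F \<zeta>) \<le> C * bergman_norm p \<gamma> f"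
    using CF[OF f] by blast
   show "interp_norm ?X ?nX ?Y ?nY \<theta> f \<le> C * bergman_norm p \<gamma> f"
    using F by (intro interp_norm_le[OF bergman_norm_nonneg F(1)]) auto
   have "bergman_norm p \<gamma> f / E \<le> interp_norm ?X ?nX ?Y ?nY \<theta> f"
    using F(1) EF by (intro interp_norm_ge[OF bergman_norm_nonneg _ E]) auto
   then show "(1 / E) * bergman_norm p \<gamma> f \<le> interp_norm ?X ?nX ?Y ?nY \<theta> f" by simp
  qed
  then have "equivalent_norms_on (bergman_space p \<gamma>) (interp_norm ?X ?nX ?Y ?nY \<theta>) (bergman_norm p \<gamma>)"
   unfolding equivalent_norms_on_def using C E by (intro exI[of _ "1 / E"] exI[of _ C] conjI ballI) auto
  with space show ?thesis by blast
qed

end
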